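(* Let $G$ be a subgroup of $U_n\ltimes\mathbb{C}^n$. Let $\mathcal{C}_{b,u}(\mathbb{C}^n)^G$ denote the set of all $G$-invariant bounded uniformly continuous functions on $\mathbb{C}^n$, and let $C_{b,u}(\mathcal{F}^2)^G = C_{b,u}(\mathcal{F}^2)\cap \mathrm{Hom}(G,\pi_G)$ be the set of all $G$-invariant bounded uniformly continuous operators on the Fock space. Suppose $\psi\in L^1(\mathbb{C}^n)$ is a radial regular function and let $\Psi$ be a regular radial operator. Then (1) $\mathcal{C}_{b,u}(\mathbb{C}^n)^G=\overline{\psi\ast \mathcal{C}_{b,u}(\mathbb{C}^n)^G}$; (2) $C_{b,u}(\mathcal{F}^2)^G=\overline{\psi\ast C_{b,u}(\mathcal{F}^2)^G}$; (3) $\mathcal{C}_{b,u}(\mathbb{C}^n)^G=\overline{\Psi\ast C_{b,u}(\mathcal{F}^2)^G}$; (4) $C_{b,u}(\mathcal{F}^2)^G=\overline{\Psi\ast \mathcal{C}_{b,u}(\mathbb{C}^n)^G}$. In particular, $$\mathfrak{T}^G=C_{b,u}(\mathcal{F}^2)^G=\overline{\{T_a\mid a\in \mathcal{C}_{b,u}(\mathbb{C}^n)^G\}},$$ where $\mathfrak{T}^G$ is the norm closed subalgebra of $\mathfrak{L}(\mathcal{F}^2)$ generated by all $G$-invariant Toeplitz operators with bounded symbols. Closures of sets of functions are taken in the supremum norm and closures of sets of operators in the operator norm.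
   Context: Fock space: $d\lambda(z)=e^{-\pi|z|^2}dz$ on $\mathbb{C}^n$ ($dz$ Lebesgue measure); $\mathcal{F}^2=\mathcal{F}^2(\mathbb{C}^n)$ is the closed subspace of holomorphic functions in $L^2(\mathbb{C}^n,d\lambda)$. Normalized reproducing kernels: $k_z(w)=e^{\pi\bar z w-\frac{\pi}{2}|z|^2}$, where $\bar z w=\sum_j \bar z_j w_j$. $\mathfrak{L}(\mathcal{F}^2)$ denotes the bounded operators and $\mathcal{S}^1(\mathcal{F}^2)$ the trace class operators. For $a\in L^\infty(\mathbb{C}^n)$, the Toeplitz operator is $T_af=P(af)$, where $P:L^2(\mathbb{C}^n,d\lambda)\to\mathcal{F}^2$ is the orthogonal projection. Translations: Weyl unitaries $W_zf(w)=k_z(w)f(w-z)$ on $\mathcal{F}^2$; $L_zS=W_zSW_z^*$ for $S\in\mathfrak{L}(\mathcal{F}^2)$. $C_{b,u}(\mathcal{F}^2)$ is the set of $S\in\mathfrak{L}(\mathcal{F}^2)$ such that $z\mapsto L_zS$ is continuous on $\mathbb{C}^n$ in operator norm. Convolutions: for $\psi\in L^1(\mathbb{C}^n)$, $a\in L^\infty(\mathbb{C}^n)$, $S\in\mathfrak{L}(\mathcal{F}^2)$: $(\psi\ast a)(z)=\int a(z-w)\psi(w)\,dw$ and $\psi\ast S=\int L_zS\,\psi(z)\,dz$ (weak integral). With $(Uf)(z)=f(-z)$, for bounded operators $T,S$ at least one of which is trace class, $T\ast S$ is the function $(T\ast S)(z)=\mathrm{Tr}(T\,L_z(USU))$. For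 $a\in L^\infty(\mathbb{C}^n)$ and $S\in\mathcal{S}^1(\mathcal{F}^2)$, $a\ast S=S\ast a$ is the bounded operator determined by $\mathrm{Tr}((a\ast S)A)=\int_{\mathbb{C}^n}a(z)\,(A\ast(USU))(z)\,dz$ for all $A\in\mathcal{S}^1(\mathcal{F}^2)$, i.e. $a\ast S=\int a(z)L_zS\,dz$ weakly. For a set $X$, $\psi\ast X=\{\psi\ast x: x\in X\}$, and similarly $\Psi\ast X$. Regularity: $\psi\in L^1(\mathbb{C}^n)$ is regular if its Fourier transform vanishes nowhere. An operator $\Psi\in\mathcal{S}^1(\mathcal{F}^2)$ is regular if the linear span of its translates $L_z\Psi$, $z\in\mathbb{C}^n$, is dense in $\mathcal{S}^1(\mathcal{F}^2)$ in trace norm. Group action: $U_n$ is the group of $n\times n$ unitary matrices. $U_n\ltimes\mathbb{C}^n$ acts on $\mathbb{C}^n$ by $(A,z)\cdot w=Aw+z$, and has a projective unitary representation $\pi$ on $\mathcal{F}^2$: for $g=(A,z)$, $(\pi(g)f)(w)=k_z(w)f(A^{-1}(w-z))$. For a subgroup $G$, $\pi_G$ is the restriction of $\pi$ to $G$, and $L_gS=\pi_G(g)S\pi_G(g)^*$ for $g\in G$. A function $a$ on $\mathbb{C}^n$ is $G$-invariant if $a(g^{-1}\cdot z)=a(z)$ for all $z\in\mathbb{C}^n$, $g\in G$. An operator $S$ is $G$-invariant if $L_gS=S$ for all $g\in G$; $\mathrm{Hom}(G,\pi_G)$ is the set of all $G$-invariant bounded operators. A function or operator is radial if it is invariant under $U_n$,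 that is, $a(A^{-1}z)=a(z)$ (for almost every $z$ when $a\in L^1(\mathbb{C}^n)$), respectively $L_{(A,0)}S=S$, for all $A\in U_n$. *)

theory Defs
  imports "HOL-Analysis.Analysis" "HOL-Algebra.Group"
begin

section \<open>The Fock space\<close>

definition entire :: "(complex^'n \<Rightarrow> complex) \<Rightarrow> bool" where
  "entire f \<longleftrightarrow>
     (\<forall>z. \<exists>D. (f has_derivative D) (at z) \<and> (\<forall>c h. D (c *s h) = c * D h))"

definition gauss_measure :: "(complex^'n) measure" where
  "gauss_measure = density lborel (\<lambda>z. ennreal (exp (- pi * (norm z)\<^sup>2)))"

definition fock_set :: "(complex^'n \<Rightarrow> complex) set" where
  "fock_set = {f. entire f \<and> integrable gauss_measure (\<lambda>z. (cmod (f z))\<^sup>2)}"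

lemma sets_gauss_measure [simp, measurable_cong]: "sets gauss_measure = sets borel"
  by (simp add: gauss_measure_def)

lemma entire_continuous: "entire f \<Longrightarrow> continuous_on UNIV f"
  unfolding entire_def
  by (meson continuous_at_imp_continuous_on has_derivative_continuous)

lemma entire_measurable: "entire f \<Longrightarrow> f \<in> borel_measurable gauss_measure"
  by (simp add: borel_measurable_continuous_onI entire_continuous measurable_cong_sets[OF sets_gauss_measure refl])

lemma entire_0: "entire (\<lambda>z. 0)"
  unfolding entire_def by (auto intro!: exI[of _ "\<lambda>h. 0"])

lemma entire_add:
  assumes "entire f" "entire g"
  shows "entire (\<lambda>z. f z + g z)"
  unfolding entire_def
proof
  fix z
  obtain D E where "(f has_derivative D) (at z)" "\<forall>c h. D (c *s h) = c * D h"
    "(g has_derivative E) (at z)" "\<forall>c h. E (c *s h) = c * E h"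
    using assms unfolding entire_def by meson
  then show "\<exists>D. ((\<lambda>z. f z + g z) has_derivative D) (at z) \<and> (\<forall>c h. D (c *s h) = c * D h)"
    by (intro exI[of _ "\<lambda>h. D h + E h"]) (auto intro!: derivative_eq_intros simp: algebra_simps)
qed

lemma entire_cmult:
  assumes "entire f"
  shows "entire (\<lambda>z. a * f z)"
  unfolding entire_def
proof
  fix z
  obtain D where "(f has_derivative D) (at z)" "\<forall>c h. D (c *s h) = c * D h"
    using assms unfolding entire_def by meson
  then show "\<exists>D. ((\<lambda>z. a * f z) has_derivative D) (at z) \<and> (\<forall>c h. D (c *s h) = c * D h)"
    by (intro exI[of _ "\<lambda>h. a * D h"]) (auto intro!: derivative_eq_intros simp: algebra_simps)
qed

lemma fock_set_0: "(\<lambda>z. 0) \<in> fock_set"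
  by (simp add: fock_set_def entire_0)

lemma cmod_add_square_le: "(cmod (a + b))\<^sup>2 \<le> 2 * (cmod a)\<^sup>2 + 2 * (cmod b)\<^sup>2"
proof -
  have "(cmod (a + b))\<^sup>2 \<le> (cmod a + cmod b)\<^sup>2"
    by (simp add: norm_triangle_ineq power_mono)
  also have "\<dots> \<le> 2 * (cmod a)\<^sup>2 + 2 * (cmod b)\<^sup>2"
    using zero_le_power2[of "cmod a - cmod b"] by (simp add: power2_eq_square algebra_simps)
  finally show ?thesis .
qed

lemma fock_set_add:
  assumes "f \<in> fock_set" "g \<in> fock_set"
  shows "(\<lambda>z. f z + g z) \<in> fock_set"
proof -
  have f: "entire f" "integrable gauss_measure (\<lambda>z. (cmod (f z))\<^sup>2)"
   and g: "entire g" "integrable gauss_measure (\<lambda>z. (cmod (g z))\<^sup>2)"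
    using assms by (auto simp: fock_set_def)
  have [measurable]: "f \<in> borel_measurable gauss_measure" "g \<in> borel_measurable gauss_measure"
    using f g entire_measurable by auto
  have "integrable gauss_measure (\<lambda>z. (cmod (f z + g z))\<^sup>2)"
    by (rule Bochner_Integration.integrable_bound
        [of _ "\<lambda>z. 2 * (cmod (f z))\<^sup>2 + 2 * (cmod (g z))\<^sup>2"])
      (use f g in \<open>auto intro!: AE_I2 simp: cmod_add_square_le\<close>)
  then show ?thesis using f g by (simp add: fock_set_def entire_add)
qed

lemma fock_set_cmult: "f \<in> fock_set \<Longrightarrow> (\<lambda>z. c * f z) \<in> fock_set"
  by (auto simp: fock_set_def entire_cmult norm_mult power_mult_distrib)

lemma fock_set_integrable_mult:
  assumes "f \<in> fock_set" "g \<in> fock_set"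
  shows "integrable gauss_measure (\<lambda>z. f z * cnj (g z))"
proof -
  have f: "entire f" "integrable gauss_measure (\<lambda>z. (cmod (f z))\<^sup>2)"
   and g: "entire g" "integrable gauss_measure (\<lambda>z. (cmod (g z))\<^sup>2)"
    using assms by (auto simp: fock_set_def)
  have [measurable]: "f \<in> borel_measurable gauss_measure" "g \<in> borel_measurable gauss_measure"
    using f g entire_measurable by auto
  have cnj [measurable]: "(cnj :: complex \<Rightarrow> complex) \<in> borel_measurable borel"
    by (intro borel_measurable_continuous_onI continuous_intros)
  have "cmod (f z * cnj (g z)) \<le> (cmod (f z))\<^sup>2 + (cmod (g z))\<^sup>2" for z
  proof -
    have "2 * (cmod (f z) * cmod (g z)) \<le> (cmod (f z))\<^sup>2 + (cmod (g z))\<^sup>2"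
      using zero_le_power2[of "cmod (f z) - cmod (g z)"]
      by (simp add: power2_eq_square algebra_simps)
    moreover have "0 \<le> cmod (f z) * cmod (g z)" by simp
    ultimately have "cmod (f z) * cmod (g z) \<le> (cmod (f z))\<^sup>2 + (cmod (g z))\<^sup>2" by linarith
    then show ?thesis by (simp add: norm_mult)
  qed
  then have "AE z in gauss_measure.
      norm (f z * cnj (g z)) \<le> norm ((cmod (f z))\<^sup>2 + (cmod (g z))\<^sup>2)"
    by (intro AE_I2) (metis abs_of_nonneg add_nonneg_nonneg real_norm_def zero_le_power2)
  moreover have "(\<lambda>z. f z * cnj (g z)) \<in> borel_measurable gauss_measure"
    by measurable
  ultimately show ?thesis
    using Bochner_Integration.integrable_bound Bochner_Integration.integrable_add[OF f(2) g(2)]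
    by blast
qed

lemma fock_set_eq_0:
  fixes f :: "complex^'n \<Rightarrow> complex"
  assumes "f \<in> fock_set" "(\<integral>z. (cmod (f z))\<^sup>2 \<partial>gauss_measure) = 0"
  shows "f z = 0"
proof -
  have f: "entire f" "integrable gauss_measure (\<lambda>z. (cmod (f z))\<^sup>2)"
    using assms by (auto simp: fock_set_def)
  have "AE z in gauss_measure. (cmod (f z))\<^sup>2 = 0"
    using integral_nonneg_eq_0_iff_AE[OF f(2)] assms(2) by simp
  then have "AE z in lborel. z \<in> f -` {0}"
    unfolding gauss_measure_def by (subst (asm) AE_density) auto
  then have ae: "AE z in lebesgue. z \<in> f -` {0}"
    by (rule AE_completion)
  show ?thesis
    using mem_closed_if_AE_lebesgue[OF _ ae, of z] entire_continuous[OF f(1)]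
    by (simp add: closed_vimage continuous_on_eq_continuous_at)
qed

typedef (overloaded) ('n::finite) fock = "fock_set :: (complex^'n \<Rightarrow> complex) set"
  morphisms fock_fun Abs_fock
  using fock_set_0 by blast

text \<open>The inner product is linear in the first argument.\<close>

definition cinner :: "'n::finite fock \<Rightarrow> 'n fock \<Rightarrow> complex" where
  "cinner f g = (\<integral>z. fock_fun f z * cnj (fock_fun g z) \<partial>gauss_measure)"

definition scaleC :: "complex \<Rightarrow> 'n::finite fock \<Rightarrow> 'n fock" where
  "scaleC c f = Abs_fock (\<lambda>z. c * fock_fun f z)"

lemma fock_fun_scaleC: "fock_fun (scaleC c f) = (\<lambda>z. c * fock_fun f z)"
  using fock_fun[of f] by (simp add: scaleC_def Abs_fock_inverse fock_set_cmult)

text \<open>As a real inner product space the Fock space carries the real part of \<^const>\<open>cinner\<close>, hence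
  the norm of \<open>L\<^sup>2\<close>. Bounded real-linear maps form the type of \<open>blinfun\<close>; the complex-linear ones
  are singled out below.\<close>

instantiation fock :: (finite) real_inner
begin

definition zero_fock :: "'a fock" where "zero_fock = Abs_fock (\<lambda>z. 0)"

definition plus_fock :: "'a fock \<Rightarrow> 'a fock \<Rightarrow> 'a fock" where
  "plus_fock f g = Abs_fock (\<lambda>z. fock_fun f z + fock_fun g z)"

definition uminus_fock :: "'a fock \<Rightarrow> 'a fock" where
  "uminus_fock f = scaleC (- 1) f"

definition minus_fock :: "'a fock \<Rightarrow> 'a fock \<Rightarrow> 'a fock" where
  "minus_fock f g = f + (- g)"

definition scaleR_fock :: "real \<Rightarrow> 'a fock \<Rightarrow> 'a fock" where
  "scaleR_fock r f = scaleC (complex_of_real r) f"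

definition inner_fock :: "'a fock \<Rightarrow> 'a fock \<Rightarrow> real" where
  "inner_fock f g = Re (cinner f g)"

definition norm_fock :: "'a fock \<Rightarrow> real" where
  "norm_fock f = sqrt (inner f f)"

definition sgn_fock :: "'a fock \<Rightarrow> 'a fock" where
  "sgn_fock f = scaleR (inverse (norm f)) f"

definition dist_fock :: "'a fock \<Rightarrow> 'a fock \<Rightarrow> real" where
  "dist_fock f g = norm (f - g)"

definition uniformity_fock :: "('a fock \<times> 'a fock) filter" where
  "uniformity_fock = (INF e\<in>{0<..}. principal {(x, y). dist x y < e})"

definition open_fock :: "'a fock set \<Rightarrow> bool" where
  "open_fock U = (\<forall>x\<in>U. eventually (\<lambda>(x', y). x' = x \<longrightarrow> y \<in> U) uniformity)"

lemma fock_fun_zero: "fock_fun 0 = (\<lambda>z. 0)"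
  by (simp add: zero_fock_def Abs_fock_inverse fock_set_0)

lemma fock_fun_plus: "fock_fun (f + g) = (\<lambda>z. fock_fun f z + fock_fun g z)"
  using fock_fun[of f] fock_fun[of g] by (simp add: plus_fock_def Abs_fock_inverse fock_set_add)

lemma fock_fun_uminus: "fock_fun (- f) = (\<lambda>z. - fock_fun f z)"
  by (simp add: uminus_fock_def fock_fun_scaleC)

lemma fock_fun_minus: "fock_fun (f - g) = (\<lambda>z. fock_fun f z - fock_fun g z)"
  by (simp add: minus_fock_def fock_fun_plus fock_fun_uminus)

lemma fock_fun_scaleR: "fock_fun (r *\<^sub>R f) = (\<lambda>z. complex_of_real r * fock_fun f z)"
  by (simp add: scaleR_fock_def fock_fun_scaleC)

lemmas fock_fun_simps = fock_fun_zero fock_fun_plus fock_fun_uminus fock_fun_minus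
  fock_fun_scaleR fock_fun_scaleC

lemma fock_eqI: "(\<And>z. fock_fun f z = fock_fun g z) \<Longrightarrow> f = g"
  by (metis ext fock_fun_inject)

lemma cinner_integrable:
  "integrable gauss_measure (\<lambda>z. fock_fun f z * cnj (fock_fun g z))"
  using fock_set_integrable_mult[OF fock_fun fock_fun] .

lemma cinner_commute: "cinner g f = cnj (cinner f g)"
proof -
  have "cinner g f = (\<integral>z. cnj (fock_fun f z * cnj (fock_fun g z)) \<partial>gauss_measure)"
    unfolding cinner_def complex_cnj_mult complex_cnj_cnj by (simp only: mult.commute)
  then show ?thesis
    unfolding cinner_def Bochner_Integration.integral_cnj .
qed

lemma cinner_self:
  "cinner f f = complex_of_real (\<integral>z. (cmod (fock_fun f z))\<^sup>2 \<partial>gauss_measure)"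
  unfolding cinner_def integral_complex_of_real[symmetric] complex_norm_square ..

instance
proof
  fix f g h :: "'a fock" and r s :: real
  show "f + g + h = f + (g + h)" "f + g = g + f" "0 + f = f" "- f + f = 0" "f - g = f + - g"
    by (auto intro!: fock_eqI simp: fock_fun_simps)
  show "r *\<^sub>R (f + g) = r *\<^sub>R f + r *\<^sub>R g" "(r + s) *\<^sub>R f = r *\<^sub>R f + s *\<^sub>R f"
    "r *\<^sub>R s *\<^sub>R f = (r * s) *\<^sub>R f" "1 *\<^sub>R f = f"
    by (auto intro!: fock_eqI simp: fock_fun_simps algebra_simps)
  show "sgn f = scaleR (inverse (norm f)) f" "dist f g = norm (f - g)" "norm f = sqrt (inner f f)"
    by (simp_all add: sgn_fock_def dist_fock_def norm_fock_def)
  show "uniformity = (INF e\<in>{0<..}. principal {(x :: 'a fock, y). dist x y < e})"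
    by (rule uniformity_fock_def)
  show "open U = (\<forall>x\<in>U. \<forall>\<^sub>F (x', y) in uniformity. x' = x \<longrightarrow> y \<in> U)" for U :: "'a fock set"
    by (rule open_fock_def)
  show "inner f g = inner g f"
    unfolding inner_fock_def by (subst cinner_commute) simp
  have "cinner (f + g) h = cinner f h + cinner g h"
    unfolding cinner_def
    by (simp add: fock_fun_plus ring_distribs cinner_integrable)
  then show "inner (f + g) h = inner f h + inner g h"
    by (simp add: inner_fock_def)
  have "cinner (r *\<^sub>R f) g = complex_of_real r * cinner f g"
    unfolding cinner_def
    by (simp add: fock_fun_scaleR mult.assoc)
  then show "inner (r *\<^sub>R f) g = r * inner f g"
    by (simp add: inner_fock_def)
  show "0 \<le> inner f f"
    by (simp add: inner_fock_def cinner_self)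
  show "inner f f = 0 \<longleftrightarrow> f = 0"
  proof
    assume "inner f f = 0"
    then have "(\<integral>z. (cmod (fock_fun f z))\<^sup>2 \<partial>gauss_measure) = 0"
      by (simp add: inner_fock_def cinner_self)
    then show "f = 0"
      using fock_set_eq_0[OF fock_fun] by (auto intro!: fock_eqI simp: fock_fun_zero)
  next
    assume "f = 0"
    then show "inner f f = 0" by (simp add: inner_fock_def cinner_self fock_fun_zero)
  qed
qed

end


section \<open>Bounded and trace class operators\<close>

type_synonym 'n op = "'n fock \<Rightarrow>\<^sub>L 'n fock"

definition bounded_ops :: "'n::finite op set" where
  "bounded_ops = {S. \<forall>c f. blinfun_apply S (scaleC c f) = scaleC c (blinfun_apply S f)}"

definition op_scaleC :: "complex \<Rightarrow> 'n::finite op \<Rightarrow> 'n op" where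
  "op_scaleC c S = Blinfun (\<lambda>f. scaleC c (blinfun_apply S f))"

definition op_adjoint :: "'n::finite op \<Rightarrow> 'n op" where
  "op_adjoint S =
     (THE T. \<forall>f g. cinner (blinfun_apply S f) g = cinner f (blinfun_apply T g))"

definition positive_op :: "'n::finite op \<Rightarrow> bool" where
  "positive_op S \<longleftrightarrow> S \<in> bounded_ops \<and> (\<forall>f. cinner (blinfun_apply S f) f \<in> \<real>\<^sub>\<ge>\<^sub>0)"

definition abs_op :: "'n::finite op \<Rightarrow> 'n op" where
  "abs_op S = (THE R. positive_op R \<and> R o\<^sub>L R = op_adjoint S o\<^sub>L S)"

definition is_onb :: "'n::finite fock set \<Rightarrow> bool" where
  "is_onb B \<longleftrightarrow> (\<forall>e\<in>B. \<forall>f\<in>B. cinner e f = (if e = f then 1 else 0)) \<and>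
     (\<forall>f. (\<forall>e\<in>B. cinner f e = 0) \<longrightarrow> f = 0)"

text \<open>The trace and the trace norm do not depend on the orthonormal basis, so one is fixed.\<close>

definition fock_onb :: "'n::finite fock set" where
  "fock_onb = (SOME B. is_onb B)"

definition trace_class :: "'n::finite op set" where
  "trace_class = {S \<in> bounded_ops.
     (\<lambda>e. Re (cinner (blinfun_apply (abs_op S) e) e)) summable_on fock_onb}"

definition trace_norm :: "'n::finite op \<Rightarrow> real" where
  "trace_norm S = (\<Sum>\<^sub>\<infinity>e\<in>fock_onb. Re (cinner (blinfun_apply (abs_op S) e) e))"

definition op_trace :: "'n::finite op \<Rightarrow> complex" where
  "op_trace S = (\<Sum>\<^sub>\<infinity>e\<in>fock_onb. cinner (blinfun_apply S e) e)"


section \<open>Toeplitz operators\<close>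

definition L_infinity :: "(complex^'n \<Rightarrow> complex) set" where
  "L_infinity = {a. a \<in> borel_measurable borel \<and> (\<exists>C. AE z in lborel. cmod (a z) \<le> C)}"

text \<open>Orthogonal projection of a function in \<open>L\<^sup>2\<close> of the Gaussian measure.\<close>

definition fock_proj :: "(complex^'n \<Rightarrow> complex) \<Rightarrow> 'n::finite fock" where
  "fock_proj h =
     (THE f. \<forall>g. (\<integral>z. (h z - fock_fun f z) * cnj (fock_fun g z) \<partial>gauss_measure) = 0)"

definition toeplitz :: "(complex^'n \<Rightarrow> complex) \<Rightarrow> 'n::finite op" where
  "toeplitz a = Blinfun (\<lambda>f. fock_proj (\<lambda>z. a z * fock_fun f z))"


section \<open>Translations and convolutions\<close>

definition kern :: "complex^'n \<Rightarrow> complex^'n \<Rightarrow> complex" where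
  "kern z w = exp (complex_of_real pi * (\<Sum>j\<in>UNIV. cnj (z $ j) * w $ j)
                   - complex_of_real (pi / 2 * (norm z)\<^sup>2))"

definition weyl :: "complex^'n \<Rightarrow> 'n::finite op" where
  "weyl z = Blinfun (\<lambda>f. Abs_fock (\<lambda>w. kern z w * fock_fun f (w - z)))"

definition op_translate :: "complex^'n \<Rightarrow> 'n::finite op \<Rightarrow> 'n op" where
  "op_translate z S = weyl z o\<^sub>L S o\<^sub>L op_adjoint (weyl z)"

definition parity_op :: "'n::finite op" where
  "parity_op = Blinfun (\<lambda>f. Abs_fock (\<lambda>w. fock_fun f (- w)))"

definition conv_fun_fun ::
  "(complex^'n \<Rightarrow> complex) \<Rightarrow> (complex^'n \<Rightarrow> complex) \<Rightarrow> complex^'n \<Rightarrow> complex" where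
  "conv_fun_fun \<psi> a z = (\<integral>w. a (z - w) * \<psi> w \<partial>lborel)"

text \<open>Convolution of an integrable function with a bounded operator.\<close>

definition conv_L1_op :: "(complex^'n \<Rightarrow> complex) \<Rightarrow> 'n::finite op \<Rightarrow> 'n op" where
  "conv_L1_op \<psi> S = (THE R. \<forall>f g. cinner (blinfun_apply R f) g =
     (\<integral>z. cinner (blinfun_apply (op_translate z S) f) g * \<psi> z \<partial>lborel))"

definition conv_op_op :: "'n::finite op \<Rightarrow> 'n op \<Rightarrow> complex^'n \<Rightarrow> complex" where
  "conv_op_op T S z =
     op_trace (T o\<^sub>L op_translate z (parity_op o\<^sub>L S o\<^sub>L parity_op))"

text \<open>Convolution of a trace class operator with a bounded function, by trace duality.\<close>

definition conv_tc_fun :: "'n::finite op \<Rightarrow> (complex^'n \<Rightarrow> complex) \<Rightarrow> 'n op" where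
  "conv_tc_fun S a = (THE R. R \<in> bounded_ops \<and> (\<forall>A\<in>trace_class. op_trace (R o\<^sub>L A) =
     (\<integral>z. a z * conv_op_op A (parity_op o\<^sub>L S o\<^sub>L parity_op) z \<partial>lborel)))"


section \<open>Regularity\<close>

text \<open>Here \<open>x \<bullet> \<xi>\<close> is the real inner product of \<open>complex^'n\<close>, that is, of \<open>\<real>\<^sup>2\<^sup>n\<close>.\<close>

definition fourier :: "(complex^'n \<Rightarrow> complex) \<Rightarrow> complex^'n \<Rightarrow> complex" where
  "fourier \<psi> \<xi> = (\<integral>x. exp (- (2 * pi * \<i>) * complex_of_real (x \<bullet> \<xi>)) * \<psi> x \<partial>lborel)"

definition regular_fun :: "(complex^'n \<Rightarrow> complex) \<Rightarrow> bool" where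
  "regular_fun \<psi> \<longleftrightarrow> integrable lborel \<psi> \<and> (\<forall>\<xi>. fourier \<psi> \<xi> \<noteq> 0)"

definition regular_op :: "'n::finite op \<Rightarrow> bool" where
  "regular_op \<Psi> \<longleftrightarrow> \<Psi> \<in> trace_class \<and>
     (\<forall>A\<in>trace_class. \<forall>\<epsilon>>0. \<exists>F c. finite F \<and>
        trace_norm (A - (\<Sum>z\<in>F. op_scaleC (c z) (op_translate z \<Psi>))) < \<epsilon>)"


section \<open>The group action\<close>

definition conj_transpose :: "complex^'n^'m \<Rightarrow> complex^'m^'n" where
  "conj_transpose A = (\<chi> i j. cnj (A $ j $ i))"

definition unitary_matrices :: "(complex^'n^'n) set" where
  "unitary_matrices = {A. A ** conj_transpose A = mat 1 \<and> conj_transpose A ** A = mat 1}"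

type_synonym 'n motion = "(complex^'n^'n) \<times> (complex^'n)"

text \<open>The semidirect product of the unitary group and the translations.\<close>

definition motion_group :: "'n::finite motion monoid" where
  "motion_group = \<lparr>carrier = unitary_matrices \<times> UNIV,
     mult = (\<lambda>(A, z) (B, w). (A ** B, A *v w + z)),
     one = (mat 1, 0)\<rparr>"

lemma conj_transpose_mult: "conj_transpose (A ** B) = conj_transpose B ** conj_transpose A"
  by (simp add: conj_transpose_def matrix_matrix_mult_def vec_eq_iff mult.commute)

lemma conj_transpose_mat_1 [simp]: "conj_transpose (mat 1) = mat 1"
  by (auto simp: conj_transpose_def mat_def vec_eq_iff)

lemma conj_transpose_conj_transpose [simp]: "conj_transpose (conj_transpose A) = A"
  by (simp add: conj_transpose_def vec_eq_iff)

lemma unitary_matrices_mult: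
  assumes "A \<in> unitary_matrices" "B \<in> unitary_matrices"
  shows "A ** B \<in> unitary_matrices"
proof -
  have "A ** B ** (conj_transpose B ** conj_transpose A) =
      A ** (B ** conj_transpose B) ** conj_transpose A"
    "conj_transpose B ** conj_transpose A ** (A ** B) =
      conj_transpose B ** (conj_transpose A ** A) ** B"
    by (simp_all add: matrix_mul_assoc)
  then show ?thesis
    using assms by (simp add: unitary_matrices_def conj_transpose_mult)
qed

lemma group_motion_group: "group (motion_group :: 'n::finite motion monoid)"
proof (rule groupI)
  fix x :: "'n::finite motion"
  assume "x \<in> carrier motion_group"
  then obtain A z where x: "x = (A, z)" "A \<in> unitary_matrices"
    by (auto simp: motion_group_def)
  then show "\<exists>y\<in>carrier motion_group. y \<otimes>\<^bsub>motion_group\<^esub> x = \<one>\<^bsub>motion_group\<^esub>"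
    by (intro bexI[of _ "(conj_transpose A, - (conj_transpose A *v z))"])
      (auto simp: motion_group_def unitary_matrices_def)
next
  fix x y z :: "'n::finite motion"
  show "x \<otimes>\<^bsub>motion_group\<^esub> y \<otimes>\<^bsub>motion_group\<^esub> z =
      x \<otimes>\<^bsub>motion_group\<^esub> (y \<otimes>\<^bsub>motion_group\<^esub> z)"
    by (cases x; cases y; cases z)
      (simp add: motion_group_def matrix_mul_assoc matrix_vector_mul_assoc
        matrix_vector_right_distrib)
  show "\<one>\<^bsub>motion_group\<^esub> \<otimes>\<^bsub>motion_group\<^esub> x = x"
    by (cases x) (simp add: motion_group_def)
  show "\<one>\<^bsub>motion_group\<^esub> \<in> carrier (motion_group :: 'n motion monoid)"
    by (simp add: motion_group_def unitary_matrices_def)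
  assume "x \<in> carrier motion_group" "y \<in> carrier motion_group"
  then show "x \<otimes>\<^bsub>motion_group\<^esub> y \<in> carrier motion_group"
    by (cases x; cases y) (simp add: motion_group_def unitary_matrices_mult)
qed

definition motion_act :: "'n::finite motion \<Rightarrow> complex^'n \<Rightarrow> complex^'n" where
  "motion_act = (\<lambda>(A, z) w. A *v w + z)"

definition motion_rep :: "'n::finite motion \<Rightarrow> 'n op" where
  "motion_rep = (\<lambda>(A, z). Blinfun (\<lambda>f. Abs_fock (\<lambda>w.
     kern z w * fock_fun f (matrix_inv A *v (w - z)))))"

definition op_motion :: "'n::finite motion \<Rightarrow> 'n op \<Rightarrow> 'n op" where
  "op_motion g S = motion_rep g o\<^sub>L S o\<^sub>L op_adjoint (motion_rep g)"

definition invariant_fun ::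
  "'n::finite motion set \<Rightarrow> (complex^'n \<Rightarrow> complex) \<Rightarrow> bool" where
  "invariant_fun G a \<longleftrightarrow> (\<forall>g\<in>G. \<forall>z. a (motion_act (inv\<^bsub>motion_group\<^esub> g) z) = a z)"

definition Hom_ops :: "'n::finite motion set \<Rightarrow> 'n op set" where
  "Hom_ops G = {S \<in> bounded_ops. \<forall>g\<in>G. op_motion g S = S}"

definition radial_L1 :: "(complex^'n \<Rightarrow> complex) \<Rightarrow> bool" where
  "radial_L1 \<psi> \<longleftrightarrow>
     (\<forall>A\<in>unitary_matrices. AE z in lborel. \<psi> (matrix_inv A *v z) = \<psi> z)"

definition radial_op :: "'n::finite op \<Rightarrow> bool" where
  "radial_op S \<longleftrightarrow> S \<in> bounded_ops \<and> (\<forall>A\<in>unitary_matrices. op_motion (A, 0) S = S)"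


section \<open>Uniformly continuous functions and operators\<close>

definition Cbu_fun :: "'n::finite motion set \<Rightarrow> (complex^'n \<Rightarrow> complex) set" where
  "Cbu_fun G =
     {a. bounded (range a) \<and> uniformly_continuous_on UNIV a \<and> invariant_fun G a}"

definition Cbu_op :: "'n::finite op set" where
  "Cbu_op = {S \<in> bounded_ops. continuous_on UNIV (\<lambda>z. op_translate z S)}"

definition sup_closure :: "('a \<Rightarrow> complex) set \<Rightarrow> ('a \<Rightarrow> complex) set" where
  "sup_closure X = {f. \<forall>\<epsilon>>0. \<exists>g\<in>X. \<forall>z. cmod (f z - g z) \<le> \<epsilon>}"


section \<open>The Toeplitz algebra\<close>

definition closed_subalgebra :: "'n::finite op set \<Rightarrow> bool" where
  "closed_subalgebra \<A> \<longleftrightarrow> \<A> \<subseteq> bounded_ops \<and> closed \<A> \<and> 0 \<in> \<A> \<and>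
     (\<forall>S\<in>\<A>. \<forall>T\<in>\<A>. S + T \<in> \<A> \<and> S o\<^sub>L T \<in> \<A>) \<and> (\<forall>S\<in>\<A>. \<forall>c. op_scaleC c S \<in> \<A>)"

text \<open>The generators are all Toeplitz operators with bounded symbol that are invariant as
  operators.\<close>

definition toeplitz_algebra :: "'n::finite motion set \<Rightarrow> 'n op set" where
  "toeplitz_algebra G =
     \<Inter> {\<A>. closed_subalgebra \<A> \<and> toeplitz ` L_infinity \<inter> Hom_ops G \<subseteq> \<A>}"

end

theory Submission
  imports Defs "HOL-Real_Asymp.Real_Asymp" "HOL-Probability.Probability" "HOL-Complex_Analysis.Complex_Analysis"
begin

text \<open>The Berezin transform \<open>S \<mapsto> \<langle>S k\<^sub>z, k\<^sub>z\<rangle>\<close> is injective on bounded operators and commutes with the group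
  action. It turns \<open>\<psi> * S\<close>, \<open>\<Psi> * a\<close> and \<open>T\<^sub>a\<close> into convolutions of functions, in which \<open>\<Psi>\<close> enters through its
  integrable transform and the Toeplitz operators through the Gaussian, the transform of the
  projection onto the vacuum. Regularity of \<open>\<Psi>\<close> makes its transform a regular function. By Wiener's
  theorem a regular radial \<open>\<psi>\<close> admits an approximate identity of the form \<open>\<phi> = \<psi> * h\<close> with \<open>h\<close> integrable,
  and \<open>h\<close> is radial because its Fourier transform is a quotient of radial functions. Convolution
  with a radial \<open>h\<close> preserves \<open>G\<close>-invariance, so \<open>a \<approx> \<phi> * a = \<psi> * (h * a)\<close>, and likewise for
  operators. The statements about \<open>\<Psi>\<close> and about Toeplitz operators follow from \<open>\<Psi>\<^sup>~ * S = \<Psi> * S\<^sup>~\<close> and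
  \<open>\<Psi>\<^sup>~ * b = \<Psi> * T\<^sub>b\<close>, where \<open>\<^sup>~\<close> denotes the Berezin transform.\<close>

section \<open>Operators on Hilbert spaces\<close>

text \<open>Operators are bounded real-linear maps on a real inner product space, so adjoints,
  square roots and factorizations are obtained over the reals and made complex linear afterwards.
  The trace class is given through the absolute value and a fixed basis, a form that suits neither
  sums nor integrals. It is exchanged for series of rank one operators
  \<open>f \<mapsto> \<langle>f, v n\<rangle> u n\<close> with
  \<open>\<Sum>n. norm (u n) * norm (v n)\<close> finite, and an estimate for \<open>\<Psi>\<close>
  becomes a rank one estimate summed up. The rank one estimate is the square integrability of
  \<open>z \<mapsto> \<langle>W_z u, g\<rangle>\<close>. In Wiener's theorem
  \<open>fourier \<psi>\<close> is merely continuous, so decay of derivatives cannot make a quotient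
  by it the transform of an integrable function. Instead, on functions with spectrum near
  \<open>\<xi>\<close> convolution with \<open>\<psi>\<close> is the scalar
  \<open>fourier \<psi> \<xi>\<close> up to an error small in the L1 norm, and a Neumann series
  divides there. A partition of a compact ball joins the local quotients. This reaches only
  band-limited targets, which is why an approximate identity appears.\<close>

lemma quadratic_nonneg_discriminant:
  fixes a b c :: real
  assumes "\<And>t. 0 \<le> a + 2 * t * b + t\<^sup>2 * c" "0 \<le> a" "0 \<le> c"
  shows "b\<^sup>2 \<le> a * c"
proof (cases "c = 0")
  case True
  have "b = 0"
  proof (rule ccontr)
    assume "b \<noteq> 0"
    \<comment> \<open>At this \<open>t\<close> the left-over expression is
      \<open>a - (a + 1) = -1\<close>.\<close>
    then show False
      using assms(1)[of "- (a + 1) / (2 * b)"] True assms(2) by (simp add: field_simps)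
  qed
  then show ?thesis using True by simp
next
  case False
  have "0 \<le> a + 2 * (- b / c) * b + (- b / c)\<^sup>2 * c" by (rule assms(1))
  also have "\<dots> = a - b\<^sup>2 / c"
    using False by (simp add: power2_eq_square field_simps)
  finally show ?thesis using False assms(3) by (simp add: field_simps)
qed

section \<open>Orthogonal projection, Riesz representation and adjoints\<close>

lemma closed_subspace_projection:
  fixes M :: "'a::{real_inner,banach} set"
  assumes "subspace M" "closed M"
  shows "\<exists>p\<in>M. \<forall>y\<in>M. (x - p) \<bullet> y = 0"
proof -
  define D where "D = (INF y\<in>M. (norm (x - y))\<^sup>2)"
  have bdd: "bdd_below ((\<lambda>y. (norm (x - y))\<^sup>2) ` M)"
    by (intro bdd_belowI[of _ 0]) auto
  have ne: "M \<noteq> {}" using assms(1) subspace_0 by blast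
  have D_le: "D \<le> (norm (x - y))\<^sup>2" if "y \<in> M" for y
    unfolding D_def using bdd that by (rule cINF_lower)
  have "\<exists>y\<in>M. (norm (x - y))\<^sup>2 < D + 1 / (real n + 1)" for n
  proof -
    have "D < D + 1 / (real n + 1)" by (simp add: add_nonneg_pos)
    then have "\<exists>r\<in>(\<lambda>y. (norm (x - y))\<^sup>2) ` M. r < D + 1 / (real n + 1)"
      using cInf_less_iff[OF _ bdd, of "D + 1 / (real n + 1)"] ne unfolding D_def by simp
    then show ?thesis by blast
  qed
  then obtain Y where Y: "\<And>n. Y n \<in> M" "\<And>n. (norm (x - Y n))\<^sup>2 < D + 1 / (real n + 1)"
    by metis
  have dist: "(norm (Y m - Y n))\<^sup>2 \<le> 2 / (real m + 1) + 2 / (real n + 1)" for m n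
  proof -
    \<comment> \<open>The midpoint lies in \<open>M\<close>, so its distance to \<open>x\<close>
      cannot beat the infimum. The parallelogram law turns this into smallness of
      \<open>Y m - Y n\<close>.\<close>
    have "(1/2) *\<^sub>R (Y m + Y n) \<in> M"
      using assms(1) Y(1) by (simp add: subspace_add subspace_mul)
    then have "D \<le> (norm (x - (1/2) *\<^sub>R (Y m + Y n)))\<^sup>2" by (rule D_le)
    moreover have "(norm (Y m - Y n))\<^sup>2 = 2 * (norm (x - Y m))\<^sup>2 + 2 * (norm (x - Y n))\<^sup>2
       - 4 * (norm (x - (1/2) *\<^sub>R (Y m + Y n)))\<^sup>2"
      by (simp add: power2_norm_eq_inner inner_simps inner_commute algebra_simps)
    ultimately show ?thesis using Y(2)[of m] Y(2)[of n] by simp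
  qed
  have "Cauchy Y"
  proof (rule metric_CauchyI)
    fix e :: real assume e: "0 < e"
    obtain N :: nat where N: "4 / e\<^sup>2 < real N" using reals_Archimedean2 by blast
    have "dist (Y m) (Y n) < e" if "m \<ge> N" "n \<ge> N" for m n
    proof -
      have "2 / (real m + 1) \<le> 2 / (real N + 1)" "2 / (real n + 1) \<le> 2 / (real N + 1)"
        using that by (auto simp: frac_le)
      then have "(norm (Y m - Y n))\<^sup>2 \<le> 4 / (real N + 1)" using dist[of m n] by simp
      also have "\<dots> < e\<^sup>2"
      proof -
        have "4 < real N * e\<^sup>2" using N e by (simp add: pos_divide_less_eq)
        also have "\<dots> \<le> e\<^sup>2 * (real N + 1)" by (simp add: algebra_simps)
        finally show ?thesis by (simp add: pos_divide_less_eq add_nonneg_pos)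
      qed
      finally show ?thesis using e by (simp add: dist_norm power2_less_imp_less)
    qed
    then show "\<exists>N. \<forall>m\<ge>N. \<forall>n\<ge>N. dist (Y m) (Y n) < e" by blast
  qed
  then obtain p where p: "Y \<longlonglongrightarrow> p" using Cauchy_convergent convergent_def by blast
  have pM: "p \<in> M" using closed_sequentially[OF assms(2) Y(1) p] .
  have "(\<lambda>n. D + 1 / (real n + 1)) \<longlonglongrightarrow> D + 0"
    by real_asymp
  moreover have "(\<lambda>n. (norm (x - Y n))\<^sup>2) \<longlonglongrightarrow> (norm (x - p))\<^sup>2"
    by (intro tendsto_intros p)
  ultimately have pD: "(norm (x - p))\<^sup>2 \<le> D"
    using LIMSEQ_le[of "\<lambda>n. (norm (x - Y n))\<^sup>2" _ "\<lambda>n. D + 1 / (real n + 1)"] Y(2)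
    by (simp add: less_imp_le)
  show ?thesis
  proof (intro bexI[of _ p] ballI pM)
    fix y assume y: "y \<in> M"
    \<comment> \<open>Minimality of \<open>p\<close> along the line through \<open>y\<close>,
      written as a quadratic in \<open>t\<close> whose constant term is 0. The discriminant bound
      then leaves no room for a linear term.\<close>
    have "0 \<le> 0 + 2 * t * ((x - p) \<bullet> y) + t\<^sup>2 * (y \<bullet> y)" for t
    proof -
      have "p - t *\<^sub>R y \<in> M" using pM y assms(1) by (simp add: subspace_diff subspace_mul)
      then have "(norm (x - p))\<^sup>2 \<le> (norm (x - (p - t *\<^sub>R y)))\<^sup>2" using D_le[OF \<open>p - t *\<^sub>R y \<in> M\<close>] pD by linarith
      moreover have "(norm (x - (p - t *\<^sub>R y)))\<^sup>2 = (norm (x - p))\<^sup>2 + 2 * t * ((x - p) \<bullet> y) + t\<^sup>2 * (y \<bullet> y)"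
        unfolding power2_norm_eq_inner
        by (simp add: inner_simps inner_commute power2_eq_square algebra_simps)
      ultimately show ?thesis by linarith
    qed
    then have "((x - p) \<bullet> y)\<^sup>2 \<le> 0 * (y \<bullet> y)"
      by (rule quadratic_nonneg_discriminant) auto
    then show "(x - p) \<bullet> y = 0" by simp
  qed
qed

lemma subspace_closure:
  fixes S :: "'a::real_normed_vector set"
  assumes "subspace S"
  shows "subspace (closure S)"
  unfolding subspace_def
proof (intro conjI ballI allI)
  show "0 \<in> closure S" using assms closure_subset subspace_0 by blast
  fix x y c assume "x \<in> closure S" "y \<in> closure S"
  then obtain f g where "\<And>n. f n \<in> S" "f \<longlonglongrightarrow> x" "\<And>n. g n \<in> S" "g \<longlonglongrightarrow> y"
    unfolding closure_sequential by blast
  then have "\<forall>n. f n + g n \<in> S" "(\<lambda>n. f n + g n) \<longlonglongrightarrow> x + y"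
    "\<forall>n. c *\<^sub>R f n \<in> S" "(\<lambda>n. c *\<^sub>R f n) \<longlonglongrightarrow> c *\<^sub>R x"
    using assms by (auto intro!: tendsto_intros simp: subspace_add subspace_mul)
  then show "x + y \<in> closure S" "c *\<^sub>R x \<in> closure S"
    unfolding closure_sequential by (metis, metis)
qed

lemma riesz_representation:
  fixes f :: "'a::{real_inner,banach} \<Rightarrow> real"
  assumes "bounded_linear f"
  shows "\<exists>y. \<forall>x. f x = x \<bullet> y"
proof (cases "\<forall>x. f x = 0")
  case True
  then show ?thesis by (auto intro: exI[of _ 0])
next
  case False
  interpret f: bounded_linear f by fact
  define M where "M = {x. f x = 0}"
  have "closed M"
    unfolding M_def by (intro closed_Collect_eq continuous_intros f.continuous_on)
  moreover have "subspace M"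
    unfolding M_def subspace_def by (auto simp: f.add f.scaleR f.zero)
  moreover obtain x0 where x0: "f x0 \<noteq> 0" using False by blast
  ultimately obtain p where p: "p \<in> M" "\<And>y. y \<in> M \<Longrightarrow> (x0 - p) \<bullet> y = 0"
    using closed_subspace_projection by metis
  define z where "z = x0 - p"
  have fz: "f z \<noteq> 0" using p(1) x0 by (simp add: z_def f.diff M_def)
  then have z0: "z \<bullet> z \<noteq> 0" using f.zero by auto
  have "f x = x \<bullet> ((f z / (z \<bullet> z)) *\<^sub>R z)" for x
  proof -
    have "x - (f x / f z) *\<^sub>R z \<in> M" using fz by (simp add: M_def f.diff f.scaleR)
    then have "z \<bullet> (x - (f x / f z) *\<^sub>R z) = 0" using p(2) by (simp add: z_def)
    then have "z \<bullet> x = (f x / f z) * (z \<bullet> z)" by (simp add: inner_simps)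
    then show ?thesis using fz z0 by (simp add: inner_commute field_simps)
  qed
  then show ?thesis by blast
qed

text \<open>Riesz representation defines \<open>T\<close> pointwise. Its bound comes from
  \<open>T y \<bullet> T y = S (T y) \<bullet> y\<close>, divided by
  \<open>norm (T y)\<close>.\<close>

lemma adjoint_blinfun_exists:
  fixes S :: "'a::{real_inner,banach} \<Rightarrow>\<^sub>L 'a"
  shows "\<exists>T :: 'a \<Rightarrow>\<^sub>L 'a. (\<forall>x y. blinfun_apply S x \<bullet> y = x \<bullet> blinfun_apply T y) \<and> norm T \<le> norm S"
proof -
  have "\<exists>w. \<forall>x. S x \<bullet> y = x \<bullet> w" for y
    by (rule riesz_representation)
      (intro bounded_linear_compose[OF bounded_linear_inner_left] blinfun.bounded_linear_right)
  then obtain T :: "'a \<Rightarrow> 'a" where T: "\<And>x y. S x \<bullet> y = x \<bullet> T y" by metis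
  have "norm (T y) \<le> norm S * norm y" for y
  proof (cases "T y = 0")
    case False
    have "norm (T y) * norm (T y) = S (T y) \<bullet> y" by (simp add: T norm_eq_sqrt_inner)
    also have "\<dots> \<le> norm (S (T y)) * norm y" by (rule norm_cauchy_schwarz)
    also have "\<dots> \<le> (norm S * norm (T y)) * norm y"
      by (intro mult_right_mono norm_blinfun) auto
    finally show ?thesis using False by (simp add: mult_ac)
  qed auto
  moreover have "linear T"
    by (rule linearI; rule vector_eq_ldot[THEN iffD1])
      (auto simp: T[symmetric] inner_simps)
  ultimately have "bounded_linear T"
    by (intro bounded_linear_intro[where K="norm S"]) (auto simp: linear_add linear_scale mult.commute)
  then have "T = blinfun_apply (Blinfun T)" by (simp add: bounded_linear_Blinfun_apply)
  with T \<open>\<And>y. norm (T y) \<le> norm S * norm y\<close> show ?thesis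
    by (intro exI[of _ "Blinfun T"]) (simp add: norm_blinfun_bound)
qed

section \<open>Positive square roots\<close>

text \<open>Symmetry is demanded separately: over the reals it does not follow from positivity of
  the quadratic form, as a rotation by a right angle shows.\<close>

definition positive_selfadjoint :: "('a::real_inner \<Rightarrow>\<^sub>L 'a) \<Rightarrow> bool" where
  "positive_selfadjoint A \<longleftrightarrow> (\<forall>x y. A x \<bullet> y = x \<bullet> A y) \<and> (\<forall>x. 0 \<le> A x \<bullet> x)"

lemma positive_selfadjoint_cauchy_schwarz:
  assumes "positive_selfadjoint A"
  shows "(A x \<bullet> y)\<^sup>2 \<le> (A x \<bullet> x) * (A y \<bullet> y)"
proof (rule quadratic_nonneg_discriminant)
  fix t
  have "0 \<le> A (x + t *\<^sub>R y) \<bullet> (x + t *\<^sub>R y)"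
    using assms unfolding positive_selfadjoint_def by blast
  moreover have "A y \<bullet> x = A x \<bullet> y"
    using assms by (simp add: positive_selfadjoint_def inner_commute)
  ultimately show "0 \<le> A x \<bullet> x + 2 * t * (A x \<bullet> y) + t\<^sup>2 * (A y \<bullet> y)"
    by (simp add: blinfun.bilinear_simps inner_simps power2_eq_square algebra_simps)
qed (use assms in \<open>auto simp: positive_selfadjoint_def\<close>)

lemma positive_selfadjoint_eq_0:
  assumes "positive_selfadjoint A" "A x \<bullet> x = 0"
  shows "A x = 0"
  using positive_selfadjoint_cauchy_schwarz[OF assms(1), of x "A x"] assms(2) by simp

text \<open>The Cauchy-Schwarz inequality for the form \<open>A x \<bullet> y\<close> at
  \<open>y = A x\<close> bounds the fourth power of \<open>norm (A x)\<close> by the square of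
  \<open>norm x * norm (A x)\<close>.\<close>

lemma positive_selfadjoint_norm_le:
  assumes "positive_selfadjoint A" "\<And>x. A x \<bullet> x \<le> x \<bullet> x"
  shows "norm A \<le> 1"
proof (rule norm_blinfun_bound)
  fix x
  have "(A x \<bullet> A x)\<^sup>2 \<le> (A x \<bullet> x) * (A (A x) \<bullet> A x)"
    by (rule positive_selfadjoint_cauchy_schwarz[OF assms(1)])
  also have "\<dots> \<le> (x \<bullet> x) * (A x \<bullet> A x)"
    using assms(1) unfolding positive_selfadjoint_def by (intro mult_mono assms(2)) (blast intro: inner_ge_zero)+
  finally have "A x \<bullet> A x \<le> x \<bullet> x"
    by (cases "A x = 0") (auto simp: power2_eq_square)
  then show "norm (A x) \<le> 1 * norm x" by (simp add: norm_le)
qed simp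

text \<open>The square root is \<open>1 - Y\<close>, where \<open>Y = (X + Y\<^sup>2) / 2\<close> and \<open>X = 1 - A\<close>. The iterates for \<open>Y\<close>
  are compared in norm with the increasing sequence of iterates at the scalar \<open>X = 1\<close>.\<close>

primrec sqrt_iter :: "('a::real_normed_vector \<Rightarrow>\<^sub>L 'a) \<Rightarrow> nat \<Rightarrow> 'a \<Rightarrow>\<^sub>L 'a" where
  "sqrt_iter X 0 = 0"
| "sqrt_iter X (Suc n) = (1/2) *\<^sub>R (X + (sqrt_iter X n o\<^sub>L sqrt_iter X n))"

primrec sqrt_iter_bound :: "nat \<Rightarrow> real" where
  "sqrt_iter_bound 0 = 0"
| "sqrt_iter_bound (Suc n) = (1 + (sqrt_iter_bound n)\<^sup>2) / 2"

lemmas blinfun_compose_simps = bounded_bilinear.add_left[OF bounded_bilinear_blinfun_compose]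
  bounded_bilinear.add_right[OF bounded_bilinear_blinfun_compose]
  bounded_bilinear.diff_left[OF bounded_bilinear_blinfun_compose]
  bounded_bilinear.diff_right[OF bounded_bilinear_blinfun_compose]
  bounded_bilinear.scaleR_left[OF bounded_bilinear_blinfun_compose]
  bounded_bilinear.scaleR_right[OF bounded_bilinear_blinfun_compose]

lemma blinfun_compose_assoc: "(A o\<^sub>L B) o\<^sub>L C = A o\<^sub>L (B o\<^sub>L C)"
  by (rule blinfun_eqI) simp

lemma sqrt_iter_bound_mem: "0 \<le> sqrt_iter_bound n" "sqrt_iter_bound n \<le> 1"
proof (induction n)
  case (Suc n)
  { case 1 show ?case by simp }
  { case 2 show ?case using Suc power_le_one[of "sqrt_iter_bound n" 2] by simp }
qed auto

lemma sqrt_iter_bound_mono: "sqrt_iter_bound n \<le> sqrt_iter_bound (Suc n)"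
  using zero_le_power2[of "sqrt_iter_bound n - 1"] by (simp add: power2_eq_square algebra_simps)

lemma sqrt_iter_commute:
  assumes "B o\<^sub>L X = X o\<^sub>L B"
  shows "B o\<^sub>L sqrt_iter X n = sqrt_iter X n o\<^sub>L B"
proof (induction n)
  case (Suc n)
  have "B o\<^sub>L (sqrt_iter X n o\<^sub>L sqrt_iter X n) = (sqrt_iter X n o\<^sub>L sqrt_iter X n) o\<^sub>L B"
    by (metis Suc blinfun_compose_assoc)
  then show ?case using assms by (simp add: blinfun_compose_simps)
qed (simp add: blinfun_compose_zero)

lemma norm_sqrt_iter:
  assumes "norm X \<le> 1"
  shows "norm (sqrt_iter X n) \<le> sqrt_iter_bound n"
proof (induction n)
  case (Suc n)
  have "norm (X + (sqrt_iter X n o\<^sub>L sqrt_iter X n))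
      \<le> norm X + norm (sqrt_iter X n) * norm (sqrt_iter X n)"
    by (intro norm_triangle_le add_left_mono norm_blinfun_compose)
  also have "\<dots> \<le> 1 + (sqrt_iter_bound n)\<^sup>2"
    unfolding power2_eq_square by (intro add_mono assms mult_mono Suc sqrt_iter_bound_mem) auto
  finally show ?case by simp
qed simp

text \<open>The iterates commute with each other, so the difference of two consecutive squares
  factors as difference times sum. Both factors are dominated by their scalar counterparts, and the
  product of these is exactly twice the next scalar step.\<close>

lemma norm_sqrt_iter_step:
  assumes "norm X \<le> 1"
  shows "norm (sqrt_iter X (Suc n) - sqrt_iter X n) \<le> sqrt_iter_bound (Suc n) - sqrt_iter_bound n"
proof (induction n)
  case 0
  then show ?case using assms by (simp add: blinfun_compose_zero)
next
  case (Suc n)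
  let ?Y = "sqrt_iter X" and ?y = "sqrt_iter_bound"
  have "?Y n o\<^sub>L ?Y (Suc n) = ?Y (Suc n) o\<^sub>L ?Y n"
    by (intro sqrt_iter_commute) (simp add: sqrt_iter_commute)
  then have "(?Y (Suc n) - ?Y n) o\<^sub>L (?Y (Suc n) + ?Y n)
      = (?Y (Suc n) o\<^sub>L ?Y (Suc n)) - (?Y n o\<^sub>L ?Y n)"
    by (simp only: blinfun_compose_simps) (simp del: sqrt_iter.simps)
  then have "?Y (Suc (Suc n)) - ?Y (Suc n)
      = (1/2) *\<^sub>R ((?Y (Suc n) - ?Y n) o\<^sub>L (?Y (Suc n) + ?Y n))"
    by (simp only: sqrt_iter.simps(2)[of X "Suc n"] sqrt_iter.simps(2)[of X n]) (simp only: scaleR_diff_right[symmetric] add_diff_cancel_left)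
  then have "norm (?Y (Suc (Suc n)) - ?Y (Suc n))
      = norm ((?Y (Suc n) - ?Y n) o\<^sub>L (?Y (Suc n) + ?Y n)) / 2" by simp
  also have "\<dots> \<le> norm (?Y (Suc n) - ?Y n) * norm (?Y (Suc n) + ?Y n) / 2"
    by (intro divide_right_mono norm_blinfun_compose) auto
  also have "\<dots> \<le> (?y (Suc n) - ?y n) * (?y (Suc n) + ?y n) / 2"
    using sqrt_iter_bound_mono[of n] sqrt_iter_bound_mem(1)[of n]
    by (intro divide_right_mono mult_mono Suc order_trans[OF norm_triangle_ineq] add_mono norm_sqrt_iter assms)
      (simp_all del: sqrt_iter_bound.simps)
  also have "\<dots> = ?y (Suc (Suc n)) - ?y (Suc n)"
    by (simp add: power2_eq_square field_simps)
  finally show ?case .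
qed

lemma Cauchy_sqrt_iter:
  fixes X :: "'a::banach \<Rightarrow>\<^sub>L 'a"
  assumes "norm X \<le> 1"
  shows "Cauchy (sqrt_iter X)"
proof -
  have "convergent sqrt_iter_bound"
    using sqrt_iter_bound_mem sqrt_iter_bound_mono
    by (intro Bseq_monoseq_convergent BseqI'[of _ 1]) (auto simp: incseq_SucI incseq_imp_monoseq simp del: sqrt_iter_bound.simps)
  then have Cauchy: "Cauchy sqrt_iter_bound" by (simp add: Cauchy_convergent_iff)
  have diff: "norm (sqrt_iter X (n + k) - sqrt_iter X n) \<le> sqrt_iter_bound (n + k) - sqrt_iter_bound n" for n k
  proof (induction k)
    case (Suc k)
    have "norm (sqrt_iter X (n + Suc k) - sqrt_iter X n)
        \<le> norm (sqrt_iter X (Suc (n + k)) - sqrt_iter X (n + k)) + norm (sqrt_iter X (n + k) - sqrt_iter X n)"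
      using norm_triangle_ineq[of "sqrt_iter X (Suc (n + k)) - sqrt_iter X (n + k)" "sqrt_iter X (n + k) - sqrt_iter X n"]
      by (simp del: sqrt_iter.simps)
    then show ?case using norm_sqrt_iter_step[OF assms, of "n + k"] Suc
      by (simp del: sqrt_iter.simps sqrt_iter_bound.simps)
  qed simp
  show ?thesis
  proof (rule metric_CauchyI)
    fix e :: real assume "0 < e"
    then obtain N where N: "\<And>m n. m \<ge> N \<Longrightarrow> n \<ge> N \<Longrightarrow> dist (sqrt_iter_bound m) (sqrt_iter_bound n) < e"
      using metric_CauchyD[OF Cauchy] by metis
    have le: "dist (sqrt_iter X m) (sqrt_iter X n) < e" if "N \<le> n" "n \<le> m" for m n
      using diff[of n "m - n"] N[of m n] that by (simp add: dist_norm)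
    then have "dist (sqrt_iter X m) (sqrt_iter X n) < e" if "N \<le> n" "N \<le> m" for m n
      using that by (metis dist_commute nle_le)
    then show "\<exists>N. \<forall>m\<ge>N. \<forall>n\<ge>N. dist (sqrt_iter X m) (sqrt_iter X n) < e" by blast
  qed
qed

lemma blinfun_compose_tendsto:
  "(f \<longlongrightarrow> A) F \<Longrightarrow> (g \<longlongrightarrow> B) F \<Longrightarrow> ((\<lambda>n. f n o\<^sub>L g n) \<longlongrightarrow> (A o\<^sub>L B)) F"
  by (rule bounded_bilinear.tendsto[OF bounded_bilinear_blinfun_compose])

text \<open>The limit \<open>L\<close> has norm at most 1, which makes \<open>id_blinfun - L\<close>
  positive. The clause on commuting operators is part of the conclusion because both the uniqueness
  of the root and its complex linearity are later drawn from it.\<close>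

lemma positive_sqrt_exists_contraction:
  fixes A :: "'a::{real_inner,banach} \<Rightarrow>\<^sub>L 'a"
  assumes A: "positive_selfadjoint A" "\<And>x. A x \<bullet> x \<le> x \<bullet> x"
  shows "\<exists>R. positive_selfadjoint R \<and> R o\<^sub>L R = A \<and> (\<forall>B. B o\<^sub>L A = A o\<^sub>L B \<longrightarrow> B o\<^sub>L R = R o\<^sub>L B)"
proof -
  define X where "X = id_blinfun - A"
  have Asa: "A x \<bullet> y = x \<bullet> A y" "0 \<le> A x \<bullet> x" for x y
    using A(1) unfolding positive_selfadjoint_def by blast+
  have Xsa: "X x \<bullet> y = x \<bullet> X y" for x y
    unfolding X_def by (simp add: blinfun.diff_left inner_simps Asa(1))
  have X: "positive_selfadjoint X"
    unfolding positive_selfadjoint_def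
  proof (intro conjI allI Xsa)
    show "0 \<le> X x \<bullet> x" for x
      using A(2)[of x] unfolding X_def blinfun.diff_left inner_diff_left by simp
  qed
  moreover have "X x \<bullet> x \<le> x \<bullet> x" for x
    using Asa(2)[of x] unfolding X_def blinfun.diff_left inner_diff_left by simp
  ultimately have nX: "norm X \<le> 1" by (rule positive_selfadjoint_norm_le)
  obtain L where L: "sqrt_iter X \<longlonglongrightarrow> L"
    using Cauchy_sqrt_iter[OF nX] Cauchy_convergent convergent_def by blast
  have "(\<lambda>n. sqrt_iter X (Suc n)) \<longlonglongrightarrow> (1/2) *\<^sub>R (X + (L o\<^sub>L L))"
    unfolding sqrt_iter.simps by (intro tendsto_intros blinfun_compose_tendsto L)
  then have LX: "L = (1/2) *\<^sub>R (X + (L o\<^sub>L L))"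
    using LIMSEQ_unique LIMSEQ_Suc[OF L] by blast
  have "norm (sqrt_iter X n) \<le> 1" for n
    using norm_sqrt_iter[OF nX, of n] sqrt_iter_bound_mem(2)[of n] by simp
  then have nL: "norm L \<le> 1"
    by (intro LIMSEQ_le_const2[OF tendsto_norm[OF L]]) auto
  have sa: "sqrt_iter X n x \<bullet> y = x \<bullet> sqrt_iter X n y" for n x y
  proof (induction n arbitrary: x y)
    case (Suc n)
    then show ?case by (simp add: blinfun.add_left blinfun.scaleR_left inner_add_left inner_add_right Xsa)
  qed simp
  have Lsa: "L x \<bullet> y = x \<bullet> L y" for x y
  proof (rule LIMSEQ_unique)
    show "(\<lambda>n. sqrt_iter X n x \<bullet> y) \<longlonglongrightarrow> L x \<bullet> y"
      by (intro tendsto_intros blinfun.tendsto L)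
    show "(\<lambda>n. sqrt_iter X n x \<bullet> y) \<longlonglongrightarrow> x \<bullet> L y"
      unfolding sa by (intro tendsto_intros blinfun.tendsto L)
  qed
  have Lpos: "L x \<bullet> x \<le> x \<bullet> x" for x
  proof -
    have "L x \<bullet> x \<le> norm (L x) * norm x" by (rule norm_cauchy_schwarz)
    also have "\<dots> \<le> (1 * norm x) * norm x"
      by (intro mult_right_mono order_trans[OF norm_blinfun] nL) auto
    finally show ?thesis by (simp add: norm_eq_sqrt_inner)
  qed
  define R where "R = id_blinfun - L"
  have RR: "R o\<^sub>L R = A"
  proof (rule blinfun_eqI)
    fix x
    have "2 *\<^sub>R L x = X x + L (L x)"
      by (subst LX) (simp add: blinfun.add_left blinfun.scaleR_left)
    then have *: "L (L x) = L x + L x - (x - A x)"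
      by (simp add: X_def blinfun.diff_left scaleR_2)
    show "(R o\<^sub>L R) x = A x"
      by (simp add: R_def blinfun.diff_left blinfun.diff_right *)
  qed
  have Rpos: "positive_selfadjoint R"
    unfolding positive_selfadjoint_def R_def using Lsa Lpos
    by (simp add: blinfun.diff_left inner_diff_left inner_diff_right)
  have "B o\<^sub>L R = R o\<^sub>L B" if "B o\<^sub>L A = A o\<^sub>L B" for B
  proof -
    have id: "B o\<^sub>L id_blinfun = id_blinfun o\<^sub>L B" by (rule blinfun_eqI) simp
    have "B o\<^sub>L X = X o\<^sub>L B"
      unfolding X_def by (simp add: blinfun_compose_simps that id)
    then have "B o\<^sub>L sqrt_iter X n = sqrt_iter X n o\<^sub>L B" for n by (rule sqrt_iter_commute)
    moreover have lim: "(\<lambda>n. B o\<^sub>L sqrt_iter X n) \<longlonglongrightarrow> (B o\<^sub>L L)" "(\<lambda>n. sqrt_iter X n o\<^sub>L B) \<longlonglongrightarrow> (L o\<^sub>L B)"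
      by (rule blinfun_compose_tendsto[OF tendsto_const L], rule blinfun_compose_tendsto[OF L tendsto_const])
    ultimately have "(\<lambda>n. sqrt_iter X n o\<^sub>L B) \<longlonglongrightarrow> (B o\<^sub>L L)" by (simp only:)
    then have "B o\<^sub>L L = L o\<^sub>L B" using lim(2) by (rule LIMSEQ_unique)
    then show ?thesis unfolding R_def by (simp only: blinfun_compose_simps id)
  qed
  with RR Rpos show ?thesis by (intro exI[of _ R] conjI allI impI)
qed

lemma positive_sqrt_exists:
  fixes A :: "'a::{real_inner,banach} \<Rightarrow>\<^sub>L 'a"
  assumes A: "positive_selfadjoint A"
  shows "\<exists>R. positive_selfadjoint R \<and> R o\<^sub>L R = A \<and> (\<forall>B. B o\<^sub>L A = A o\<^sub>L B \<longrightarrow> B o\<^sub>L R = R o\<^sub>L B)"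
proof -
  \<comment> \<open>The summand 1 keeps \<open>c\<close> positive when \<open>A = 0\<close>.\<close>
  define c where "c = norm A + 1"
  have c: "c > 0" unfolding c_def by (simp add: add_nonneg_pos)
  have "positive_selfadjoint ((1/c) *\<^sub>R A)"
    using A c unfolding positive_selfadjoint_def blinfun.scaleR_left inner_scaleR_left inner_scaleR_right
    by (metis less_imp_le mult_nonneg_nonneg zero_le_divide_1_iff)
  moreover have "((1/c) *\<^sub>R A) x \<bullet> x \<le> x \<bullet> x" for x
  proof -
    have "A x \<bullet> x \<le> norm (A x) * norm x" by (rule norm_cauchy_schwarz)
    also have "\<dots> \<le> (c * norm x) * norm x"
      by (intro mult_right_mono order_trans[OF norm_blinfun]) (auto simp: c_def)
    finally have "A x \<bullet> x \<le> c * (x \<bullet> x)" by (simp add: power2_norm_eq_inner[symmetric] power2_eq_square)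
    then show ?thesis using c by (simp add: blinfun.bilinear_simps field_simps)
  qed
  ultimately obtain R where R: "positive_selfadjoint R" "R o\<^sub>L R = (1/c) *\<^sub>R A"
     "\<forall>B. B o\<^sub>L ((1/c) *\<^sub>R A) = ((1/c) *\<^sub>R A) o\<^sub>L B \<longrightarrow> B o\<^sub>L R = R o\<^sub>L B"
    by (blast dest: positive_sqrt_exists_contraction[of "(1/c) *\<^sub>R A"]) 
  show ?thesis
  proof (intro exI[of _ "sqrt c *\<^sub>R R"] conjI allI impI)
    show "positive_selfadjoint (sqrt c *\<^sub>R R)"
      using R(1) c unfolding positive_selfadjoint_def blinfun.scaleR_left inner_scaleR_left inner_scaleR_right
      by (metis less_imp_le mult_nonneg_nonneg real_sqrt_ge_0_iff)
    show "sqrt c *\<^sub>R R o\<^sub>L sqrt c *\<^sub>R R = A"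
      using c R(2) by (simp add: blinfun_compose_simps)
    show "B o\<^sub>L sqrt c *\<^sub>R R = sqrt c *\<^sub>R R o\<^sub>L B" if "B o\<^sub>L A = A o\<^sub>L B" for B
      using R(3)[rule_format, of B] that by (simp only: blinfun_compose_simps)
  qed
qed

text \<open>For commuting roots \<open>(R + R') (R - R') = 0\<close>. On
  \<open>g = R f - R' f\<close> two nonnegative forms add up to 0, so \<open>R\<close> and
  \<open>R'\<close> both kill \<open>g\<close>, and symmetry then gives
  \<open>g \<bullet> g = 0\<close>.\<close>

lemma positive_sqrt_unique:
  fixes R R' :: "'a::real_inner \<Rightarrow>\<^sub>L 'a"
  assumes "positive_selfadjoint R" "positive_selfadjoint R'" "R o\<^sub>L R = R' o\<^sub>L R'" "R' o\<^sub>L R = R o\<^sub>L R'"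
  shows "R = R'"
proof (rule blinfun_eqI)
  fix f
  have sq: "R (R x) = R' (R' x)" and comm: "R' (R x) = R (R' x)" for x
    using arg_cong[OF assms(3), of "\<lambda>T. blinfun_apply T x"] arg_cong[OF assms(4), of "\<lambda>T. blinfun_apply T x"]
    by auto
  define g where "g = R f - R' f"
  have "R g + R' g = 0" unfolding g_def using sq comm by (simp add: blinfun.bilinear_simps)
  then have "R g \<bullet> g + R' g \<bullet> g = 0" by (metis inner_add_left inner_zero_left)
  moreover have "R g \<bullet> g \<ge> 0" "R' g \<bullet> g \<ge> 0"
    using assms(1,2) by (auto simp: positive_selfadjoint_def)
  ultimately have "R g = 0" "R' g = 0"
    using positive_selfadjoint_eq_0[OF assms(1)] positive_selfadjoint_eq_0[OF assms(2)] by auto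
  moreover have "g \<bullet> g = f \<bullet> (R g - R' g)"
  proof -
    have "R f \<bullet> g = f \<bullet> R g" "R' f \<bullet> g = f \<bullet> R' g"
      using assms(1,2) unfolding positive_selfadjoint_def by blast+
    then show ?thesis by (subst (1) g_def) (simp add: inner_simps)
  qed
  ultimately show "R f = R' f" by (simp add: g_def)
qed

text \<open>On the range of \<open>R\<close> the factor must be \<open>R x \<mapsto> S x\<close>.
  The inequality makes this well defined and contractive, so it extends to the closure of the range,
  and the projection \<open>P\<close> supplies the value 0 on the complement.\<close>

lemma douglas_factorization:
  fixes S R :: "'a::{real_inner,banach} \<Rightarrow>\<^sub>L 'a"
  assumes "\<And>x. norm (S x) \<le> norm (R x)"
  shows "\<exists>V. S = V o\<^sub>L R \<and> norm V \<le> 1"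
proof -
  define M where "M = closure (range R)"
  have M: "subspace M" "closed M"
    by (auto simp: M_def intro!: subspace_closure linear_subspace_image blinfun.bounded_linear_right[THEN bounded_linear.linear])
  obtain P where P: "\<And>x. P x \<in> M" "\<And>x y. y \<in> M \<Longrightarrow> (x - P x) \<bullet> y = 0"
    using closed_subspace_projection[OF M] by metis
  have P_unique: "P x = p" if "p \<in> M" "\<And>y. y \<in> M \<Longrightarrow> (x - p) \<bullet> y = 0" for x p
  proof -
    have "P x - p \<in> M" using P(1) that(1) M(1) by (simp add: subspace_diff)
    then have "(x - p) \<bullet> (P x - p) = 0" "(x - P x) \<bullet> (P x - p) = 0" using that(2) P(2) by auto
    then have "(P x - p) \<bullet> (P x - p) = 0" by (simp add: inner_simps)
    then show ?thesis by simp
  qed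
  have P_add: "P (x + y) = P x + P y" for x y
  proof (rule P_unique)
    show "P x + P y \<in> M" using P(1) M(1) by (simp add: subspace_add)
    show "(x + y - (P x + P y)) \<bullet> z = 0" if "z \<in> M" for z
      using P(2)[OF that, of x] P(2)[OF that, of y] by (simp add: inner_simps)
  qed
  have P_scale: "P (c *\<^sub>R x) = c *\<^sub>R P x" for c x
  proof (rule P_unique)
    show "c *\<^sub>R P x \<in> M" using P(1) M(1) by (simp add: subspace_mul)
    show "(c *\<^sub>R x - c *\<^sub>R P x) \<bullet> z = 0" if "z \<in> M" for z
      using P(2)[OF that, of x] by (simp add: inner_simps)
  qed
  have P_norm: "norm (P x) \<le> norm x" for x
  proof -
    have "(x - P x) \<bullet> P x = 0" using P by auto
    then have "x \<bullet> x = P x \<bullet> P x + (x - P x) \<bullet> (x - P x)" by (simp add: inner_simps inner_commute)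
    then show ?thesis by (simp add: norm_le)
  qed
  have P_R: "P (R x) = R x" for x
    by (rule P_unique) (auto simp: M_def intro: closure_subset[THEN subsetD])
  have seq: "\<exists>f. (\<lambda>n::nat. R (f n)) \<longlonglongrightarrow> P x" for x
  proof -
    have "\<exists>g. (\<forall>n::nat. g n \<in> range R) \<and> g \<longlonglongrightarrow> P x"
      using P(1)[of x] by (simp only: M_def closure_sequential)
    then obtain g where g: "\<forall>n::nat. g n \<in> range R" "g \<longlonglongrightarrow> P x" by (elim exE conjE)
    have "\<forall>n. \<exists>y. g n = R y" using g(1) by (simp add: image_iff)
    from choice[OF this] obtain f where "\<forall>n. g n = R (f n)" ..
    then have "g = (\<lambda>n. R (f n))" by (intro ext) simp
    with g(2) show ?thesis by (intro exI[of _ f]) (simp only:)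
  qed
  \<comment> \<open>The value of \<open>V\<close> at \<open>x\<close> is the common limit along all
    sequences with \<open>R (f n)\<close> tending to \<open>P x\<close>; two such sequences differ
    by something that \<open>S\<close> sends to 0.\<close>
  have "\<exists>v. \<forall>f. (\<lambda>n. R (f n)) \<longlonglongrightarrow> P x \<longrightarrow> (\<lambda>n. S (f n)) \<longlonglongrightarrow> v" for x
  proof -
    obtain f where f: "(\<lambda>n::nat. R (f n)) \<longlonglongrightarrow> P x" using seq by blast
    have "Cauchy (\<lambda>n. S (f n))"
    proof (rule metric_CauchyI)
      fix e :: real assume "0 < e"
      then obtain N where "\<And>m n. m \<ge> N \<Longrightarrow> n \<ge> N \<Longrightarrow> dist (R (f m)) (R (f n)) < e"
        using metric_CauchyD[OF LIMSEQ_imp_Cauchy[OF f]] by metis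
      moreover have "dist (S (f m)) (S (f n)) \<le> dist (R (f m)) (R (f n))" for m n
        using assms[of "f m - f n"] by (simp add: dist_norm blinfun.bilinear_simps)
      ultimately show "\<exists>N. \<forall>m\<ge>N. \<forall>n\<ge>N. dist (S (f m)) (S (f n)) < e"
        by (meson order_le_less_trans)
    qed
    then obtain v where v: "(\<lambda>n. S (f n)) \<longlonglongrightarrow> v" using Cauchy_convergent convergent_def by blast
    have "(\<lambda>n. S (g n)) \<longlonglongrightarrow> v" if g: "(\<lambda>n. R (g n)) \<longlonglongrightarrow> P x" for g
    proof -
      have "(\<lambda>n. R (g n - f n)) \<longlonglongrightarrow> 0"
        using tendsto_diff[OF g f] by (simp add: blinfun.bilinear_simps)
      then have "(\<lambda>n. S (g n - f n)) \<longlonglongrightarrow> 0"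
        by (rule Lim_null_comparison[rotated, OF tendsto_norm_zero]) (simp add: assms)
      from tendsto_add[OF this v] show ?thesis by (simp add: blinfun.bilinear_simps)
    qed
    then show ?thesis by blast
  qed
  then obtain V where V: "\<And>x f. (\<lambda>n. R (f n)) \<longlonglongrightarrow> P x \<Longrightarrow> (\<lambda>n. S (f n)) \<longlonglongrightarrow> V x" by metis
  have V_R: "V (R x) = S x" for x
  proof -
    have "(\<lambda>n. S x) \<longlonglongrightarrow> V (R x)" by (rule V) (simp add: P_R)
    then show ?thesis by (simp add: LIMSEQ_const_iff)
  qed
  have V_norm: "norm (V x) \<le> norm x" for x
  proof -
    obtain f where f: "(\<lambda>n::nat. R (f n)) \<longlonglongrightarrow> P x" using seq by blast
    have "norm (V x) \<le> norm (P x)"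
      by (rule LIMSEQ_le[OF tendsto_norm[OF V[OF f]] tendsto_norm[OF f]]) (use assms in auto)
    then show ?thesis using P_norm order_trans by blast
  qed
  have "bounded_linear V"
  proof (rule bounded_linear_intro[where K=1])
    fix x y
    obtain f g where fg: "(\<lambda>n::nat. R (f n)) \<longlonglongrightarrow> P x" "(\<lambda>n::nat. R (g n)) \<longlonglongrightarrow> P y" using seq by meson
    have "(\<lambda>n. R (f n + g n)) \<longlonglongrightarrow> P (x + y)"
      using tendsto_add[OF fg] by (simp add: blinfun.bilinear_simps P_add)
    from LIMSEQ_unique[OF V[OF this]] tendsto_add[OF V[OF fg(1)] V[OF fg(2)]]
    show "V (x + y) = V x + V y" by (simp add: blinfun.bilinear_simps)
  next
    fix c x
    obtain f where f: "(\<lambda>n::nat. R (f n)) \<longlonglongrightarrow> P x" using seq by meson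
    have "(\<lambda>n. R (c *\<^sub>R f n)) \<longlonglongrightarrow> P (c *\<^sub>R x)"
      using tendsto_scaleR[OF tendsto_const f, of c] by (simp add: blinfun.bilinear_simps P_scale)
    from LIMSEQ_unique[OF V[OF this]] tendsto_scaleR[OF tendsto_const V[OF f], of c]
    show "V (c *\<^sub>R x) = c *\<^sub>R V x" by (simp add: blinfun.bilinear_simps)
  qed (simp add: V_norm)
  then have VB: "blinfun_apply (Blinfun V) = V" by (rule bounded_linear_Blinfun_apply)
  show ?thesis
    by (intro exI[of _ "Blinfun V"] conjI blinfun_eqI norm_blinfun_bound) (auto simp: VB V_R V_norm)
qed

section \<open>Lebesgue measure and the Gaussian measure\<close>

lemma nn_integral_lborel_affine:
  fixes t :: "'a::euclidean_space"
  assumes [measurable]: "f \<in> borel_measurable borel" and c: "c \<noteq> 0"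
  shows "(\<integral>\<^sup>+x. f x \<partial>lborel) = ennreal (\<bar>c\<bar> ^ DIM('a)) * (\<integral>\<^sup>+x. f (t + c *\<^sub>R x) \<partial>lborel)"
  by (subst lborel_affine[OF c, of t])
     (simp add: nn_integral_density nn_integral_distr nn_integral_cmult)

lemma lborel_integrable_affine:
  fixes f :: "'a::euclidean_space \<Rightarrow> 'b :: {banach, second_countable_topology}"
  assumes f: "integrable lborel f" and c: "c \<noteq> 0"
  shows "integrable lborel (\<lambda>x. f (t + c *\<^sub>R x))"
proof -
  have m: "f \<in> borel_measurable borel" using borel_measurable_integrable[OF f] by simp
  then have "(\<lambda>x. f (t + c *\<^sub>R x)) \<in> borel_measurable borel" by measurable
  moreover have "(\<integral>\<^sup>+x. ennreal (norm (f (t + c *\<^sub>R x))) \<partial>lborel) < \<infinity>"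
    using f m c unfolding integrable_iff_bounded
    by (subst (asm) nn_integral_lborel_affine[where c=c and t=t]) (auto simp: ennreal_mult_less_top)
  ultimately show ?thesis by (simp add: integrable_iff_bounded)
qed

lemma lborel_integrable_affine_iff:
  fixes f :: "'a::euclidean_space \<Rightarrow> 'b :: {banach, second_countable_topology}"
  assumes c: "c \<noteq> 0"
  shows "integrable lborel (\<lambda>x. f (t + c *\<^sub>R x)) \<longleftrightarrow> integrable lborel f"
  using lborel_integrable_affine[of f c t]
    lborel_integrable_affine[of "\<lambda>x. f (t + c *\<^sub>R x)" "1/c" "-(1/c) *\<^sub>R t"] c
  by (auto simp: scaleR_add_right scaleR_diff_right)

lemma lborel_integral_affine:
  fixes f :: "'a::euclidean_space \<Rightarrow> 'b :: {banach, second_countable_topology}"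
  assumes c: "c \<noteq> 0"
  shows "(\<integral>x. f x \<partial>lborel) = \<bar>c\<bar> ^ DIM('a) *\<^sub>R (\<integral>x. f (t + c *\<^sub>R x) \<partial>lborel)"
proof cases
  assume f[measurable]: "integrable lborel f"
  then have [measurable]: "f \<in> borel_measurable borel" using borel_measurable_integrable by auto
  then show ?thesis
    by (subst lborel_affine[OF c, of t]) (simp add: integral_density integral_distr)
next
  assume "\<not> integrable lborel f" with c show ?thesis
    by (simp add: lborel_integrable_affine_iff not_integrable_integral_eq)
qed

lemma lborel_integral_translate:
  fixes f :: "'a::euclidean_space \<Rightarrow> 'b :: {banach, second_countable_topology}"
  shows "(\<integral>x. f (x + t) \<partial>lborel) = (\<integral>x. f x \<partial>lborel)"
    "(\<integral>x. f (x - t) \<partial>lborel) = (\<integral>x. f x \<partial>lborel)"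
    "(\<integral>x. f (t - x) \<partial>lborel) = (\<integral>x. f x \<partial>lborel)"
  using lborel_integral_affine[of 1 f t] lborel_integral_affine[of 1 f "-t"]
    lborel_integral_affine[of "-1" f t]
  by (simp_all add: add.commute)

lemma lborel_integrable_translate:
  fixes f :: "'a::euclidean_space \<Rightarrow> 'b :: {banach, second_countable_topology}"
  shows "integrable lborel (\<lambda>x. f (x + t)) \<longleftrightarrow> integrable lborel f"
    "integrable lborel (\<lambda>x. f (x - t)) \<longleftrightarrow> integrable lborel f"
    "integrable lborel (\<lambda>x. f (t - x)) \<longleftrightarrow> integrable lborel f"
  using lborel_integrable_affine_iff[of 1 f t] lborel_integrable_affine_iff[of 1 f "-t"]
    lborel_integrable_affine_iff[of "-1" f t]
  by (simp_all add: add.commute)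

lemma nn_integral_lborel_translate:
  fixes t :: "'a::euclidean_space"
  assumes [measurable]: "f \<in> borel_measurable borel"
  shows "(\<integral>\<^sup>+x. f (x + t) \<partial>lborel) = (\<integral>\<^sup>+x. f x \<partial>lborel)"
    "(\<integral>\<^sup>+x. f (x - t) \<partial>lborel) = (\<integral>\<^sup>+x. f x \<partial>lborel)"
    "(\<integral>\<^sup>+x. f (t - x) \<partial>lborel) = (\<integral>\<^sup>+x. f x \<partial>lborel)"
  using nn_integral_lborel_affine[OF assms, of 1 t] nn_integral_lborel_affine[OF assms, of 1 "-t"]
    nn_integral_lborel_affine[OF assms, of "-1" t]
  by (simp_all add: add.commute)

text \<open>Both measures are translation invariant and agree on the unit ball, so Fubini's theorem
  identifies them as in the uniqueness proof for Haar measure.\<close>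

lemma lborel_distr_isometry:
  fixes T :: "'a::euclidean_space \<Rightarrow> 'a"
  assumes lin: "linear T" and norm: "\<And>x. norm (T x) = norm x"
  shows "distr lborel borel T = lborel"
proof (rule measure_eqI)
  have cont: "continuous_on UNIV T"
    using lin by (simp add: linear_continuous_on linear_conv_bounded_linear)
  have [measurable]: "T \<in> borel_measurable borel" by (rule borel_measurable_continuous_onI[OF cont])
  have "inj T" using lin norm by (metis linear_injective_0 norm_eq_zero)
  with lin have "surj T" by (rule linear_inj_imp_surj)
  fix A assume "A \<in> sets (distr lborel borel T)"
  then have [measurable]: "A \<in> sets borel" by simp
  \<comment> \<open>The auxiliary function is invariant under \<open>T\<close>, and its integral
    \<open>c\<close> is neither 0 nor infinite, so that it can be cancelled at the end.\<close>
  define g :: "'a \<Rightarrow> ennreal" where "g = indicator (ball 0 1)"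
  define f :: "'a \<Rightarrow> ennreal" where "f = indicator A"
  have [measurable]: "g \<in> borel_measurable borel" "f \<in> borel_measurable borel"
    by (auto simp: g_def f_def intro!: borel_measurable_indicator)
  have gT: "g (T x) = g x" for x by (simp add: g_def norm indicator_def)
  define c where "c = (\<integral>\<^sup>+x. g x \<partial>lborel)"
  have c: "c = emeasure lborel (ball (0::'a) 1)" by (simp add: c_def g_def)
  have c0: "c \<noteq> 0" unfolding c
    using emeasure_lborel_ball_finite[of "0::'a" 1]
    by (metis content_ball_pos emeasure_eq_ennreal_measure ennreal_0 ennreal_inj infinity_ennreal_def
        less_irrefl measure_nonneg order_less_le zero_less_one order_refl)
  have ctop: "c \<noteq> \<top>" unfolding c using emeasure_lborel_ball_finite[of "0::'a" 1] by simp
  have "(\<integral>\<^sup>+x. f (T x) \<partial>lborel) * c = (\<integral>\<^sup>+x. f (T x) * (\<integral>\<^sup>+y. g y \<partial>lborel) \<partial>lborel)"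
    by (simp add: c_def nn_integral_multc)
  also have "\<dots> = (\<integral>\<^sup>+x. (\<integral>\<^sup>+y. f (T x) * g (y - T x) \<partial>lborel) \<partial>lborel)"
    by (simp add: nn_integral_cmult nn_integral_lborel_translate)
  also have "\<dots> = (\<integral>\<^sup>+y. (\<integral>\<^sup>+x. f (T x) * g (y - T x) \<partial>lborel) \<partial>lborel)"
    by (rule lborel_pair.Fubini'[symmetric]) measurable
  also have "\<dots> = (\<integral>\<^sup>+y. (\<integral>\<^sup>+x. f (y - T x) * g x \<partial>lborel) \<partial>lborel)"
  proof (rule nn_integral_cong)
    fix y
    obtain y' where y: "y = T y'" using \<open>surj T\<close> by blast
    \<comment> \<open>With \<open>y = T y'\<close>, the substitution
      \<open>x \<mapsto> y' - x\<close> moves \<open>T\<close> from the argument of \<open>g\<close>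
      to that of \<open>f\<close>, where translation invariance in \<open>y\<close> removes
      it.\<close>
    have "(\<integral>\<^sup>+x. f (T x) * g (y - T x) \<partial>lborel) = (\<integral>\<^sup>+x. f (T (y' - x)) * g (y - T (y' - x)) \<partial>lborel)"
      by (rule nn_integral_lborel_translate(3)[symmetric]) measurable
    also have "\<dots> = (\<integral>\<^sup>+x. f (y - T x) * g x \<partial>lborel)"
      by (simp add: y linear_diff[OF lin] gT)
    finally show "(\<integral>\<^sup>+x. f (T x) * g (y - T x) \<partial>lborel) = (\<integral>\<^sup>+x. f (y - T x) * g x \<partial>lborel)" .
  qed
  also have "\<dots> = (\<integral>\<^sup>+x. (\<integral>\<^sup>+y. f (y - T x) * g x \<partial>lborel) \<partial>lborel)"
    by (rule lborel_pair.Fubini') measurable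
  also have "\<dots> = (\<integral>\<^sup>+x. (\<integral>\<^sup>+y. f y \<partial>lborel) * g x \<partial>lborel)"
    by (simp add: nn_integral_multc nn_integral_lborel_translate)
  also have "\<dots> = (\<integral>\<^sup>+y. f y \<partial>lborel) * c"
    by (simp add: nn_integral_cmult c_def)
  finally have "(\<integral>\<^sup>+x. f (T x) \<partial>lborel) = (\<integral>\<^sup>+y. f y \<partial>lborel)"
    using c0 ctop by (metis ennreal_mult_cancel_left mult.commute)
  then show "emeasure (distr lborel borel T) A = emeasure lborel A"
    using nn_integral_distr[of T lborel borel f] by (simp add: f_def)
qed simp

lemma lborel_isometry:
  fixes T :: "'a::euclidean_space \<Rightarrow> 'a" and f :: "'a \<Rightarrow> 'b::{banach,second_countable_topology}"
  assumes lin: "linear T" and norm: "\<And>x. norm (T x) = norm x"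
  shows lborel_integrable_isometry: "integrable lborel f \<Longrightarrow> integrable lborel (\<lambda>x. f (T x))"
    and lborel_integral_isometry: "f \<in> borel_measurable borel \<Longrightarrow> (\<integral>x. f (T x) \<partial>lborel) = (\<integral>x. f x \<partial>lborel)"
proof -
  have [measurable]: "T \<in> borel_measurable borel"
    using lin by (intro borel_measurable_continuous_onI) (simp add: linear_continuous_on linear_conv_bounded_linear)
  note d = lborel_distr_isometry[OF assms]
  show "integrable lborel f \<Longrightarrow> integrable lborel (\<lambda>x. f (T x))"
    by (rule integrable_distr[of T lborel borel]) (simp_all add: d)
  show "(\<integral>x. f (T x) \<partial>lborel) = (\<integral>x. f x \<partial>lborel)" if "f \<in> borel_measurable borel"
    using integral_distr[of T lborel borel f] that by (simp add: d)
qed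

section \<open>The hermitian product and unitary matrices\<close>

definition hip :: "complex^'n \<Rightarrow> complex^'n \<Rightarrow> complex" where
  "hip z w = (\<Sum>j\<in>UNIV. cnj (z $ j) * w $ j)"

lemma kern_hip: "kern z w = exp (pi * hip z w - pi / 2 * (norm z)\<^sup>2)"
  by (simp add: kern_def hip_def)

lemma scaleR_vector: "r *\<^sub>R x = complex_of_real r *s x"
  by (simp add: vec_eq_iff scaleR_conv_of_real[where 'a=complex])

lemma hip_simps:
  "hip (x + y) w = hip x w + hip y w" "hip (x - y) w = hip x w - hip y w" "hip (- x) w = - hip x w"
  "hip x (w + v) = hip x w + hip x v" "hip x (w - v) = hip x w - hip x v" "hip x (- w) = - hip x w"
  "hip (c *s x) w = cnj c * hip x w" "hip x (c *s w) = c * hip x w" "hip 0 w = 0" "hip x 0 = 0"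
  "hip (r *\<^sub>R x) w = complex_of_real r * hip x w" "hip x (r *\<^sub>R w) = complex_of_real r * hip x w"
  unfolding hip_def scaleR_vector
  by (simp_all add: algebra_simps sum.distrib sum_subtractf sum_negf sum_distrib_left)

lemma hip_commute: "hip w z = cnj (hip z w)"
  by (simp add: hip_def cnj_sum mult.commute)

lemma hip_self: "hip z z = complex_of_real ((norm z)\<^sup>2)"
  by (simp add: hip_def norm_vec_def L2_set_def sum_nonneg mult.commute complex_norm_square
      del: of_real_power flip: complex_norm_square)

lemma Re_hip: "Re (hip z w) = z \<bullet> w"
  by (simp add: hip_def inner_vec_def inner_complex_def)

lemma inner_conv_hip: "complex_of_real (z \<bullet> w) = (hip z w + hip w z) / 2"
  unfolding hip_commute[of w z] by (simp add: complex_add_cnj Re_hip)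

lemma cmod_hip_le: "cmod (hip z w) \<le> norm z * norm w"
proof -
  have "cmod (hip z w) \<le> (\<Sum>j\<in>UNIV. \<bar>cmod (z $ j)\<bar> * \<bar>cmod (w $ j)\<bar>)"
    unfolding hip_def by (rule order_trans[OF norm_sum]) (simp add: norm_mult)
  also have "\<dots> \<le> norm z * norm w"
    unfolding norm_vec_def by (rule L2_set_mult_ineq)
  finally show ?thesis .
qed

lemma continuous_on_hip [continuous_intros]:
  "continuous_on S f \<Longrightarrow> continuous_on S g \<Longrightarrow> continuous_on S (\<lambda>x. hip (f x) (g x))"
  unfolding hip_def by (intro continuous_intros)

lemma hip_matrix_vector: "hip (A *v z) w = hip z (conj_transpose A *v w)"
proof -
  have "hip (A *v z) w = (\<Sum>i\<in>UNIV. \<Sum>j\<in>UNIV. cnj (A $ i $ j) * cnj (z $ j) * w $ i)"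
    by (simp add: hip_def matrix_vector_mult_def sum_distrib_right)
  also have "\<dots> = (\<Sum>j\<in>UNIV. \<Sum>i\<in>UNIV. cnj (A $ i $ j) * cnj (z $ j) * w $ i)" by (rule sum.swap)
  also have "\<dots> = hip z (conj_transpose A *v w)"
    by (simp add: hip_def matrix_vector_mult_def sum_distrib_left conj_transpose_def mult_ac)
  finally show ?thesis .
qed

lemma unitary_cancel:
  assumes "A \<in> unitary_matrices"
  shows "conj_transpose A *v (A *v z) = z" "A *v (conj_transpose A *v z) = z"
  using assms by (auto simp: unitary_matrices_def matrix_vector_mul_assoc)

text \<open>\<open>matrix_inv\<close> is a choice of a two-sided inverse, and such an inverse is
  unique.\<close>

lemma matrix_inv_unitary:
  assumes "A \<in> unitary_matrices"
  shows "matrix_inv A = conj_transpose A"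
proof -
  have A: "A ** conj_transpose A = mat 1" "conj_transpose A ** A = mat 1"
    using assms by (auto simp: unitary_matrices_def)
  then have "matrix_inv A ** A = mat 1"
    using someI[of "\<lambda>B. A ** B = mat 1 \<and> B ** A = mat 1" "conj_transpose A"]
    unfolding matrix_inv_def by blast
  then have "matrix_inv A ** (A ** conj_transpose A) = conj_transpose A" by (simp add: matrix_mul_assoc)
  then show ?thesis by (simp add: A)
qed

lemma conj_transpose_unitary: "A \<in> unitary_matrices \<Longrightarrow> conj_transpose A \<in> unitary_matrices"
  by (simp add: unitary_matrices_def)

lemma norm_unitary:
  assumes "A \<in> unitary_matrices"
  shows "norm (A *v z) = norm z"
proof -
  have "hip (A *v z) (A *v z) = hip z z" by (simp add: hip_matrix_vector unitary_cancel[OF assms])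
  then have "(norm (A *v z))\<^sup>2 = (norm z)\<^sup>2" unfolding hip_self of_real_eq_iff .
  then show ?thesis by simp
qed

lemma linear_unitary: "linear ((*v) (A :: complex^'n^'m))"
  by (rule linearI)
    (simp_all add: matrix_vector_mult_def vec_eq_iff scaleR_vector sum_distrib_left sum.distrib algebra_simps)

lemma norm_vector_scalar_mult: "norm (c *s z) = cmod c * norm (z :: complex^'n)"
  by (simp add: norm_vec_def L2_set_def norm_mult power_mult_distrib sum_distrib_left[symmetric] real_sqrt_mult)

lemma linear_vector_scalar_mult: "linear ((*s) (c :: complex) :: complex^'n \<Rightarrow> complex^'n)"
  by (rule linearI) (simp_all add: vec_eq_iff algebra_simps)

section \<open>The Gaussian as a probability density\<close>

lemma nn_integral_gauss_real: "(\<integral>\<^sup>+x. ennreal (exp (- pi * (x::real)\<^sup>2)) \<partial>lborel) = 1"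
proof -
  \<comment> \<open>The standard deviation for which the normal density is exactly
    \<open>exp (- pi * x\<^sup>2)\<close>, without a prefactor.\<close>
  define \<sigma> where "\<sigma> = 1 / sqrt (2 * pi)"
  have \<sigma>: "\<sigma> > 0" "2 * pi * \<sigma>\<^sup>2 = 1" "2 * \<sigma>\<^sup>2 = 1 / pi"
    by (auto simp: \<sigma>_def power_divide)
  interpret prob_space "density lborel (normal_density 0 \<sigma>)"
    by (rule prob_space_normal_density) (rule \<sigma>)
  have "normal_density 0 \<sigma> x = exp (- pi * x\<^sup>2)" for x
    unfolding normal_density_def \<sigma>(2,3) by (simp add: mult.commute)
  then show ?thesis using emeasure_space_1 by (simp add: emeasure_density)
qed

lemma nn_integral_gauss: "(\<integral>\<^sup>+x. ennreal (exp (- pi * (norm (x::'a::euclidean_space))\<^sup>2)) \<partial>lborel) = 1"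
proof -
  have "ennreal (exp (- pi * (norm x)\<^sup>2)) = (\<Prod>b\<in>Basis. ennreal (exp (- pi * (x \<bullet> b)\<^sup>2)))" for x :: 'a
    unfolding power2_norm_eq_inner euclidean_inner[of x x]
    by (simp add: prod_ennreal exp_sum[symmetric] sum_distrib_left sum_negf power2_eq_square)
  then have "(\<integral>\<^sup>+x. ennreal (exp (- pi * (norm (x::'a))\<^sup>2)) \<partial>lborel)
      = (\<Prod>b\<in>(Basis::'a set). (\<integral>\<^sup>+x. ennreal (exp (- pi * x\<^sup>2)) \<partial>lborel))"
    by (simp only:) (rule nn_integral_lborel_prod, auto)
  then show ?thesis by (simp only: nn_integral_gauss_real prod.neutral_const)
qed

lemma prob_space_gauss_measure: "prob_space (gauss_measure :: (complex^'n) measure)"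
  using nn_integral_gauss[where 'a="complex^'n"]
  by (intro prob_spaceI) (simp add: gauss_measure_def emeasure_density)

lemma space_gauss_measure [simp]: "space gauss_measure = UNIV"
  by (simp add: gauss_measure_def)

lemma integrable_gauss_measure_iff:
  fixes f :: "complex^'n \<Rightarrow> 'b::{banach,second_countable_topology}"
  assumes "f \<in> borel_measurable borel"
  shows "integrable gauss_measure f \<longleftrightarrow> integrable lborel (\<lambda>z. exp (- pi * (norm z)\<^sup>2) *\<^sub>R f z)"
  unfolding gauss_measure_def using assms by (intro integrable_density) auto

lemma integral_gauss_measure:
  fixes f :: "complex^'n \<Rightarrow> 'b::{banach,second_countable_topology}"
  assumes "f \<in> borel_measurable borel"
  shows "integral\<^sup>L gauss_measure f = (\<integral>z. exp (- pi * (norm z)\<^sup>2) *\<^sub>R f z \<partial>lborel)"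
  unfolding gauss_measure_def using assms by (intro integral_density) auto

section \<open>Entire functions\<close>

lemma entire_comp_linear:
  assumes f: "entire f" and L: "linear L" "\<And>c h. L (c *s h) = c *s L h"
  shows "entire (\<lambda>z. f (L z + b))"
  unfolding entire_def
proof
  fix z
  obtain D where D: "(f has_derivative D) (at (L z + b))" "\<And>c h. D (c *s h) = c * D h"
    using f unfolding entire_def by blast
  have "((\<lambda>z. L z + b) has_derivative L) (at z)"
    using L(1) by (auto intro!: derivative_eq_intros linear_imp_has_derivative)
  from has_derivative_compose[OF this D(1)]
  have "((\<lambda>z. f (L z + b)) has_derivative (\<lambda>h. D (L h))) (at z)" .
  then show "\<exists>D. ((\<lambda>z. f (L z + b)) has_derivative D) (at z) \<and> (\<forall>c h. D (c *s h) = c * D h)"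
    using D(2) L(2) by (intro exI[of _ "\<lambda>h. D (L h)"]) auto
qed

lemma entire_mult:
  assumes "entire f" "entire g"
  shows "entire (\<lambda>z. f z * g z)"
  unfolding entire_def
proof
  fix z
  obtain D E where "(f has_derivative D) (at z)" "\<forall>c h. D (c *s h) = c * D h"
    "(g has_derivative E) (at z)" "\<forall>c h. E (c *s h) = c * E h"
    using assms unfolding entire_def by meson
  then show "\<exists>D. ((\<lambda>z. f z * g z) has_derivative D) (at z) \<and> (\<forall>c h. D (c *s h) = c * D h)"
    by (intro exI[of _ "\<lambda>h. f z * E h + D h * g z"]) (auto intro!: derivative_eq_intros simp: algebra_simps)
qed

lemma entire_const: "entire (\<lambda>z. c)"
  unfolding entire_def by (auto intro!: exI[of _ "\<lambda>h. 0"])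

lemma entire_hip: "entire (hip a)"
  unfolding entire_def
proof
  fix z
  have "bounded_linear (hip a)"
    by (rule bounded_linear_intro[where K="norm a"])
      (auto simp: hip_simps scaleR_conv_of_real[where 'a=complex] mult.commute[of _ "norm a"] cmod_hip_le)
  then show "\<exists>D. (hip a has_derivative D) (at z) \<and> (\<forall>c h. D (c *s h) = c * D h)"
    by (intro exI[of _ "hip a"]) (auto simp: hip_simps bounded_linear_imp_has_derivative)
qed

lemma entire_exp:
  assumes "entire f"
  shows "entire (\<lambda>z. exp (f z))"
  unfolding entire_def
proof
  fix z
  obtain D where D: "(f has_derivative D) (at z)" "\<forall>c h. D (c *s h) = c * D h"
    using assms unfolding entire_def by meson
  have "((\<lambda>z. exp (f z)) has_derivative (\<lambda>h. exp (f z) * D h)) (at z)"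
    using has_derivative_compose[OF D(1), of exp "\<lambda>h. exp (f z) * h"]
      DERIV_exp[of "f z", unfolded has_field_derivative_def] by simp
  then show "\<exists>D. ((\<lambda>z. exp (f z)) has_derivative D) (at z) \<and> (\<forall>c h. D (c *s h) = c * D h)"
    using D(2) by (intro exI[of _ "\<lambda>h. exp (f z) * D h"]) auto
qed

lemma entire_kern: "entire (kern a)"
proof -
  have "entire (\<lambda>z. exp (pi * hip a z + (- (pi / 2 * (norm a)\<^sup>2))))"
    by (intro entire_exp entire_add entire_cmult entire_hip entire_const)
  then show ?thesis by (simp add: kern_hip[abs_def])
qed

text \<open>Restriction to a complex line is the passage to one-variable complex analysis: the mean
  value property and Cauchy's estimate are both applied along such lines.\<close>

lemma entire_line_has_derivative:
  fixes f :: "complex^'n \<Rightarrow> complex"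
  assumes D: "(f has_derivative D) (at (a + t *s b))" "\<And>c h. D (c *s h) = c * D h"
  shows "((\<lambda>t. f (a + t *s b)) has_field_derivative D b) (at t)"
proof -
  have "bounded_linear (\<lambda>h. h *s b)"
    by (rule bounded_linear_intro[where K="norm b"])
      (simp_all add: vec_eq_iff algebra_simps norm_vector_scalar_mult)
  then have "((\<lambda>t. a + t *s b) has_derivative (\<lambda>h. h *s b)) (at t)"
    by (auto intro!: derivative_eq_intros bounded_linear_imp_has_derivative)
  from has_derivative_compose[OF this D(1)] show ?thesis
    by (simp add: has_field_derivative_def D(2) mult_commute_abs)
qed

lemma entire_line_holomorphic:
  assumes "entire f"
  shows "(\<lambda>t. f (a + t *s b)) holomorphic_on A"
proof (rule holomorphic_onI)
  fix t
  obtain D where D: "(f has_derivative D) (at (a + t *s b))" "\<And>c h. D (c *s h) = c * D h"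
    using assms unfolding entire_def by meson
  show "(\<lambda>t. f (a + t *s b)) field_differentiable at t within A"
    using entire_line_has_derivative[OF D] field_differentiable_at_within field_differentiable_def by blast
qed

text \<open>Cauchy's integral formula at the centre of the unit circle. The integral over the angle
  is a Lebesgue integral with an indicator so that Fubini's theorem can exchange it with integrals
  over the space.\<close>

lemma circle_mean_value:
  fixes h :: "complex \<Rightarrow> complex"
  assumes "h holomorphic_on UNIV"
  shows "(\<integral>\<theta>. indicator {0..1} \<theta> *\<^sub>R h (exp (2 * of_real pi * \<i> * of_real \<theta>)) \<partial>lborel) = h 0"
proof -
  have "((\<lambda>u. h u / (u - 0)) has_contour_integral (2 * of_real pi * \<i> * h 0)) (circlepath 0 1)"
    using assms by (intro Cauchy_integral_circlepath_simple) (auto intro: holomorphic_on_subset)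
  then have "((\<lambda>x. h (circlepath 0 1 x) / circlepath 0 1 x * vector_derivative (circlepath 0 1) (at x within {0..1}))
     has_integral (2 * of_real pi * \<i> * h 0)) {0..1}"
    by (simp add: has_contour_integral_def)
  then have "((\<lambda>x. (2 * of_real pi * \<i>) * h (exp (2 * of_real pi * \<i> * of_real x))) has_integral (2 * of_real pi * \<i> * h 0)) {0..1}"
  proof (rule has_integral_eq[rotated])
    fix x :: real assume "x \<in> {0..1}"
    then have vd: "vector_derivative (circlepath 0 1) (at x within {0..1})
        = 2 * of_real pi * \<i> * exp (2 * of_real pi * \<i> * of_real x)"
      using vector_derivative_circlepath01[of x 0 1] by simp
    have "circlepath 0 1 x = exp (2 * of_real pi * \<i> * of_real x)"
      by (simp add: circlepath)
    then show "h (circlepath 0 1 x) / circlepath 0 1 x * vector_derivative (circlepath 0 1) (at x within {0..1})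
        = 2 * of_real pi * \<i> * h (exp (2 * of_real pi * \<i> * of_real x))"
      unfolding vd by simp
  qed
  from has_integral_mult_right[OF this, of "1 / (2 * of_real pi * \<i>)"]
  have 1: "((\<lambda>x. h (exp (2 * of_real pi * \<i> * of_real x))) has_integral h 0) {0..1}" by simp
  have "continuous_on {0..1} (\<lambda>x. h (exp (2 * of_real pi * \<i> * of_real x)))"
    by (rule continuous_on_compose2[OF holomorphic_on_imp_continuous_on[OF assms]])
      (auto intro!: continuous_intros)
  then have "set_integrable lborel {0..1} (\<lambda>x. h (exp (2 * of_real pi * \<i> * of_real x)))"
    by (rule borel_integrable_atLeastAtMost')
  from set_borel_integral_eq_integral(2)[OF this] integral_unique[OF 1]
  show ?thesis by (simp add: set_lebesgue_integral_def)
qed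

lemma borel_measurable_entire: "entire f \<Longrightarrow> f \<in> borel_measurable borel"
  by (simp add: borel_measurable_continuous_onI entire_continuous)

text \<open>Averaging over the rotations \<open>z \<mapsto> e\<^sup>i\<^sup>\<theta> z\<close>, which preserve the Gaussian measure, reduces the
  mean value property to the one-variable case on every complex line through the origin.\<close>

lemma gauss_mean_value:
  fixes f :: "complex^'n \<Rightarrow> complex"
  assumes f: "entire f" "integrable gauss_measure f"
  shows "integral\<^sup>L gauss_measure f = f 0"
proof -
  note [measurable] = borel_measurable_entire[OF f(1)]
  define e where "e \<theta> = exp (2 * of_real pi * \<i> * of_real \<theta>)" for \<theta> :: real
  have e: "cmod (e \<theta>) = 1" for \<theta> by (simp add: e_def norm_exp_eq_Re)
  have [measurable]: "e \<in> borel_measurable borel"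
    unfolding e_def by (intro borel_measurable_continuous_onI continuous_intros)
  define F where "F z = exp (- pi * (norm z)\<^sup>2) *\<^sub>R f z" for z
  have [measurable]: "F \<in> borel_measurable borel" unfolding F_def by measurable
  have Fint: "integrable lborel F"
    using f(2) integrable_gauss_measure_iff[of f] by (simp add: F_def[abs_def])
  have rot: "(\<integral>z. F (e \<theta> *s z) \<partial>lborel) = (\<integral>z. F z \<partial>lborel)"
     "(\<integral>z. norm (F (e \<theta> *s z)) \<partial>lborel) = (\<integral>z. norm (F z) \<partial>lborel)"
     "integrable lborel (\<lambda>z. F (e \<theta> *s z))" for \<theta>
  proof -
    note iso = linear_vector_scalar_mult[of "e \<theta>"]
    have n: "norm (e \<theta> *s z) = norm z" for z :: "complex^'n" by (simp add: norm_vector_scalar_mult e)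
    show "(\<integral>z. F (e \<theta> *s z) \<partial>lborel) = (\<integral>z. F z \<partial>lborel)"
      by (rule lborel_integral_isometry[OF iso n]) measurable
    show "(\<integral>z. norm (F (e \<theta> *s z)) \<partial>lborel) = (\<integral>z. norm (F z) \<partial>lborel)"
      by (rule lborel_integral_isometry[OF iso n, of "\<lambda>z. norm (F z)"]) measurable
    show "integrable lborel (\<lambda>z. F (e \<theta> *s z))"
      by (rule lborel_integrable_isometry[OF iso n Fint])
  qed
  \<comment> \<open>Integrating over \<open>z\<close> first gives the integral of \<open>F\<close>,
    by rotation invariance. Integrating over the angle first gives the Gaussian weight times
    \<open>f 0\<close>.\<close>
  define G where "G \<theta> z = indicator {0..1} \<theta> *\<^sub>R F (e \<theta> *s z)" for \<theta> :: real and z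
  have cont: "continuous_on UNIV (\<lambda>(\<theta>, z). e \<theta> *s z :: complex^'n)"
    unfolding e_def vector_scalar_mult_def case_prod_unfold
    by (intro continuous_intros continuous_on_vec_lambda)
  have [measurable]: "(\<lambda>(\<theta>, z). e \<theta> *s z :: complex^'n) \<in> borel_measurable (lborel \<Otimes>\<^sub>M lborel)"
    using borel_measurable_continuous_onI[OF cont] by (simp add: borel_prod[symmetric] cong: measurable_cong_sets)
  have Gm: "(\<lambda>(\<theta>, z). G \<theta> z) \<in> borel_measurable (lborel \<Otimes>\<^sub>M lborel)"
  proof -
    have "(\<lambda>p. F ((\<lambda>(\<theta>, z). e \<theta> *s z) p)) \<in> borel_measurable (lborel \<Otimes>\<^sub>M lborel)" by measurable
    then show ?thesis unfolding G_def case_prod_unfold by measurable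
  qed
  have Gint: "integrable (lborel \<Otimes>\<^sub>M lborel) (\<lambda>(\<theta>, z). G \<theta> z)"
  proof (rule lborel_pair.Fubini_integrable[OF Gm])
    have "(\<integral>z. norm (G \<theta> z) \<partial>lborel) = indicator {0..1} \<theta> * (\<integral>z. norm (F z) \<partial>lborel)" for \<theta>
      using rot(2)[of \<theta>] by (simp add: G_def)
    then show "integrable lborel (\<lambda>x. \<integral>y. norm (case (x, y) of (\<theta>, z) \<Rightarrow> G \<theta> z) \<partial>lborel)"
      by simp
    show "AE x in lborel. integrable lborel (\<lambda>y. case (x, y) of (\<theta>, z) \<Rightarrow> G \<theta> z)"
      using rot(3) by (intro AE_I2) (auto simp: G_def)
  qed
  have "(\<integral>\<theta>. (\<integral>z. G \<theta> z \<partial>lborel) \<partial>lborel) = (\<integral>\<theta>. indicator {0..1::real} \<theta> *\<^sub>R (\<integral>z. F z \<partial>lborel) \<partial>lborel)"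
    unfolding G_def by (simp add: rot(1))
  also have "\<dots> = (\<integral>z. F z \<partial>lborel)" by simp
  finally have 1: "(\<integral>\<theta>. (\<integral>z. G \<theta> z \<partial>lborel) \<partial>lborel) = (\<integral>z. F z \<partial>lborel)" .
  have inner: "(\<integral>\<theta>. G \<theta> z \<partial>lborel) = exp (- pi * (norm z)\<^sup>2) *\<^sub>R f 0" for z
  proof -
    have "(\<integral>\<theta>. G \<theta> z \<partial>lborel) = (\<integral>\<theta>. exp (- pi * (norm z)\<^sup>2) *\<^sub>R (indicator {0..1} \<theta> *\<^sub>R f (0 + e \<theta> *s z)) \<partial>lborel)"
      by (simp add: G_def F_def norm_vector_scalar_mult e mult.commute)
    also have "\<dots> = exp (- pi * (norm z)\<^sup>2) *\<^sub>R (\<integral>\<theta>. indicator {0..1} \<theta> *\<^sub>R f (0 + e \<theta> *s z) \<partial>lborel)"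
      by (rule integral_scaleR_right)
    also have "(\<integral>\<theta>. indicator {0..1} \<theta> *\<^sub>R f (0 + e \<theta> *s z) \<partial>lborel) = f 0"
      using circle_mean_value[OF entire_line_holomorphic[OF f(1)], of 0 z] by (simp add: e_def)
    finally show ?thesis .
  qed
  have "(\<integral>z. F z \<partial>lborel) = (\<integral>z. (\<integral>\<theta>. G \<theta> z \<partial>lborel) \<partial>lborel)"
    unfolding 1[symmetric] using lborel_pair.Fubini_integral[OF Gint] by simp
  also have "\<dots> = (\<integral>z. exp (- pi * (norm (z :: complex^'n))\<^sup>2) *\<^sub>R f 0 \<partial>lborel)"
    by (simp only: inner)
  also have "\<dots> = (\<integral>z. f 0 \<partial>(gauss_measure :: (complex^'n) measure))"
    by (rule integral_gauss_measure[symmetric]) simp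
  also have "\<dots> = f 0"
    using prob_space.prob_space[OF prob_space_gauss_measure[where 'n='n]]
    by (simp only: lebesgue_integral_const space_gauss_measure scaleR_one)
  finally show ?thesis by (simp add: integral_gauss_measure F_def)
qed

section \<open>Reproducing kernels and completeness\<close>

lemma fock_fun_entire: "entire (fock_fun f)"
  and fock_fun_square_integrable: "integrable gauss_measure (\<lambda>z. (cmod (fock_fun f z))\<^sup>2)"
  using fock_fun[of f] by (auto simp: fock_set_def)

lemma borel_measurable_fock_fun [measurable]: "fock_fun f \<in> borel_measurable borel"
  by (rule borel_measurable_entire[OF fock_fun_entire])

lemma cnj_borel_measurable [measurable]: "(cnj :: complex \<Rightarrow> complex) \<in> borel_measurable borel"
  by (intro borel_measurable_continuous_onI continuous_intros)

lemma cinner_simps: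
  "cinner (f + g) h = cinner f h + cinner g h" "cinner (f - g) h = cinner f h - cinner g h"
  "cinner (- f) h = - cinner f h"
  "cinner h (f + g) = cinner h f + cinner h g" "cinner h (f - g) = cinner h f - cinner h g"
  "cinner h (- f) = - cinner h f"
  "cinner (scaleC c f) h = c * cinner f h" "cinner h (scaleC c f) = cnj c * cinner h f"
  "cinner (r *\<^sub>R f) h = complex_of_real r * cinner f h" "cinner h (r *\<^sub>R f) = complex_of_real r * cinner h f"
  "cinner 0 h = 0" "cinner h 0 = 0"
proof -
  have i: "integrable gauss_measure (\<lambda>z. fock_fun f z * cnj (fock_fun g z))" for f g :: "'a fock"
    by (rule cinner_integrable)
  show a: "cinner (f + g) h = cinner f h + cinner g h" for f g h :: "'a fock"
    by (simp add: cinner_def fock_fun_plus ring_distribs i)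
  show c: "cinner (scaleC c f) h = c * cinner f h" for c and f h :: "'a fock"
    by (simp add: cinner_def fock_fun_scaleC mult.assoc)
  show n: "cinner (- f) h = - cinner f h" for f h :: "'a fock"
    unfolding uminus_fock_def c by simp
  show s: "cinner (f - g) h = cinner f h - cinner g h" for f g h :: "'a fock"
    unfolding minus_fock_def a n by simp
  show r: "cinner (r *\<^sub>R f) h = complex_of_real r * cinner f h" for r and f h :: "'a fock"
    unfolding scaleR_fock_def c ..
  show z: "cinner 0 h = 0" for h :: "'a fock"
    by (simp add: cinner_def fock_fun_zero)
  show "cinner h (f + g) = cinner h f + cinner h g"
    unfolding cinner_commute[of h] a by simp
  show "cinner h (f - g) = cinner h f - cinner h g"
    unfolding cinner_commute[of h] s by simp
  show "cinner h (- f) = - cinner h f"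
    unfolding cinner_commute[of h] n by simp
  show "cinner h (scaleC c f) = cnj c * cinner h f"
    unfolding cinner_commute[of h] c by simp
  show "cinner h (r *\<^sub>R f) = complex_of_real r * cinner h f"
    unfolding cinner_commute[of h] r by simp
  show "cinner h 0 = 0"
    unfolding cinner_commute[of h] z by simp
qed

lemma cinner_self_norm: "cinner f f = complex_of_real ((norm f)\<^sup>2)"
proof -
  have "Im (cinner f f) = 0" by (simp add: cinner_self)
  then show ?thesis by (simp add: complex_eq_iff power2_norm_eq_inner inner_fock_def)
qed

lemma scaleC_simps:
  "scaleC c (f + g) = scaleC c f + scaleC c g" "scaleC c (f - g) = scaleC c f - scaleC c g"
  "scaleC c (- f) = - scaleC c f" "scaleC c 0 = 0" "scaleC 0 f = 0" "scaleC 1 f = f"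
  "scaleC (c + d) f = scaleC c f + scaleC d f" "scaleC c (scaleC d f) = scaleC (c * d) f"
  "scaleC c (r *\<^sub>R f) = r *\<^sub>R scaleC c f" "scaleC (complex_of_real r) f = r *\<^sub>R f"
  by (auto intro!: fock_eqI simp: fock_fun_simps algebra_simps)

lemma norm_scaleC: "norm (scaleC c f) = cmod c * norm f"
proof -
  have "cinner (scaleC c f) (scaleC c f) = complex_of_real ((cmod c * norm f)\<^sup>2)"
    unfolding cinner_simps(7,8) cinner_self_norm[of f] power_mult_distrib of_real_mult complex_norm_square
    by (simp add: mult_ac)
  then have "(norm (scaleC c f))\<^sup>2 = (cmod c * norm f)\<^sup>2"
    unfolding cinner_self_norm of_real_eq_iff .
  then show ?thesis by (rule power2_eq_imp_eq) auto
qed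

lemma cinner_conv_inner: "cinner f g = Complex (inner f g) (inner f (scaleC \<i> g))"
  by (simp add: complex_eq_iff inner_fock_def cinner_simps)

lemma cinner_cauchy_schwarz: "cmod (cinner f g) \<le> norm f * norm g"
proof (cases "cinner f g = 0")
  case False
  \<comment> \<open>A unimodular factor that makes the product real and equal to its modulus, so
    that the real Cauchy-Schwarz inequality applies.\<close>
  define c where "c = cnj (cinner f g) / cmod (cinner f g)"
  have c: "cmod c = 1" using False by (simp add: c_def norm_divide)
  have "cinner (scaleC c f) g = complex_of_real (cmod (cinner f g))"
    using False by (simp add: cinner_simps c_def mult.commute complex_norm_square[symmetric] power2_eq_square field_simps)
  then have "cmod (cinner f g) = inner (scaleC c f) g" by (simp add: inner_fock_def)
  also have "\<dots> \<le> norm (scaleC c f) * norm g" by (rule norm_cauchy_schwarz)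
  finally show ?thesis by (simp add: norm_scaleC c)
qed simp

lemma cinner_eqI: "(\<And>g. cinner f g = cinner h g) \<Longrightarrow> f = h"
  by (metis cinner_simps(2) cinner_self_norm eq_iff_diff_eq_0 norm_eq_zero of_real_eq_0_iff zero_eq_power2)

lemma tendsto_cinner:
  "(f \<longlongrightarrow> a) F \<Longrightarrow> (g \<longlongrightarrow> b) F \<Longrightarrow> ((\<lambda>x. cinner (f x) (g x)) \<longlongrightarrow> cinner a b) F"
  for a b :: "'n::finite fock"
proof -
  have "bounded_linear (scaleC \<i> :: 'n fock \<Rightarrow> 'n fock)"
    by (rule bounded_linear_intro[where K=1]) (auto simp: scaleC_simps norm_scaleC)
  note l = bounded_linear.tendsto[OF this]
  assume "(f \<longlongrightarrow> a) F" "(g \<longlongrightarrow> b) F"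
  then show ?thesis
    unfolding cinner_conv_inner by (intro tendsto_Complex tendsto_inner l)
qed

lemma cinner_lborel:
  "cinner f g = (\<integral>z. exp (- pi * (norm z)\<^sup>2) *\<^sub>R (fock_fun f z * cnj (fock_fun g z)) \<partial>lborel)"
  unfolding cinner_def by (rule integral_gauss_measure) measurable

lemma kern_exp: "kern z w = exp (complex_of_real pi * (hip z w - hip z z / 2))"
  by (simp add: kern_hip hip_self algebra_simps)

lemma cnj_hip_self: "cnj (hip z z) = hip z z"
  by (simp add: hip_self)

lemma of_real_exp_norm: "complex_of_real (exp (- pi * (norm w)\<^sup>2)) = exp (- complex_of_real pi * hip w w)"
  by (simp add: hip_self exp_of_real[symmetric])

text \<open>The squared modulus of \<open>kern z w\<close> turns the Gaussian weight at
  \<open>w\<close> into the weight at \<open>w - z\<close>. What remains is a translation followed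
  by an isometry of Lebesgue measure. The Weyl operators are the case \<open>A = mat 1\<close>, the
  parity is the case \<open>A = - mat 1\<close> and \<open>z = 0\<close>.\<close>

lemma motion_fock_set_aux:
  assumes A: "A \<in> unitary_matrices" and f: "f \<in> fock_set" and g: "g \<in> fock_set"
  shows "(\<integral>w. (kern z w * f (conj_transpose A *v (w - z))) * cnj (kern z w * g (conj_transpose A *v (w - z))) \<partial>gauss_measure)
      = (\<integral>w. f w * cnj (g w) \<partial>gauss_measure)"
    and "(\<lambda>w. kern z w * f (conj_transpose A *v (w - z))) \<in> fock_set"
proof -
  have fe: "entire f" "entire g" using f g by (auto simp: fock_set_def)
  note [measurable] = borel_measurable_entire[OF fe(1)] borel_measurable_entire[OF fe(2)]
    borel_measurable_entire[OF entire_kern[of z]]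
  have cA: "conj_transpose A \<in> unitary_matrices" by (rule conj_transpose_unitary[OF A])
  note lin = linear_unitary[of "conj_transpose A"]
  have [measurable]: "(*v) (conj_transpose A) \<in> borel_measurable borel"
    using lin by (intro borel_measurable_continuous_onI) (simp add: linear_continuous_on linear_conv_bounded_linear)
  have weight: "exp (- pi * (norm w)\<^sup>2) *\<^sub>R ((kern z w * a) * cnj (kern z w * b))
     = exp (- pi * (norm (w - z))\<^sup>2) *\<^sub>R (a * cnj b)" for w a b
  proof -
    have "exp (- pi * (norm w)\<^sup>2) * (cmod (kern z w))\<^sup>2 = exp (- pi * (norm (w - z))\<^sup>2)"
      by (simp add: kern_hip norm_exp_eq_Re Re_hip exp_double[symmetric] exp_add[symmetric] power2_norm_eq_inner
          inner_simps inner_commute algebra_simps)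
    moreover have "(kern z w * a) * cnj (kern z w * b) = complex_of_real ((cmod (kern z w))\<^sup>2) * (a * cnj b)"
      by (simp add: complex_norm_square mult_ac del: of_real_power)
    ultimately show ?thesis
      by (simp only: scaleR_conv_of_real mult.assoc[symmetric] of_real_mult[symmetric])
  qed
  define G where "G w = exp (- pi * (norm w)\<^sup>2) *\<^sub>R (f w * cnj (g w))" for w
  define F where "F w = exp (- pi * (norm w)\<^sup>2) *\<^sub>R (f w * cnj (f w))" for w
  have [measurable]: "G \<in> borel_measurable borel" "F \<in> borel_measurable borel"
    unfolding G_def F_def by measurable
  have m: "exp (- pi * (norm w)\<^sup>2) *\<^sub>R ((kern z w * f (conj_transpose A *v (w - z))) * cnj (kern z w * g (conj_transpose A *v (w - z))))
      = G (conj_transpose A *v (w - z))"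
    "exp (- pi * (norm w)\<^sup>2) *\<^sub>R ((kern z w * f (conj_transpose A *v (w - z))) * cnj (kern z w * f (conj_transpose A *v (w - z))))
      = F (conj_transpose A *v (w - z))" for w
    unfolding weight by (simp_all add: G_def F_def norm_unitary[OF cA])
  have "(\<integral>w. (kern z w * f (conj_transpose A *v (w - z))) * cnj (kern z w * g (conj_transpose A *v (w - z))) \<partial>gauss_measure)
      = (\<integral>w. G (conj_transpose A *v (w - z)) \<partial>lborel)"
    by (subst integral_gauss_measure) (measurable, simp only: m)
  also have "\<dots> = (\<integral>w. G (conj_transpose A *v w) \<partial>lborel)"
    by (rule lborel_integral_translate(2))
  also have "\<dots> = (\<integral>w. G w \<partial>lborel)"
    by (rule lborel_integral_isometry[OF lin norm_unitary[OF cA]]) measurable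
  also have "\<dots> = (\<integral>w. f w * cnj (g w) \<partial>gauss_measure)"
    unfolding G_def by (rule integral_gauss_measure[symmetric]) measurable
  finally show "(\<integral>w. (kern z w * f (conj_transpose A *v (w - z))) * cnj (kern z w * g (conj_transpose A *v (w - z))) \<partial>gauss_measure)
      = (\<integral>w. f w * cnj (g w) \<partial>gauss_measure)" .
  have "integrable gauss_measure (\<lambda>w. f w * cnj (f w))" by (rule fock_set_integrable_mult[OF f f])
  then have "integrable lborel F" unfolding F_def[abs_def] by (subst (asm) integrable_gauss_measure_iff) auto
  then have "integrable lborel (\<lambda>w. F (conj_transpose A *v w))"
    by (rule lborel_integrable_isometry[OF lin norm_unitary[OF cA]])
  then have "integrable lborel (\<lambda>w. F (conj_transpose A *v (w - z)))"
    using lborel_integrable_translate(2)[of "\<lambda>w. F (conj_transpose A *v w)" z] by simp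
  then have "integrable gauss_measure (\<lambda>w. (kern z w * f (conj_transpose A *v (w - z))) * cnj (kern z w * f (conj_transpose A *v (w - z))))"
    by (subst integrable_gauss_measure_iff) (measurable, simp only: m)
  then have "integrable gauss_measure (\<lambda>w. (cmod (kern z w * f (conj_transpose A *v (w - z))))\<^sup>2)"
    unfolding complex_norm_square[symmetric] complex_of_real_integrable_eq .
  moreover have "entire (\<lambda>w. f (conj_transpose A *v w + (- (conj_transpose A *v z))))"
    by (rule entire_comp_linear[OF fe(1) lin]) (simp add: matrix_vector_mult_def vec_eq_iff sum_distrib_left mult_ac)
  ultimately show "(\<lambda>w. kern z w * f (conj_transpose A *v (w - z))) \<in> fock_set"
    unfolding fock_set_def by (auto intro!: entire_mult entire_kern simp: matrix_vector_mult_diff_distrib)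
qed

lemma mat_1_unitary: "mat 1 \<in> unitary_matrices"
  by (simp add: unitary_matrices_def)

lemma translate_fock_set:
  assumes "f \<in> fock_set"
  shows "(\<lambda>w. kern z w * f (w - z)) \<in> fock_set"
  using motion_fock_set_aux(2)[OF mat_1_unitary assms assms, of z] by simp

lemma fock_set_integrable:
  fixes f :: "complex^'n \<Rightarrow> complex"
  assumes "f \<in> fock_set"
  shows "integrable gauss_measure f"
proof -
  interpret prob_space "gauss_measure :: (complex^'n) measure" by (rule prob_space_gauss_measure)
  have f: "entire f" "integrable gauss_measure (\<lambda>z. (cmod (f z))\<^sup>2)"
    using assms by (auto simp: fock_set_def)
  have "cmod (f z) \<le> norm (1 + (cmod (f z))\<^sup>2)" for z
      proof -
    have "cmod (f z) \<le> 1 + (cmod (f z))\<^sup>2"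
      using sum_power2_ge_zero[of "cmod (f z) - 1" "cmod (f z)"]
      by (simp add: power2_eq_square algebra_simps)
    then show ?thesis by simp
  qed
  then show ?thesis
    by (intro Bochner_Integration.integrable_bound[where g = f and f = "\<lambda>z. 1 + (cmod (f z))\<^sup>2"])
      (use f in \<open>auto intro: entire_measurable\<close>)
qed

lemma fock_set_1: "(\<lambda>z::complex^'n. 1) \<in> fock_set"
proof -
  interpret prob_space "gauss_measure :: (complex^'n) measure" by (rule prob_space_gauss_measure)
  show ?thesis by (simp add: fock_set_def entire_const)
qed

lemma kern_fock_set: "kern z \<in> fock_set"
  using translate_fock_set[OF fock_set_1, of z] by simp

definition coh :: "complex^'n \<Rightarrow> 'n::finite fock" where
  "coh z = Abs_fock (kern z)"

lemma fock_fun_coh: "fock_fun (coh z) = kern z"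
  by (simp add: coh_def Abs_fock_inverse kern_fock_set)

text \<open>The reproducing property. It is the Gaussian mean value property for \<open>f\<close>
  translated by \<open>- z\<close>, whose value at the origin is a multiple of
  \<open>f z\<close>.\<close>

lemma fock_fun_conv_coh: "fock_fun f z = exp (pi / 2 * (norm z)\<^sup>2) * cinner f (coh z)"
proof -
  define h where "h w = kern (- z) w * fock_fun f (w - (- z))" for w
  have h: "h \<in> fock_set" unfolding h_def by (rule translate_fock_set[OF fock_fun])
  then have he: "entire h" by (simp add: fock_set_def)
  note [measurable] = borel_measurable_entire[OF he] borel_measurable_entire[OF entire_kern]
  have "h 0 = integral\<^sup>L gauss_measure h"
    by (rule gauss_mean_value[OF he fock_set_integrable[OF h], symmetric])
  also have "\<dots> = (\<integral>w. exp (- pi * (norm w)\<^sup>2) *\<^sub>R h w \<partial>lborel)"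
    by (rule integral_gauss_measure) measurable
  also have "\<dots> = (\<integral>w. exp (- pi * (norm (w - z))\<^sup>2) *\<^sub>R h (w - z) \<partial>lborel)"
    by (rule lborel_integral_translate(2)[symmetric])
  also have "\<dots> = cinner f (coh z)"
    unfolding cinner_lborel
  proof (rule Bochner_Integration.integral_cong[OF refl])
    fix w
    have "complex_of_real (exp (- pi * (norm (w - z))\<^sup>2)) * kern (- z) (w - z)
        = complex_of_real (exp (- pi * (norm w)\<^sup>2)) * cnj (kern z w)"
      unfolding of_real_exp_norm kern_exp exp_add[symmetric] exp_cnj
      by (simp add: hip_simps hip_commute[of w z] cnj_hip_self algebra_simps)
    then show "exp (- pi * (norm (w - z))\<^sup>2) *\<^sub>R h (w - z)
        = exp (- pi * (norm w)\<^sup>2) *\<^sub>R (fock_fun f w * cnj (fock_fun (coh z) w))"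
      by (simp add: h_def scaleR_conv_of_real fock_fun_coh mult_ac)
  qed
  finally have "kern (- z) 0 * fock_fun f z = cinner f (coh z)"
    by (simp add: h_def)
  moreover have "kern (- z) 0 = inverse (complex_of_real (exp (pi / 2 * (norm z)\<^sup>2)))"
    unfolding kern_hip hip_simps by (simp add: exp_minus exp_of_real[symmetric])
  ultimately show ?thesis by (simp add: field_simps)
qed

lemma norm_coh: "norm (coh z) = 1"
proof -
  have "kern z z = complex_of_real (exp (pi / 2 * (norm z)\<^sup>2))"
    unfolding kern_exp hip_self by (simp add: exp_of_real[symmetric])
  then have "cinner (coh z) (coh z) = 1"
    using fock_fun_conv_coh[of "coh z" z] by (simp add: fock_fun_coh)
  then have "complex_of_real ((norm (coh z))\<^sup>2) = complex_of_real 1"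
    unfolding cinner_self_norm by simp
  then have "(norm (coh z))\<^sup>2 = 1\<^sup>2" unfolding of_real_eq_iff by simp
  then show ?thesis by (rule power2_eq_imp_eq) simp_all
qed

lemma cmod_fock_fun_le: "cmod (fock_fun f z) \<le> exp (pi / 2 * (norm z)\<^sup>2) * norm f"
proof -
  have "cmod (fock_fun f z) = exp (pi / 2 * (norm z)\<^sup>2) * cmod (cinner f (coh z))"
    by (subst fock_fun_conv_coh) (simp add: norm_mult)
  also have "\<dots> \<le> exp (pi / 2 * (norm z)\<^sup>2) * (norm f * norm (coh z))"
    by (intro mult_left_mono cinner_cauchy_schwarz) auto
  finally show ?thesis by (simp add: norm_coh)
qed

section \<open>Completeness of the Fock space\<close>

text \<open>Cauchy's estimate on the unit circle of the complex line through \<open>z\<close> in the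
  direction of \<open>h\<close>, followed by homogeneity of \<open>D\<close>.\<close>

lemma entire_derivative_bound:
  assumes g: "entire g" and D: "(g has_derivative D) (at z)" "\<And>c h. D (c *s h) = c * D h"
    and bound: "\<And>w. norm w \<le> norm z + 1 \<Longrightarrow> cmod (g w) \<le> B"
  shows "cmod (D h) \<le> B * norm h"
proof (cases "h = 0")
  case True
  then show ?thesis using D(2)[of 0 h] by simp
next
  case False
  define e where "e = (1 / norm h) *\<^sub>R h"
  have e: "norm e = 1" using False by (simp add: e_def)
  have "((\<lambda>t. g (z + t *s e)) has_field_derivative D e) (at 0)"
    by (rule entire_line_has_derivative) (use D in auto)
  then have "deriv (\<lambda>t. g (z + t *s e)) 0 = D e" by (rule DERIV_imp_deriv)
  moreover have "cmod ((deriv ^^ 1) (\<lambda>t. g (z + t *s e)) 0) \<le> fact 1 * B / 1 ^ 1"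
  proof (rule Cauchy_inequality)
    show "(\<lambda>t. g (z + t *s e)) holomorphic_on ball 0 1" by (rule entire_line_holomorphic[OF g])
    show "continuous_on (cball 0 1) (\<lambda>t. g (z + t *s e))"
      by (rule holomorphic_on_imp_continuous_on[OF entire_line_holomorphic[OF g]])
    show "cmod (g (z + x *s e)) \<le> B" if "cmod (0 - x) = 1" for x
      using that e norm_triangle_ineq[of z "x *s e"] by (intro bound) (simp add: norm_vector_scalar_mult)
  qed simp
  ultimately have "cmod (D e) \<le> B" by simp
  moreover have "D h = complex_of_real (norm h) * D e"
    using False by (simp add: D(2)[symmetric] e_def scaleR_vector[symmetric])
  then have "cmod (D h) = cmod (D e) * norm h" by (simp add: norm_mult)
  ultimately show ?thesis using mult_right_mono[of "cmod (D e)" B "norm h"] by simp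
qed

lemma entire_frechet_derivative:
  assumes "entire f"
  shows "(f has_derivative frechet_derivative f (at z)) (at z)"
    and "frechet_derivative f (at z) (c *s h) = c * frechet_derivative f (at z) h"
proof -
  obtain D where "(f has_derivative D) (at z)" "\<And>c h. D (c *s h) = c * D h"
    using assms unfolding entire_def by meson
  moreover from this have "D = frechet_derivative f (at z)" by (simp add: frechet_derivative_at)
  ultimately show "(f has_derivative frechet_derivative f (at z)) (at z)"
    "frechet_derivative f (at z) (c *s h) = c * frechet_derivative f (at z) h" by auto
qed

text \<open>Point evaluations are bounded locally uniformly, and by Cauchy's estimate so are
  derivatives. A norm Cauchy sequence therefore converges locally uniformly together with its
  derivatives, and complex linearity of the derivatives survives the limit.\<close>

lemma fock_Cauchy_pointwise_limit:
  fixes X :: "nat \<Rightarrow> 'n::finite fock"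
  assumes X: "Cauchy X"
  shows "\<exists>F. entire F \<and> (\<forall>z. (\<lambda>n. fock_fun (X n) z) \<longlonglongrightarrow> F z)"
proof -
  define D where "D n z = frechet_derivative (fock_fun (X n)) (at z)" for n z
  have D: "(fock_fun (X n) has_derivative D n z) (at z)" "D n z (c *s h) = c * D n z h" for n z c h
    unfolding D_def using entire_frechet_derivative[OF fock_fun_entire] by blast+
  have bd: "cmod (D n z h - D m z h) \<le> exp (pi / 2 * (norm z + 1)\<^sup>2) * norm (X n - X m) * norm h" for m n z h
  proof (rule entire_derivative_bound[of "fock_fun (X n - X m)" "\<lambda>h. D n z h - D m z h"])
    show "(fock_fun (X n - X m) has_derivative (\<lambda>h. D n z h - D m z h)) (at z)"
      unfolding fock_fun_minus by (intro has_derivative_diff D)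
    show "cmod (fock_fun (X n - X m) w) \<le> exp (pi / 2 * (norm z + 1)\<^sup>2) * norm (X n - X m)"
      if "norm w \<le> norm z + 1" for w
      by (rule order_trans[OF cmod_fock_fun_le])
        (use that in \<open>auto intro!: mult_right_mono mult_left_mono power_mono\<close>)
  qed (auto simp: fock_fun_entire D algebra_simps)
  have small: "\<exists>N. \<forall>m\<ge>N. \<forall>n\<ge>N. C * norm (X n - X m) < e" if pos: "e > 0" "C > 0" for C e
  proof -
    obtain N where "\<forall>m\<ge>N. \<forall>n\<ge>N. dist (X m) (X n) < e / C"
      using metric_CauchyD[OF X divide_pos_pos[OF pos]] by blast
    then show ?thesis using pos
      by (intro exI[of _ N]) (simp add: dist_norm pos_less_divide_eq mult.commute norm_minus_commute)
  qed
  have "convergent (\<lambda>n. D n z h)" for z h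
  proof (rule Cauchy_convergent, rule metric_CauchyI)
    fix e :: real assume "e > 0"
    have "exp (pi / 2 * (norm z + 1)\<^sup>2) * (norm h + 1) > 0" by (simp add: add_nonneg_pos)
    from small[OF \<open>e > 0\<close> this] obtain N where
      N: "\<forall>m\<ge>N. \<forall>n\<ge>N. exp (pi / 2 * (norm z + 1)\<^sup>2) * (norm h + 1) * norm (X n - X m) < e"
      by blast
    have "dist (D m z h) (D n z h) < e" if "m \<ge> N" "n \<ge> N" for m n
    proof -
      have "dist (D m z h) (D n z h) \<le> exp (pi / 2 * (norm z + 1)\<^sup>2) * norm (X m - X n) * norm h"
        using bd[of m z h n] by (simp add: dist_norm)
      also have "\<dots> \<le> exp (pi / 2 * (norm z + 1)\<^sup>2) * norm (X m - X n) * (norm h + 1)"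
        by (intro mult_left_mono) auto
      also have "\<dots> < e" using N[rule_format, of n m] that by (simp add: mult_ac)
      finally show ?thesis .
    qed
    then show "\<exists>N. \<forall>m\<ge>N. \<forall>n\<ge>N. dist (D m z h) (D n z h) < e" by blast
  qed
  then obtain G where G: "\<And>z h. (\<lambda>n. D n z h) \<longlonglongrightarrow> G z h"
    unfolding convergent_def by metis
  have G_linear: "G z (c *s h) = c * G z h" for z c h
  proof -
    have "(\<lambda>n. D n z (c *s h)) \<longlonglongrightarrow> c * G z h" unfolding D(2) by (intro tendsto_intros G)
    then show ?thesis using G LIMSEQ_unique by blast
  qed
  have conv: "convergent (\<lambda>n. fock_fun (X n) z)" for z
  proof (rule Cauchy_convergent, rule metric_CauchyI)
    fix e :: real assume "e > 0"
    obtain N where N: "\<forall>m\<ge>N. \<forall>n\<ge>N. exp (pi / 2 * (norm z)\<^sup>2) * norm (X n - X m) < e"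
      using small[OF \<open>e > 0\<close> exp_gt_zero] by blast
    have "dist (fock_fun (X m) z) (fock_fun (X n) z) < e" if "m \<ge> N" "n \<ge> N" for m n
      using cmod_fock_fun_le[of "X m - X n" z] N[rule_format, of n m] that by (simp add: dist_norm fock_fun_minus)
    then show "\<exists>N. \<forall>m\<ge>N. \<forall>n\<ge>N. dist (fock_fun (X m) z) (fock_fun (X n) z) < e" by blast
  qed
  define F where "F z = lim (\<lambda>n. fock_fun (X n) z)" for z
  have F: "(\<lambda>n. fock_fun (X n) z) \<longlonglongrightarrow> F z" for z
    using conv by (simp add: F_def convergent_LIMSEQ_iff)
  have "(F has_derivative G z) (at z)" for z
  proof -
    define S where "S = ball (0 :: complex^'n) (norm z + 1)"
    have zS: "z \<in> S" by (simp add: S_def)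
    have "\<exists>g. \<forall>x\<in>S. (\<lambda>n. fock_fun (X n) x) \<longlonglongrightarrow> g x \<and> (g has_derivative G x) (at x within S)"
    proof (rule has_derivative_sequence[where f' = D])
      show "convex S" by (simp add: S_def)
      show "(fock_fun (X n) has_derivative D n x) (at x within S)" for n x
        by (rule has_derivative_at_withinI[OF D(1)])
      show "(\<lambda>n. fock_fun (X n) z) \<longlonglongrightarrow> F z" by (rule F)
      fix e :: real assume "e > 0"
      \<comment> \<open>Points of \<open>S\<close> have norm at most \<open>norm z + 1\<close>, and
        the derivative estimate looks one unit further, hence the 2.\<close>
      obtain N where N: "\<forall>m\<ge>N. \<forall>n\<ge>N. exp (pi / 2 * (norm z + 2)\<^sup>2) * norm (X n - X m) < e"
      using small[OF \<open>e > 0\<close> exp_gt_zero] by blast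
      have "cmod (D n x h - G x h) \<le> e * norm h" if "n \<ge> N" "x \<in> S" for n x h
      proof (rule LIMSEQ_le_const2)
        show "(\<lambda>m. cmod (D n x h - D m x h)) \<longlonglongrightarrow> cmod (D n x h - G x h)"
          by (intro tendsto_intros G)
        have "cmod (D n x h - D m x h) \<le> e * norm h" if "m \<ge> N" for m
        proof -
          have "norm x \<le> norm z + 1" using \<open>x \<in> S\<close> by (simp add: S_def)
          then have "exp (pi / 2 * (norm x + 1)\<^sup>2) * norm (X n - X m) * norm h \<le> exp (pi / 2 * (norm z + 2)\<^sup>2) * norm (X n - X m) * norm h"
            by (intro mult_right_mono) (auto intro!: power_mono mult_left_mono)
          also have "\<dots> \<le> e * norm h" using N[rule_format, OF that \<open>n \<ge> N\<close>] by (intro mult_right_mono) auto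
          finally show ?thesis using bd[of n x h m] by simp
        qed
        then show "\<exists>N. \<forall>m\<ge>N. cmod (D n x h - D m x h) \<le> e * norm h" by blast
      qed
      then show "\<forall>\<^sub>F n in sequentially. \<forall>x\<in>S. \<forall>h. cmod (D n x h - G x h) \<le> e * norm h"
        unfolding eventually_sequentially by blast
    qed (rule zS)
    then obtain g where g: "\<And>x. x \<in> S \<Longrightarrow> (\<lambda>n. fock_fun (X n) x) \<longlonglongrightarrow> g x"
      "(g has_derivative G z) (at z within S)" using zS by blast
    have "open S" by (simp add: S_def)
    moreover have "g x = F x" if "x \<in> S" for x using g(1)[OF that] F LIMSEQ_unique by blast
    ultimately show ?thesis
      using g(2) zS by (metis at_within_open has_derivative_transform_within_open)
  qed
  then show ?thesis using F G_linear unfolding entire_def by blast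
qed

lemma norm_fock_nn_integral:
  "(\<integral>\<^sup>+z. ennreal ((cmod (fock_fun f z))\<^sup>2) \<partial>gauss_measure) = ennreal ((norm f)\<^sup>2)"
proof -
  have "(norm f)\<^sup>2 = (\<integral>z. (cmod (fock_fun f z))\<^sup>2 \<partial>gauss_measure)"
    using cinner_self_norm[of f] unfolding cinner_self of_real_eq_iff by simp
  then show ?thesis
    using nn_integral_eq_integral[OF fock_fun_square_integrable[of f]] by simp
qed

text \<open>Fatou's lemma along the pointwise limit serves twice: with a fixed index it shows that
  the limit is square integrable, with a growing index that the convergence holds in norm.\<close>

instance fock :: (finite) banach
proof
  fix X :: "nat \<Rightarrow> 'a fock"
  assume X: "Cauchy X"
  obtain F where F: "entire F" "\<And>z. (\<lambda>n. fock_fun (X n) z) \<longlonglongrightarrow> F z"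
    using fock_Cauchy_pointwise_limit[OF X] by metis
  note [measurable] = borel_measurable_entire[OF F(1)]
  have Fatou: "(\<integral>\<^sup>+z. ennreal ((cmod (fock_fun (X n) z - F z))\<^sup>2) \<partial>gauss_measure) \<le> ennreal (e\<^sup>2)"
    if "\<And>m. m \<ge> N \<Longrightarrow> norm (X n - X m) \<le> e" "e \<ge> 0" for n N e
  proof -
    have "(\<integral>\<^sup>+z. ennreal ((cmod (fock_fun (X n) z - F z))\<^sup>2) \<partial>gauss_measure)
        = (\<integral>\<^sup>+z. liminf (\<lambda>m. ennreal ((cmod (fock_fun (X n - X m) z))\<^sup>2)) \<partial>gauss_measure)"
    proof (rule nn_integral_cong)
      fix z
      have "(\<lambda>m. ennreal ((cmod (fock_fun (X n - X m) z))\<^sup>2)) \<longlonglongrightarrow> ennreal ((cmod (fock_fun (X n) z - F z))\<^sup>2)"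
        unfolding fock_fun_minus by (intro tendsto_intros F tendsto_ennrealI)
      then show "ennreal ((cmod (fock_fun (X n) z - F z))\<^sup>2) = liminf (\<lambda>m. ennreal ((cmod (fock_fun (X n - X m) z))\<^sup>2))"
        using lim_imp_Liminf[OF trivial_limit_sequentially] by metis
    qed
    also have "\<dots> \<le> liminf (\<lambda>m. \<integral>\<^sup>+z. ennreal ((cmod (fock_fun (X n - X m) z))\<^sup>2) \<partial>gauss_measure)"
      by (rule nn_integral_liminf) measurable
    also have "\<dots> = liminf (\<lambda>m. ennreal ((norm (X n - X m))\<^sup>2))"
      by (simp only: norm_fock_nn_integral)
    also have "\<dots> \<le> limsup (\<lambda>m. ennreal ((norm (X n - X m))\<^sup>2))"
      by (rule Liminf_le_Limsup) simp
    also have "\<dots> \<le> ennreal (e\<^sup>2)"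
      using that by (intro Limsup_bounded) (auto simp: eventually_sequentially intro!: exI[of _ N] ennreal_leI power_mono)
    finally show ?thesis .
  qed
  have mem: "F \<in> fock_set"
  proof -
    obtain N where N: "\<forall>m\<ge>N. \<forall>n\<ge>N. norm (X m - X n) < 1"
      using metric_CauchyD[OF X, of "1"] unfolding dist_norm by (meson half_gt_zero zero_less_one)
    have "(\<integral>\<^sup>+z. ennreal ((cmod (fock_fun (X N) z - F z))\<^sup>2) \<partial>gauss_measure) \<le> ennreal (1\<^sup>2)"
      by (rule Fatou[of N]) (use N in \<open>auto intro: less_imp_le\<close>)
    then have "integrable gauss_measure (\<lambda>z. (cmod (fock_fun (X N) z - F z))\<^sup>2)"
      by (intro integrableI_bounded) (auto simp: order_le_less_trans[of _ 1])
    moreover have "entire (\<lambda>z. fock_fun (X N) z + (-1) * F z)"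
      by (intro entire_add entire_cmult F fock_fun_entire)
    ultimately have "(\<lambda>z. fock_fun (X N) z - F z) \<in> fock_set" by (simp add: fock_set_def)
    from fock_set_add[OF fock_fun[of "X N"] fock_set_cmult[OF this, of "-1"]] show ?thesis by simp
  qed
  have "X \<longlonglongrightarrow> Abs_fock F"
  proof (rule metric_LIMSEQ_I)
    fix e :: real assume "e > 0"
    then obtain N where N: "\<forall>m\<ge>N. \<forall>n\<ge>N. norm (X m - X n) < e / 2"
      using metric_CauchyD[OF X, of "e / 2"] unfolding dist_norm by (meson half_gt_zero zero_less_one)
    have "dist (X n) (Abs_fock F) < e" if "n \<ge> N" for n
    proof -
      have "ennreal ((norm (X n - Abs_fock F))\<^sup>2) \<le> ennreal ((e / 2)\<^sup>2)"
        unfolding norm_fock_nn_integral[symmetric] fock_fun_minus Abs_fock_inverse[OF mem]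
        by (rule Fatou[of N]) (use N that \<open>e > 0\<close> in \<open>auto intro: less_imp_le\<close>)
      then have "(norm (X n - Abs_fock F))\<^sup>2 \<le> (e / 2)\<^sup>2" by (subst (asm) ennreal_le_iff) auto
      then have "norm (X n - Abs_fock F) \<le> e / 2" by (rule power2_le_imp_le) (use \<open>e > 0\<close> in simp)
      then show ?thesis using \<open>e > 0\<close> by (simp add: dist_norm)
    qed
    then show "\<exists>N. \<forall>n\<ge>N. dist (X n) (Abs_fock F) < e" by blast
  qed
  then show "convergent X" by (auto simp: convergent_def)
qed

section \<open>Adjoints, square roots and absolute values\<close>

lemma bounded_linear_scaleC: "bounded_linear (scaleC c)"
  by (rule bounded_linear_intro[where K="cmod c"]) (simp_all add: scaleC_simps norm_scaleC mult.commute)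

lemma op_scaleC_apply: "blinfun_apply (op_scaleC c S) f = scaleC c (blinfun_apply S f)"
  unfolding op_scaleC_def
  by (subst bounded_linear_Blinfun_apply)
    (auto intro: bounded_linear_compose[OF bounded_linear_scaleC] blinfun.bounded_linear_right)

lemma bounded_opsD: "S \<in> bounded_ops \<Longrightarrow> blinfun_apply S (scaleC c f) = scaleC c (blinfun_apply S f)"
  by (simp add: bounded_ops_def)

lemma bounded_ops_closed_under:
  "0 \<in> bounded_ops" "id_blinfun \<in> bounded_ops"
  "S \<in> bounded_ops \<Longrightarrow> T \<in> bounded_ops \<Longrightarrow> S + T \<in> bounded_ops"
  "S \<in> bounded_ops \<Longrightarrow> T \<in> bounded_ops \<Longrightarrow> S - T \<in> bounded_ops"
  "S \<in> bounded_ops \<Longrightarrow> - S \<in> bounded_ops"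
  "S \<in> bounded_ops \<Longrightarrow> T \<in> bounded_ops \<Longrightarrow> (S o\<^sub>L T) \<in> bounded_ops"
  "S \<in> bounded_ops \<Longrightarrow> op_scaleC c S \<in> bounded_ops"
  "S \<in> bounded_ops \<Longrightarrow> r *\<^sub>R S \<in> bounded_ops"
  by (simp_all add: bounded_ops_def blinfun.bilinear_simps scaleC_simps op_scaleC_apply mult.commute)

lemma closed_bounded_ops: "closed (bounded_ops :: 'n::finite op set)"
proof -
  have eq: "bounded_ops = (\<Inter>c. \<Inter>f. {S :: 'n op. blinfun_apply S (scaleC c f) = scaleC c (blinfun_apply S f)})"
    by (auto simp: bounded_ops_def)
  have "closed {S :: 'n op. blinfun_apply S (scaleC c f) = scaleC c (blinfun_apply S f)}" for c f
    by (intro closed_Collect_eq continuous_intros bounded_linear.continuous_on[OF bounded_linear_scaleC])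
  then show ?thesis unfolding eq by (intro closed_INT ballI)
qed

text \<open>An adjoint for the real part of the inner product is already an adjoint for
  \<open>cinner\<close>: complex linearity of \<open>S\<close> makes \<open>T\<close> complex
  linear, and the imaginary part is a real part at \<open>scaleC \<i> g\<close>.\<close>

lemma blinfun_adjoint_bounded_ops:
  assumes S: "S \<in> bounded_ops" and T: "\<And>f g. inner (blinfun_apply S f) g = inner f (blinfun_apply T g)"
  shows "T \<in> bounded_ops" "cinner (blinfun_apply S f) g = cinner f (blinfun_apply T g)"
proof -
  have move: "inner (scaleC (cnj c) f) g = inner f (scaleC c g)" for c and f g :: "'a fock"
    by (simp add: inner_fock_def cinner_simps)
  have "inner f (T (scaleC c g)) = inner f (scaleC c (T g))" for f c g
    unfolding T[symmetric] move[symmetric] bounded_opsD[OF S, symmetric] ..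
  then have lin: "T (scaleC c g) = scaleC c (T g)" for c g by (rule vector_eq_ldot[THEN iffD1, OF allI])
  then show "T \<in> bounded_ops" by (simp add: bounded_ops_def)
  show "cinner (blinfun_apply S f) g = cinner f (blinfun_apply T g)"
    unfolding cinner_conv_inner T lin ..
qed

lemma op_adjointI:
  assumes "\<And>f g. cinner (blinfun_apply S f) g = cinner f (blinfun_apply T g)"
  shows "op_adjoint S = T"
  unfolding op_adjoint_def
proof (rule the_equality)
  fix T' assume *: "\<forall>f g. cinner (blinfun_apply S f) g = cinner f (blinfun_apply T' g)"
  have "blinfun_apply T' g = blinfun_apply T g" for g
  proof (rule cinner_eqI)
    fix f
    have "cinner f (blinfun_apply T' g) = cinner f (blinfun_apply T g)" using * assms by metis
    then show "cinner (blinfun_apply T' g) f = cinner (blinfun_apply T g) f"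
      by (metis cinner_commute)
  qed
  then show "T' = T" by (rule blinfun_eqI)
qed (use assms in blast)

lemma op_adjoint:
  fixes S :: "'n::finite op"
  assumes S: "S \<in> bounded_ops"
  shows op_adjoint_bounded_ops: "op_adjoint S \<in> bounded_ops"
    and cinner_op_adjoint: "cinner (blinfun_apply S f) g = cinner f (blinfun_apply (op_adjoint S) g)"
    and norm_op_adjoint_le: "norm (op_adjoint S) \<le> norm S"
proof -
  obtain T :: "'n op" where T: "\<forall>f g. inner (blinfun_apply S f) g = inner f (blinfun_apply T g)" "norm T \<le> norm S"
    using adjoint_blinfun_exists by blast
  note T' = blinfun_adjoint_bounded_ops[OF S T(1)[rule_format]]
  have "op_adjoint S = T" by (rule op_adjointI[OF T'(2)])
  with T' T show "op_adjoint S \<in> bounded_ops"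
    "cinner (blinfun_apply S f) g = cinner f (blinfun_apply (op_adjoint S) g)"
    "norm (op_adjoint S) \<le> norm S" by auto
qed

lemma cinner_op_adjoint': "S \<in> bounded_ops \<Longrightarrow> cinner (blinfun_apply (op_adjoint S) f) g = cinner f (blinfun_apply S g)"
  using cinner_op_adjoint[of S g f] by (metis cinner_commute)

text \<open>Over the complex numbers a real-valued quadratic form forces symmetry, by evaluating it
  at \<open>f + scaleC \<i> g\<close>. This links the complex notion of positivity to the real
  theory of square roots.\<close>

lemma positive_op_iff:
  fixes R :: "'n::finite op"
  shows "positive_op R \<longleftrightarrow> R \<in> bounded_ops \<and> positive_selfadjoint R"
proof (intro iffI conjI)
  assume R: "positive_op R"
  then show b: "R \<in> bounded_ops" by (simp add: positive_op_def)
  have q: "0 \<le> Re (cinner (R f) f)" "Im (cinner (R f) f) = 0" for f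
    using R by (auto simp: positive_op_def complex_nonneg_Reals_iff)
  have "inner (R f) g = inner f (R g)" for f g
  proof -
    have "Im (cinner (R (f + scaleC \<i> g)) (f + scaleC \<i> g)) = 0" by (rule q)
    then have "Re (cinner (R f) g) = Re (cinner (R g) f)"
      using q[of f] q[of g] by (simp add: blinfun.add_right bounded_opsD[OF b] cinner_simps)
    then show ?thesis by (metis inner_fock_def inner_commute)
  qed
  then show "positive_selfadjoint R"
    using q(1) by (simp add: positive_selfadjoint_def inner_fock_def)
next
  assume R: "R \<in> bounded_ops \<and> positive_selfadjoint R"
  then have sa: "inner (R f) g = inner f (R g)" "0 \<le> inner (R f) f" for f g
    unfolding positive_selfadjoint_def by blast+
  have "cinner (R f) f = cinner f (R f)" for f
    by (rule blinfun_adjoint_bounded_ops(2)) (use R sa in auto)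
  then have "Im (cinner (R f) f) = 0" for f
    by (metis cinner_commute complex_cnj_cancel_iff complex_is_Real_iff Reals_cnj_iff)
  then show "positive_op R"
    using R sa(2) by (simp add: positive_op_def complex_nonneg_Reals_iff inner_fock_def)
qed

text \<open>Complex linearity is commutation with the scalar operators, so the root inherits it from
  \<open>A\<close> through the commutation clause.\<close>

lemma positive_op_sqrt:
  fixes A :: "'n::finite op"
  assumes A: "positive_op A"
  shows "\<exists>R. positive_op R \<and> R o\<^sub>L R = A \<and> (\<forall>B. B o\<^sub>L A = A o\<^sub>L B \<longrightarrow> B o\<^sub>L R = R o\<^sub>L B)"
proof -
  have A': "A \<in> bounded_ops" "positive_selfadjoint A" using A by (auto simp: positive_op_iff)
  obtain R where R: "positive_selfadjoint R" "R o\<^sub>L R = A" "\<forall>B. B o\<^sub>L A = A o\<^sub>L B \<longrightarrow> B o\<^sub>L R = R o\<^sub>L B"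
    using positive_sqrt_exists[OF A'(2)] by (elim exE conjE)
  have "blinfun_apply R (scaleC c f) = scaleC c (blinfun_apply R f)" for c f
  proof -
    have "op_scaleC c id_blinfun o\<^sub>L A = A o\<^sub>L op_scaleC c id_blinfun"
      by (rule blinfun_eqI) (simp add: op_scaleC_apply bounded_opsD[OF A'(1)])
    then have "op_scaleC c id_blinfun o\<^sub>L R = R o\<^sub>L op_scaleC c id_blinfun" using R(3) by blast
    from arg_cong[OF this, of "\<lambda>T. blinfun_apply T f"] show ?thesis by (simp add: op_scaleC_apply)
  qed
  then have "R \<in> bounded_ops" by (simp add: bounded_ops_def)
  then have "positive_op R" using R(1) by (simp add: positive_op_iff)
  then show ?thesis using R(2,3) by (intro exI[of _ R] conjI)
qed

text \<open>\<open>abs_op\<close> is a definite description, so uniqueness is needed as well as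
  existence. Any competing root commutes with its own square, hence with the constructed root
  \<open>R\<close>, and commuting roots coincide.\<close>

lemma abs_op:
  fixes S :: "'n::finite op"
  assumes S: "S \<in> bounded_ops"
  shows positive_abs_op: "positive_op (abs_op S)"
    and norm_abs_op_apply: "norm (blinfun_apply (abs_op S) f) = norm (blinfun_apply S f)"
proof -
  define A where "A = op_adjoint S o\<^sub>L S"
  have "positive_op A"
    unfolding positive_op_def
  proof (intro conjI allI)
    show "A \<in> bounded_ops" unfolding A_def by (intro bounded_ops_closed_under op_adjoint_bounded_ops S)
    show "cinner (blinfun_apply A f) f \<in> \<real>\<^sub>\<ge>\<^sub>0" for f
      unfolding A_def blinfun_apply_blinfun_compose cinner_op_adjoint'[OF S] cinner_self_norm
      by (simp only: nonneg_Reals_of_real_iff zero_le_power2)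
  qed
  obtain R where R: "positive_op R" "R o\<^sub>L R = A" "\<forall>B. B o\<^sub>L A = A o\<^sub>L B \<longrightarrow> B o\<^sub>L R = R o\<^sub>L B"
    using positive_op_sqrt[OF \<open>positive_op A\<close>] by (elim exE conjE)
  have uniq: "R' = R" if R': "positive_op R' \<and> R' o\<^sub>L R' = op_adjoint S o\<^sub>L S" for R'
  proof (rule positive_sqrt_unique)
    show "positive_selfadjoint R'" "positive_selfadjoint R" using R(1) R' by (auto simp: positive_op_iff)
    show "R' o\<^sub>L R' = R o\<^sub>L R" using R(2) R' by (simp add: A_def)
    have "R' o\<^sub>L A = A o\<^sub>L R'" using R' by (metis A_def blinfun_compose_assoc)
    then show "R o\<^sub>L R' = R' o\<^sub>L R" using R(3) by metis
  qed
  have "abs_op S = R"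
    unfolding abs_op_def
  proof (rule the_equality)
    show "positive_op R \<and> R o\<^sub>L R = op_adjoint S o\<^sub>L S" using R(1,2) unfolding A_def by (rule conjI)
  qed (rule uniq)
  then show "positive_op (abs_op S)" using R(1) by simp
  have sa: "inner (R f) g = inner f (R g)" for f g
    using R(1) unfolding positive_op_iff positive_selfadjoint_def by blast
  have "inner (R f) (R f) = inner f (A f)" by (simp add: sa R(2)[symmetric])
  also have "\<dots> = inner (S f) (S f)"
    unfolding A_def blinfun_apply_blinfun_compose inner_fock_def cinner_op_adjoint[OF S] ..
  finally show "norm (blinfun_apply (abs_op S) f) = norm (blinfun_apply S f)"
    unfolding \<open>abs_op S = R\<close> by (simp add: norm_eq_sqrt_inner)
qed

text \<open>The real-linear factor is made complex linear by averaging it with its conjugate by \<open>i\<close>.\<close>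

lemma complex_douglas_factorization:
  fixes S R :: "'n::finite op"
  assumes S: "S \<in> bounded_ops" and R: "R \<in> bounded_ops"
    and le: "\<And>f. norm (blinfun_apply S f) \<le> norm (blinfun_apply R f)"
  shows "\<exists>V\<in>bounded_ops. S = V o\<^sub>L R \<and> norm V \<le> 1"
proof -
  obtain V where V: "S = V o\<^sub>L R" "norm V \<le> 1" using douglas_factorization[OF le] by blast
  define J :: "'n op" where "J = op_scaleC \<i> id_blinfun"
  have J: "blinfun_apply J f = scaleC \<i> f" for f by (simp add: J_def op_scaleC_apply)
  define W where "W = (1/2) *\<^sub>R (V - (J o\<^sub>L V o\<^sub>L J))"
  have W: "W f = (1/2) *\<^sub>R (V f - scaleC \<i> (V (scaleC \<i> f)))" for f
    by (simp add: W_def J blinfun.bilinear_simps)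
  have V_neg: "V (- f) = - V f" for f by (rule blinfun.minus_right)
  have ii: "scaleC \<i> (scaleC \<i> f) = - f" for f :: "'n fock"
    by (rule fock_eqI) (simp add: fock_fun_simps)
  have Wi: "W (scaleC \<i> f) = scaleC \<i> (W f)" for f
    by (simp add: W scaleC_simps(1-3) scaleC_simps(9) ii V_neg)
  have "W (scaleC c f) = scaleC c (W f)" for c f
  proof -
    have c: "scaleC c g = Re c *\<^sub>R g + Im c *\<^sub>R scaleC \<i> g" for g :: "'n fock"
      by (rule fock_eqI) (simp add: fock_fun_simps complex_eq_iff algebra_simps)
    show ?thesis unfolding c by (simp add: blinfun.bilinear_simps Wi)
  qed
  then have "W \<in> bounded_ops" by (simp add: bounded_ops_def)
  moreover have "S = W o\<^sub>L R"
  proof (rule blinfun_eqI)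
    fix f
    have "V (R g) = S g" for g by (simp add: V(1))
    then have "(W o\<^sub>L R) f = (1/2) *\<^sub>R (S f - scaleC \<i> (S (scaleC \<i> f)))"
      by (simp add: W bounded_opsD[OF R, symmetric])
    also have "\<dots> = S f"
      by (simp add: bounded_opsD[OF S] ii scaleR_2[symmetric])
    finally show "S f = (W o\<^sub>L R) f" ..
  qed
  moreover have "norm W \<le> 1"
  proof (rule norm_blinfun_bound)
    fix f
    have Vle: "norm (V g) \<le> norm g" for g
      using norm_blinfun[of V g] mult_right_mono[OF V(2), of "norm g"] by simp
    have "norm (V f - scaleC \<i> (V (scaleC \<i> f))) \<le> norm (V f) + norm (scaleC \<i> (V (scaleC \<i> f)))"
      by (rule norm_triangle_ineq4)
    also have "\<dots> \<le> norm f + norm f"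
      using Vle[of f] Vle[of "scaleC \<i> f"] by (simp add: norm_scaleC)
    finally show "norm (W f) \<le> 1 * norm f" by (simp add: W)
  qed simp
  ultimately show ?thesis by blast
qed

section \<open>Orthonormal bases\<close>

text \<open>By Zorn's lemma there is a maximal orthonormal set. A nonzero vector orthogonal to it
  could be normalized and added.\<close>

lemma is_onb_fock_onb: "is_onb (fock_onb :: 'n::finite fock set)"
proof -
  define \<A> where "\<A> = {B :: 'n fock set. \<forall>e\<in>B. \<forall>f\<in>B. cinner e f = (if e = f then 1 else 0)}"
  have "\<exists>M\<in>\<A>. \<forall>X\<in>\<A>. M \<subseteq> X \<longrightarrow> X = M"
  proof (rule subset_Zorn_nonempty)
    have "{} \<in> \<A>" by (simp add: \<A>_def)
    then show "\<A> \<noteq> {}" by blast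
    fix \<C> assume C: "\<C> \<noteq> {}" "subset.chain \<A> \<C>"
    show "\<Union>\<C> \<in> \<A>"
      unfolding \<A>_def
    proof (intro CollectI ballI)
      fix e f assume "e \<in> \<Union>\<C>" "f \<in> \<Union>\<C>"
      then obtain X Y where XY: "X \<in> \<C>" "e \<in> X" "Y \<in> \<C>" "f \<in> Y" by blast
      then have "X \<subseteq> Y \<or> Y \<subseteq> X" using C(2) unfolding subset_chain_def by blast
      then obtain Z where "Z \<in> \<C>" "e \<in> Z" "f \<in> Z" using XY by blast
      then show "cinner e f = (if e = f then 1 else 0)"
        using C(2) unfolding subset_chain_def \<A>_def by blast
    qed
  qed
  then obtain B where B: "B \<in> \<A>" "\<And>X. X \<in> \<A> \<Longrightarrow> B \<subseteq> X \<Longrightarrow> X = B" by metis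
  have "f = 0" if f: "\<forall>e\<in>B. cinner f e = 0" for f
  proof (rule ccontr)
    assume "f \<noteq> 0"
    define g where "g = (1 / norm f) *\<^sub>R f"
    have gg: "cinner g g = 1" using \<open>f \<noteq> 0\<close> unfolding cinner_self_norm by (simp add: g_def)
    have ge: "cinner g e = 0" "cinner e g = 0" if "e \<in> B" for e
      using f that cinner_commute[of e g] by (simp_all add: g_def cinner_simps)
    have "insert g B \<in> \<A>"
      using B(1) gg ge unfolding \<A>_def by auto
    then have "g \<in> B" using B(2)[of "insert g B"] by blast
    then show False using ge(1) gg by force
  qed
  then have "is_onb B" using B(1) by (auto simp: is_onb_def \<A>_def)
  then show ?thesis unfolding fock_onb_def by (rule someI)
qed

lemma fock_onb_cinner: "e \<in> fock_onb \<Longrightarrow> f \<in> fock_onb \<Longrightarrow> cinner e f = (if e = f then 1 else 0)"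
  using is_onb_fock_onb unfolding is_onb_def by blast

lemma fock_onb_complete: "(\<And>e. e \<in> fock_onb \<Longrightarrow> cinner f e = 0) \<Longrightarrow> f = 0"
  using is_onb_fock_onb unfolding is_onb_def by blast

definition onb_sum :: "'n::finite fock set \<Rightarrow> ('n fock \<Rightarrow> complex) \<Rightarrow> 'n fock" where
  "onb_sum F a = (\<Sum>e\<in>F. scaleC (a e) e)"

lemma cinner_sum_left: "cinner (\<Sum>x\<in>F. f x) g = (\<Sum>x\<in>F. cinner (f x) g)"
  by (induction F rule: infinite_finite_induct) (simp_all add: cinner_simps)

lemma cinner_onb_sum:
  assumes "finite F" "F \<subseteq> fock_onb" "e \<in> F"
  shows "cinner (onb_sum F a) e = a e"
proof -
  have "cinner (onb_sum F a) e = (\<Sum>f\<in>F. if f = e then a f else 0)"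
    unfolding onb_sum_def cinner_sum_left cinner_simps
    by (rule sum.cong) (auto simp: fock_onb_cinner[OF subsetD[OF assms(2)] subsetD[OF assms(2,3)]])
  then show ?thesis using assms by simp
qed

lemma cinner_sum_right: "cinner g (\<Sum>x\<in>F. f x) = (\<Sum>x\<in>F. cinner g (f x))"
  by (induction F rule: infinite_finite_induct) (simp_all add: cinner_simps)

text \<open>The coefficients \<open>a\<close> are arbitrary so that one identity yields both
  Bessel's inequality and the fact that the Fourier coefficients give the best
  approximation.\<close>

lemma onb_pythagoras:
  assumes F: "finite F" "F \<subseteq> fock_onb"
  shows "(norm (f - onb_sum F a))\<^sup>2
    = (norm f)\<^sup>2 - (\<Sum>e\<in>F. (cmod (cinner f e))\<^sup>2) + (\<Sum>e\<in>F. (cmod (cinner f e - a e))\<^sup>2)"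
proof -
  have 1: "cinner f (onb_sum F a) = (\<Sum>e\<in>F. cnj (a e) * cinner f e)"
    by (simp add: onb_sum_def cinner_sum_right cinner_simps)
  have 2: "cinner (onb_sum F a) (onb_sum F a) = (\<Sum>e\<in>F. cnj (a e) * a e)"
    by (subst (2) onb_sum_def) (simp add: cinner_sum_right cinner_simps cinner_onb_sum[OF F])
  have 3: "cinner (onb_sum F a) f = (\<Sum>e\<in>F. a e * cnj (cinner f e))"
    by (subst cinner_commute) (simp add: 1)
  have "complex_of_real ((norm (f - onb_sum F a))\<^sup>2) = cinner (f - onb_sum F a) (f - onb_sum F a)"
    by (rule cinner_self_norm[symmetric])
  also have "\<dots> = cinner f f - (\<Sum>e\<in>F. cnj (a e) * cinner f e) - (\<Sum>e\<in>F. a e * cnj (cinner f e)) + (\<Sum>e\<in>F. cnj (a e) * a e)"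
    by (simp add: cinner_simps 1 2 3)
  also have "\<dots> = cinner f f - (\<Sum>e\<in>F. cinner f e * cnj (cinner f e)) + (\<Sum>e\<in>F. (cinner f e - a e) * cnj (cinner f e - a e))"
    by (simp add: algebra_simps sum.distrib sum_subtractf)
  also have "\<dots> = complex_of_real ((norm f)\<^sup>2 - (\<Sum>e\<in>F. (cmod (cinner f e))\<^sup>2) + (\<Sum>e\<in>F. (cmod (cinner f e - a e))\<^sup>2))"
    unfolding complex_norm_square[symmetric] cinner_self_norm by simp
  finally show ?thesis unfolding of_real_eq_iff .
qed

lemma onb_bessel:
  assumes F: "finite F" "F \<subseteq> fock_onb"
  shows "(\<Sum>e\<in>F. (cmod (cinner f e))\<^sup>2) \<le> (norm f)\<^sup>2"
  using onb_pythagoras[OF F, of f "cinner f"] by simp (metis zero_le_power2 diff_ge_0_iff_ge)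

lemma onb_bessel_L2: "finite F \<Longrightarrow> F \<subseteq> fock_onb \<Longrightarrow> L2_set (\<lambda>e. cmod (cinner f e)) F \<le> norm f"
  unfolding L2_set_def using onb_bessel[of F f] by (metis norm_ge_zero real_sqrt_le_iff real_sqrt_unique)

lemma onb_cauchy_schwarz:
  assumes "finite F" "F \<subseteq> fock_onb"
  shows "(\<Sum>e\<in>F. cmod (cinner f e) * cmod (cinner g e)) \<le> norm f * norm g"
proof -
  have "(\<Sum>e\<in>F. cmod (cinner f e) * cmod (cinner g e))
      \<le> L2_set (\<lambda>e. cmod (cinner f e)) F * L2_set (\<lambda>e. cmod (cinner g e)) F"
    using L2_set_mult_ineq[of "\<lambda>e. cmod (cinner f e)" "\<lambda>e. cmod (cinner g e)" F] by simp
  also have "\<dots> \<le> norm f * norm g"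
    by (rule mult_mono) (auto simp: onb_bessel_L2 assms L2_set_nonneg)
  finally show ?thesis .
qed

text \<open>Completeness of the basis makes finite combinations dense. Best approximation then
  upgrades density to unconditional convergence: a finite set larger than one that already
  approximates well approximates at least as well.\<close>

lemma onb_expansion:
  fixes f :: "'n::finite fock"
  shows "((\<lambda>e. scaleC (cinner f e) e) has_sum f) fock_onb"
proof -
  define V where "V = {onb_sum F a |F (a :: 'n fock \<Rightarrow> complex). finite F \<and> F \<subseteq> fock_onb}"
  \<comment> \<open>Padding with zeros allows combinations over different finite sets to be compared
    over a common one.\<close>
  have extend: "onb_sum F a = onb_sum G (\<lambda>e. if e \<in> F then a e else 0)"
    if "finite G" "F \<subseteq> G" for F G and a :: "'n fock \<Rightarrow> complex"
  proof -
    have "(\<Sum>e\<in>G. scaleC (if e \<in> F then a e else 0) e) = (\<Sum>e\<in>F. scaleC (if e \<in> F then a e else 0) e)"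
      by (rule sum.mono_neutral_right) (use that in \<open>auto simp: scaleC_simps\<close>)
    then show ?thesis by (simp add: onb_sum_def)
  qed
  have "subspace V"
    unfolding subspace_def
  proof (intro conjI ballI allI)
    show "0 \<in> V" unfolding V_def by (intro CollectI exI[of _ "{}"] exI[of _ "\<lambda>_. 0"]) (simp add: onb_sum_def)
    fix x y assume "x \<in> V" "y \<in> V"
    then obtain F a G b where x: "x = onb_sum F a" "finite F" "F \<subseteq> fock_onb"
      and y: "y = onb_sum G b" "finite G" "G \<subseteq> fock_onb" by (auto simp: V_def)
    have "x + y = onb_sum (F \<union> G) (\<lambda>e. (if e \<in> F then a e else 0) + (if e \<in> G then b e else 0))"
      unfolding x(1) y(1) extend[of "F \<union> G" F a, OF finite_UnI[OF x(2) y(2)] Un_upper1]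
        extend[of "F \<union> G" G b, OF finite_UnI[OF x(2) y(2)] Un_upper2]
      by (simp add: onb_sum_def scaleC_simps(7) sum.distrib)
    then show "x + y \<in> V" unfolding V_def using x y by blast
    show "c *\<^sub>R x \<in> V" for c
    proof -
      have "c *\<^sub>R x = onb_sum F (\<lambda>e. complex_of_real c * a e)"
        unfolding x(1) onb_sum_def scaleR_sum_right
        by (rule sum.cong) (simp_all add: scaleC_simps(8)[symmetric] scaleC_simps(10))
      then show ?thesis unfolding V_def using x by blast
    qed
  qed
  then have sub: "subspace (closure V)" by (rule subspace_closure)
  obtain p where p: "p \<in> closure V" "\<And>y. y \<in> closure V \<Longrightarrow> inner (f - p) y = 0"
    using closed_subspace_projection[OF sub closed_closure] by metis
  have "f - p = 0"
  proof (rule fock_onb_complete)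
    fix e :: "'n fock" assume e: "e \<in> fock_onb"
    have "scaleC c e \<in> V" for c
      unfolding V_def using e by (intro CollectI exI[of _ "{e}"] exI[of _ "\<lambda>_. c"]) (simp add: onb_sum_def)
    then have 0: "inner (f - p) (scaleC c e) = 0" for c using p(2) closure_subset by blast
    show "cinner (f - p) e = 0"
      using 0[of 1] 0[of \<i>] by (simp add: cinner_conv_inner scaleC_simps(6) complex_eq_iff)
  qed
  then have f: "f \<in> closure V" using p(1) by simp
  show ?thesis
    unfolding has_sum_def tendsto_iff eventually_finite_subsets_at_top
  proof (intro allI impI)
    fix \<epsilon> :: real assume "\<epsilon> > 0"
    then obtain g where g: "g \<in> V" "dist g f < \<epsilon>" using f closure_approachable by blast
    then obtain F a where F: "g = onb_sum F a" "finite F" "F \<subseteq> fock_onb" by (auto simp: V_def)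
    show "\<exists>X. finite X \<and> X \<subseteq> fock_onb \<and> (\<forall>Y. finite Y \<and> X \<subseteq> Y \<and> Y \<subseteq> fock_onb \<longrightarrow> dist (\<Sum>e\<in>Y. scaleC (cinner f e) e) f < \<epsilon>)"
    proof (intro exI[of _ F] conjI F allI impI)
      fix Y :: "'n fock set" assume Y: "finite Y \<and> F \<subseteq> Y \<and> Y \<subseteq> fock_onb"
      then have Y': "finite Y" "F \<subseteq> Y" "Y \<subseteq> fock_onb" by auto
      have "(norm (f - onb_sum Y (cinner f)))\<^sup>2 \<le> (norm (f - g))\<^sup>2"
        unfolding F(1) extend[OF Y'(1,2)] onb_pythagoras[OF Y'(1,3)] by (simp add: sum_nonneg)
      then have "norm (f - onb_sum Y (cinner f)) \<le> norm (f - g)" by (rule power2_le_imp_le) simp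
      then show "dist (\<Sum>e\<in>Y. scaleC (cinner f e) e) f < \<epsilon>"
        using g(2) by (simp add: onb_sum_def dist_norm norm_minus_commute)
    qed
  qed
qed

lemma bounded_linear_cinner_left: "bounded_linear (\<lambda>f. cinner f g)"
  by (rule bounded_linear_intro[where K="norm g"])
    (simp_all add: cinner_simps scaleR_conv_of_real cinner_cauchy_schwarz)

lemma onb_parseval: "((\<lambda>e. cinner f e * cinner e g) has_sum cinner f g) fock_onb"
  using has_sum_bounded_linear[OF bounded_linear_cinner_left onb_expansion, of f g]
  by (simp add: cinner_simps)

section \<open>Trace class operators\<close>

text \<open>A series of rank one operators that converges absolutely in trace norm. The operators
  with such a representation turn out to be exactly those in \<open>trace_class\<close>; unlike the
  definition through \<open>abs_op\<close>, the representation composes directly with bounded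
  operators on either side and can be integrated term by term.\<close>

definition nuclear_rep :: "'n::finite op \<Rightarrow> (nat \<Rightarrow> 'n fock) \<Rightarrow> (nat \<Rightarrow> 'n fock) \<Rightarrow> bool" where
  "nuclear_rep S u v \<longleftrightarrow> summable (\<lambda>n. norm (u n) * norm (v n)) \<and>
     (\<forall>f. (\<lambda>n. scaleC (cinner f (v n)) (u n)) sums blinfun_apply S f)"

lemma nuclear_repD:
  assumes "nuclear_rep S u v"
  shows "summable (\<lambda>n. norm (u n) * norm (v n))"
    and "(\<lambda>n. scaleC (cinner f (v n)) (u n)) sums blinfun_apply S f"
  using assms by (auto simp: nuclear_rep_def)

lemma nuclear_rep_bounded_ops:
  assumes "nuclear_rep S u v"
  shows "S \<in> bounded_ops"
proof -
  have "blinfun_apply S (scaleC c f) = scaleC c (blinfun_apply S f)" for c f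
  proof (rule sums_unique2[OF nuclear_repD(2)[OF assms]])
    show "(\<lambda>n. scaleC (cinner (scaleC c f) (v n)) (u n)) sums scaleC c (blinfun_apply S f)"
      using bounded_linear.sums[OF bounded_linear_scaleC nuclear_repD(2)[OF assms], of c f]
      by (simp add: cinner_simps scaleC_simps)
  qed
  then show ?thesis by (simp add: bounded_ops_def)
qed

lemma nuclear_rep_cinner_sums:
  assumes "nuclear_rep S u v"
  shows "(\<lambda>n. cinner f (v n) * cinner (u n) g) sums cinner (blinfun_apply S f) g"
  using bounded_linear.sums[OF bounded_linear_cinner_left nuclear_repD(2)[OF assms], of f g]
  by (simp add: cinner_simps)

lemma nuclear_rep_compose_left:
  assumes "nuclear_rep S u v" "T \<in> bounded_ops"
  shows "nuclear_rep (T o\<^sub>L S) (\<lambda>n. blinfun_apply T (u n)) v"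
  unfolding nuclear_rep_def
proof (intro conjI allI)
  show "summable (\<lambda>n. norm (T (u n)) * norm (v n))"
  proof (rule summable_comparison_test'[of "\<lambda>n. norm T * (norm (u n) * norm (v n))" 0])
    show "summable (\<lambda>n. norm T * (norm (u n) * norm (v n)))"
      by (intro summable_mult nuclear_repD(1)[OF assms(1)])
    show "norm (norm (T (u n)) * norm (v n)) \<le> norm T * (norm (u n) * norm (v n))" for n
      using mult_right_mono[OF norm_blinfun[of T "u n"], of "norm (v n)"] by (simp add: mult.assoc)
  qed
  show "(\<lambda>n. scaleC (cinner f (v n)) (T (u n))) sums (T o\<^sub>L S) f" for f
    using bounded_linear.sums[OF blinfun.bounded_linear_right nuclear_repD(2)[OF assms(1)], of T f]
    by (simp add: bounded_opsD[OF assms(2)])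
qed

lemma nuclear_rep_compose_right:
  assumes "nuclear_rep S u v" "T \<in> bounded_ops"
  shows "nuclear_rep (S o\<^sub>L T) u (\<lambda>n. blinfun_apply (op_adjoint T) (v n))"
  unfolding nuclear_rep_def
proof (intro conjI allI)
  show "summable (\<lambda>n. norm (u n) * norm (op_adjoint T (v n)))"
  proof (rule summable_comparison_test'[of "\<lambda>n. norm (op_adjoint T) * (norm (u n) * norm (v n))" 0])
    show "summable (\<lambda>n. norm (op_adjoint T) * (norm (u n) * norm (v n)))"
      by (intro summable_mult nuclear_repD(1)[OF assms(1)])
    show "norm (norm (u n) * norm (op_adjoint T (v n))) \<le> norm (op_adjoint T) * (norm (u n) * norm (v n))" for n
      using mult_left_mono[OF norm_blinfun[of "op_adjoint T" "v n"], of "norm (u n)"] by (simp add: mult_ac)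
  qed
  show "(\<lambda>n. scaleC (cinner f (op_adjoint T (v n))) (u n)) sums (S o\<^sub>L T) f" for f
    using nuclear_repD(2)[OF assms(1), of "T f"] by (simp add: cinner_op_adjoint[OF assms(2)])
qed

text \<open>The trace of the series is a double sum over \<open>n\<close> and the basis. It
  converges absolutely, since each row is bounded by \<open>norm (u n) * norm (v n)\<close>, and
  Parseval's identity evaluates the rows after the order of summation is exchanged.\<close>

lemma nuclear_rep_trace:
  fixes S :: "'n::finite op"
  assumes S: "nuclear_rep S u v"
  shows "(\<lambda>n. cinner (u n) (v n)) sums op_trace S"
    and "summable (\<lambda>n. norm (cinner (u n) (v n)))"
proof -
  let ?B = "fock_onb :: 'n fock set"
  define a where "a n e = cinner e (v n) * cinner (u n) e" for n and e :: "'n fock"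
  have bound: "(\<Sum>e\<in>F. norm (a n e)) \<le> norm (u n) * norm (v n)" if "finite F" "F \<subseteq> ?B" for n F
  proof -
    have "(\<Sum>e\<in>F. norm (a n e)) = (\<Sum>e\<in>F. cmod (cinner (u n) e) * cmod (cinner (v n) e))"
      unfolding a_def by (intro sum.cong refl) (subst cinner_commute, simp add: norm_mult mult.commute)
    then show ?thesis using onb_cauchy_schwarz[OF that] by simp
  qed
  have sum_e: "(\<lambda>e. norm (a n e)) summable_on ?B" for n
    by (rule nonneg_bdd_above_summable_on) (auto intro!: bdd_aboveI2 bound)
  have le_e: "(\<Sum>\<^sub>\<infinity>e\<in>?B. norm (a n e)) \<le> norm (u n) * norm (v n)" for n
    by (rule infsum_le_finite_sums[OF sum_e bound])
  have nonneg: "0 \<le> (\<Sum>\<^sub>\<infinity>e\<in>?B. norm (a n e))" for n by (rule infsum_nonneg) simp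
  have summ: "summable (\<lambda>n. norm (u n) * norm (v n))" by (rule nuclear_repD(1)[OF S])
  have "summable (\<lambda>n. norm (\<Sum>\<^sub>\<infinity>e\<in>?B. norm (a n e)))"
    by (rule summable_comparison_test'[OF summ, of 0]) (use le_e nonneg in auto)
  then have abs2: "(\<lambda>n. norm (\<Sum>\<^sub>\<infinity>e\<in>?B. norm (a n e))) summable_on UNIV"
    by (intro norm_summable_imp_summable_on) simp
  have "(\<lambda>p. norm ((\<lambda>(n, e). a n e) p)) summable_on (UNIV \<times> ?B)"
    unfolding Infinite_Sum.abs_summable_on_Sigma_iff using sum_e abs2 by simp
  then have swap: "(\<lambda>(n, e). a n e) summable_on (UNIV \<times> ?B)"
    by (rule Infinite_Sum.abs_summable_summable)
  show sm: "summable (\<lambda>n. norm (cinner (u n) (v n)))"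
    by (rule summable_comparison_test'[OF summ, of 0]) (simp add: cinner_cauchy_schwarz)
  have row: "(\<Sum>\<^sub>\<infinity>e\<in>?B. a n e) = cinner (u n) (v n)" for n
    using infsumI[OF onb_parseval[of "u n" "v n"]] by (simp add: a_def mult.commute)
  have col: "(\<Sum>\<^sub>\<infinity>n\<in>UNIV. a n e) = cinner (blinfun_apply S e) e" if "e \<in> ?B" for e
  proof -
    have "summable (\<lambda>n. norm (a n e))"
    proof (rule summable_comparison_test'[OF summ, of 0])
      show "norm (norm (a n e)) \<le> norm (u n) * norm (v n)" for n
        using bound[of "{e}" n] that by simp
    qed
    then have "((\<lambda>n. a n e) has_sum cinner (blinfun_apply S e) e) UNIV"
      unfolding a_def by (rule norm_summable_imp_has_sum[OF _ nuclear_rep_cinner_sums[OF S]])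
    then show ?thesis by (rule infsumI)
  qed
  have "op_trace S = (\<Sum>\<^sub>\<infinity>e\<in>?B. \<Sum>\<^sub>\<infinity>n\<in>UNIV. a n e)"
    unfolding op_trace_def by (rule infsum_cong) (simp add: col)
  also have "\<dots> = (\<Sum>\<^sub>\<infinity>n\<in>UNIV. \<Sum>\<^sub>\<infinity>e\<in>?B. a n e)"
    by (rule infsum_swap_banach[OF swap, symmetric])
  also have "\<dots> = (\<Sum>\<^sub>\<infinity>n\<in>UNIV. cinner (u n) (v n))" by (simp only: row)
  also have "\<dots> = (\<Sum>n. cinner (u n) (v n))"
    by (intro infsumI norm_summable_imp_has_sum[OF sm] summable_sums summable_norm_cancel[OF sm])
  finally show "(\<lambda>n. cinner (u n) (v n)) sums op_trace S"
    using summable_sums[OF summable_norm_cancel[OF sm]] by simp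
qed

text \<open>Unlike nuclear representations, this bound on all compressions \<open>C S\<close> is obviously additive
  in \<open>S\<close>; with \<open>\<bar>S\<bar> = C S\<close> it bounds the trace of the absolute value.\<close>

definition trace_bounded :: "'n::finite op \<Rightarrow> real \<Rightarrow> bool" where
  "trace_bounded S K \<longleftrightarrow> S \<in> bounded_ops \<and>
     (\<forall>C\<in>bounded_ops. norm C \<le> 1 \<longrightarrow> (\<forall>F. finite F \<and> F \<subseteq> fock_onb \<longrightarrow>
        cmod (\<Sum>e\<in>F. cinner (blinfun_apply C (blinfun_apply S e)) e) \<le> K))"

lemma nuclear_imp_trace_bounded:
  assumes S: "nuclear_rep S u v"
  shows "trace_bounded S (\<Sum>n. norm (u n) * norm (v n))"
  unfolding trace_bounded_def
proof (intro conjI ballI allI impI)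
  show "S \<in> bounded_ops" by (rule nuclear_rep_bounded_ops[OF S])
  fix C :: "'a op" and F :: "'a fock set"
  assume C: "C \<in> bounded_ops" "norm C \<le> 1" and F: "finite F \<and> F \<subseteq> fock_onb"
  have "(\<lambda>n. \<Sum>e\<in>F. cinner e (v n) * cinner (C (u n)) e) sums (\<Sum>e\<in>F. cinner ((C o\<^sub>L S) e) e)"
    by (intro sums_sum nuclear_rep_cinner_sums[OF nuclear_rep_compose_left[OF S C(1)]])
  then have s: "(\<lambda>n. \<Sum>e\<in>F. cinner e (v n) * cinner (C (u n)) e) sums (\<Sum>e\<in>F. cinner (C (S e)) e)"
    by simp
  have le: "norm (\<Sum>e\<in>F. cinner e (v n) * cinner (C (u n)) e) \<le> norm (u n) * norm (v n)" for n
  proof -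
    have "norm (\<Sum>e\<in>F. cinner e (v n) * cinner (C (u n)) e) \<le> (\<Sum>e\<in>F. norm (cinner e (v n) * cinner (C (u n)) e))"
      by (rule norm_sum)
    also have "\<dots> = (\<Sum>e\<in>F. cmod (cinner (C (u n)) e) * cmod (cinner (v n) e))"
      by (intro sum.cong refl) (subst cinner_commute, simp add: norm_mult mult.commute)
    also have "\<dots> \<le> norm (C (u n)) * norm (v n)"
      using F by (intro onb_cauchy_schwarz) auto
    also have "\<dots> \<le> (1 * norm (u n)) * norm (v n)"
      by (intro mult_right_mono order_trans[OF norm_blinfun] C(2)) auto
    finally show ?thesis by simp
  qed
  have sm: "summable (\<lambda>n. norm (\<Sum>e\<in>F. cinner e (v n) * cinner (C (u n)) e))"
    by (rule summable_comparison_test'[OF nuclear_repD(1)[OF S], of 0]) (simp add: le)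
  have "norm (\<Sum>n. \<Sum>e\<in>F. cinner e (v n) * cinner (C (u n)) e) \<le> (\<Sum>n. norm (\<Sum>e\<in>F. cinner e (v n) * cinner (C (u n)) e))"
    by (rule summable_norm[OF sm])
  also have "\<dots> \<le> (\<Sum>n. norm (u n) * norm (v n))"
    by (rule suminf_le[OF le sm nuclear_repD(1)[OF S]])
  finally show "cmod (\<Sum>e\<in>F. cinner (C (S e)) e) \<le> (\<Sum>n. norm (u n) * norm (v n))"
    unfolding sums_unique[OF s] .
qed

lemma trace_bounded_add:
  assumes "trace_bounded S K" "trace_bounded T L"
  shows "trace_bounded (S + T) (K + L)"
  unfolding trace_bounded_def
proof (intro conjI ballI allI impI)
  show "S + T \<in> bounded_ops" using assms by (auto simp: trace_bounded_def intro: bounded_ops_closed_under)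
  fix C :: "'a op" and F :: "'a fock set"
  assume C: "C \<in> bounded_ops" "norm C \<le> 1" and F: "finite F \<and> F \<subseteq> fock_onb"
  have "(\<Sum>e\<in>F. cinner (C ((S + T) e)) e) = (\<Sum>e\<in>F. cinner (C (S e)) e) + (\<Sum>e\<in>F. cinner (C (T e)) e)"
    by (simp add: blinfun.bilinear_simps cinner_simps sum.distrib)
  moreover have "cmod (\<Sum>e\<in>F. cinner (C (S e)) e) \<le> K" "cmod (\<Sum>e\<in>F. cinner (C (T e)) e) \<le> L"
    using assms C F unfolding trace_bounded_def by blast+
  ultimately show "cmod (\<Sum>e\<in>F. cinner (C ((S + T) e)) e) \<le> K + L"
    by (simp add: norm_triangle_mono)
qed

lemma trace_bounded_scale:
  assumes "trace_bounded S K"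
  shows "trace_bounded (op_scaleC c S) (cmod c * K)"
  unfolding trace_bounded_def
proof (intro conjI ballI allI impI)
  show "op_scaleC c S \<in> bounded_ops" using assms by (auto simp: trace_bounded_def intro: bounded_ops_closed_under)
  fix C :: "'a op" and F :: "'a fock set"
  assume C: "C \<in> bounded_ops" "norm C \<le> 1" and F: "finite F \<and> F \<subseteq> fock_onb"
  have "(\<Sum>e\<in>F. cinner (C (op_scaleC c S e)) e) = c * (\<Sum>e\<in>F. cinner (C (S e)) e)"
    by (simp add: op_scaleC_apply bounded_opsD[OF C(1)] cinner_simps sum_distrib_left)
  moreover have "cmod (\<Sum>e\<in>F. cinner (C (S e)) e) \<le> K"
    using assms C F unfolding trace_bounded_def by blast
  ultimately show "cmod (\<Sum>e\<in>F. cinner (C (op_scaleC c S e)) e) \<le> cmod c * K"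
    by (simp add: norm_mult mult_left_mono)
qed

lemma trace_bounded_imp_trace_class:
  fixes S :: "'n::finite op"
  assumes S: "trace_bounded S K"
  shows "S \<in> trace_class"
proof -
  have Sb: "S \<in> bounded_ops" using S by (simp add: trace_bounded_def)
  have R: "positive_op (abs_op S)" by (rule positive_abs_op[OF Sb])
  then have Rb: "abs_op S \<in> bounded_ops" by (simp add: positive_op_def)
  obtain C where C: "C \<in> bounded_ops" "abs_op S = C o\<^sub>L S" "norm C \<le> 1"
    using complex_douglas_factorization[OF Rb Sb] norm_abs_op_apply[OF Sb] by auto
  have "(\<lambda>e. Re (cinner (abs_op S e) e)) summable_on fock_onb"
  proof (rule nonneg_bdd_above_summable_on)
    show "0 \<le> Re (cinner (abs_op S e) e)" for e
      using R by (auto simp: positive_op_def complex_nonneg_Reals_iff)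
    show "bdd_above (sum (\<lambda>e. Re (cinner (abs_op S e) e)) ` {F. F \<subseteq> fock_onb \<and> finite F})"
    proof (rule bdd_aboveI2)
      fix F :: "'n fock set" assume "F \<in> {F. F \<subseteq> fock_onb \<and> finite F}"
      then have "cmod (\<Sum>e\<in>F. cinner (C (S e)) e) \<le> K"
        using S C unfolding trace_bounded_def by blast
      moreover have "(\<Sum>e\<in>F. Re (cinner (abs_op S e) e)) = Re (\<Sum>e\<in>F. cinner (C (S e)) e)"
        by (simp add: C(2))
      ultimately show "(\<Sum>e\<in>F. Re (cinner (abs_op S e) e)) \<le> K"
        using complex_Re_le_cmod order_trans by metis
    qed
  qed
  then show ?thesis using Sb by (simp add: trace_class_def)
qed

text \<open>Write \<open>S = V |S|\<close> with a contraction \<open>V\<close>, and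
  \<open>|S| = Q Q\<close>. Expanding \<open>Q f\<close> in the basis gives \<open>S f\<close> as
  the sum of \<open>\<langle>f, Q e\<rangle> V Q e\<close>, and the products of norms are at most
  \<open>(norm (Q e))\<^sup>2\<close>, which sum to the trace norm.\<close>

lemma trace_class_imp_nuclear:
  fixes S :: "'n::finite op"
  assumes S: "S \<in> trace_class"
  shows "\<exists>u v. nuclear_rep S u v \<and> (\<Sum>n. norm (u n) * norm (v n)) \<le> trace_norm S"
proof -
  let ?B = "fock_onb :: 'n fock set"
  have Sb: "S \<in> bounded_ops" using S by (simp add: trace_class_def)
  have R: "positive_op (abs_op S)" by (rule positive_abs_op[OF Sb])
  then have Rb: "abs_op S \<in> bounded_ops" by (simp add: positive_op_def)
  obtain V where V: "V \<in> bounded_ops" "S = V o\<^sub>L abs_op S" "norm V \<le> 1"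
    using complex_douglas_factorization[OF Sb Rb] norm_abs_op_apply[OF Sb] by auto
  obtain Q where Q: "positive_op Q" "Q o\<^sub>L Q = abs_op S" using positive_op_sqrt[OF R] by blast
  have Qb: "Q \<in> bounded_ops" using Q(1) by (simp add: positive_op_def)
  have Qsa: "cinner (Q f) g = cinner f (Q g)" for f g
    by (rule blinfun_adjoint_bounded_ops(2)[OF Qb])
      (use Q(1) in \<open>simp only: positive_op_iff positive_selfadjoint_def\<close>)
  have sq: "Re (cinner (abs_op S e) e) = (norm (Q e))\<^sup>2" for e
    unfolding Q(2)[symmetric] blinfun_apply_blinfun_compose Qsa[of "Q e"] cinner_self_norm by simp
  define q where "q e = (norm (Q e))\<^sup>2" for e
  have q: "(q has_sum trace_norm S) ?B"
  proof -
    have "(\<lambda>e. Re (cinner (abs_op S e) e)) summable_on ?B" using S by (simp add: trace_class_def)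
    then show ?thesis unfolding trace_norm_def sq q_def by (rule has_sum_infsum)
  qed
  define C where "C = {e\<in>?B. q e \<noteq> 0}"
  have "countable C" unfolding C_def using q by (intro summable_countable_real) (auto simp: summable_on_def)
  define h where "h = to_nat_on C"
  have inj: "inj_on h C" unfolding h_def by (rule inj_on_to_nat_on[OF \<open>countable C\<close>])
  define r where "r = inv_into C h"
  have r: "r (h e) = e" if "e \<in> C" for e unfolding r_def using inj that by (rule inv_into_f_f)
  define u where "u n = (if n \<in> h ` C then V (Q (r n)) else 0)" for n
  define v where "v n = (if n \<in> h ` C then Q (r n) else 0)" for n
  have Q0: "Q e = 0" if "e \<in> ?B - C" for e using that by (auto simp: C_def q_def)
  \<comment> \<open>Turns an unordered sum over the basis into one over the natural numbers; it is
    used for the norms and for the vectors alike.\<close>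
  have transfer: "((\<lambda>n. if n \<in> h ` C then a (r n) else 0) has_sum s) UNIV"
    if "(a has_sum s) ?B" "\<And>e. e \<in> ?B - C \<Longrightarrow> a e = 0" for a :: "'n fock \<Rightarrow> 'b::real_normed_vector" and s
  proof -
    have "(a has_sum s) C"
      using has_sum_cong_neutral[of C ?B a a s] that by (auto simp: C_def)
    moreover have "((a \<circ> r) \<circ> h has_sum s) C \<longleftrightarrow> (a has_sum s) C"
      by (rule has_sum_cong) (simp add: r)
    ultimately have "((a \<circ> r) has_sum s) (h ` C)" using has_sum_reindex[OF inj] by blast
    then show ?thesis
      using has_sum_cong_neutral[of "h ` C" UNIV "a \<circ> r" "\<lambda>n. if n \<in> h ` C then a (r n) else 0" s]
      by auto
  qed
  have "((\<lambda>n. if n \<in> h ` C then q (r n) else 0) has_sum trace_norm S) UNIV"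
    by (rule transfer[OF q]) (auto simp: C_def)
  then have qs: "(\<lambda>n. if n \<in> h ` C then q (r n) else 0) sums trace_norm S" by (rule has_sum_imp_sums)
  have le: "norm (u n) * norm (v n) \<le> (if n \<in> h ` C then q (r n) else 0)" for n
  proof -
    have "norm (V (Q (r n))) \<le> 1 * norm (Q (r n))"
      by (rule order_trans[OF norm_blinfun]) (intro mult_right_mono V(3), simp)
    then have "norm (V (Q (r n))) * norm (Q (r n)) \<le> norm (Q (r n)) * norm (Q (r n))"
      by (intro mult_right_mono) auto
    then show ?thesis by (simp add: u_def v_def q_def power2_eq_square)
  qed
  have sm: "summable (\<lambda>n. norm (u n) * norm (v n))"
    by (rule summable_comparison_test'[OF sums_summable[OF qs], of 0]) (use le in simp)
  have "(\<Sum>n. norm (u n) * norm (v n)) \<le> trace_norm S"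
    using suminf_le[OF le sm sums_summable[OF qs]] sums_unique[OF qs] by simp
  moreover have "(\<lambda>n. scaleC (cinner f (v n)) (u n)) sums S f" for f
  proof -
    have VQ: "bounded_linear (\<lambda>g. V (Q g))"
      by (rule bounded_linear_compose[OF blinfun.bounded_linear_right blinfun.bounded_linear_right])
    have "((\<lambda>e. V (Q (scaleC (cinner (Q f) e) e))) has_sum V (Q (Q f))) ?B"
      by (rule has_sum_bounded_linear[OF VQ onb_expansion])
    moreover have "V (Q (Q f)) = S f"
      by (subst V(2)) (simp add: Q(2)[symmetric])
    ultimately have "((\<lambda>e. scaleC (cinner f (Q e)) (V (Q e))) has_sum S f) ?B"
      by (simp add: bounded_opsD[OF Qb] bounded_opsD[OF V(1)] Qsa)
    then have "((\<lambda>n. if n \<in> h ` C then scaleC (cinner f (Q (r n))) (V (Q (r n))) else 0) has_sum S f) UNIV"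
      by (rule transfer) (simp add: Q0 scaleC_simps)
    moreover have "(\<lambda>n. if n \<in> h ` C then scaleC (cinner f (Q (r n))) (V (Q (r n))) else 0) = (\<lambda>n. scaleC (cinner f (v n)) (u n))"
      by (rule ext) (simp add: u_def v_def scaleC_simps)
    ultimately show ?thesis by (simp add: has_sum_imp_sums)
  qed
  ultimately show ?thesis using sm unfolding nuclear_rep_def by blast
qed

lemma nuclear_imp_trace_class: "nuclear_rep S u v \<Longrightarrow> S \<in> trace_class"
  by (rule trace_bounded_imp_trace_class[OF nuclear_imp_trace_bounded])

lemma trace_class_trace_bounded: "S \<in> trace_class \<Longrightarrow> \<exists>K. trace_bounded S K"
  using trace_class_imp_nuclear nuclear_imp_trace_bounded by blast

lemma trace_class_add: "S \<in> trace_class \<Longrightarrow> T \<in> trace_class \<Longrightarrow> S + T \<in> trace_class"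
  using trace_class_trace_bounded trace_bounded_add trace_bounded_imp_trace_class by meson

lemma trace_class_scale: "S \<in> trace_class \<Longrightarrow> op_scaleC c S \<in> trace_class"
  using trace_class_trace_bounded trace_bounded_scale trace_bounded_imp_trace_class by meson

lemma rank_one_exists: "\<exists>S. nuclear_rep S (\<lambda>n. if n = 0 then u else 0) (\<lambda>n. if n = 0 then v else 0) \<and>
    (\<forall>f. blinfun_apply S f = scaleC (cinner f v) u)"
proof -
  have "bounded_linear (\<lambda>f. scaleC (cinner f v) u)"
  proof (rule bounded_linear_intro[where K="norm v * norm u"])
    fix f g :: "'a fock" and r :: real
    show "scaleC (cinner (f + g) v) u = scaleC (cinner f v) u + scaleC (cinner g v) u"
      by (simp only: cinner_simps(1) scaleC_simps(7))
    show "scaleC (cinner (r *\<^sub>R f) v) u = r *\<^sub>R scaleC (cinner f v) u"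
      by (simp only: cinner_simps(9) scaleC_simps(8)[symmetric] scaleC_simps(10))
    show "norm (scaleC (cinner f v) u) \<le> norm f * (norm v * norm u)"
      using mult_right_mono[OF cinner_cauchy_schwarz[of f v], of "norm u"] by (simp add: norm_scaleC mult.assoc)
  qed
  then have S: "blinfun_apply (Blinfun (\<lambda>f. scaleC (cinner f v) u)) f = scaleC (cinner f v) u" for f
    by (simp add: bounded_linear_Blinfun_apply)
  have "nuclear_rep (Blinfun (\<lambda>f. scaleC (cinner f v) u)) (\<lambda>n. if n = 0 then u else 0) (\<lambda>n. if n = 0 then v else 0)"
    unfolding nuclear_rep_def S
  proof (intro conjI allI)
    show "summable (\<lambda>n::nat. norm (if n = 0 then u else 0) * norm (if n = 0 then v else 0))"
      by (rule summable_finite[of "{0}"]) auto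
    show "(\<lambda>n::nat. scaleC (cinner f (if n = 0 then v else 0)) (if n = 0 then u else 0)) sums scaleC (cinner f v) u" for f
      using sums_finite[of "{0}" "\<lambda>n::nat. scaleC (cinner f (if n = 0 then v else 0)) (if n = 0 then u else 0)"]
      by (simp add: scaleC_simps(4))
  qed
  then show ?thesis using S by blast
qed

section \<open>Translations and unitary rotations\<close>

lemma fock_fun_motion:
  assumes A: "A \<in> unitary_matrices"
  shows "fock_fun (blinfun_apply (motion_rep (A, z)) f) w = kern z w * fock_fun f (conj_transpose A *v (w - z))"
    and "cinner (blinfun_apply (motion_rep (A, z)) f) (blinfun_apply (motion_rep (A, z)) g) = cinner f g"
    and "motion_rep (A, z) \<in> bounded_ops"
    and "norm (motion_rep (A, z)) \<le> 1"
proof -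
  define M where "M f = Abs_fock (\<lambda>w. kern z w * fock_fun f (conj_transpose A *v (w - z)))" for f
  have M: "fock_fun (M f) = (\<lambda>w. kern z w * fock_fun f (conj_transpose A *v (w - z)))" for f
    unfolding M_def by (intro Abs_fock_inverse motion_fock_set_aux(2)[OF A fock_fun fock_fun])
  have iso: "cinner (M f) (M g) = cinner f g" for f g
    unfolding cinner_def M by (rule motion_fock_set_aux(1)[OF A fock_fun fock_fun])
  have norm: "norm (M f) = norm f" for f
    using iso[of f f] unfolding cinner_self_norm of_real_eq_iff by (rule power2_eq_imp_eq) simp_all
  have lin: "M (f + g) = M f + M g" "M (scaleC c f) = scaleC c (M f)" "M (r *\<^sub>R f) = r *\<^sub>R M f" for f g c r
    by (auto intro!: fock_eqI simp: M fock_fun_simps algebra_simps)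
  have "bounded_linear M"
    by (rule bounded_linear_intro[where K=1]) (simp_all add: lin norm)
  moreover have "motion_rep (A, z) = Blinfun M"
    unfolding motion_rep_def M_def[abs_def] by (simp add: matrix_inv_unitary[OF A])
  ultimately have app: "blinfun_apply (motion_rep (A, z)) = M" by (simp add: bounded_linear_Blinfun_apply)
  show "fock_fun (blinfun_apply (motion_rep (A, z)) f) w = kern z w * fock_fun f (conj_transpose A *v (w - z))"
    by (simp add: app M)
  show "cinner (blinfun_apply (motion_rep (A, z)) f) (blinfun_apply (motion_rep (A, z)) g) = cinner f g"
    by (simp add: app iso)
  show "motion_rep (A, z) \<in> bounded_ops" by (simp add: bounded_ops_def app lin)
  show "norm (motion_rep (A, z)) \<le> 1" by (rule norm_blinfun_bound) (simp_all add: app norm)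
qed

section \<open>Weyl operators and parity as special motions\<close>

lemma conj_transpose_minus_mat: "conj_transpose (- mat 1) = - mat 1"
  by (auto simp: conj_transpose_def mat_def vec_eq_iff)

lemma minus_matrix_vector: "(- A) *v x = - ((A :: 'a::ring_1^'k^'n) *v x)"
  by (simp add: matrix_vector_mult_def vec_eq_iff sum_negf[symmetric])

lemma minus_matrix_mult: "(- A) ** (- B) = A ** (B :: 'a::ring_1^'k^'n)"
  by (simp add: matrix_matrix_mult_def)

lemma minus_mat_1_unitary: "- mat 1 \<in> unitary_matrices"
  by (simp add: unitary_matrices_def conj_transpose_minus_mat minus_matrix_mult)

lemma kern_0: "kern 0 w = 1"
  by (simp add: kern_hip hip_simps)

lemma weyl_conv_motion: "weyl z = motion_rep (mat 1, z)"
  by (simp add: weyl_def motion_rep_def matrix_inv_unitary[OF mat_1_unitary])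

lemma op_translate_conv_motion: "op_translate z S = op_motion (mat 1, z) S"
  by (simp add: op_translate_def op_motion_def weyl_conv_motion)

lemma fock_fun_weyl: "fock_fun (blinfun_apply (weyl z) f) w = kern z w * fock_fun f (w - z)"
  by (simp add: weyl_conv_motion fock_fun_motion(1)[OF mat_1_unitary])

lemma parity_conv_motion: "parity_op = motion_rep (- mat 1, 0)"
  by (simp add: parity_op_def motion_rep_def matrix_inv_unitary[OF minus_mat_1_unitary]
      conj_transpose_minus_mat minus_matrix_vector kern_0)

lemma parity_parity: "parity_op o\<^sub>L parity_op = id_blinfun"
proof (rule blinfun_eqI, rule fock_eqI)
  fix f w
  show "fock_fun ((parity_op o\<^sub>L parity_op) f) w = fock_fun (id_blinfun f) w"
    by (simp add: parity_conv_motion fock_fun_motion(1)[OF minus_mat_1_unitary]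
        conj_transpose_minus_mat minus_matrix_vector kern_0)
qed

lemma parity_bounded_ops: "parity_op \<in> bounded_ops"
  unfolding parity_conv_motion by (rule fock_fun_motion(3)[OF minus_mat_1_unitary])

lemma op_adjoint_parity: "op_adjoint parity_op = parity_op"
proof (rule op_adjointI)
  fix f g :: "'a fock"
  have "parity_op (parity_op g) = g"
    using arg_cong[OF parity_parity, of "\<lambda>T. blinfun_apply T g"] by simp
  then show "cinner (parity_op f) g = cinner f (parity_op g)"
    using fock_fun_motion(2)[OF minus_mat_1_unitary, of 0 f "parity_op g"] by (simp add: parity_conv_motion)
qed

lemma op_motion_parity: "op_motion (- mat 1, 0) S = parity_op o\<^sub>L S o\<^sub>L parity_op"
  by (simp add: op_motion_def parity_conv_motion[symmetric] op_adjoint_parity)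

lemma op_adjoint_motion:
  assumes A: "A \<in> unitary_matrices"
  shows "op_adjoint (motion_rep (A, z)) o\<^sub>L motion_rep (A, z) = id_blinfun"
    and "op_adjoint (motion_rep (A, z)) \<in> bounded_ops"
    and "norm (op_adjoint (motion_rep (A, z))) \<le> 1"
proof -
  note M = fock_fun_motion[OF A, of z]
  show "op_adjoint (motion_rep (A, z)) o\<^sub>L motion_rep (A, z) = id_blinfun"
  proof (rule blinfun_eqI, rule cinner_eqI)
    fix f g
    show "cinner ((op_adjoint (motion_rep (A, z)) o\<^sub>L motion_rep (A, z)) f) g = cinner (id_blinfun f) g"
      by (simp add: cinner_op_adjoint'[OF M(3)] M(2))
  qed
  show "op_adjoint (motion_rep (A, z)) \<in> bounded_ops" by (rule op_adjoint_bounded_ops[OF M(3)])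
  show "norm (op_adjoint (motion_rep (A, z))) \<le> 1"
    using norm_op_adjoint_le[OF M(3)] M(4) by (rule order_trans)
qed

lemma norm_compose_contraction: "norm A \<le> 1 \<Longrightarrow> norm B \<le> 1 \<Longrightarrow> norm (A o\<^sub>L S o\<^sub>L B) \<le> norm S"
proof -
  assume A: "norm A \<le> 1" and B: "norm B \<le> 1"
  have "norm (A o\<^sub>L S o\<^sub>L B) \<le> norm (A o\<^sub>L S) * norm B" by (rule norm_blinfun_compose)
  also have "\<dots> \<le> (norm A * norm S) * norm B" by (intro mult_right_mono norm_blinfun_compose) auto
  also have "\<dots> \<le> (1 * norm S) * 1" by (intro mult_mono A B) auto
  finally show ?thesis by simp
qed

lemma op_motion_props:
  assumes A: "A \<in> unitary_matrices"
  shows op_motion_bounded_ops: "S \<in> bounded_ops \<Longrightarrow> op_motion (A, z) S \<in> bounded_ops"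
    and norm_op_motion_le: "norm (op_motion (A, z) S) \<le> norm S"
    and op_motion_compose: "op_motion (A, z) (S o\<^sub>L T) = (op_motion (A, z) S o\<^sub>L op_motion (A, z) T)"
    and cinner_op_motion: "cinner (blinfun_apply (op_motion (A, z) S) f) g =
      cinner (blinfun_apply S (blinfun_apply (op_adjoint (motion_rep (A, z))) f))
        (blinfun_apply (op_adjoint (motion_rep (A, z))) g)"
proof -
  note M = fock_fun_motion[OF A, of z] and N = op_adjoint_motion[OF A, of z]
  show "S \<in> bounded_ops \<Longrightarrow> op_motion (A, z) S \<in> bounded_ops"
    unfolding op_motion_def using M(3) N(2) by (simp add: bounded_ops_closed_under)
  show "norm (op_motion (A, z) S) \<le> norm S"
    unfolding op_motion_def by (rule norm_compose_contraction[OF M(4) N(3)])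
  show "op_motion (A, z) (S o\<^sub>L T) = (op_motion (A, z) S o\<^sub>L op_motion (A, z) T)"
  proof (rule blinfun_eqI)
    fix f
    have "op_adjoint (motion_rep (A, z)) (motion_rep (A, z) g) = g" for g
      using arg_cong[OF N(1), of "\<lambda>T. blinfun_apply T g"] by simp
    then show "op_motion (A, z) (S o\<^sub>L T) f = (op_motion (A, z) S o\<^sub>L op_motion (A, z) T) f"
      by (simp add: op_motion_def)
  qed
  show "cinner (blinfun_apply (op_motion (A, z) S) f) g =
      cinner (blinfun_apply S (blinfun_apply (op_adjoint (motion_rep (A, z))) f))
        (blinfun_apply (op_adjoint (motion_rep (A, z))) g)"
    unfolding op_motion_def by (simp add: cinner_op_adjoint[OF M(3)])
qed

lemma op_motion_linear:
  "op_motion g (S + T) = op_motion g S + op_motion g T" "op_motion g (S - T) = op_motion g S - op_motion g T"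
  by (simp_all add: op_motion_def blinfun_compose_simps)

lemmas op_translate_props = op_motion_props[OF mat_1_unitary, folded op_translate_conv_motion weyl_conv_motion]

lemma op_translate_linear:
  "op_translate z (S + T) = op_translate z S + op_translate z T"
  "op_translate z (S - T) = op_translate z S - op_translate z T"
  unfolding op_translate_conv_motion by (rule op_motion_linear)+

text \<open>Motions permute the coherent states up to a phase. Only the modulus of the phase is
  recorded, since it enters the Berezin transform together with its conjugate.\<close>

lemma adjoint_motion_coh:
  assumes A: "A \<in> unitary_matrices"
  shows "\<exists>c. cmod c = 1 \<and>
     blinfun_apply (op_adjoint (motion_rep (A, z))) (coh w) = scaleC c (coh (conj_transpose A *v (w - z)))"
proof -
  define w' where "w' = conj_transpose A *v (w - z)"
  have n: "norm w' = norm (w - z)" unfolding w'_def by (rule norm_unitary[OF conj_transpose_unitary[OF A]])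
  \<comment> \<open>Obtained by comparing the reproducing formulas at \<open>w\<close> and at
    \<open>w'\<close>. The exponents cancel in modulus because
    \<open>norm w' = norm (w - z)\<close>.\<close>
  define c where "c = exp (- (pi / 2 * (norm w)\<^sup>2)) * exp (pi / 2 * (norm w')\<^sup>2) * kern z w"
  have "cmod c = exp (- (pi / 2 * (norm w)\<^sup>2)) * exp (pi / 2 * (norm w')\<^sup>2) * exp (pi * (z \<bullet> w) - pi / 2 * (norm z)\<^sup>2)"
    by (simp add: c_def norm_mult kern_hip norm_exp_eq_Re Re_hip)
  also have "\<dots> = exp (- (pi / 2 * (norm w)\<^sup>2) + pi / 2 * (norm w')\<^sup>2 + (pi * (z \<bullet> w) - pi / 2 * (norm z)\<^sup>2))"
    by (simp only: exp_add)
  also have "- (pi / 2 * (norm w)\<^sup>2) + pi / 2 * (norm w')\<^sup>2 + (pi * (z \<bullet> w) - pi / 2 * (norm z)\<^sup>2) = 0"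
    unfolding n power2_norm_eq_inner by (simp add: inner_simps inner_commute algebra_simps)
  finally have "cmod (cnj c) = 1" by simp
  moreover have "op_adjoint (motion_rep (A, z)) (coh w) = scaleC (cnj c) (coh w')"
  proof (rule cinner_eqI)
    fix f
    have e: "cinner g (coh v) = exp (- (pi / 2 * (norm v)\<^sup>2)) * fock_fun g v" for g :: "'a fock" and v
      unfolding fock_fun_conv_coh by (simp add: exp_minus)
    have "cinner f (op_adjoint (motion_rep (A, z)) (coh w)) = c * cinner f (coh w')"
      unfolding cinner_op_adjoint[OF fock_fun_motion(3)[OF A], symmetric] e fock_fun_motion(1)[OF A] w'_def[symmetric]
      by (simp add: c_def exp_minus)
    then show "cinner (op_adjoint (motion_rep (A, z)) (coh w)) f = cinner (scaleC (cnj c) (coh w')) f"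
      unfolding cinner_commute[of _ f] by (simp add: cinner_simps)
  qed
  ultimately show ?thesis unfolding w'_def by blast
qed

section \<open>The Berezin transform under the group action\<close>

definition berezin :: "'n::finite op \<Rightarrow> complex^'n \<Rightarrow> complex" where
  "berezin S z = cinner (blinfun_apply S (coh z)) (coh z)"

lemma berezin_op_motion:
  assumes A: "A \<in> unitary_matrices" and S: "S \<in> bounded_ops"
  shows "berezin (op_motion (A, z) S) w = berezin S (conj_transpose A *v (w - z))"
proof -
  obtain c where c: "cmod c = 1" "op_adjoint (motion_rep (A, z)) (coh w) = scaleC c (coh (conj_transpose A *v (w - z)))"
    using adjoint_motion_coh[OF A] by blast
  have "c * cnj c = 1" "cnj c * c = 1"
    using c(1) by (simp_all add: complex_norm_square[symmetric] mult.commute[of "cnj c"])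
  then show ?thesis
    unfolding berezin_def cinner_op_motion[OF A] c(2) bounded_opsD[OF S] cinner_simps
    by (simp add: mult.assoc[symmetric])
qed

lemma berezin_op_translate: "S \<in> bounded_ops \<Longrightarrow> berezin (op_translate z S) w = berezin S (w - z)"
  unfolding op_translate_conv_motion by (simp add: berezin_op_motion[OF mat_1_unitary])

lemma berezin_parity: "S \<in> bounded_ops \<Longrightarrow> berezin (parity_op o\<^sub>L S o\<^sub>L parity_op) w = berezin S (- w)"
  using berezin_op_motion[OF minus_mat_1_unitary, of S 0 w]
  by (simp add: op_motion_parity conj_transpose_minus_mat minus_matrix_vector)

lemma berezin_simps:
  "berezin (S + T) z = berezin S z + berezin T z" "berezin (S - T) z = berezin S z - berezin T z"
  "berezin (op_scaleC c S) z = c * berezin S z" "berezin 0 z = 0"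
  by (simp_all add: berezin_def blinfun.bilinear_simps cinner_simps op_scaleC_apply)

lemma cmod_berezin_le: "cmod (berezin S z) \<le> norm S"
proof -
  have "cmod (berezin S z) \<le> norm (S (coh z)) * norm (coh z)"
    unfolding berezin_def by (rule cinner_cauchy_schwarz)
  also have "\<dots> \<le> norm S * norm (coh z) * norm (coh z)" by (intro mult_right_mono norm_blinfun) simp
  finally show ?thesis by (simp add: norm_coh)
qed

section \<open>Injectivity of the Berezin transform\<close>

text \<open>The unnormalized reproducing kernel. It depends antiholomorphically on \<open>x\<close>,
  which the Gaussian factor of \<open>coh x\<close> would spoil.\<close>

definition rkern :: "complex^'n \<Rightarrow> 'n::finite fock" where
  "rkern x = scaleC (exp (pi / 2 * (norm x)\<^sup>2)) (coh x)"

lemma fock_fun_rkern: "fock_fun (rkern x) w = exp (pi * hip x w)"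
proof -
  have "exp (pi / 2 * (norm x)\<^sup>2) * kern x w = exp (complex_of_real (pi / 2 * (norm x)\<^sup>2) + (pi * hip x w - pi / 2 * (norm x)\<^sup>2))"
    unfolding kern_hip exp_add by (simp add: exp_of_real[symmetric])
  then show ?thesis by (simp add: rkern_def fock_fun_scaleC fock_fun_coh)
qed

lemma cinner_rkern: "cinner f (rkern z) = fock_fun f z"
  unfolding rkern_def cinner_simps fock_fun_conv_coh by simp

text \<open>Half of the Gaussian exponent is spent on absorbing the exponential, by completing the
  square. The dilation by \<open>1 / sqrt 2\<close> shows that the other half is still
  integrable.\<close>

lemma exp_norm_integrable: "integrable gauss_measure (\<lambda>w :: complex^'n. exp (c * norm w))"
proof -
  have "integrable lborel (\<lambda>w :: complex^'n. exp (- pi * (norm w)\<^sup>2))"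
    using integrable_gauss_measure_iff[of "\<lambda>w :: complex^'n. 1 :: real"]
      prob_space.finite_measure[OF prob_space_gauss_measure[where 'n='n]]
    by (simp add: finite_measure.integrable_const)
  from lborel_integrable_affine[OF this, of "1 / sqrt 2" 0]
  have 1: "integrable lborel (\<lambda>w :: complex^'n. exp (c\<^sup>2 / (2 * pi)) * exp (- (pi / 2) * (norm w)\<^sup>2))"
    by (simp add: power_mult_distrib power_divide)
  have "integrable lborel (\<lambda>w :: complex^'n. exp (- pi * (norm w)\<^sup>2) *\<^sub>R exp (c * norm w))"
  proof (rule Bochner_Integration.integrable_bound[OF 1])
    have "c * t - pi * t\<^sup>2 \<le> c\<^sup>2 / (2 * pi) - pi / 2 * t\<^sup>2" for t :: real
    proof -
      have "0 \<le> (c - pi * t)\<^sup>2 / (2 * pi)" by simp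
      also have "\<dots> = c\<^sup>2 / (2 * pi) - c * t + pi / 2 * t\<^sup>2"
        by (simp add: power2_eq_square field_simps)
      finally show ?thesis by (simp add: algebra_simps)
    qed
    from this[of "norm w" for w :: "complex^'n"]
    have "exp (- pi * (norm w)\<^sup>2) * exp (c * norm w) \<le> exp (c\<^sup>2 / (2 * pi)) * exp (- (pi / 2) * (norm w)\<^sup>2)" for w :: "complex^'n"
      unfolding exp_add[symmetric] exp_le_cancel_iff by (simp add: algebra_simps)
    then show "AE w in lborel. norm (exp (- pi * (norm w)\<^sup>2) *\<^sub>R exp (c * norm w))
        \<le> norm (exp (c\<^sup>2 / (2 * pi)) * exp (- (pi / 2) * (norm (w :: complex^'n))\<^sup>2))"
      by simp
  qed measurable
  then show ?thesis by (subst integrable_gauss_measure_iff) auto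
qed

lemma exponential_bound_fock:
  fixes g :: "complex^'n \<Rightarrow> complex"
  assumes g: "entire g" and le: "\<And>w. cmod (g w) \<le> B * exp (c * norm w)"
  shows "g \<in> fock_set" "norm (Abs_fock g) \<le> B * sqrt (\<integral>w. exp (2 * c * norm w) \<partial>(gauss_measure :: (complex^'n) measure))"
proof -
  have B: "0 \<le> B" using order_trans[OF norm_ge_zero le[of 0]] by simp
  have le2: "(cmod (g w))\<^sup>2 \<le> B\<^sup>2 * exp (2 * c * norm w)" for w
    using power_mono[OF le norm_ge_zero, of w 2] by (simp add: power_mult_distrib exp_double[symmetric] mult_ac)
  have i: "integrable gauss_measure (\<lambda>w :: complex^'n. B\<^sup>2 * exp (2 * c * norm w))"
    by (intro integrable_mult_right exp_norm_integrable)
  have i2: "integrable gauss_measure (\<lambda>w. (cmod (g w))\<^sup>2)"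
    by (rule Bochner_Integration.integrable_bound[OF i])
      (use le2 entire_measurable[OF g] in auto)
  then show mem: "g \<in> fock_set" using g by (simp add: fock_set_def)
  have "(norm (Abs_fock g))\<^sup>2 = (\<integral>w. (cmod (g w))\<^sup>2 \<partial>gauss_measure)"
    using cinner_self[of "Abs_fock g"] unfolding cinner_self_norm of_real_eq_iff Abs_fock_inverse[OF mem] .
  also have "\<dots> \<le> (\<integral>w. B\<^sup>2 * exp (2 * c * norm w) \<partial>(gauss_measure :: (complex^'n) measure))"
    by (rule integral_mono[OF i2 i le2])
  also have "\<dots> = B\<^sup>2 * (\<integral>w. exp (2 * c * norm w) \<partial>(gauss_measure :: (complex^'n) measure))"
    by (rule integral_mult_right_zero)
  finally have "norm (Abs_fock g) \<le> sqrt (B\<^sup>2 * (\<integral>w. exp (2 * c * norm w) \<partial>(gauss_measure :: (complex^'n) measure)))"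
    by (rule real_le_rsqrt)
  then show "norm (Abs_fock g) \<le> B * sqrt (\<integral>w. exp (2 * c * norm w) \<partial>(gauss_measure :: (complex^'n) measure))"
    using B by (simp add: real_sqrt_mult)
qed

lemma square_le_exp: "0 \<le> t \<Longrightarrow> t\<^sup>2 \<le> 2 * exp t" for t :: real
  using exp_lower_Taylor_quadratic[of t] by simp

text \<open>Evaluated at a point, the remainder of the difference quotient is a second-order Taylor
  remainder of the exponential. A bound of exponential type for it is also a norm bound, so the
  pointwise expansion holds in the Fock space. The conjugate on \<open>\<alpha>\<close> compensates
  the antiholomorphic dependence.\<close>

lemma rkern_line_derivative:
  fixes m f :: "complex^'n"
  shows "\<exists>d. ((\<lambda>\<alpha>. rkern (m + cnj \<alpha> *s f)) has_derivative (\<lambda>h. scaleC h d)) (at \<alpha>)"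
proof -
  define x where "x = m + cnj \<alpha> *s f"
  define b where "b = pi * norm f"
  define a where "a = pi * norm x"
  \<comment> \<open>One \<open>b\<close> bounds the exponential in the Taylor remainder, the other
    absorbs the square \<open>(b * norm w)\<^sup>2\<close> at the cost of a factor 2.\<close>
  define c where "c = a + 2 * b"
  define g where "g w = pi * hip f w * exp (pi * hip x w)" for w
  have ab: "0 \<le> a" "0 \<le> b" by (auto simp: a_def b_def)
  have s: "cmod (pi * hip f w) \<le> b * norm w" for w
    using mult_left_mono[OF cmod_hip_le[of f w], of pi] by (simp add: b_def norm_mult)
  have e: "cmod (exp (pi * hip x w)) \<le> exp (a * norm w)" for w
  proof -
    have "Re (pi * hip x w) \<le> a * norm w"
      using mult_left_mono[OF norm_cauchy_schwarz[of x w], of pi] by (simp add: Re_hip a_def)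
    then show ?thesis by (simp only: norm_exp_eq_Re exp_le_cancel_iff)
  qed
  have "entire g"
    unfolding g_def[abs_def] by (intro entire_mult entire_cmult entire_exp entire_hip)
  moreover have "cmod (g w) \<le> 1 * exp ((a + b) * norm w)" for w
  proof -
    have "b * norm w \<le> exp (b * norm w)" using exp_ge_add_one_self[of "b * norm w"] by linarith
    then have "cmod (pi * hip f w) \<le> exp (b * norm w)" using s order_trans by blast
    then have "cmod (g w) \<le> exp (b * norm w) * exp (a * norm w)"
      unfolding g_def norm_mult[of "complex_of_real pi * hip f w"] by (intro mult_mono e) auto
    then show ?thesis by (simp add: exp_add[symmetric] algebra_simps)
  qed
  ultimately have gm: "g \<in> fock_set" by (rule exponential_bound_fock(1))
  define d where "d = Abs_fock g"
  have d: "fock_fun d = g" unfolding d_def by (rule Abs_fock_inverse[OF gm])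
  define C where "C = 2 * sqrt (\<integral>w. exp (2 * c * norm w) \<partial>(gauss_measure :: (complex^'n) measure))"
  have est: "norm (rkern (m + cnj \<beta> *s f) - rkern x - scaleC (\<beta> - \<alpha>) d) \<le> (cmod (\<beta> - \<alpha>))\<^sup>2 * C"
    if "cmod (\<beta> - \<alpha>) \<le> 1" for \<beta>
  proof -
    define h where "h = \<beta> - \<alpha>"
    have h: "cmod h \<le> 1" using that by (simp add: h_def)
    define D where "D = rkern (m + cnj \<beta> *s f) - rkern x - scaleC h d"
    have mx: "hip (m + cnj \<beta> *s f) w = hip x w + h * hip f w" for w
      by (simp add: x_def h_def hip_simps algebra_simps)
    have D: "fock_fun D w = exp (pi * hip x w) * (exp (h * (pi * hip f w)) - 1 - h * (pi * hip f w))" for w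
      by (simp add: D_def fock_fun_simps fock_fun_rkern mx d g_def exp_add algebra_simps)
    have "cmod (fock_fun D w) \<le> (2 * (cmod h)\<^sup>2) * exp (c * norm w)" for w
    proof -
      let ?s = "h * (pi * hip f w)"
      have hs: "cmod ?s \<le> cmod h * (b * norm w)"
        unfolding norm_mult[of h] by (intro mult_left_mono s) auto
      also have "\<dots> \<le> 1 * (b * norm w)" using h ab by (intro mult_right_mono) auto
      finally have hs1: "\<bar>Re ?s\<bar> \<le> b * norm w" using abs_Re_le_cmod[of ?s] by linarith
      have "cmod (exp ?s - 1 - ?s) \<le> exp \<bar>Re ?s\<bar> * (cmod ?s)\<^sup>2"
        using Taylor_exp[of ?s 1] by (simp add: power2_eq_square diff_diff_eq)
      also have "\<dots> \<le> exp (b * norm w) * (cmod h * (b * norm w))\<^sup>2"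
        using hs hs1 by (intro mult_mono power_mono) auto
      also have "\<dots> \<le> exp (b * norm w) * ((cmod h)\<^sup>2 * (2 * exp (b * norm w)))"
        unfolding power_mult_distrib[of "cmod h"] using ab by (intro mult_left_mono square_le_exp) auto
      finally have "cmod (fock_fun D w) \<le> exp (a * norm w) * (exp (b * norm w) * ((cmod h)\<^sup>2 * (2 * exp (b * norm w))))"
        unfolding D norm_mult[of "exp (pi * hip x w)"] by (intro mult_mono e) auto
      also have "\<dots> = (2 * (cmod h)\<^sup>2) * exp (a * norm w + b * norm w + b * norm w)"
        unfolding exp_add by (simp add: mult_ac)
      also have "a * norm w + b * norm w + b * norm w = c * norm w" by (simp add: c_def algebra_simps)
      finally show ?thesis .
    qed
    from exponential_bound_fock(2)[OF fock_fun_entire this]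
    have "norm D \<le> (2 * (cmod h)\<^sup>2) * sqrt (\<integral>w. exp (2 * c * norm w) \<partial>(gauss_measure :: (complex^'n) measure))"
      by (simp add: fock_fun_inverse)
    then show ?thesis by (simp add: D_def h_def C_def mult_ac)
  qed
  have "((\<lambda>\<alpha>. rkern (m + cnj \<alpha> *s f)) has_derivative (\<lambda>h. scaleC h d)) (at \<alpha>)"
  proof (rule has_derivativeI_sandwich[where e=1 and H="\<lambda>\<beta>. C * cmod (\<beta> - \<alpha>)"])
    show "bounded_linear (\<lambda>h. scaleC h d)"
      by (rule bounded_linear_intro[where K="norm d"])
        (auto intro!: fock_eqI simp: fock_fun_simps algebra_simps scaleR_conv_of_real norm_scaleC)
    show "((\<lambda>\<beta>. C * cmod (\<beta> - \<alpha>)) \<longlongrightarrow> 0) (at \<alpha>)"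
      by (auto intro!: tendsto_eq_intros)
    fix \<beta> assume "\<beta> \<noteq> \<alpha>" "dist \<beta> \<alpha> < 1"
    then show "norm (rkern (m + cnj \<beta> *s f) - rkern (m + cnj \<alpha> *s f) - scaleC (\<beta> - \<alpha>) d) / norm (\<beta> - \<alpha>) \<le> C * cmod (\<beta> - \<alpha>)"
      using est[of \<beta>] by (simp add: x_def[symmetric] dist_norm divide_le_eq power2_eq_square mult_ac)
  qed simp
  then show ?thesis by blast
qed

lemma bounded_bilinear_cinner: "bounded_bilinear cinner"
  by (rule bounded_bilinear.intro)
    (auto simp: cinner_simps scaleR_conv_of_real intro!: exI[of _ 1] cinner_cauchy_schwarz)

text \<open>The function \<open>\<alpha> \<mapsto> \<langle>X K\<^bsub>m + cnj \<alpha> f\<^esub>, K\<^bsub>m + \<alpha> f\<^esub>\<rangle>\<close> is entire and vanishes for real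
  \<open>\<alpha>\<close>; its value at \<open>\<alpha> = \<i>\<close> is an arbitrary matrix coefficient.\<close>

lemma berezin_inj_0:
  assumes X: "X \<in> bounded_ops" and 0: "\<And>z. berezin X z = 0"
  shows "X = (0 :: 'n::finite op)"
proof -
  have kk: "cinner (X (rkern x)) (rkern y) = 0" for x y :: "complex^'n"
  proof -
    define m where "m = (1/2) *\<^sub>R (x + y)"
    define e where "e = (1/2) *\<^sub>R (y - x)"
    \<comment> \<open>The factor \<open>- \<i>\<close> makes \<open>\<alpha> = \<i>\<close> give
      \<open>m - e = x\<close> in the first slot and \<open>m + e = y\<close> in the second.\<close>
    define f where "f = (- \<i>) *s e"
    define H where "H \<alpha> = cinner (X (rkern (m + cnj \<alpha> *s f))) (rkern (m + \<alpha> *s f))" for \<alpha>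
    have "H field_differentiable (at \<alpha>)" for \<alpha>
    proof -
      obtain d where d: "((\<lambda>\<alpha>. rkern (m + cnj \<alpha> *s f)) has_derivative (\<lambda>h. scaleC h d)) (at \<alpha>)"
        using rkern_line_derivative by blast
      obtain d' where d': "((\<lambda>\<alpha>. rkern (m + cnj \<alpha> *s f)) has_derivative (\<lambda>h. scaleC h d')) (at (cnj \<alpha>))"
        using rkern_line_derivative by blast
      have "(cnj has_derivative cnj) (at \<alpha>)"
        by (rule bounded_linear_imp_has_derivative[OF bounded_linear_cnj])
      from has_derivative_compose[OF this d']
      have d'': "((\<lambda>\<alpha>. rkern (m + \<alpha> *s f)) has_derivative (\<lambda>h. scaleC (cnj h) d')) (at \<alpha>)" by simp
      have "((\<lambda>\<alpha>. X (rkern (m + cnj \<alpha> *s f))) has_derivative (\<lambda>h. X (scaleC h d))) (at \<alpha>)"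
        by (rule bounded_linear.has_derivative[OF blinfun.bounded_linear_right d])
      from bounded_bilinear.FDERIV[OF bounded_bilinear_cinner this d'']
      have "(H has_derivative (\<lambda>h. (cinner (X (rkern (m + cnj \<alpha> *s f))) d' + cinner (X d) (rkern (m + \<alpha> *s f))) * h)) (at \<alpha>)"
        unfolding H_def by (simp add: bounded_opsD[OF X] cinner_simps algebra_simps)
      then show ?thesis
        unfolding field_differentiable_def has_field_derivative_def
        by (intro exI[of _ "cinner (X (rkern (m + cnj \<alpha> *s f))) d' + cinner (X d) (rkern (m + \<alpha> *s f))"])
    qed
    then have "H holomorphic_on UNIV" by (simp add: holomorphic_on_def)
    moreover have "(0::complex) islimpt \<real>"
      unfolding islimpt_approachable
    proof (intro allI impI)
      fix e :: real assume "e > 0"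
      then show "\<exists>x'\<in>\<real>. x' \<noteq> 0 \<and> dist x' (0::complex) < e"
        by (intro bexI[of _ "complex_of_real (e / 2)"]) auto
    qed
    moreover have "H \<alpha> = 0" if "\<alpha> \<in> \<real>" for \<alpha>
    proof -
      have "cnj \<alpha> = \<alpha>" using that by (simp add: Reals_cnj_iff)
      then show ?thesis
        using 0[of "m + \<alpha> *s f"] unfolding H_def rkern_def bounded_opsD[OF X] cinner_simps by (simp add: berezin_def)
    qed
    ultimately have "H \<i> = 0"
      using analytic_continuation[of H UNIV \<real> 0 \<i>] by (auto simp: connected_UNIV)
    moreover have "m + cnj \<i> *s f = x" "m + \<i> *s f = y"
      by (simp_all add: m_def e_def f_def vec_eq_iff scaleR_conv_of_real[where 'a=complex] field_simps)
    ultimately show ?thesis by (simp add: H_def)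
  qed
  have Xk: "X (rkern x) = 0" for x
    by (rule fock_eqI) (simp add: cinner_rkern[symmetric] kk fock_fun_zero)
  \<comment> \<open>A vector is determined by its pairings with kernels, so vanishing on kernels
    passes to the adjoint, and from the adjoint to \<open>X\<close> on every vector.\<close>
  have "op_adjoint X (rkern y) = 0" for y
  proof (rule fock_eqI)
    fix w
    show "fock_fun (op_adjoint X (rkern y)) w = fock_fun 0 w"
      by (simp add: cinner_rkern[symmetric] cinner_op_adjoint'[OF X] Xk cinner_simps)
  qed
  then have "X f = 0" for f
    by (intro fock_eqI) (simp add: cinner_rkern[symmetric] cinner_op_adjoint[OF X] cinner_simps)
  then show ?thesis by (intro blinfun_eqI) simp
qed

lemma berezin_inj:
  assumes "S \<in> bounded_ops" "T \<in> bounded_ops" "\<And>z. berezin S z = berezin T z"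
  shows "S = T"
  using berezin_inj_0[of "S - T"] assms by (simp add: bounded_ops_closed_under berezin_simps)

text \<open>Weyl operators compose only up to a phase. The phase cancels in the conjugation, and
  comparing Berezin transforms spares its computation.\<close>

lemma op_translate_translate:
  "S \<in> bounded_ops \<Longrightarrow> op_translate z (op_translate w S) = op_translate (z + w) S"
  by (rule berezin_inj) (auto simp: op_translate_props berezin_op_translate algebra_simps)

lemma op_translate_0: "S \<in> bounded_ops \<Longrightarrow> op_translate 0 S = S"
  by (rule berezin_inj) (auto simp: op_translate_props berezin_op_translate)

lemma inv_motion_act:
  assumes "A \<in> unitary_matrices"
  shows "motion_act (inv\<^bsub>motion_group\<^esub> (A, z)) w = conj_transpose A *v (w - z)"
proof -
  have "inv\<^bsub>motion_group\<^esub> (A, z) = (conj_transpose A, - (conj_transpose A *v z))"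
  proof (rule group.inv_equality[OF group_motion_group])
    show "(conj_transpose A, - (conj_transpose A *v z)) \<otimes>\<^bsub>motion_group\<^esub> (A, z) = \<one>\<^bsub>motion_group\<^esub>"
      using assms by (simp add: motion_group_def unitary_matrices_def)
  qed (use assms conj_transpose_unitary[OF assms] in \<open>simp_all add: motion_group_def\<close>)
  then show ?thesis by (simp add: motion_act_def matrix_vector_mult_diff_distrib)
qed

text \<open>Reduces invariance of operators to invariance of functions, so that a single argument
  about convolutions serves for both.\<close>

lemma Hom_ops_iff:
  assumes G: "G \<subseteq> carrier motion_group"
  shows "S \<in> Hom_ops G \<longleftrightarrow> S \<in> bounded_ops \<and> invariant_fun G (berezin S)"
proof (cases "S \<in> bounded_ops")
  case True
  have "op_motion g S = S \<longleftrightarrow> (\<forall>w. berezin S (motion_act (inv\<^bsub>motion_group\<^esub> g) w) = berezin S w)" if gG: "g \<in> G" for g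
  proof -
    have "g \<in> unitary_matrices \<times> UNIV" using G gG by (auto simp: motion_group_def)
    then obtain A z where g: "g = (A, z)" "A \<in> unitary_matrices" by blast
    have b: "berezin (op_motion g S) w = berezin S (motion_act (inv\<^bsub>motion_group\<^esub> g) w)" for w
      unfolding g(1) inv_motion_act[OF g(2)] by (rule berezin_op_motion[OF g(2) True])
    have "op_motion g S \<in> bounded_ops" unfolding g(1) by (rule op_motion_bounded_ops[OF g(2) True])
    then have "op_motion g S = S \<longleftrightarrow> (\<forall>w. berezin (op_motion g S) w = berezin S w)"
      using berezin_inj[OF _ True] by metis
    then show ?thesis unfolding b .
  qed
  then show ?thesis using True by (auto simp: Hom_ops_def invariant_fun_def)
qed (simp add: Hom_ops_def)

section \<open>Square integrability of the matrix coefficients of translations\<close>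

lemma ennreal_le_of_square_le:
  fixes x :: ennreal
  assumes "x\<^sup>2 \<le> ennreal (a\<^sup>2)" "0 \<le> a"
  shows "x \<le> ennreal a"
proof (cases x rule: ennreal_cases)
  case (real r)
  then have "r\<^sup>2 \<le> a\<^sup>2" using assms by (simp add: ennreal_power)
  then have "r \<le> a" using assms(2) by (rule power2_le_imp_le)
  then show ?thesis unfolding real(2) by (rule ennreal_leI)
next
  case top
  have "x\<^sup>2 = \<top>" unfolding top power2_eq_square by (simp add: ennreal_top_mult)
  then show ?thesis using assms(1) by (simp add: top_unique)
qed

lemma nn_integral_cauchy_schwarz:
  fixes f g :: "'a \<Rightarrow> complex"
  assumes [measurable]: "f \<in> borel_measurable M" "g \<in> borel_measurable M"
    and f: "(\<integral>\<^sup>+x. ennreal ((cmod (f x))\<^sup>2) \<partial>M) \<le> ennreal (a\<^sup>2)"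
    and g: "(\<integral>\<^sup>+x. ennreal ((cmod (g x))\<^sup>2) \<partial>M) \<le> ennreal (b\<^sup>2)"
    and "0 \<le> a" "0 \<le> b"
  shows "(\<integral>\<^sup>+x. ennreal (cmod (f x * g x)) \<partial>M) \<le> ennreal (a * b)"
proof (rule ennreal_le_of_square_le)
  have "(\<integral>\<^sup>+x. ennreal (cmod (f x * g x)) \<partial>M)\<^sup>2 = (\<integral>\<^sup>+x. ennreal (cmod (f x)) * ennreal (cmod (g x)) \<partial>M)\<^sup>2"
    by (simp add: norm_mult ennreal_mult)
  also have "\<dots> \<le> (\<integral>\<^sup>+x. (ennreal (cmod (f x)))\<^sup>2 \<partial>M) * (\<integral>\<^sup>+x. (ennreal (cmod (g x)))\<^sup>2 \<partial>M)"
    by (rule Cauchy_Schwarz_nn_integral) measurable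
  also have "\<dots> \<le> ennreal (a\<^sup>2) * ennreal (b\<^sup>2)"
    using f g by (intro mult_mono) (simp_all add: ennreal_power)
  also have "\<dots> = ennreal ((a * b)\<^sup>2)" by (simp add: ennreal_mult power_mult_distrib)
  finally show "(\<integral>\<^sup>+x. ennreal (cmod (f x * g x)) \<partial>M)\<^sup>2 \<le> ennreal ((a * b)\<^sup>2)" .
qed (use assms in simp)

lemma weyl_bounded_ops: "weyl z \<in> bounded_ops"
  unfolding weyl_conv_motion by (rule fock_fun_motion(3)[OF mat_1_unitary])

lemma norm_weyl_apply: "norm (blinfun_apply (weyl z) f) = norm f"
proof -
  have "cinner (weyl z f) (weyl z f) = cinner f f"
    unfolding weyl_conv_motion by (rule fock_fun_motion(2)[OF mat_1_unitary])
  then show ?thesis unfolding cinner_self_norm of_real_eq_iff by (rule power2_eq_imp_eq) simp_all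
qed

lemma borel_measurable_weyl_coefficient [measurable]:
  "(\<lambda>z. cinner (blinfun_apply (weyl z) u) g) \<in> borel_measurable borel"
proof -
  define F where "F z w = exp (- pi * (norm w)\<^sup>2) *\<^sub>R (kern z w * fock_fun u (w - z) * cnj (fock_fun g w))" for z w
  have cont: "continuous_on UNIV (fock_fun h)" for h :: "'a fock" by (rule entire_continuous[OF fock_fun_entire])
  have comp: "continuous_on UNIV (\<lambda>p. fock_fun u (snd p - fst p))" "continuous_on UNIV (\<lambda>p :: _ \<times> _. fock_fun g (snd p))"
    by (rule continuous_on_compose2[OF cont]; auto intro!: continuous_intros)+
  have "continuous_on UNIV (\<lambda>(z, w). F z w)"
    unfolding F_def kern_hip case_prod_unfold by (intro continuous_intros comp)
  then have "(\<lambda>(z, w). F z w) \<in> borel_measurable borel" by (rule borel_measurable_continuous_onI)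
  then have "(\<lambda>(z, w). F z w) \<in> borel_measurable (borel \<Otimes>\<^sub>M lborel)"
    by (simp add: borel_prod[symmetric] cong: measurable_cong_sets)
  from lborel.borel_measurable_lebesgue_integral[OF this] show ?thesis
    by (simp add: cinner_lborel fock_fun_weyl F_def[abs_def] mult.assoc)
qed

text \<open>Complex multiples are included because \<open>span\<close> is taken over the
  reals.\<close>

definition rkern_multiples :: "'n::finite fock set" where
  "rkern_multiples = {scaleC c (rkern a) |c a. True}"

lemma rkern_span_dense: "closure (span rkern_multiples) = (UNIV :: 'n::finite fock set)"
proof (rule UNIV_eq_I[symmetric])
  fix f :: "'n fock"
  have sub: "subspace (closure (span rkern_multiples :: 'n fock set))" by (rule subspace_closure[OF subspace_span])
  obtain p where p: "p \<in> closure (span rkern_multiples)" "\<And>y. y \<in> closure (span rkern_multiples) \<Longrightarrow> inner (f - p) y = 0"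
    using closed_subspace_projection[OF sub closed_closure] by metis
  have "fock_fun (f - p) a = 0" for a
  proof -
    have "scaleC c (rkern a) \<in> span rkern_multiples" for c
      by (rule span_base) (auto simp: rkern_multiples_def)
    then have 0: "inner (f - p) (scaleC c (rkern a)) = 0" for c using p(2) closure_subset by blast
    show ?thesis
      unfolding cinner_rkern[symmetric] cinner_conv_inner using 0[of 1] 0[of \<i>]
      by (simp add: scaleC_simps(6) complex_eq_iff)
  qed
  then have "f - p = 0" by (intro fock_eqI) (simp add: fock_fun_zero)
  then show "f \<in> closure (span rkern_multiples)" using p(1) by simp
qed

text \<open>The orthogonality relation for matrix coefficients of the Weyl operators, also known as
  Moyal's identity. As a predicate in four vectors it can be extended from kernels to their span one
  slot at a time.\<close>

definition moyal :: "'n::finite fock \<Rightarrow> 'n fock \<Rightarrow> 'n fock \<Rightarrow> 'n fock \<Rightarrow> bool" where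
  "moyal u u' g g' \<longleftrightarrow> has_bochner_integral lborel
     (\<lambda>z. cinner (blinfun_apply (weyl z) u) g * cnj (cinner (blinfun_apply (weyl z) u') g'))
     (cinner u u' * cinner g' g)"

text \<open>For kernels the integrand is the Gaussian weight times one kernel and one conjugate
  kernel in \<open>z\<close>, so the integral is evaluated by the reproducing property. The constant
  \<open>K\<close> collects what does not depend on \<open>z\<close>.\<close>

lemma moyal_rkern: "moyal (rkern a) (rkern b) (rkern c) (rkern d)"
proof -
  define K where "K = exp (complex_of_real pi * (hip a c + hip d b))"
  have w: "cinner (weyl z (rkern x)) (rkern y) = exp (complex_of_real pi * (hip z y - hip z z / 2 + hip x y - hip x z))" for x y z
    unfolding cinner_rkern fock_fun_weyl kern_exp fock_fun_rkern exp_add[symmetric]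
    by (simp add: hip_simps algebra_simps)
  have eq: "cinner (weyl z (rkern a)) (rkern c) * cnj (cinner (weyl z (rkern b)) (rkern d))
      = K * (exp (- pi * (norm z)\<^sup>2) *\<^sub>R (fock_fun (rkern (d - a)) z * cnj (fock_fun (rkern (c - b)) z)))" for z
  proof -
    have "cinner (weyl z (rkern a)) (rkern c) * cnj (cinner (weyl z (rkern b)) (rkern d))
        = exp (complex_of_real pi * (hip z c - hip z z / 2 + hip a c - hip a z) + complex_of_real pi * (hip d z - hip z z / 2 + hip d b - hip z b))"
      unfolding w exp_cnj exp_add by (simp add: cnj_hip_self hip_commute[symmetric])
    also have "\<dots> = exp (complex_of_real pi * (hip a c + hip d b) + (- complex_of_real pi * hip z z + (complex_of_real pi * hip (d - a) z + complex_of_real pi * hip z (c - b))))"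
      by (simp add: hip_simps algebra_simps)
    also have "\<dots> = K * (complex_of_real (exp (- pi * (norm z)\<^sup>2)) * (exp (complex_of_real pi * hip (d - a) z) * cnj (exp (complex_of_real pi * hip (c - b) z))))"
      unfolding K_def of_real_exp_norm exp_cnj exp_add by (simp add: hip_commute[symmetric])
    finally show ?thesis by (simp add: fock_fun_rkern scaleR_conv_of_real)
  qed
  have "has_bochner_integral lborel (\<lambda>z. exp (- pi * (norm z)\<^sup>2) *\<^sub>R (fock_fun (rkern (d - a)) z * cnj (fock_fun (rkern (c - b)) z)))
      (cinner (rkern (d - a)) (rkern (c - b)))"
    using cinner_integrable[of "rkern (d - a)" "rkern (c - b)"]
    by (subst (asm) integrable_gauss_measure_iff) (auto simp: has_bochner_integral_iff cinner_lborel)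
  from has_bochner_integral_mult_right[OF this, of K]
  have "has_bochner_integral lborel (\<lambda>z. cinner (weyl z (rkern a)) (rkern c) * cnj (cinner (weyl z (rkern b)) (rkern d)))
      (K * cinner (rkern (d - a)) (rkern (c - b)))"
    unfolding eq by simp
  moreover have "K * cinner (rkern (d - a)) (rkern (c - b)) = cinner (rkern a) (rkern b) * cinner (rkern d) (rkern c)"
    unfolding cinner_rkern fock_fun_rkern K_def exp_add[symmetric] by (simp add: hip_simps algebra_simps)
  ultimately show ?thesis by (simp add: moyal_def)
qed

lemma moyal_scaleC:
  assumes "moyal u u' g g'"
  shows "moyal (scaleC a u) (scaleC b u') (scaleC c g) (scaleC d g')"
  using has_bochner_integral_mult_right[OF assms[unfolded moyal_def], of "a * cnj b * cnj c * d"]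
  by (simp add: moyal_def bounded_opsD[OF weyl_bounded_ops] cinner_simps mult_ac)

lemma moyal_subspace:
  "subspace {u. moyal u u' g g'}" "subspace {u'. moyal u u' g g'}"
  "subspace {g. moyal u u' g g'}" "subspace {g'. moyal u u' g g'}"
proof -
  have 0: "moyal 0 u' g g'" "moyal u 0 g g'" "moyal u u' 0 g'" "moyal u u' g 0" for u u' g g' :: "'a fock"
    by (simp_all add: moyal_def cinner_simps blinfun.zero_right has_bochner_integral_zero)
  have add: "moyal x u' g g' \<Longrightarrow> moyal y u' g g' \<Longrightarrow> moyal (x + y) u' g g'"
    "moyal u x g g' \<Longrightarrow> moyal u y g g' \<Longrightarrow> moyal u (x + y) g g'"
    "moyal u u' x g' \<Longrightarrow> moyal u u' y g' \<Longrightarrow> moyal u u' (x + y) g'"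
    "moyal u u' g x \<Longrightarrow> moyal u u' g y \<Longrightarrow> moyal u u' g (x + y)" for x y u u' g g' :: "'a fock"
    unfolding moyal_def by (drule (1) has_bochner_integral_add, simp add: blinfun.add_right cinner_simps algebra_simps)+
  have scale: "moyal x u' g g' \<Longrightarrow> moyal (r *\<^sub>R x) u' g g'" "moyal u x g g' \<Longrightarrow> moyal u (r *\<^sub>R x) g g'"
    "moyal u u' x g' \<Longrightarrow> moyal u u' (r *\<^sub>R x) g'" "moyal u u' g x \<Longrightarrow> moyal u u' g (r *\<^sub>R x)"
    for r x u u' g g' using moyal_scaleC[of x u' g g' "of_real r" 1 1 1] moyal_scaleC[of u x g g' 1 "of_real r" 1 1]
      moyal_scaleC[of u u' x g' 1 1 "of_real r" 1] moyal_scaleC[of u u' g x 1 1 1 "of_real r"]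
    by (simp_all add: scaleC_simps)
  show "subspace {u. moyal u u' g g'}" "subspace {u'. moyal u u' g g'}"
    "subspace {g. moyal u u' g g'}" "subspace {g'. moyal u u' g g'}"
    by (simp_all add: subspace_def 0 add scale)
qed

lemma moyal_span:
  assumes "u \<in> span rkern_multiples" "u' \<in> span rkern_multiples" "g \<in> span rkern_multiples" "g' \<in> span rkern_multiples"
  shows "moyal u u' g g'"
proof -
  have 1: "moyal u u' g g'" if "u \<in> rkern_multiples" "u' \<in> rkern_multiples" "g \<in> rkern_multiples" "g' \<in> rkern_multiples"
    for u u' g g' :: "'a fock"
    using that moyal_scaleC[OF moyal_rkern] by (auto simp: rkern_multiples_def)
  have 2: "moyal u u' g g'" if "u \<in> span rkern_multiples" "u' \<in> rkern_multiples" "g \<in> rkern_multiples" "g' \<in> rkern_multiples"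
    for u u' g g' :: "'a fock"
    by (rule span_induct[OF that(1) moyal_subspace(1)]) (rule 1[OF _ that(2-4)])
  have 3: "moyal u u' g g'" if "u \<in> span rkern_multiples" "u' \<in> span rkern_multiples" "g \<in> rkern_multiples" "g' \<in> rkern_multiples"
    for u u' g g' :: "'a fock"
    by (rule span_induct[OF that(2) moyal_subspace(2)]) (rule 2[OF that(1) _ that(3,4)])
  have 4: "moyal u u' g g'" if "u \<in> span rkern_multiples" "u' \<in> span rkern_multiples" "g \<in> span rkern_multiples" "g' \<in> rkern_multiples"
    for u u' g g' :: "'a fock"
    by (rule span_induct[OF that(3) moyal_subspace(3)]) (rule 3[OF that(1,2) _ that(4)])
  show ?thesis
    by (rule span_induct[OF assms(4) moyal_subspace(4)]) (rule 4[OF assms(1-3)])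
qed

text \<open>Approximation by the span of the kernels and Fatou's lemma carry the identity to
  arbitrary vectors in the form of an inequality.\<close>

lemma moyal_le:
  "(\<integral>\<^sup>+z. ennreal ((cmod (cinner (blinfun_apply (weyl z) u) g))\<^sup>2) \<partial>lborel) \<le> ennreal ((norm u * norm g)\<^sup>2)"
proof -
  have dense: "\<exists>s. (\<forall>n::nat. s n \<in> span rkern_multiples) \<and> s \<longlonglongrightarrow> h" for h :: "'a fock"
    using rkern_span_dense closure_sequential[of h "span rkern_multiples"] by auto
  obtain s where s: "\<And>n. s n \<in> span rkern_multiples" "s \<longlonglongrightarrow> u" using dense by metis
  obtain t where t: "\<And>n. t n \<in> span rkern_multiples" "t \<longlonglongrightarrow> g" using dense by metis
  have span_eq: "(\<integral>\<^sup>+z. ennreal ((cmod (cinner (weyl z (s n)) (t n)))\<^sup>2) \<partial>lborel) = ennreal ((norm (s n) * norm (t n))\<^sup>2)" for n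
  proof -
    have "has_bochner_integral lborel (\<lambda>z. complex_of_real ((cmod (cinner (weyl z (s n)) (t n)))\<^sup>2))
        (complex_of_real ((norm (s n) * norm (t n))\<^sup>2))"
      using moyal_span[OF s(1)[of n] s(1)[of n] t(1)[of n] t(1)[of n]]
      unfolding moyal_def complex_norm_square[symmetric] cinner_self_norm by (simp add: power_mult_distrib)
    then have i: "integrable lborel (\<lambda>z. (cmod (cinner (weyl z (s n)) (t n)))\<^sup>2)"
      "(\<integral>z. (cmod (cinner (weyl z (s n)) (t n)))\<^sup>2 \<partial>lborel) = (norm (s n) * norm (t n))\<^sup>2"
      unfolding has_bochner_integral_iff complex_of_real_integrable_eq integral_complex_of_real of_real_eq_iff by auto
    show ?thesis using nn_integral_eq_integral[OF i(1)] i(2) by simp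
  qed
  have "(\<integral>\<^sup>+z. ennreal ((cmod (cinner (weyl z u) g))\<^sup>2) \<partial>lborel)
      = (\<integral>\<^sup>+z. liminf (\<lambda>n. ennreal ((cmod (cinner (weyl z (s n)) (t n)))\<^sup>2)) \<partial>lborel)"
  proof (rule nn_integral_cong)
    fix z
    have "(\<lambda>n. ennreal ((cmod (cinner (weyl z (s n)) (t n)))\<^sup>2)) \<longlonglongrightarrow> ennreal ((cmod (cinner (weyl z u) g))\<^sup>2)"
      by (intro tendsto_intros tendsto_cinner blinfun.tendsto tendsto_ennrealI s t)
    then show "ennreal ((cmod (cinner (weyl z u) g))\<^sup>2) = liminf (\<lambda>n. ennreal ((cmod (cinner (weyl z (s n)) (t n)))\<^sup>2))"
      using lim_imp_Liminf[OF trivial_limit_sequentially] by metis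
  qed
  also have "\<dots> \<le> liminf (\<lambda>n. \<integral>\<^sup>+z. ennreal ((cmod (cinner (weyl z (s n)) (t n)))\<^sup>2) \<partial>lborel)"
    by (rule nn_integral_liminf) measurable
  also have "\<dots> = liminf (\<lambda>n. ennreal ((norm (s n) * norm (t n))\<^sup>2))" by (simp only: span_eq)
  also have "\<dots> = ennreal ((norm u * norm g)\<^sup>2)"
    by (rule lim_imp_Liminf) (simp, intro tendsto_ennrealI tendsto_intros s t)
  finally show ?thesis .
qed

lemma weyl_coefficients_product:
  "integrable lborel (\<lambda>z. cinner f (blinfun_apply (weyl z) v) * cinner (blinfun_apply (weyl z) u) g)"
  "(\<integral>z. cmod (cinner f (blinfun_apply (weyl z) v) * cinner (blinfun_apply (weyl z) u) g) \<partial>lborel)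
     \<le> norm u * norm v * (norm f * norm g)"
proof -
  have [measurable]: "(\<lambda>z. cinner f (weyl z v)) \<in> borel_measurable borel"
    unfolding cinner_commute[of f] by measurable
  have "(\<integral>\<^sup>+z. ennreal (cmod (cinner f (weyl z v) * cinner (weyl z u) g)) \<partial>lborel)
      \<le> ennreal ((norm v * norm f) * (norm u * norm g))"
    using moyal_le[of v f] moyal_le[of u g]
    by (intro nn_integral_cauchy_schwarz) (simp_all add: cinner_commute[of f])
  then have le: "(\<integral>\<^sup>+z. ennreal (cmod (cinner f (weyl z v) * cinner (weyl z u) g)) \<partial>lborel)
      \<le> ennreal (norm u * norm v * (norm f * norm g))"
    by (simp add: mult_ac)
  then show i: "integrable lborel (\<lambda>z. cinner f (weyl z v) * cinner (weyl z u) g)"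
    by (intro integrableI_bounded) (auto intro: le_less_trans)
  show "(\<integral>z. cmod (cinner f (weyl z v) * cinner (weyl z u) g) \<partial>lborel)
     \<le> norm u * norm v * (norm f * norm g)"
    using le nn_integral_eq_integral[OF integrable_norm[OF i]] by simp
qed

section \<open>Weakly defined operators\<close>

text \<open>Riesz representation applies to the real part of the form; sesquilinearity recovers the
  imaginary part by replacing \<open>g\<close> with \<open>scaleC \<i> g\<close>.\<close>

lemma weak_operator_exists:
  fixes B :: "'n::finite fock \<Rightarrow> 'n fock \<Rightarrow> complex"
  assumes add: "\<And>f f' g. B (f + f') g = B f g + B f' g" "\<And>f g g'. B f (g + g') = B f g + B f g'"
    and scale: "\<And>c f g. B (scaleC c f) g = c * B f g" "\<And>c f g. B f (scaleC c g) = cnj c * B f g"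
    and bound: "\<And>f g. cmod (B f g) \<le> K * (norm f * norm g)"
  shows "\<exists>R\<in>bounded_ops. \<forall>f g. cinner (blinfun_apply R f) g = B f g"
proof -
  have "\<exists>y. \<forall>g. Re (B f g) = inner g y" for f
  proof (rule riesz_representation, rule bounded_linear_intro[where K = "K * norm f"])
    fix g g' :: "'n fock" and r :: real
    show "Re (B f (g + g')) = Re (B f g) + Re (B f g')" by (simp add: add)
    show "Re (B f (r *\<^sub>R g)) = r *\<^sub>R Re (B f g)"
      unfolding scaleR_fock_def by (simp add: scale)
    show "norm (Re (B f g)) \<le> norm g * (K * norm f)"
      using order_trans[OF abs_Re_le_cmod bound] by (simp add: mult_ac)
  qed
  then obtain R where R: "\<And>f g. Re (B f g) = inner g (R f)" by metis
  have RB: "cinner (R f) g = B f g" for f g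
  proof -
    have "inner (R f) g = Re (B f g)" for g by (simp add: R inner_commute)
    then show ?thesis unfolding cinner_conv_inner by (simp add: scale complex_eq_iff)
  qed
  have lin: "R (f + f') = R f + R f'" "R (scaleC c f) = scaleC c (R f)" for f f' c
    by (rule cinner_eqI, simp add: RB add scale cinner_simps)+
  have "bounded_linear R"
  proof (rule bounded_linear_intro[where K = K])
    show "R (r *\<^sub>R f) = r *\<^sub>R R f" for r f by (simp add: scaleR_fock_def lin)
    fix f
    have "norm (R f) * norm (R f) = cmod (cinner (R f) (R f))"
      by (simp add: cinner_self_norm power2_eq_square norm_mult)
    also have "\<dots> \<le> K * (norm f * norm (R f))" unfolding RB by (rule bound)
    finally have "norm (R f) * norm (R f) \<le> (norm f * K) * norm (R f)" by (simp add: mult_ac)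
    then show "norm (R f) \<le> norm f * K"
    proof (cases "R f = 0")
      case True
      \<comment> \<open>The sign of \<open>K\<close> is extracted from the bound itself, which
        forces \<open>0 \<le> K\<close> unless \<open>f = 0\<close>.\<close>
      have "0 \<le> K * (norm f * norm f)" using order_trans[OF norm_ge_zero bound[of f f]] .
      then have "f = 0 \<or> 0 \<le> K"
        using mult_neg_pos[of K "norm f * norm f"] by (metis mult_pos_pos not_le zero_less_norm_iff)
      then show ?thesis using True by auto
    qed simp
  qed (rule lin(1))
  then have "blinfun_apply (Blinfun R) = R" by (rule bounded_linear_Blinfun_apply)
  then show ?thesis using lin RB by (intro bexI[of _ "Blinfun R"]) (auto simp: bounded_ops_def)
qed

lemma norm_op_le:
  assumes "\<And>f g. cmod (cinner (blinfun_apply R f) g) \<le> K * (norm f * norm g)" "0 \<le> K"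
  shows "norm R \<le> K"
proof (rule norm_blinfun_bound[OF assms(2)])
  fix f
  have "norm (R f) * norm (R f) = cmod (cinner (R f) (R f))"
    by (simp add: cinner_self_norm power2_eq_square norm_mult)
  also have "\<dots> \<le> K * (norm f * norm (R f))" by (rule assms(1))
  finally have "norm (R f) * norm (R f) \<le> (K * norm f) * norm (R f)" by (simp add: mult_ac)
  then show "norm (R f) \<le> K * norm f" using assms(2) by (cases "R f = 0") auto
qed

lemma op_eqI: "(\<And>f g. cinner (blinfun_apply R f) g = cinner (blinfun_apply S f) g) \<Longrightarrow> R = S"
  by (intro blinfun_eqI cinner_eqI)

lemma weak_integral_exists:
  fixes T :: "'a \<Rightarrow> 'n::finite op"
  assumes T: "\<And>z. T z \<in> bounded_ops"
    and int: "\<And>f g. integrable M (\<lambda>z. cinner (blinfun_apply (T z) f) g * \<psi> z)"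
    and bound: "\<And>f g. cmod (\<integral>z. cinner (blinfun_apply (T z) f) g * \<psi> z \<partial>M) \<le> K * (norm f * norm g)"
  shows "\<exists>R\<in>bounded_ops. \<forall>f g. cinner (blinfun_apply R f) g = (\<integral>z. cinner (blinfun_apply (T z) f) g * \<psi> z \<partial>M)"
proof (rule weak_operator_exists[OF _ _ _ _ bound])
  fix f f' g g' :: "'n fock" and c :: complex
  show "(\<integral>z. cinner (T z (f + f')) g * \<psi> z \<partial>M) = (\<integral>z. cinner (T z f) g * \<psi> z \<partial>M) + (\<integral>z. cinner (T z f') g * \<psi> z \<partial>M)"
    by (simp add: blinfun.add_right cinner_simps distrib_right int)
  show "(\<integral>z. cinner (T z f) (g + g') * \<psi> z \<partial>M) = (\<integral>z. cinner (T z f) g * \<psi> z \<partial>M) + (\<integral>z. cinner (T z f) g' * \<psi> z \<partial>M)"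
    by (simp add: cinner_simps distrib_right int)
  show "(\<integral>z. cinner (T z (scaleC c f)) g * \<psi> z \<partial>M) = c * (\<integral>z. cinner (T z f) g * \<psi> z \<partial>M)"
    by (simp add: bounded_opsD[OF T] cinner_simps mult.assoc)
  show "(\<integral>z. cinner (T z f) (scaleC c g) * \<psi> z \<partial>M) = cnj c * (\<integral>z. cinner (T z f) g * \<psi> z \<partial>M)"
    by (simp add: cinner_simps mult.assoc)
qed

section \<open>Convolutions and Toeplitz operators\<close>

text \<open>Termwise integration under a summable bound on the L1 norms. The last conclusion is the
  source of the estimates by \<open>\<Sum>n. norm (u n) * norm (v n)\<close>.\<close>

lemma integral_sums:
  fixes f :: "nat \<Rightarrow> 'a \<Rightarrow> complex"
  assumes int: "\<And>n. integrable M (f n)" and le: "\<And>n. (\<integral>x. norm (f n x) \<partial>M) \<le> d n" and d: "summable d"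
    and pt: "\<And>x. summable (\<lambda>n. norm (f n x))" and F: "\<And>x. (\<lambda>n. f n x) sums F x"
  shows "integrable M F" "(\<lambda>n. integral\<^sup>L M (f n)) sums integral\<^sup>L M F" "norm (integral\<^sup>L M F) \<le> suminf d"
proof -
  have sm: "summable (\<lambda>n. \<integral>x. norm (f n x) \<partial>M)"
    by (rule summable_comparison_test'[OF d, of 0]) (use le in \<open>simp add: integral_nonneg_AE\<close>)
  have eq: "(\<lambda>x. \<Sum>n. f n x) = F" using F by (auto simp: sums_iff)
  show "integrable M F"
    using integrable_suminf[OF int AE_I2[OF pt] sm] unfolding eq .
  show s: "(\<lambda>n. integral\<^sup>L M (f n)) sums integral\<^sup>L M F"
    using sums_integral[OF int AE_I2[OF pt] sm] unfolding eq .
  have le': "norm (integral\<^sup>L M (f n)) \<le> d n" for n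
    using order_trans[OF integral_norm_bound le] .
  have sm': "summable (\<lambda>n. norm (integral\<^sup>L M (f n)))"
    by (rule summable_comparison_test'[OF d, of 0]) (use le' in simp)
  have "norm (integral\<^sup>L M F) \<le> (\<Sum>n. norm (integral\<^sup>L M (f n)))"
    unfolding sums_unique[OF s] by (rule summable_norm[OF sm'])
  also have "\<dots> \<le> suminf d" by (rule suminf_le[OF le' sm' d])
  finally show "norm (integral\<^sup>L M F) \<le> suminf d" .
qed

lemma op_translate_sums:
  assumes "nuclear_rep \<Psi> u v"
  shows "(\<lambda>n. cinner f (blinfun_apply (weyl z) (v n)) * cinner (blinfun_apply (weyl z) (u n)) g)
    sums cinner (blinfun_apply (op_translate z \<Psi>) f) g"
  using nuclear_rep_cinner_sums[OF assms, of "op_adjoint (weyl z) f" "op_adjoint (weyl z) g"]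
  by (simp add: op_translate_props(4) cinner_op_adjoint'[OF weyl_bounded_ops] cinner_op_adjoint[OF weyl_bounded_ops, symmetric])

text \<open>Each rank one term of the translated operator is a product of two Weyl coefficients,
  whose L1 norm is bounded by the square integrability above. Summation over the nuclear
  representation gives integrability over the whole space.\<close>

lemma nuclear_translate_integral:
  fixes a :: "complex^'n::finite \<Rightarrow> complex"
  assumes \<Psi>: "nuclear_rep \<Psi> u v" and a: "a \<in> borel_measurable borel" "\<And>z. cmod (a z) \<le> C"
  shows "integrable lborel (\<lambda>z. cinner (blinfun_apply (op_translate z \<Psi>) f) g * a z)"
    and "(\<integral>z. cmod (cinner (blinfun_apply (op_translate z \<Psi>) f) g * a z) \<partial>lborel)
      \<le> C * (\<Sum>n. norm (u n) * norm (v n)) * (norm f * norm g)"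
proof -
  define c where "c n z = cinner f (weyl z (v n)) * cinner (weyl z (u n)) g" for n z
  define T where "T z = cinner (op_translate z \<Psi> f) g" for z
  have C: "0 \<le> C" using order_trans[OF norm_ge_zero a(2)] .
  note sm = nuclear_repD(1)[OF \<Psi>]
  have c: "integrable lborel (c n)" "(\<integral>z. norm (c n z) \<partial>lborel) \<le> norm (u n) * norm (v n) * (norm f * norm g)" for n
    unfolding c_def using weyl_coefficients_product by blast+
  have pt: "summable (\<lambda>n. norm (c n z))" for z
  proof (rule summable_comparison_test'[OF summable_mult[OF sm, of "norm f * norm g"], of 0])
    fix n
    have "norm (c n z) \<le> (norm f * norm (weyl z (v n))) * (norm (weyl z (u n)) * norm g)"
      unfolding c_def norm_mult by (intro mult_mono cinner_cauchy_schwarz) auto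
    then show "norm (norm (c n z)) \<le> norm f * norm g * (norm (u n) * norm (v n))"
      by (simp add: norm_weyl_apply mult_ac)
  qed
  have cT: "(\<lambda>n. c n z) sums T z" for z unfolding c_def T_def by (rule op_translate_sums[OF \<Psi>])
  have Ti: "integrable lborel T"
    by (rule integral_sums(1)[OF c summable_mult2[OF sm] pt cT])
  have "T \<in> borel_measurable borel" using borel_measurable_integrable[OF Ti] by simp
  with a(1) have [measurable]: "(\<lambda>z. T z * a z) \<in> borel_measurable borel" by measurable
  have le: "norm (T z * a z) \<le> C * norm (T z)" for z
    using mult_right_mono[OF a(2)[of z], of "norm (T z)"] by (simp add: norm_mult mult.commute)
  have i: "integrable lborel (\<lambda>z. T z * a z)"
    by (rule Bochner_Integration.integrable_bound[OF integrable_mult_right[OF integrable_norm[OF Ti], of C]])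
      (use le C in \<open>auto simp: norm_mult abs_mult\<close>)
  then show "integrable lborel (\<lambda>z. cinner (blinfun_apply (op_translate z \<Psi>) f) g * a z)"
    by (simp add: T_def)
  \<comment> \<open>A measurable factor of modulus at most 1 with
    \<open>s z * T z = \<bar>T z\<bar>\<close>. It turns the L1 norm of the series into the integral
    of a series, to which the termwise bound applies.\<close>
  define s where "s z = (if T z = 0 then 0 else cnj (T z) / cmod (T z))" for z
  have "(\<integral>z. norm (T z) \<partial>lborel) \<le> (\<Sum>n. norm (u n) * norm (v n)) * (norm f * norm g)"
  proof -
    have [measurable]: "s \<in> borel_measurable borel"
      using borel_measurable_integrable[OF Ti] unfolding s_def by measurable
    have s1: "norm (s z) \<le> 1" for z by (simp add: s_def norm_divide)
    have sT: "s z * T z = complex_of_real (norm (T z))" for z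
      by (simp add: s_def complex_norm_square[symmetric] mult.commute power2_eq_square)
    have si: "integrable lborel (\<lambda>z. s z * c n z)" for n
      by (rule Bochner_Integration.integrable_bound[OF c(1)[of n]])
        (use borel_measurable_integrable[OF c(1)] mult_right_mono[OF s1] in \<open>auto simp: norm_mult\<close>)
    have sle: "(\<integral>z. norm (s z * c n z) \<partial>lborel) \<le> norm (u n) * norm (v n) * (norm f * norm g)" for n
    proof -
      have "(\<integral>z. norm (s z * c n z) \<partial>lborel) \<le> (\<integral>z. norm (c n z) \<partial>lborel)"
        by (rule integral_mono[OF integrable_norm[OF si] integrable_norm[OF c(1)]])
          (use mult_right_mono[OF s1] in \<open>simp add: norm_mult\<close>)
      then show ?thesis using c(2) order_trans by blast
    qed
    have spt: "summable (\<lambda>n. norm (s z * c n z))" for z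
      unfolding norm_mult by (rule summable_mult[OF pt])
    have "norm (\<integral>z. s z * T z \<partial>lborel) \<le> (\<Sum>n. norm (u n) * norm (v n) * (norm f * norm g))"
      by (rule integral_sums(3)[OF si sle summable_mult2[OF sm] spt sums_mult[OF cT]])
    then show ?thesis
      unfolding sT by (simp add: suminf_mult2[OF sm] integral_nonneg_AE)
  qed
  then have "C * (\<integral>z. norm (T z) \<partial>lborel) \<le> C * ((\<Sum>n. norm (u n) * norm (v n)) * (norm f * norm g))"
    by (rule mult_left_mono[OF _ C])
  moreover have "(\<integral>z. norm (T z * a z) \<partial>lborel) \<le> (\<integral>z. C * norm (T z) \<partial>lborel)"
    by (rule integral_mono[OF integrable_norm[OF i] _ le]) (intro integrable_mult_right integrable_norm Ti)
  ultimately show "(\<integral>z. cmod (cinner (blinfun_apply (op_translate z \<Psi>) f) g * a z) \<partial>lborel)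
      \<le> C * (\<Sum>n. norm (u n) * norm (v n)) * (norm f * norm g)"
    by (simp add: T_def mult.assoc)
qed

lemma parity_parity_apply: "blinfun_apply parity_op (blinfun_apply parity_op f) = f"
  using arg_cong[OF parity_parity, of "\<lambda>T. blinfun_apply T f"] by simp

lemma parity_conj_twice: "parity_op o\<^sub>L (parity_op o\<^sub>L S o\<^sub>L parity_op) o\<^sub>L parity_op = S"
  by (rule blinfun_eqI) (simp add: parity_parity_apply)

lemma op_trace_compose:
  fixes A :: "'n::finite op"
  assumes A: "nuclear_rep A p q" and T: "T \<in> bounded_ops"
  shows "(\<lambda>m. cinner (blinfun_apply T (p m)) (q m)) sums op_trace (A o\<^sub>L T)"
    and "(\<lambda>m. cinner (blinfun_apply T (p m)) (q m)) sums op_trace (T o\<^sub>L A)"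
proof -
  show "(\<lambda>m. cinner (blinfun_apply T (p m)) (q m)) sums op_trace (T o\<^sub>L A)"
    by (rule nuclear_rep_trace(1)[OF nuclear_rep_compose_left[OF A T]])
  show "(\<lambda>m. cinner (blinfun_apply T (p m)) (q m)) sums op_trace (A o\<^sub>L T)"
    using nuclear_rep_trace(1)[OF nuclear_rep_compose_right[OF A T]]
    by (simp add: cinner_op_adjoint[OF T])
qed

text \<open>The weak integral of the translates is a candidate whose traces against \<open>A\<close>
  are computed termwise from a nuclear representation of \<open>A\<close>. Rank one \<open>A\<close>
  show that no other operator satisfies the duality, so the definite description yields the
  candidate.\<close>

lemma conv_tc_fun:
  fixes \<Psi> :: "'n::finite op" and a :: "complex^'n \<Rightarrow> complex"
  assumes \<Psi>: "nuclear_rep \<Psi> u v" and a: "a \<in> borel_measurable borel" "\<And>z. cmod (a z) \<le> C"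
  shows conv_tc_fun_bounded_ops: "conv_tc_fun \<Psi> a \<in> bounded_ops"
    and cinner_conv_tc_fun: "cinner (blinfun_apply (conv_tc_fun \<Psi> a) f) g =
      (\<integral>z. cinner (blinfun_apply (op_translate z \<Psi>) f) g * a z \<partial>lborel)"
    and norm_conv_tc_fun_le: "norm (conv_tc_fun \<Psi> a) \<le> C * (\<Sum>n. norm (u n) * norm (v n))"
proof -
  let ?K = "\<Sum>n. norm (u n) * norm (v n)"
  note ti = nuclear_translate_integral[OF \<Psi> a]
  have \<Psi>b: "\<Psi> \<in> bounded_ops" by (rule nuclear_rep_bounded_ops[OF \<Psi>])
  have tb: "op_translate z \<Psi> \<in> bounded_ops" for z by (rule op_translate_props(1)[OF \<Psi>b])
  have C: "0 \<le> C" using order_trans[OF norm_ge_zero a(2)] .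
  have K: "0 \<le> ?K" by (rule suminf_nonneg[OF nuclear_repD(1)[OF \<Psi>]]) simp
  have bound: "cmod (\<integral>z. cinner (op_translate z \<Psi> f) g * a z \<partial>lborel) \<le> C * ?K * (norm f * norm g)" for f g
    using order_trans[OF integral_norm_bound ti(2)] .
  obtain R where R: "R \<in> bounded_ops"
    "\<And>f g. cinner (blinfun_apply R f) g = (\<integral>z. cinner (op_translate z \<Psi> f) g * a z \<partial>lborel)"
    using weak_integral_exists[OF tb ti(1) bound] by blast
  have trace: "op_trace (R o\<^sub>L A) =
     (\<integral>z. a z * conv_op_op A (parity_op o\<^sub>L \<Psi> o\<^sub>L parity_op) z \<partial>lborel)" if A: "A \<in> trace_class" for A
  proof -
    obtain p q where pq: "nuclear_rep A p q" using trace_class_imp_nuclear[OF A] by blast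
    define f where "f m z = cinner (op_translate z \<Psi> (p m)) (q m) * a z" for m z
    \<comment> \<open>The parity conjugation in the definition and the one inside
      \<open>conv_op_op\<close> cancel, leaving the trace of \<open>A\<close> against the translate
      of \<open>\<Psi>\<close>.\<close>
    have conv: "(\<lambda>m. cinner (op_translate z \<Psi> (p m)) (q m)) sums conv_op_op A (parity_op o\<^sub>L \<Psi> o\<^sub>L parity_op) z" for z
      unfolding conv_op_op_def parity_conj_twice by (rule op_trace_compose(1)[OF pq tb])
    have sm: "summable (\<lambda>m. C * ?K * (norm (p m) * norm (q m)))"
      by (rule summable_mult[OF nuclear_repD(1)[OF pq]])
    have pt: "summable (\<lambda>m. norm (f m z))" for z
    proof (rule summable_comparison_test'[OF summable_mult[OF nuclear_repD(1)[OF pq], of "norm \<Psi> * C"], of 0])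
      fix m
      have "norm (f m z) \<le> (norm (op_translate z \<Psi> (p m)) * norm (q m)) * C"
        unfolding f_def norm_mult by (intro mult_mono cinner_cauchy_schwarz a(2)) auto
      also have "\<dots> \<le> ((norm \<Psi> * norm (p m)) * norm (q m)) * C"
        by (intro mult_right_mono C order_trans[OF norm_blinfun] op_translate_props(2)) auto
      finally show "norm (norm (f m z)) \<le> norm \<Psi> * C * (norm (p m) * norm (q m))" by (simp add: mult_ac)
    qed
    have "(\<lambda>m. \<integral>z. f m z \<partial>lborel) sums (\<integral>z. conv_op_op A (parity_op o\<^sub>L \<Psi> o\<^sub>L parity_op) z * a z \<partial>lborel)"
      by (rule integral_sums(2)[OF _ _ sm pt])
        (use ti sums_mult2[OF conv] in \<open>simp_all add: f_def\<close>)
    moreover have "(\<lambda>m. \<integral>z. f m z \<partial>lborel) sums op_trace (R o\<^sub>L A)"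
      using op_trace_compose(2)[OF pq R(1)] by (simp add: R(2) f_def)
    ultimately have "op_trace (R o\<^sub>L A) = (\<integral>z. conv_op_op A (parity_op o\<^sub>L \<Psi> o\<^sub>L parity_op) z * a z \<partial>lborel)"
      by (rule sums_unique2[rotated])
    then show ?thesis by (simp only: mult.commute)
  qed
  have "conv_tc_fun \<Psi> a = R"
    unfolding conv_tc_fun_def
  proof (rule the_equality)
    show "R \<in> bounded_ops \<and> (\<forall>A\<in>trace_class. op_trace (R o\<^sub>L A) =
       (\<integral>z. a z * conv_op_op A (parity_op o\<^sub>L \<Psi> o\<^sub>L parity_op) z \<partial>lborel))"
      using R(1) trace by blast
    fix R' assume R': "R' \<in> bounded_ops \<and> (\<forall>A\<in>trace_class. op_trace (R' o\<^sub>L A) =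
       (\<integral>z. a z * conv_op_op A (parity_op o\<^sub>L \<Psi> o\<^sub>L parity_op) z \<partial>lborel))"
    show "R' = R"
    proof (rule op_eqI)
      fix f g :: "'n fock"
      obtain A where A: "nuclear_rep A (\<lambda>n. if n = 0 then f else 0) (\<lambda>n. if n = 0 then g else 0)"
        using rank_one_exists by blast
      have "op_trace (X o\<^sub>L A) = cinner (X f) g" if "X \<in> bounded_ops" for X
      proof (rule sums_unique2[OF op_trace_compose(2)[OF A that]])
        show "(\<lambda>m. cinner (X (if m = 0 then f else 0)) (if m = 0 then g else 0)) sums cinner (X f) g"
          using sums_finite[of "{0}" "\<lambda>m. cinner (X (if m = 0 then f else 0)) (if m = 0 then g else 0)"]
          by (simp add: cinner_simps)
      qed
      then show "cinner (R' f) g = cinner (R f) g"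
        using R' R(1) trace nuclear_imp_trace_class[OF A] by metis
    qed
  qed
  then show "conv_tc_fun \<Psi> a \<in> bounded_ops"
    "cinner (blinfun_apply (conv_tc_fun \<Psi> a) f) g = (\<integral>z. cinner (op_translate z \<Psi> f) g * a z \<partial>lborel)"
    using R by auto
  show "norm (conv_tc_fun \<Psi> a) \<le> C * ?K"
    unfolding \<open>conv_tc_fun \<Psi> a = R\<close> by (rule norm_op_le) (use bound R(2) C K in auto)
qed

lemma berezin_conv_tc_fun:
  assumes \<Psi>: "nuclear_rep \<Psi> u v" and a: "a \<in> borel_measurable borel" "\<And>z. cmod (a z) \<le> C"
  shows "berezin (conv_tc_fun \<Psi> a) w = conv_fun_fun (berezin \<Psi>) a w"
proof -
  have "berezin (conv_tc_fun \<Psi> a) w = (\<integral>z. berezin \<Psi> (w - z) * a z \<partial>lborel)"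
    unfolding berezin_op_translate[OF nuclear_rep_bounded_ops[OF \<Psi>], symmetric]
    unfolding berezin_def cinner_conv_tc_fun[OF \<Psi> a] ..
  also have "\<dots> = (\<integral>z. berezin \<Psi> (w - (w - z)) * a (w - z) \<partial>lborel)"
    by (rule lborel_integral_translate(3)[symmetric])
  finally show ?thesis by (simp add: conv_fun_fun_def mult.commute)
qed

text \<open>The case \<open>a = 1\<close> and \<open>f = g = coh 0\<close> of the translate
  integral: the matrix coefficient of the translate at the vacuum is the Berezin transform at
  \<open>- z\<close>.\<close>

lemma berezin_integrable:
  assumes \<Psi>: "nuclear_rep \<Psi> u v"
  shows "integrable lborel (berezin \<Psi>)"
    and "(\<integral>z. cmod (berezin \<Psi> z) \<partial>lborel) \<le> (\<Sum>n. norm (u n) * norm (v n))"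
proof -
  note \<Psi>b = nuclear_rep_bounded_ops[OF \<Psi>]
  have eq: "cinner (op_translate z \<Psi> (coh 0)) (coh 0) * 1 = berezin \<Psi> (0 - z)" for z
  proof -
    have "cinner (op_translate z \<Psi> (coh 0)) (coh 0) * 1 = berezin (op_translate z \<Psi>) 0"
      by (simp only: berezin_def mult_1_right)
    also have "\<dots> = berezin \<Psi> (0 - z)" by (rule berezin_op_translate[OF \<Psi>b])
    finally show ?thesis .
  qed
  have m: "(\<lambda>_. 1 :: complex) \<in> borel_measurable borel" "cmod 1 \<le> 1" by auto
  note t = nuclear_translate_integral[OF \<Psi> m, of "coh 0" "coh 0", unfolded eq norm_coh]
  show "integrable lborel (berezin \<Psi>)"
    using t(1) unfolding lborel_integrable_translate(3) .
  show "(\<integral>z. cmod (berezin \<Psi> z) \<partial>lborel) \<le> (\<Sum>n. norm (u n) * norm (v n))"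
    using t(2) unfolding lborel_integral_translate(3)[of "\<lambda>z. cmod (berezin \<Psi> z)"] by simp
qed

section \<open>Uniformly continuous operators and their convolution with functions\<close>

lemma Cbu_opD:
  assumes "S \<in> Cbu_op"
  shows "S \<in> bounded_ops" "continuous_on UNIV (\<lambda>z. op_translate z S)"
  using assms by (auto simp: Cbu_op_def)

lemma op_translate_Lipschitz: "norm (op_translate z S - op_translate z T) \<le> norm (S - T)"
  unfolding op_translate_linear(2)[symmetric] by (rule op_translate_props(2))

text \<open>Translations act by contractions and compose additively, so continuity at the origin
  spreads to every point.\<close>

lemma Cbu_op_iff:
  "S \<in> Cbu_op \<longleftrightarrow> S \<in> bounded_ops \<and> ((\<lambda>z. op_translate z S) \<longlongrightarrow> S) (at 0)"
proof safe
  assume S: "S \<in> Cbu_op"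
  then show "S \<in> bounded_ops" by (rule Cbu_opD)
  then show "((\<lambda>z. op_translate z S) \<longlongrightarrow> S) (at 0)"
    using Cbu_opD(2)[OF S] op_translate_0[of S]
    unfolding continuous_on_eq_continuous_at[OF open_UNIV] isCont_def by (metis UNIV_I)
next
  assume S: "S \<in> bounded_ops" and lim: "((\<lambda>z. op_translate z S) \<longlongrightarrow> S) (at 0)"
  have "isCont (\<lambda>z. op_translate z S) w" for w
    unfolding isCont_def
  proof (rule LIM_offset_zero_cancel, rule LIM_zero_cancel, rule Lim_null_comparison)
    have "op_translate (w + h) S - op_translate w S = op_translate w (op_translate h S) - op_translate w S" for h
      by (simp add: op_translate_translate[OF S])
    then show "\<forall>\<^sub>F h in at 0. norm (op_translate (w + h) S - op_translate w S) \<le> norm (op_translate h S - S)"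
      by (simp add: op_translate_Lipschitz)
    show "((\<lambda>h. norm (op_translate h S - S)) \<longlongrightarrow> 0) (at 0)"
      by (rule tendsto_norm_zero[OF LIM_zero[OF lim]])
  qed
  then show "S \<in> Cbu_op" using S by (simp add: Cbu_op_def continuous_at_imp_continuous_on)
qed

lemma berezin_scalar: "berezin (op_scaleC c id_blinfun) z = c"
  by (simp add: berezin_def op_scaleC_apply cinner_simps cinner_self_norm norm_coh)

lemma Cbu_op_closed_under:
  assumes S: "S \<in> Cbu_op" and T: "T \<in> Cbu_op"
  shows "S + T \<in> Cbu_op" "S - T \<in> Cbu_op" "(S o\<^sub>L T) \<in> Cbu_op" "op_scaleC c S \<in> Cbu_op"
proof -
  note S' = Cbu_opD[OF S] and T' = Cbu_opD[OF T]
  show "S + T \<in> Cbu_op" "S - T \<in> Cbu_op"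
    using S' T' by (auto simp: Cbu_op_def bounded_ops_closed_under op_translate_linear intro!: continuous_intros)
  show "(S o\<^sub>L T) \<in> Cbu_op"
    using S' T' by (auto simp: Cbu_op_def bounded_ops_closed_under op_translate_props(3)
        intro!: bounded_bilinear.continuous_on[OF bounded_bilinear_blinfun_compose])
  \<comment> \<open>Multiplication by a scalar is written as composition with a scalar operator.
    This operator is translation invariant because its Berezin transform is constant.\<close>
  have "op_scaleC c S = (op_scaleC c id_blinfun o\<^sub>L S)"
    by (rule blinfun_eqI) (simp add: op_scaleC_apply)
  moreover have "op_translate z (op_scaleC c id_blinfun) = (op_scaleC c id_blinfun :: 'a op)" for z
    by (rule berezin_inj) (simp_all add: op_translate_props(1) bounded_ops_closed_under berezin_op_translate berezin_scalar)
  ultimately have eq: "op_translate z (op_scaleC c S) = (op_scaleC c id_blinfun o\<^sub>L op_translate z S)" for z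
    by (simp only: op_translate_props(3))
  show "op_scaleC c S \<in> Cbu_op"
    unfolding Cbu_op_def mem_Collect_eq eq
    by (intro conjI bounded_ops_closed_under S' bounded_bilinear.continuous_on[OF bounded_bilinear_blinfun_compose]
        continuous_on_const)
qed

lemma Cbu_op_translate:
  assumes S: "S \<in> Cbu_op"
  shows "op_translate w S \<in> Cbu_op"
proof -
  have "continuous_on UNIV (\<lambda>z. op_translate (z + w) S)"
    by (rule continuous_on_compose2[OF Cbu_opD(2)[OF S]]) (auto intro!: continuous_intros)
  then show ?thesis
    unfolding Cbu_op_def mem_Collect_eq op_translate_translate[OF Cbu_opD(1)[OF S]]
    by (intro conjI op_translate_props(1) Cbu_opD(1) S)
qed

lemma closed_Cbu_op: "closed Cbu_op"
  unfolding closed_sequential_limits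
proof (intro allI impI, elim conjE)
  fix X :: "nat \<Rightarrow> 'a op" and S
  assume X: "\<forall>n. X n \<in> Cbu_op" and lim: "X \<longlonglongrightarrow> S"
  have S: "S \<in> bounded_ops"
    by (rule closed_sequentially[OF closed_bounded_ops Cbu_opD(1)[OF X[rule_format]] lim])
  have "uniform_limit UNIV (\<lambda>n z. op_translate z (X n)) (\<lambda>z. op_translate z S) sequentially"
    unfolding uniform_limit_iff
  proof (intro allI impI)
    fix e :: real assume "e > 0"
    then have "\<forall>\<^sub>F n in sequentially. dist (X n) S < e" by (rule tendstoD[OF lim])
    then show "\<forall>\<^sub>F n in sequentially. \<forall>z\<in>UNIV. dist (op_translate z (X n)) (op_translate z S) < e"
      unfolding dist_norm by eventually_elim (blast intro: le_less_trans op_translate_Lipschitz)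
  qed
  then have "continuous_on UNIV (\<lambda>z. op_translate z S)"
    by (rule uniform_limit_theorem[rotated]) (use X Cbu_opD in \<open>auto intro!: always_eventually\<close>)
  then show "S \<in> Cbu_op" using S by (simp add: Cbu_op_def)
qed

text \<open>Norm continuity of the translates makes the matrix coefficients continuous, so the weak
  integrand is measurable; the bound by \<open>norm S\<close> then makes it integrable.\<close>

lemma conv_L1_op:
  fixes S :: "'n::finite op"
  assumes \<psi>: "integrable lborel \<psi>" and S: "S \<in> Cbu_op"
  shows conv_L1_op_bounded_ops: "conv_L1_op \<psi> S \<in> bounded_ops"
    and cinner_conv_L1_op: "cinner (blinfun_apply (conv_L1_op \<psi> S) f) g =
      (\<integral>z. cinner (blinfun_apply (op_translate z S) f) g * \<psi> z \<partial>lborel)"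
    and conv_L1_op_integrable: "integrable lborel (\<lambda>z. cinner (blinfun_apply (op_translate z S) f) g * \<psi> z)"
    and norm_conv_L1_op_le: "norm (conv_L1_op \<psi> S) \<le> norm S * (\<integral>z. cmod (\<psi> z) \<partial>lborel)"
proof -
  note S' = Cbu_opD[OF S]
  have [measurable]: "\<psi> \<in> borel_measurable borel" using borel_measurable_integrable[OF \<psi>] by simp
  have le: "cmod (cinner (op_translate z S f) g * \<psi> z) \<le> norm S * (norm f * norm g) * cmod (\<psi> z)" for z f g
  proof -
    have "cmod (cinner (op_translate z S f) g) \<le> norm (op_translate z S f) * norm g" by (rule cinner_cauchy_schwarz)
    also have "\<dots> \<le> (norm S * norm f) * norm g"
      by (intro mult_right_mono order_trans[OF norm_blinfun] op_translate_props(2)) auto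
    finally show ?thesis unfolding norm_mult by (intro mult_right_mono) (auto simp: mult.assoc)
  qed
  have i: "integrable lborel (\<lambda>z. cinner (op_translate z S f) g * \<psi> z)" for f g
  proof (rule Bochner_Integration.integrable_bound[OF integrable_mult_right[OF integrable_norm[OF \<psi>], of "norm S * (norm f * norm g)"]])
    have "continuous_on UNIV (\<lambda>z. cinner (op_translate z S f) g)"
      by (rule bounded_linear.continuous_on[OF bounded_linear_cinner_left blinfun.continuous_on[OF S'(2) continuous_on_const]])
    then have [measurable]: "(\<lambda>z. cinner (op_translate z S f) g) \<in> borel_measurable borel" by (rule borel_measurable_continuous_onI)
    show "(\<lambda>z. cinner (op_translate z S f) g * \<psi> z) \<in> borel_measurable lborel" by measurable
  qed (use le in \<open>auto simp: norm_mult abs_mult\<close>)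
  then show "integrable lborel (\<lambda>z. cinner (blinfun_apply (op_translate z S) f) g * \<psi> z)" .
  have bound: "cmod (\<integral>z. cinner (op_translate z S f) g * \<psi> z \<partial>lborel) \<le> norm S * (\<integral>z. cmod (\<psi> z) \<partial>lborel) * (norm f * norm g)" for f g
  proof -
    have "cmod (\<integral>z. cinner (op_translate z S f) g * \<psi> z \<partial>lborel) \<le> (\<integral>z. norm S * (norm f * norm g) * cmod (\<psi> z) \<partial>lborel)"
      by (rule Bochner_Integration.integral_norm_bound_integral[OF i integrable_mult_right[OF integrable_norm[OF \<psi>]] le])
    then show ?thesis by (simp add: mult_ac)
  qed
  obtain R where R: "R \<in> bounded_ops"
    "\<And>f g. cinner (blinfun_apply R f) g = (\<integral>z. cinner (op_translate z S f) g * \<psi> z \<partial>lborel)"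
    using weak_integral_exists[OF op_translate_props(1)[OF S'(1)] i bound] by blast
  have "conv_L1_op \<psi> S = R"
    unfolding conv_L1_op_def by (rule the_equality) (use R(2) in \<open>auto intro: op_eqI\<close>)
  then show "conv_L1_op \<psi> S \<in> bounded_ops" "cinner (blinfun_apply (conv_L1_op \<psi> S) f) g =
      (\<integral>z. cinner (blinfun_apply (op_translate z S) f) g * \<psi> z \<partial>lborel)"
    "norm (conv_L1_op \<psi> S) \<le> norm S * (\<integral>z. cmod (\<psi> z) \<partial>lborel)"
    using R bound by (auto intro!: norm_op_le)
qed

lemma berezin_conv_L1_op:
  assumes "integrable lborel \<psi>" "S \<in> Cbu_op"
  shows "berezin (conv_L1_op \<psi> S) w = conv_fun_fun \<psi> (berezin S) w"
  unfolding conv_fun_fun_def berezin_op_translate[OF Cbu_opD(1)[OF assms(2)], symmetric]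
  unfolding berezin_def cinner_conv_L1_op[OF assms] ..

lemma conv_L1_op_diff:
  assumes "integrable lborel \<psi>" "S \<in> Cbu_op" "T \<in> Cbu_op"
  shows "conv_L1_op \<psi> S - conv_L1_op \<psi> T = conv_L1_op \<psi> (S - T)"
proof (rule op_eqI)
  fix f g
  show "cinner ((conv_L1_op \<psi> S - conv_L1_op \<psi> T) f) g = cinner (conv_L1_op \<psi> (S - T) f) g"
    by (simp add: blinfun.diff_left cinner_simps cinner_conv_L1_op assms Cbu_op_closed_under op_translate_linear
        left_diff_distrib conv_L1_op_integrable)
qed

lemma op_translate_conv_L1:
  assumes "integrable lborel \<psi>" "S \<in> Cbu_op"
  shows "op_translate z (conv_L1_op \<psi> S) = conv_L1_op \<psi> (op_translate z S)"
  by (rule berezin_inj) (auto simp: op_translate_props(1) conv_L1_op_bounded_ops assms Cbu_op_translate berezin_op_translate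
      berezin_conv_L1_op Cbu_opD conv_fun_fun_def algebra_simps)

lemma conv_L1_Cbu_op:
  assumes \<psi>: "integrable lborel \<psi>" and S: "S \<in> Cbu_op"
  shows "conv_L1_op \<psi> S \<in> Cbu_op"
  unfolding Cbu_op_iff
proof (intro conjI conv_L1_op_bounded_ops[OF assms])
  let ?c = "\<integral>z. cmod (\<psi> z) \<partial>lborel"
  have "norm (op_translate z (conv_L1_op \<psi> S) - conv_L1_op \<psi> S) \<le> norm (op_translate z S - S) * ?c" for z
    unfolding op_translate_conv_L1[OF assms] conv_L1_op_diff[OF \<psi> Cbu_op_translate[OF S] S]
    by (intro norm_conv_L1_op_le \<psi> Cbu_op_closed_under Cbu_op_translate S)
  then have "\<forall>\<^sub>F z in at 0. norm (op_translate z (conv_L1_op \<psi> S) - conv_L1_op \<psi> S) \<le> norm (op_translate z S - S) * ?c"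
    by (intro always_eventually allI)
  moreover have "((\<lambda>z. norm (op_translate z S - S) * ?c) \<longlongrightarrow> 0) (at 0)"
    using S unfolding Cbu_op_iff by (intro tendsto_mult_left_zero tendsto_norm_zero LIM_zero) auto
  ultimately show "((\<lambda>z. op_translate z (conv_L1_op \<psi> S)) \<longlongrightarrow> conv_L1_op \<psi> S) (at 0)"
    by (rule LIM_zero_cancel[OF Lim_null_comparison])
qed

text \<open>The operator is built weakly from the form \<open>\<integral> a f cnj g\<close>. It
  solves the orthogonality condition in \<open>fock_proj\<close>, and pairings with all
  \<open>g\<close> determine the solution. The bound on the symbol holds only almost everywhere, as
  \<open>L_infinity\<close> provides.\<close>

lemma toeplitz_props:
  fixes a :: "complex^'n::finite \<Rightarrow> complex"
  assumes a: "a \<in> borel_measurable borel" "AE z in lborel. cmod (a z) \<le> C" "0 \<le> C"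
  shows toeplitz_bounded_ops: "toeplitz a \<in> bounded_ops"
    and cinner_toeplitz: "cinner (blinfun_apply (toeplitz a) f) g = (\<integral>z. a z * fock_fun f z * cnj (fock_fun g z) \<partial>gauss_measure)"
    and toeplitz_integrable: "integrable gauss_measure (\<lambda>z. a z * fock_fun f z * cnj (fock_fun g z))"
proof -
  note [measurable] = a(1)
  have aeg: "AE z in gauss_measure. cmod (a z) \<le> C"
    unfolding gauss_measure_def using a(2) by (subst AE_density) auto
  have le: "AE z in gauss_measure. norm (a z * fock_fun f z * cnj (fock_fun g z)) \<le> C * cmod (fock_fun f z * cnj (fock_fun g z))" for f g :: "'n fock"
    using aeg
  proof eventually_elim
    case (elim z)
    from mult_right_mono[OF elim, of "cmod (fock_fun f z * cnj (fock_fun g z))"] show ?case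
      by (simp add: norm_mult mult.assoc)
  qed
  have le': "AE z in gauss_measure. norm (a z * fock_fun f z * cnj (fock_fun g z)) \<le> norm (C * cmod (fock_fun f z * cnj (fock_fun g z)))" for f g :: "'n fock"
    using le[of f g] by eventually_elim (metis abs_ge_self order_trans real_norm_def)
  have i: "integrable gauss_measure (\<lambda>z. a z * fock_fun f z * cnj (fock_fun g z))" for f g :: "'n fock"
    by (rule Bochner_Integration.integrable_bound[OF integrable_mult_right[OF integrable_norm[OF cinner_integrable]] _ le']) measurable
  then show "integrable gauss_measure (\<lambda>z. a z * fock_fun f z * cnj (fock_fun g z))" .
  have prod: "(\<integral>z. cmod (fock_fun f z * cnj (fock_fun g z)) \<partial>gauss_measure) \<le> norm f * norm g" for f g :: "'n fock"
  proof -
    have "(\<integral>\<^sup>+z. ennreal (cmod (fock_fun f z * cnj (fock_fun g z))) \<partial>gauss_measure) \<le> ennreal (norm f * norm g)"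
      by (rule nn_integral_cauchy_schwarz) (simp_all add: norm_fock_nn_integral)
    then show ?thesis
      using nn_integral_eq_integral[OF integrable_norm[OF cinner_integrable[of f g]]] by simp
  qed
  have bound: "cmod (\<integral>z. a z * fock_fun f z * cnj (fock_fun g z) \<partial>gauss_measure) \<le> C * (norm f * norm g)" for f g :: "'n fock"
  proof -
    have "cmod (\<integral>z. a z * fock_fun f z * cnj (fock_fun g z) \<partial>gauss_measure)
        \<le> (\<integral>z. norm (a z * fock_fun f z * cnj (fock_fun g z)) \<partial>gauss_measure)" by (rule integral_norm_bound)
    also have "\<dots> \<le> (\<integral>z. C * cmod (fock_fun f z * cnj (fock_fun g z)) \<partial>gauss_measure)"
      by (rule integral_mono_AE[OF integrable_norm[OF i] integrable_mult_right[OF integrable_norm[OF cinner_integrable]] le])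
    also have "\<dots> \<le> C * (norm f * norm g)" using mult_left_mono[OF prod a(3)] by simp
    finally show ?thesis .
  qed
  have "\<exists>R\<in>bounded_ops. \<forall>f g. cinner (blinfun_apply R f) g = (\<integral>z. a z * fock_fun f z * cnj (fock_fun g z) \<partial>gauss_measure)"
  proof (rule weak_operator_exists[OF _ _ _ _ bound])
    fix f f' g g' :: "'n fock" and c :: complex
    show "(\<integral>z. a z * fock_fun (f + f') z * cnj (fock_fun g z) \<partial>gauss_measure)
      = (\<integral>z. a z * fock_fun f z * cnj (fock_fun g z) \<partial>gauss_measure) + (\<integral>z. a z * fock_fun f' z * cnj (fock_fun g z) \<partial>gauss_measure)"
      unfolding Bochner_Integration.integral_add[OF i i, symmetric]
      by (rule Bochner_Integration.integral_cong) (auto simp: fock_fun_simps algebra_simps)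
    show "(\<integral>z. a z * fock_fun f z * cnj (fock_fun (g + g') z) \<partial>gauss_measure)
      = (\<integral>z. a z * fock_fun f z * cnj (fock_fun g z) \<partial>gauss_measure) + (\<integral>z. a z * fock_fun f z * cnj (fock_fun g' z) \<partial>gauss_measure)"
      unfolding Bochner_Integration.integral_add[OF i i, symmetric]
      by (rule Bochner_Integration.integral_cong) (auto simp: fock_fun_simps algebra_simps)
    show "(\<integral>z. a z * fock_fun (scaleC c f) z * cnj (fock_fun g z) \<partial>gauss_measure)
      = c * (\<integral>z. a z * fock_fun f z * cnj (fock_fun g z) \<partial>gauss_measure)"
      unfolding integral_mult_right_zero[symmetric]
      by (rule Bochner_Integration.integral_cong) (auto simp: fock_fun_simps algebra_simps)
    show "(\<integral>z. a z * fock_fun f z * cnj (fock_fun (scaleC c g) z) \<partial>gauss_measure)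
      = cnj c * (\<integral>z. a z * fock_fun f z * cnj (fock_fun g z) \<partial>gauss_measure)"
      unfolding integral_mult_right_zero[symmetric]
      by (rule Bochner_Integration.integral_cong) (auto simp: fock_fun_simps algebra_simps)
  qed
  then obtain R where R: "R \<in> bounded_ops"
    "\<And>f g. cinner (blinfun_apply R f) g = (\<integral>z. a z * fock_fun f z * cnj (fock_fun g z) \<partial>gauss_measure)" by blast
  have diff: "(\<integral>z. (a z * fock_fun f z - fock_fun h z) * cnj (fock_fun g z) \<partial>gauss_measure) = cinner (R f) g - cinner h g" for f g h
  proof -
    have "(\<integral>z. (a z * fock_fun f z - fock_fun h z) * cnj (fock_fun g z) \<partial>gauss_measure)
      = (\<integral>z. a z * fock_fun f z * cnj (fock_fun g z) - fock_fun h z * cnj (fock_fun g z) \<partial>gauss_measure)"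
      by (simp add: left_diff_distrib)
    also have "\<dots> = cinner (R f) g - cinner h g"
      unfolding R(2) cinner_def[of h g] by (rule Bochner_Integration.integral_diff[OF i cinner_integrable])
    finally show ?thesis .
  qed
  have "fock_proj (\<lambda>z. a z * fock_fun f z) = R f" for f
    unfolding fock_proj_def diff by (rule the_equality) (auto intro: cinner_eqI)
  then have "toeplitz a = R" unfolding toeplitz_def by (simp add: blinfun_apply_inverse)
  then show "toeplitz a \<in> bounded_ops"
    "cinner (blinfun_apply (toeplitz a) f) g = (\<integral>z. a z * fock_fun f z * cnj (fock_fun g z) \<partial>gauss_measure)"
    using R by auto
qed

lemma kern_weight: "exp (- pi * (norm z)\<^sup>2) *\<^sub>R (kern w z * cnj (kern w z)) = complex_of_real (exp (- pi * (norm (w - z))\<^sup>2))"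
  unfolding scaleR_conv_of_real of_real_exp_norm kern_exp exp_cnj exp_add[symmetric]
  by (simp add: hip_simps hip_commute[of z w] cnj_hip_self algebra_simps)

lemma cinner_coh_coh: "cmod (cinner (coh w) (coh z)) ^ 2 = exp (- pi * (norm (w - z))\<^sup>2)"
proof -
  have "complex_of_real (exp (pi / 2 * (norm z)\<^sup>2)) * cinner (coh w) (coh z) = kern w z"
    using fock_fun_conv_coh[of "coh w" z] by (simp add: fock_fun_coh)
  then have "cinner (coh w) (coh z) = complex_of_real (exp (- (pi / 2 * (norm z)\<^sup>2))) * kern w z"
    by (simp add: exp_minus field_simps)
  then have "(cmod (cinner (coh w) (coh z)))\<^sup>2 = (exp (- (pi / 2 * (norm z)\<^sup>2)))\<^sup>2 * (cmod (kern w z))\<^sup>2"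
    by (simp add: norm_mult power_mult_distrib)
  also have "\<dots> = exp (- pi * (norm z)\<^sup>2) * (cmod (kern w z))\<^sup>2"
    by (simp add: exp_double[symmetric])
  also have "complex_of_real \<dots> = complex_of_real (exp (- pi * (norm (w - z))\<^sup>2))"
    unfolding kern_weight[symmetric] of_real_mult complex_norm_square scaleR_conv_of_real ..
  finally show ?thesis unfolding of_real_eq_iff .
qed

lemma berezin_toeplitz:
  fixes a :: "complex^'n::finite \<Rightarrow> complex"
  assumes a: "a \<in> borel_measurable borel" "AE z in lborel. cmod (a z) \<le> C" "0 \<le> C"
  shows "berezin (toeplitz a) w = conv_fun_fun (\<lambda>z. complex_of_real (exp (- pi * (norm z)\<^sup>2))) a w"
proof -
  note [measurable] = a(1) borel_measurable_entire[OF entire_kern]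
  have "berezin (toeplitz a) w = (\<integral>z. exp (- pi * (norm z)\<^sup>2) *\<^sub>R (a z * kern w z * cnj (kern w z)) \<partial>lborel)"
    unfolding berezin_def cinner_toeplitz[OF a] fock_fun_coh by (rule integral_gauss_measure) measurable
  also have "\<dots> = (\<integral>z. a z * complex_of_real (exp (- pi * (norm (w - z))\<^sup>2)) \<partial>lborel)"
    unfolding kern_weight[symmetric] by (simp add: mult.assoc)
  also have "\<dots> = (\<integral>z. a (w - z) * complex_of_real (exp (- pi * (norm (w - (w - z)))\<^sup>2)) \<partial>lborel)"
    by (rule lborel_integral_translate(3)[symmetric])
  finally show ?thesis by (simp add: conv_fun_fun_def)
qed

text \<open>The vector \<open>coh 0\<close> is the constant function 1. The operator is chosen
  together with its nuclear representation, whose terms after the first vanish.\<close>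

definition vacuum_proj :: "'n::finite op" where
  "vacuum_proj = (SOME S. nuclear_rep S (\<lambda>n. if n = 0 then coh 0 else 0) (\<lambda>n. if n = 0 then coh 0 else 0) \<and>
    (\<forall>f. blinfun_apply S f = scaleC (cinner f (coh 0)) (coh 0)))"

lemma vacuum_proj:
  "nuclear_rep vacuum_proj (\<lambda>n. if n = 0 then coh 0 else 0) (\<lambda>n. if n = 0 then coh 0 else 0)"
  "blinfun_apply vacuum_proj f = scaleC (cinner f (coh 0)) (coh 0)"
  using someI_ex[OF rank_one_exists[of "coh 0" "coh 0"]] unfolding vacuum_proj_def[symmetric] by auto

lemma berezin_vacuum_proj: "berezin vacuum_proj z = complex_of_real (exp (- pi * (norm z)\<^sup>2))"
proof -
  have "berezin vacuum_proj z = cinner (coh z) (coh 0) * cnj (cinner (coh z) (coh 0))"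
    by (simp add: berezin_def vacuum_proj(2) cinner_simps cinner_commute[of "coh 0" "coh z"])
  also have "\<dots> = complex_of_real (exp (- pi * (norm z)\<^sup>2))"
    unfolding complex_norm_square[symmetric] using cinner_coh_coh[of z 0] by simp
  finally show ?thesis .
qed

section \<open>The Fourier transform of integrable functions\<close>

definition wave :: "real \<Rightarrow> complex" where "wave t = cis (2 * pi * t)"

lemma wave_simps: "wave 0 = 1" "wave (s + t) = wave s * wave t" "wave (- t) = cnj (wave t)" "cmod (wave t) = 1"
  by (simp_all add: wave_def cis_mult distrib_left cis_cnj)

lemma continuous_on_wave [continuous_intros]: "continuous_on S f \<Longrightarrow> continuous_on S (\<lambda>x. wave (f x))"
  unfolding wave_def by (intro continuous_intros)

lemma borel_measurable_wave [measurable]: "wave \<in> borel_measurable borel"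
  by (intro borel_measurable_continuous_onI continuous_intros)

lemma fourier_wave: "fourier \<psi> \<xi> = (\<integral>x. wave (- (x \<bullet> \<xi>)) * \<psi> x \<partial>lborel)"
proof -
  have "exp (- (2 * pi * \<i>) * complex_of_real t) = wave (- t)" for t
    by (simp add: wave_def cis_conv_exp mult_ac)
  then show ?thesis by (simp add: fourier_def)
qed

lemma integrable_mult_unimodular:
  fixes f m :: "'a \<Rightarrow> complex"
  assumes "integrable M f" "m \<in> borel_measurable M" "\<And>x. cmod (m x) = 1"
  shows "integrable M (\<lambda>x. m x * f x)"
  by (rule Bochner_Integration.integrable_bound[OF assms(1)]) (use assms in \<open>auto simp: norm_mult\<close>)

lemma wave_integrable: "integrable lborel \<psi> \<Longrightarrow> integrable lborel (\<lambda>x. wave (- (x \<bullet> \<xi>)) * \<psi> x)"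
  by (rule integrable_mult_unimodular) (auto simp: wave_simps(4))

lemma cmod_fourier_le: "cmod (fourier \<psi> \<xi>) \<le> (\<integral>x. cmod (\<psi> x) \<partial>lborel)"
  unfolding fourier_wave by (rule order_trans[OF integral_norm_bound]) (simp add: norm_mult wave_simps(4))

lemma continuous_on_sequentiallyI:
  fixes f :: "'a::metric_space \<Rightarrow> 'b::topological_space"
  assumes "\<And>(X :: nat \<Rightarrow> 'a) x. X \<longlonglongrightarrow> x \<Longrightarrow> (\<lambda>n. f (X n)) \<longlonglongrightarrow> f x"
  shows "continuous_on UNIV f"
  unfolding continuous_on_sequentially o_def using assms by blast

lemma continuous_fourier:
  fixes \<psi> :: "complex^'n \<Rightarrow> complex"
  assumes \<psi>: "integrable lborel \<psi>"
  shows "continuous_on UNIV (fourier \<psi>)"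
proof (rule continuous_on_sequentiallyI)
  fix X and \<xi> :: "complex^'n" assume X: "X \<longlonglongrightarrow> \<xi>"
  have [measurable]: "\<psi> \<in> borel_measurable borel" using borel_measurable_integrable[OF \<psi>] by simp
  have w: "continuous_on UNIV wave" by (intro continuous_intros)
  show "(\<lambda>n. fourier \<psi> (X n)) \<longlonglongrightarrow> fourier \<psi> \<xi>"
    unfolding fourier_wave
  proof (rule integral_dominated_convergence[where w="\<lambda>x. cmod (\<psi> x)"])
    show "AE x in lborel. (\<lambda>n. wave (- (x \<bullet> X n)) * \<psi> x) \<longlonglongrightarrow> wave (- (x \<bullet> \<xi>)) * \<psi> x"
    proof (rule AE_I2)
      fix x
      have "(\<lambda>n. - (x \<bullet> X n)) \<longlonglongrightarrow> - (x \<bullet> \<xi>)"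
        by (rule tendsto_minus[OF tendsto_inner[OF tendsto_const X]])
      then have "(\<lambda>n. wave (- (x \<bullet> X n))) \<longlonglongrightarrow> wave (- (x \<bullet> \<xi>))"
        by (rule continuous_on_tendsto_compose[OF w]) auto
      then show "(\<lambda>n. wave (- (x \<bullet> X n)) * \<psi> x) \<longlonglongrightarrow> wave (- (x \<bullet> \<xi>)) * \<psi> x" by (rule tendsto_mult_right)
    qed
  qed (use \<psi> in \<open>auto simp: norm_mult wave_simps(4)\<close>)
qed

lemma fourier_simps:
  assumes "integrable lborel f" "integrable lborel g"
  shows "fourier (\<lambda>x. f x - g x) \<xi> = fourier f \<xi> - fourier g \<xi>"
    "fourier (\<lambda>x. f x + g x) \<xi> = fourier f \<xi> + fourier g \<xi>"
    "fourier (\<lambda>x. c * f x) \<xi> = c * fourier f \<xi>"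
proof -
  show "fourier (\<lambda>x. f x - g x) \<xi> = fourier f \<xi> - fourier g \<xi>"
    "fourier (\<lambda>x. f x + g x) \<xi> = fourier f \<xi> + fourier g \<xi>"
    unfolding fourier_wave using wave_integrable[OF assms(1)] wave_integrable[OF assms(2)]
    by (simp_all add: right_diff_distrib distrib_left)
  have "fourier (\<lambda>x. c * f x) \<xi> = (\<integral>x. c * (wave (- (x \<bullet> \<xi>)) * f x) \<partial>lborel)"
    unfolding fourier_wave by (simp add: mult_ac)
  then show "fourier (\<lambda>x. c * f x) \<xi> = c * fourier f \<xi>" by (simp add: fourier_wave)
qed

lemma pair_product_integrable:
  fixes f g :: "'a::euclidean_space \<Rightarrow> complex"
  assumes f: "integrable lborel f" and g: "integrable lborel g"
    and m: "m \<in> borel_measurable (lborel \<Otimes>\<^sub>M lborel)" "\<And>p. cmod (m p) = 1"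
  shows "integrable (lborel \<Otimes>\<^sub>M lborel) (\<lambda>(x, y). f x * g y * m (x, y))"
proof (rule lborel_pair.Fubini_integrable)
  note [measurable] = borel_measurable_integrable[OF f] borel_measurable_integrable[OF g] m(1)
  show "(\<lambda>(x, y). f x * g y * m (x, y)) \<in> borel_measurable (lborel \<Otimes>\<^sub>M lborel)" by measurable
  have "(\<integral>y. cmod (case (x, y) of (x, y) \<Rightarrow> f x * g y * m (x, y)) \<partial>lborel) = cmod (f x) * (\<integral>y. cmod (g y) \<partial>lborel)" for x
    by (simp add: norm_mult m(2))
  then show "integrable lborel (\<lambda>x. \<integral>y. cmod (case (x, y) of (x, y) \<Rightarrow> f x * g y * m (x, y)) \<partial>lborel)"
    using f by simp
  show "AE x in lborel. integrable lborel (\<lambda>y. case (x, y) of (x, y) \<Rightarrow> f x * g y * m (x, y))"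
  proof (rule AE_I2)
    fix x
    have "integrable lborel (\<lambda>y. f x * (m (x, y) * g y))"
      by (intro integrable_mult_right integrable_mult_unimodular g m) measurable
    then show "integrable lborel (\<lambda>y. case (x, y) of (x, y) \<Rightarrow> f x * g y * m (x, y))" by (simp add: mult_ac)
  qed
qed

lemma gauss_integrable: "integrable lborel (\<lambda>x :: complex^'n. complex_of_real (exp (- pi * (norm x)\<^sup>2)))"
  and integral_gauss: "(\<integral>x. complex_of_real (exp (- pi * (norm (x :: complex^'n))\<^sup>2)) \<partial>lborel) = 1"
proof -
  have 1: "integrable gauss_measure (\<lambda>x :: complex^'n. 1 :: complex)" by (rule fock_set_integrable[OF fock_set_1])
  then show "integrable lborel (\<lambda>x :: complex^'n. complex_of_real (exp (- pi * (norm x)\<^sup>2)))"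
    by (subst (asm) integrable_gauss_measure_iff) (auto simp: scaleR_conv_of_real)
  have "(\<integral>x. 1 \<partial>(gauss_measure :: (complex^'n) measure)) = (1 :: complex)"
    using gauss_mean_value[OF entire_const 1] by simp
  then show "(\<integral>x. complex_of_real (exp (- pi * (norm (x :: complex^'n))\<^sup>2)) \<partial>lborel) = 1"
    by (subst (asm) integral_gauss_measure) (auto simp: scaleR_conv_of_real)
qed

text \<open>The character splits into a kernel and a conjugate kernel at
  \<open>\<i> *s \<xi>\<close> and \<open>(- \<i>) *s \<xi>\<close>, so the Fourier integral is an
  inner product of two kernels and the reproducing property evaluates it.\<close>

lemma fourier_gauss:
  "fourier (\<lambda>x :: complex^'n. complex_of_real (exp (- pi * (norm x)\<^sup>2))) \<xi> = complex_of_real (exp (- pi * (norm \<xi>)\<^sup>2))"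
proof -
  have "wave (- (x \<bullet> \<xi>)) * complex_of_real (exp (- pi * (norm x)\<^sup>2))
      = exp (- pi * (norm x)\<^sup>2) *\<^sub>R (fock_fun (rkern (\<i> *s \<xi>)) x * cnj (fock_fun (rkern ((- \<i>) *s \<xi>)) x))" for x
  proof -
    have "wave (- (x \<bullet> \<xi>)) = exp (- (complex_of_real pi * \<i> * (hip x \<xi> + hip \<xi> x)))"
      unfolding wave_def cis_conv_exp using inner_conv_hip[of x \<xi>] by (simp add: mult_ac)
    also have "\<dots> = fock_fun (rkern (\<i> *s \<xi>)) x * cnj (fock_fun (rkern ((- \<i>) *s \<xi>)) x)"
      unfolding fock_fun_rkern exp_cnj exp_add[symmetric] by (simp add: hip_simps hip_commute[symmetric] algebra_simps)
    finally show ?thesis by (simp add: scaleR_conv_of_real mult.commute)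
  qed
  then have "fourier (\<lambda>x. complex_of_real (exp (- pi * (norm x)\<^sup>2))) \<xi> = cinner (rkern (\<i> *s \<xi>)) (rkern ((- \<i>) *s \<xi>))"
    unfolding fourier_wave cinner_lborel by simp
  also have "\<dots> = complex_of_real (exp (- pi * (norm \<xi>)\<^sup>2))"
    unfolding cinner_rkern fock_fun_rkern of_real_exp_norm by (simp add: hip_simps)
  finally show ?thesis .
qed

section \<open>Inversion and square integrability of the transform\<close>

text \<open>A Gaussian of width \<open>1 / t\<close> makes the inversion integral absolutely
  convergent. Fubini's theorem moves the Fourier integral onto the Gaussian, which becomes an
  averaging kernel at scale \<open>t\<close>.\<close>

lemma fourier_inversion_gauss:
  fixes f :: "complex^'n \<Rightarrow> complex"
  assumes f: "integrable lborel f" and t: "t > 0"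
  shows "(\<integral>\<xi>. fourier f \<xi> * wave (x \<bullet> \<xi>) * complex_of_real (exp (- pi * (norm (t *\<^sub>R \<xi>))\<^sup>2)) \<partial>lborel)
    = (\<integral>u. f (x - t *\<^sub>R u) * complex_of_real (exp (- pi * (norm u)\<^sup>2)) \<partial>lborel)"
proof -
  define g where "g u = complex_of_real (exp (- pi * (norm u)\<^sup>2))" for u :: "complex^'n"
  let ?d = "DIM(complex^'n)"
  have g: "integrable lborel g" unfolding g_def by (rule gauss_integrable)
  have gt: "integrable lborel (\<lambda>\<xi>. g (t *\<^sub>R \<xi>))"
    using lborel_integrable_affine[OF g, of t 0] t by simp
  have m: "(\<lambda>p. wave (x \<bullet> snd p - fst p \<bullet> snd p)) \<in> borel_measurable (lborel \<Otimes>\<^sub>M lborel)"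
    by measurable
  have int: "integrable (lborel \<Otimes>\<^sub>M lborel) (\<lambda>(y, \<xi>). f y * g (t *\<^sub>R \<xi>) * wave (x \<bullet> \<xi> - y \<bullet> \<xi>))"
    using pair_product_integrable[OF f gt m] by (simp add: wave_simps(4))
  have inner: "(\<integral>\<xi>. g (t *\<^sub>R \<xi>) * wave (v \<bullet> \<xi>) \<partial>lborel) = complex_of_real (inverse t ^ ?d) * g ((1 / t) *\<^sub>R v)" for v
  proof -
    have "(\<integral>\<eta>. wave (- (\<eta> \<bullet> (- ((1 / t) *\<^sub>R v)))) * g \<eta> \<partial>lborel)
        = \<bar>t\<bar> ^ ?d *\<^sub>R (\<integral>\<xi>. wave (- ((0 + t *\<^sub>R \<xi>) \<bullet> (- ((1 / t) *\<^sub>R v)))) * g (0 + t *\<^sub>R \<xi>) \<partial>lborel)"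
      by (rule lborel_integral_affine) (use t in simp)
    also have "(\<integral>\<eta>. wave (- (\<eta> \<bullet> (- ((1 / t) *\<^sub>R v)))) * g \<eta> \<partial>lborel) = g ((1 / t) *\<^sub>R v)"
      using fourier_gauss[of "- ((1 / t) *\<^sub>R v)"] unfolding fourier_wave g_def by simp
    finally have "g ((1 / t) *\<^sub>R v) = complex_of_real (t ^ ?d) * (\<integral>\<xi>. g (t *\<^sub>R \<xi>) * wave (v \<bullet> \<xi>) \<partial>lborel)"
      using t by (simp add: scaleR_conv_of_real[where 'a=complex] inner_commute mult.commute)
    then show ?thesis using t by (simp add: power_inverse)
  qed
  have "(\<integral>\<xi>. fourier f \<xi> * wave (x \<bullet> \<xi>) * g (t *\<^sub>R \<xi>) \<partial>lborel)
      = (\<integral>\<xi>. (\<integral>y. f y * g (t *\<^sub>R \<xi>) * wave (x \<bullet> \<xi> - y \<bullet> \<xi>) \<partial>lborel) \<partial>lborel)"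
  proof (rule Bochner_Integration.integral_cong[OF refl])
    fix \<xi>
    have "fourier f \<xi> * (wave (x \<bullet> \<xi>) * g (t *\<^sub>R \<xi>)) = (\<integral>y. wave (- (y \<bullet> \<xi>)) * f y * (wave (x \<bullet> \<xi>) * g (t *\<^sub>R \<xi>)) \<partial>lborel)"
      unfolding fourier_wave by simp
    also have "\<dots> = (\<integral>y. f y * g (t *\<^sub>R \<xi>) * wave (x \<bullet> \<xi> - y \<bullet> \<xi>) \<partial>lborel)"
      by (simp only: diff_conv_add_uminus wave_simps(2) mult_ac)
    finally show "fourier f \<xi> * wave (x \<bullet> \<xi>) * g (t *\<^sub>R \<xi>) = (\<integral>y. f y * g (t *\<^sub>R \<xi>) * wave (x \<bullet> \<xi> - y \<bullet> \<xi>) \<partial>lborel)"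
      by (simp only: mult.assoc)
  qed
  also have "\<dots> = (\<integral>y. (\<integral>\<xi>. f y * g (t *\<^sub>R \<xi>) * wave (x \<bullet> \<xi> - y \<bullet> \<xi>) \<partial>lborel) \<partial>lborel)"
    by (rule lborel_pair.Fubini_integral[OF int])
  also have "\<dots> = (\<integral>y. f y * (complex_of_real (inverse t ^ ?d) * g ((1 / t) *\<^sub>R (x - y))) \<partial>lborel)"
    unfolding inner[symmetric] by (simp add: inner_diff_left mult.assoc)
  also have "\<dots> = \<bar>- t\<bar> ^ ?d *\<^sub>R (\<integral>u. f (x + (- t) *\<^sub>R u) * (complex_of_real (inverse t ^ ?d) * g ((1 / t) *\<^sub>R (x - (x + (- t) *\<^sub>R u)))) \<partial>lborel)"
    by (rule lborel_integral_affine) (use t in simp)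
  also have "\<dots> = complex_of_real (t ^ ?d * inverse t ^ ?d) * (\<integral>u. f (x - t *\<^sub>R u) * g u \<partial>lborel)"
    using t by (simp add: scaleR_conv_of_real[where 'a=complex] mult.left_commute[of _ "inverse (complex_of_real t) ^ _"])
  also have "t ^ ?d * inverse t ^ ?d = 1" using t by (simp add: power_mult_distrib[symmetric])
  finally show ?thesis by (simp add: g_def)
qed

text \<open>Continuity makes equal transforms give equality everywhere and not just almost
  everywhere. The class is preserved by convolution with integrable functions, which keeps all
  constructions in Wiener's theorem inside it.\<close>

definition cbi :: "(complex^'n \<Rightarrow> complex) \<Rightarrow> bool" where
  "cbi f \<longleftrightarrow> continuous_on UNIV f \<and> integrable lborel f \<and> (\<exists>C. \<forall>x. cmod (f x) \<le> C)"

lemma cbiD: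
  assumes "cbi f"
  shows "continuous_on UNIV f" "integrable lborel f" "f \<in> borel_measurable borel"
  using assms by (auto simp: cbi_def borel_measurable_continuous_onI)

lemma fourier_inversion:
  fixes f :: "complex^'n \<Rightarrow> complex"
  assumes f: "cbi f" and F: "integrable lborel (fourier f)"
  shows "f x = (\<integral>\<xi>. fourier f \<xi> * wave (x \<bullet> \<xi>) \<partial>lborel)"
proof -
  note f' = cbiD[OF f]
  obtain C where C: "\<And>x. cmod (f x) \<le> C" using f by (auto simp: cbi_def)
  note [measurable] = f'(3) borel_measurable_continuous_onI[OF continuous_fourier[OF f'(2)]]
  define t where "t n = 1 / (real n + 1)" for n
  have t: "t n > 0" for n by (simp add: t_def add_nonneg_pos)
  have t0: "t \<longlonglongrightarrow> 0" unfolding t_def by real_asymp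
  let ?g = "\<lambda>u. complex_of_real (exp (- pi * (norm (u :: complex^'n))\<^sup>2))"
  have gm: "?g \<in> borel_measurable borel" by measurable
  have g1: "cmod (?g u) \<le> 1" for u by simp
  have gcont: "continuous_on UNIV ?g" by (intro continuous_intros)
  have A: "(\<lambda>n. \<integral>\<xi>. fourier f \<xi> * wave (x \<bullet> \<xi>) * ?g (t n *\<^sub>R \<xi>) \<partial>lborel)
      \<longlonglongrightarrow> (\<integral>\<xi>. fourier f \<xi> * wave (x \<bullet> \<xi>) \<partial>lborel)"
  proof (rule integral_dominated_convergence[where w="\<lambda>\<xi>. cmod (fourier f \<xi>)"])
    show "AE \<xi> in lborel. (\<lambda>n. fourier f \<xi> * wave (x \<bullet> \<xi>) * ?g (t n *\<^sub>R \<xi>)) \<longlonglongrightarrow> fourier f \<xi> * wave (x \<bullet> \<xi>)"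
    proof (rule AE_I2)
      fix \<xi>
      have "(\<lambda>n. ?g (t n *\<^sub>R \<xi>)) \<longlonglongrightarrow> ?g (0 *\<^sub>R \<xi>)"
        by (rule continuous_on_tendsto_compose[OF gcont tendsto_scaleR[OF t0 tendsto_const]]) auto
      from tendsto_mult[OF tendsto_const this, of "fourier f \<xi> * wave (x \<bullet> \<xi>)"]
      show "(\<lambda>n. fourier f \<xi> * wave (x \<bullet> \<xi>) * ?g (t n *\<^sub>R \<xi>)) \<longlonglongrightarrow> fourier f \<xi> * wave (x \<bullet> \<xi>)" by simp
    qed
    show "AE \<xi> in lborel. norm (fourier f \<xi> * wave (x \<bullet> \<xi>) * ?g (t n *\<^sub>R \<xi>)) \<le> cmod (fourier f \<xi>)" for n
      using mult_left_mono[OF g1] by (intro AE_I2) (simp add: norm_mult wave_simps(4) mult_left_le)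
  qed (use F in auto)
  have B: "(\<lambda>n. \<integral>u. f (x - t n *\<^sub>R u) * ?g u \<partial>lborel) \<longlonglongrightarrow> (\<integral>u. f x * ?g u \<partial>lborel)"
  proof (rule integral_dominated_convergence[where w="\<lambda>u. C * cmod (?g u)"])
    show "AE u in lborel. (\<lambda>n. f (x - t n *\<^sub>R u) * ?g u) \<longlonglongrightarrow> f x * ?g u"
    proof (rule AE_I2)
      fix u
      have "(\<lambda>n. x - t n *\<^sub>R u) \<longlonglongrightarrow> x - 0 *\<^sub>R u" by (intro tendsto_intros t0)
      then have "(\<lambda>n. f (x - t n *\<^sub>R u)) \<longlonglongrightarrow> f x"
        by (intro continuous_on_tendsto_compose[OF f'(1)]) auto
      then show "(\<lambda>n. f (x - t n *\<^sub>R u) * ?g u) \<longlonglongrightarrow> f x * ?g u" by (intro tendsto_intros)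
    qed
    show "integrable lborel (\<lambda>u. C * cmod (?g u))"
      by (intro integrable_mult_right integrable_norm gauss_integrable)
    show "AE u in lborel. norm (f (x - t n *\<^sub>R u) * ?g u) \<le> C * cmod (?g u)" for n
      unfolding norm_mult by (intro AE_I2 mult_right_mono C) simp
  qed measurable
  have "(\<integral>u. f x * ?g u \<partial>lborel) = f x" using integral_gauss[where 'n='n] by simp
  then show ?thesis
    using LIMSEQ_unique[OF A[unfolded fourier_inversion_gauss[OF f'(2) t]] B] by (simp only:)
qed

lemma fourier_eq_0_imp:
  assumes f: "cbi f" and 0: "\<And>\<xi>. fourier f \<xi> = 0"
  shows "f x = 0"
proof -
  have "fourier f = (\<lambda>_. 0)" using 0 by blast
  then show ?thesis using fourier_inversion[OF f, of x] by simp
qed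

text \<open>A Plancherel bound. With Gaussian damping the integral of the squared modulus is the
  pairing of \<open>f\<close> with a Gaussian average of \<open>f\<close>, hence at most the L1 norm
  times the supremum bound; Fatou's lemma removes the damping.\<close>

lemma fourier_square_integrable:
  fixes f :: "complex^'n \<Rightarrow> complex"
  assumes f: "cbi f"
  shows "integrable lborel (\<lambda>\<xi>. (cmod (fourier f \<xi>))\<^sup>2)"
proof -
  note f' = cbiD[OF f]
  obtain C where C: "\<And>x. cmod (f x) \<le> C" using f by (auto simp: cbi_def)
  let ?L = "\<integral>x. cmod (f x) \<partial>lborel"
  note [measurable] = f'(3) borel_measurable_continuous_onI[OF continuous_fourier[OF f'(2)]]
  define t where "t n = 1 / (real n + 1)" for n
  have t: "t n > 0" for n by (simp add: t_def add_nonneg_pos)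
  have t0: "t \<longlonglongrightarrow> 0" unfolding t_def by real_asymp
  let ?g = "\<lambda>u. complex_of_real (exp (- pi * (norm (u :: complex^'n))\<^sup>2))"
  have Fg: "integrable lborel (\<lambda>\<xi>. fourier f \<xi> * ?g (t n *\<^sub>R \<xi>))" for n
  proof (rule Bochner_Integration.integrable_bound)
    show "integrable lborel (\<lambda>\<xi>. ?L * cmod (?g (t n *\<^sub>R \<xi>)))"
      using lborel_integrable_affine[OF gauss_integrable, of "t n" 0] t[of n]
      by (intro integrable_mult_right integrable_norm) simp
    show "AE \<xi> in lborel. norm (fourier f \<xi> * ?g (t n *\<^sub>R \<xi>)) \<le> norm (?L * cmod (?g (t n *\<^sub>R \<xi>)))"
    proof (rule AE_I2)
      fix \<xi>
      have "norm (fourier f \<xi> * ?g (t n *\<^sub>R \<xi>)) \<le> ?L * cmod (?g (t n *\<^sub>R \<xi>))"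
        unfolding norm_mult by (intro mult_right_mono cmod_fourier_le norm_ge_zero)
      then show "norm (fourier f \<xi> * ?g (t n *\<^sub>R \<xi>)) \<le> norm (?L * cmod (?g (t n *\<^sub>R \<xi>)))"
        unfolding real_norm_def by linarith
    qed
  qed measurable
  have bound: "(\<integral>\<^sup>+\<xi>. ennreal ((cmod (fourier f \<xi>))\<^sup>2 * exp (- pi * (norm (t n *\<^sub>R \<xi>))\<^sup>2)) \<partial>lborel) \<le> ennreal (?L * C)" for n
  proof -
    have cf: "integrable lborel (\<lambda>x. cnj (f x))" using f'(2) by simp
    have m: "(\<lambda>p. wave (fst p \<bullet> snd p)) \<in> borel_measurable (lborel \<Otimes>\<^sub>M lborel :: ((complex^'n) \<times> (complex^'n)) measure)"
      by measurable
    have int: "integrable (lborel \<Otimes>\<^sub>M lborel) (\<lambda>(x, \<xi>). cnj (f x) * (fourier f \<xi> * ?g (t n *\<^sub>R \<xi>)) * wave (x \<bullet> \<xi>))"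
      using pair_product_integrable[OF cf Fg m] by (simp add: wave_simps(4))
    have i2: "integrable lborel (\<lambda>\<xi>. \<integral>x. cnj (f x) * (fourier f \<xi> * ?g (t n *\<^sub>R \<xi>)) * wave (x \<bullet> \<xi>) \<partial>lborel)"
      using lborel_pair.integrable_snd[OF int] by simp
    have cnjF: "cnj (fourier f \<xi>) = (\<integral>x. wave (x \<bullet> \<xi>) * cnj (f x) \<partial>lborel)" for \<xi>
      unfolding fourier_wave Bochner_Integration.integral_cnj[symmetric] by (simp add: wave_simps(3))
    have eq: "(\<integral>x. cnj (f x) * (fourier f \<xi> * ?g (t n *\<^sub>R \<xi>)) * wave (x \<bullet> \<xi>) \<partial>lborel)
       = complex_of_real ((cmod (fourier f \<xi>))\<^sup>2 * exp (- pi * (norm (t n *\<^sub>R \<xi>))\<^sup>2))" for \<xi>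
    proof -
      have "(\<integral>x. cnj (f x) * (fourier f \<xi> * ?g (t n *\<^sub>R \<xi>)) * wave (x \<bullet> \<xi>) \<partial>lborel)
        = (\<integral>x. (fourier f \<xi> * ?g (t n *\<^sub>R \<xi>)) * (wave (x \<bullet> \<xi>) * cnj (f x)) \<partial>lborel)" by (simp only: mult_ac)
      also have "\<dots> = (fourier f \<xi> * ?g (t n *\<^sub>R \<xi>)) * cnj (fourier f \<xi>)" unfolding cnjF by simp
      also have "\<dots> = complex_of_real ((cmod (fourier f \<xi>))\<^sup>2 * exp (- pi * (norm (t n *\<^sub>R \<xi>))\<^sup>2))"
        unfolding of_real_mult complex_norm_square by (simp only: mult_ac)
      finally show ?thesis .
    qed
    note i3 = i2[unfolded eq complex_of_real_integrable_eq]
    have "complex_of_real (\<integral>\<xi>. (cmod (fourier f \<xi>))\<^sup>2 * exp (- pi * (norm (t n *\<^sub>R \<xi>))\<^sup>2) \<partial>lborel)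
      = (\<integral>\<xi>. (\<integral>x. cnj (f x) * (fourier f \<xi> * ?g (t n *\<^sub>R \<xi>)) * wave (x \<bullet> \<xi>) \<partial>lborel) \<partial>lborel)"
      unfolding eq integral_complex_of_real ..
    also have "\<dots> = (\<integral>x. (\<integral>\<xi>. cnj (f x) * (fourier f \<xi> * ?g (t n *\<^sub>R \<xi>)) * wave (x \<bullet> \<xi>) \<partial>lborel) \<partial>lborel)"
      by (rule lborel_pair.Fubini_integral[OF int])
    also have "\<dots> = (\<integral>x. cnj (f x) * (\<integral>\<xi>. fourier f \<xi> * wave (x \<bullet> \<xi>) * ?g (t n *\<^sub>R \<xi>) \<partial>lborel) \<partial>lborel)"
    proof (rule Bochner_Integration.integral_cong[OF refl])
      fix x
      have "(\<integral>\<xi>. cnj (f x) * (fourier f \<xi> * ?g (t n *\<^sub>R \<xi>)) * wave (x \<bullet> \<xi>) \<partial>lborel)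
        = (\<integral>\<xi>. cnj (f x) * (fourier f \<xi> * wave (x \<bullet> \<xi>) * ?g (t n *\<^sub>R \<xi>)) \<partial>lborel)" by (simp only: mult_ac)
      then show "(\<integral>\<xi>. cnj (f x) * (fourier f \<xi> * ?g (t n *\<^sub>R \<xi>)) * wave (x \<bullet> \<xi>) \<partial>lborel)
        = cnj (f x) * (\<integral>\<xi>. fourier f \<xi> * wave (x \<bullet> \<xi>) * ?g (t n *\<^sub>R \<xi>) \<partial>lborel)" by simp
    qed
    also have "\<dots> = (\<integral>x. cnj (f x) * (\<integral>u. f (x - t n *\<^sub>R u) * ?g u \<partial>lborel) \<partial>lborel)"
      unfolding fourier_inversion_gauss[OF f'(2) t] ..
    finally have "\<bar>\<integral>\<xi>. (cmod (fourier f \<xi>))\<^sup>2 * exp (- pi * (norm (t n *\<^sub>R \<xi>))\<^sup>2) \<partial>lborel\<bar>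
      = cmod (\<integral>x. cnj (f x) * (\<integral>u. f (x - t n *\<^sub>R u) * ?g u \<partial>lborel) \<partial>lborel)"
      by (rule trans[OF norm_of_real[symmetric] arg_cong[where f=cmod]])
    also have "\<dots> \<le> (\<integral>x. cmod (f x) * C \<partial>lborel)"
    proof (cases "integrable lborel (\<lambda>x. cnj (f x) * (\<integral>u. f (x - t n *\<^sub>R u) * ?g u \<partial>lborel))")
      case True
      have "cmod (\<integral>u. f (x - t n *\<^sub>R u) * ?g u \<partial>lborel) \<le> C" for x
      proof -
        have ge: "integrable lborel (\<lambda>u. C * cmod (?g u))"
          by (intro integrable_mult_right integrable_norm gauss_integrable)
        have m: "(\<lambda>u. f (x - t n *\<^sub>R u) * ?g u) \<in> borel_measurable lborel" by measurable
        have le: "cmod (f (x - t n *\<^sub>R u) * ?g u) \<le> C * cmod (?g u)" for u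
          unfolding norm_mult by (intro mult_right_mono C) simp
        have "integrable lborel (\<lambda>u. f (x - t n *\<^sub>R u) * ?g u)"
          by (rule Bochner_Integration.integrable_bound[OF ge m])
            (intro AE_I2 order_trans[OF le], simp add: abs_mult order_trans[OF norm_ge_zero C])
        from Bochner_Integration.integral_norm_bound_integral[OF this ge le]
        have "cmod (\<integral>u. f (x - t n *\<^sub>R u) * ?g u \<partial>lborel) \<le> (\<integral>u. C * cmod (?g u) \<partial>lborel)" .
        also have "\<dots> = C * (\<integral>u. exp (- pi * (norm (u :: complex^'n))\<^sup>2) \<partial>lborel)" by simp
        also have "(\<integral>u. exp (- pi * (norm (u :: complex^'n))\<^sup>2) \<partial>lborel) = 1"
          using integral_gauss[where 'n='n] unfolding integral_complex_of_real of_real_eq_1_iff .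
        finally show ?thesis by simp
      qed
      then show ?thesis
        by (intro Bochner_Integration.integral_norm_bound_integral[OF True] integrable_mult_left integrable_norm f'(2))
          (simp add: norm_mult mult_left_mono)
    next
      \<comment> \<open>The Bochner integral of a non-integrable function is 0, so the bound holds
        trivially.\<close>
      case False
      then show ?thesis using order_trans[OF norm_ge_zero C]
        by (simp add: not_integrable_integral_eq integral_nonneg_AE)
    qed
    finally have "(\<integral>\<xi>. (cmod (fourier f \<xi>))\<^sup>2 * exp (- pi * (norm (t n *\<^sub>R \<xi>))\<^sup>2) \<partial>lborel) \<le> ?L * C" by simp
    then show ?thesis
      unfolding nn_integral_eq_integral[OF i3 AE_I2[OF mult_nonneg_nonneg[OF zero_le_power2 less_imp_le[OF exp_gt_zero]]]]
      by (rule ennreal_leI)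
  qed
  have "(\<integral>\<^sup>+\<xi>. ennreal ((cmod (fourier f \<xi>))\<^sup>2) \<partial>lborel)
      = (\<integral>\<^sup>+\<xi>. liminf (\<lambda>n. ennreal ((cmod (fourier f \<xi>))\<^sup>2 * exp (- pi * (norm (t n *\<^sub>R \<xi>))\<^sup>2))) \<partial>lborel)"
  proof (rule nn_integral_cong)
    fix \<xi>
    have "(\<lambda>n. (cmod (fourier f \<xi>))\<^sup>2 * exp (- pi * (norm (t n *\<^sub>R \<xi>))\<^sup>2)) \<longlonglongrightarrow> (cmod (fourier f \<xi>))\<^sup>2 * exp (- pi * (norm (0 *\<^sub>R \<xi>))\<^sup>2)"
      by (intro tendsto_intros t0)
    then have "(\<lambda>n. ennreal ((cmod (fourier f \<xi>))\<^sup>2 * exp (- pi * (norm (t n *\<^sub>R \<xi>))\<^sup>2))) \<longlonglongrightarrow> ennreal ((cmod (fourier f \<xi>))\<^sup>2)"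
      by (intro tendsto_ennrealI) simp
    then show "ennreal ((cmod (fourier f \<xi>))\<^sup>2) = liminf (\<lambda>n. ennreal ((cmod (fourier f \<xi>))\<^sup>2 * exp (- pi * (norm (t n *\<^sub>R \<xi>))\<^sup>2)))"
      using lim_imp_Liminf[OF trivial_limit_sequentially] by metis
  qed
  also have "\<dots> \<le> liminf (\<lambda>n. \<integral>\<^sup>+\<xi>. ennreal ((cmod (fourier f \<xi>))\<^sup>2 * exp (- pi * (norm (t n *\<^sub>R \<xi>))\<^sup>2)) \<partial>lborel)"
    by (rule nn_integral_liminf) measurable
  also have "\<dots> \<le> limsup (\<lambda>n. \<integral>\<^sup>+\<xi>. ennreal ((cmod (fourier f \<xi>))\<^sup>2 * exp (- pi * (norm (t n *\<^sub>R \<xi>))\<^sup>2)) \<partial>lborel)"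
    by (rule Liminf_le_Limsup) simp
  also have "\<dots> \<le> ennreal (?L * C)" by (rule Limsup_bounded[OF always_eventually]) (rule allI, rule bound)
  finally have "(\<integral>\<^sup>+\<xi>. ennreal ((cmod (fourier f \<xi>))\<^sup>2) \<partial>lborel) < \<infinity>"
    by (rule order_le_less_trans) simp
  then show ?thesis by (intro integrableI_bounded) auto
qed

section \<open>Convolution of integrable functions\<close>

abbreviation l1 :: "(complex^'n \<Rightarrow> complex) \<Rightarrow> real" where
  "l1 f \<equiv> (\<integral>x. cmod (f x) \<partial>lborel)"

lemma integrable_bounded_mult:
  fixes f g :: "'a \<Rightarrow> complex"
  assumes f: "integrable M f" and g: "g \<in> borel_measurable M" and C: "\<And>x. cmod (g x) \<le> C"
  shows "integrable M (\<lambda>x. g x * f x)" "(\<integral>x. cmod (g x * f x) \<partial>M) \<le> C * (\<integral>x. cmod (f x) \<partial>M)"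
proof -
  have [measurable]: "f \<in> borel_measurable M" using f by simp
  note g [measurable]
  have le: "cmod (g x * f x) \<le> C * cmod (f x)" for x
    unfolding norm_mult by (rule mult_right_mono[OF C]) simp
  have i: "integrable M (\<lambda>x. C * cmod (f x))" by (intro integrable_mult_right integrable_norm f)
  show int: "integrable M (\<lambda>x. g x * f x)"
    by (rule Bochner_Integration.integrable_bound[OF i]) (measurable, rule AE_I2, unfold real_norm_def, rule order_trans[OF le abs_ge_self])
  have "(\<integral>x. cmod (g x * f x) \<partial>M) \<le> (\<integral>x. C * cmod (f x) \<partial>M)"
    by (rule integral_mono[OF integrable_norm[OF int] i le])
  then show "(\<integral>x. cmod (g x * f x) \<partial>M) \<le> C * (\<integral>x. cmod (f x) \<partial>M)" by simp
qed

lemma conv_fun_fun_commute: "conv_fun_fun f g = conv_fun_fun g f"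
proof
  fix z
  have "conv_fun_fun f g z = (\<integral>w. g (z - (z - w)) * f (z - w) \<partial>lborel)"
    unfolding conv_fun_fun_def by (rule lborel_integral_translate(3)[symmetric])
  then show "conv_fun_fun f g z = conv_fun_fun g f z" by (simp add: conv_fun_fun_def mult.commute)
qed

lemma conv_pair_integrable:
  fixes f g :: "complex^'n \<Rightarrow> complex"
  assumes f: "integrable lborel f" and g: "integrable lborel g"
  shows "integrable (lborel \<Otimes>\<^sub>M lborel) (\<lambda>(w, z). g (z - w) * f w)"
proof (rule lborel_pair.Fubini_integrable)
  note [measurable] = borel_measurable_integrable[OF f] borel_measurable_integrable[OF g]
  show "(\<lambda>(w, z). g (z - w) * f w) \<in> borel_measurable (lborel \<Otimes>\<^sub>M lborel)" by measurable
  have "(\<integral>z. cmod (case (w, z) of (w, z) \<Rightarrow> g (z - w) * f w) \<partial>lborel) = l1 g * cmod (f w)" for w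
    by (simp add: norm_mult lborel_integral_translate(2)[of "\<lambda>z. cmod (g z)"])
  then show "integrable lborel (\<lambda>w. \<integral>z. cmod (case (w, z) of (w, z) \<Rightarrow> g (z - w) * f w) \<partial>lborel)"
    using f by simp
  show "AE w in lborel. integrable lborel (\<lambda>z. case (w, z) of (w, z) \<Rightarrow> g (z - w) * f w)"
    using lborel_integrable_translate(2)[of g] g by (intro AE_I2) simp
qed

lemma conv_fun_fun_integrable:
  fixes f g :: "complex^'n \<Rightarrow> complex"
  assumes f: "integrable lborel f" and g: "integrable lborel g"
  shows "integrable lborel (conv_fun_fun f g)" "l1 (conv_fun_fun f g) \<le> l1 f * l1 g"
proof -
  note int = conv_pair_integrable[OF f g]
  show i: "integrable lborel (conv_fun_fun f g)"
    using lborel_pair.integrable_snd[OF int] by (simp add: conv_fun_fun_def[abs_def])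
  have int': "integrable (lborel \<Otimes>\<^sub>M lborel) (\<lambda>(w, z). cmod (g (z - w) * f w))"
    using integrable_norm[OF int] by (simp add: case_prod_unfold)
  have "l1 (conv_fun_fun f g) \<le> (\<integral>z. (\<integral>w. cmod (g (z - w) * f w) \<partial>lborel) \<partial>lborel)"
    by (rule integral_mono[OF integrable_norm[OF i] lborel_pair.integrable_snd[OF int']])
      (unfold conv_fun_fun_def, rule integral_norm_bound)
  also have "\<dots> = (\<integral>w. (\<integral>z. cmod (g (z - w) * f w) \<partial>lborel) \<partial>lborel)"
    by (rule lborel_pair.Fubini_integral[OF int'])
  also have "\<dots> = l1 f * l1 g"
    by (simp add: norm_mult lborel_integral_translate(2)[of "\<lambda>z. cmod (g z)"] mult.commute)
  finally show "l1 (conv_fun_fun f g) \<le> l1 f * l1 g" .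
qed

lemma fourier_conv:
  fixes f g :: "complex^'n \<Rightarrow> complex"
  assumes f: "integrable lborel f" and g: "integrable lborel g"
  shows "fourier (conv_fun_fun f g) \<xi> = fourier f \<xi> * fourier g \<xi>"
proof -
  have m: "(\<lambda>(w, z). wave (- (z \<bullet> \<xi>))) \<in> borel_measurable (lborel \<Otimes>\<^sub>M lborel :: ((complex^'n) \<times> (complex^'n)) measure)"
    by measurable
  have int: "integrable (lborel \<Otimes>\<^sub>M lborel) (\<lambda>(w, z). wave (- (z \<bullet> \<xi>)) * (g (z - w) * f w))"
    using integrable_mult_unimodular[OF conv_pair_integrable[OF f g] m]
    by (simp add: wave_simps(4) case_prod_unfold)
  have inner: "(\<integral>z. wave (- (z \<bullet> \<xi>)) * (g (z - w) * f w) \<partial>lborel) = wave (- (w \<bullet> \<xi>)) * f w * fourier g \<xi>" for w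
  proof -
    have "(\<integral>z. wave (- (z \<bullet> \<xi>)) * (g (z - w) * f w) \<partial>lborel)
      = (\<integral>z. wave (- ((z + w) \<bullet> \<xi>)) * (g (z + w - w) * f w) \<partial>lborel)"
      by (rule lborel_integral_translate(1)[symmetric])
    also have "\<dots> = (\<integral>z. (wave (- (w \<bullet> \<xi>)) * f w) * (wave (- (z \<bullet> \<xi>)) * g z) \<partial>lborel)"
    proof (rule Bochner_Integration.integral_cong[OF refl])
      fix z
      have "- ((z + w) \<bullet> \<xi>) = - (w \<bullet> \<xi>) + - (z \<bullet> \<xi>)" by (simp add: inner_add_left)
      then show "wave (- ((z + w) \<bullet> \<xi>)) * (g (z + w - w) * f w) = (wave (- (w \<bullet> \<xi>)) * f w) * (wave (- (z \<bullet> \<xi>)) * g z)"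
        by (simp only: wave_simps(2) add_diff_cancel_right' mult_ac)
    qed
    finally show ?thesis unfolding fourier_wave by simp
  qed
  have "fourier (conv_fun_fun f g) \<xi> = (\<integral>z. (\<integral>w. wave (- (z \<bullet> \<xi>)) * (g (z - w) * f w) \<partial>lborel) \<partial>lborel)"
    unfolding fourier_wave conv_fun_fun_def by simp
  also have "\<dots> = (\<integral>w. (\<integral>z. wave (- (z \<bullet> \<xi>)) * (g (z - w) * f w) \<partial>lborel) \<partial>lborel)"
    by (rule lborel_pair.Fubini_integral[OF int])
  also have "\<dots> = fourier f \<xi> * fourier g \<xi>" unfolding inner by (simp add: fourier_wave)
  finally show ?thesis .
qed

lemma conv_fun_fun_bounded:
  fixes f a :: "complex^'n \<Rightarrow> complex"
  assumes f: "integrable lborel f" and a: "a \<in> borel_measurable borel" "\<And>z. cmod (a z) \<le> C"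
  shows "integrable lborel (\<lambda>w. a (z - w) * f w)" "cmod (conv_fun_fun f a z) \<le> C * l1 f"
proof -
  note [measurable] = a(1)
  have "(\<lambda>w. a (z - w)) \<in> borel_measurable lborel" by measurable
  note * = integrable_bounded_mult[OF f this a(2)]
  show "integrable lborel (\<lambda>w. a (z - w) * f w)" by (rule *)
  show "cmod (conv_fun_fun f a z) \<le> C * l1 f"
    unfolding conv_fun_fun_def by (rule order_trans[OF integral_norm_bound *(2)])
qed

lemma continuous_conv_fun_fun:
  fixes f a :: "complex^'n \<Rightarrow> complex"
  assumes f: "integrable lborel f" and a: "continuous_on UNIV a" "\<And>z. cmod (a z) \<le> C"
  shows "continuous_on UNIV (conv_fun_fun f a)"
proof (rule continuous_on_sequentiallyI)
  fix X and x :: "complex^'n" assume X: "X \<longlonglongrightarrow> x"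
  have am [measurable]: "a \<in> borel_measurable borel" by (rule borel_measurable_continuous_onI[OF a(1)])
  have [measurable]: "f \<in> borel_measurable borel" using borel_measurable_integrable[OF f] by simp
  show "(\<lambda>n. conv_fun_fun f a (X n)) \<longlonglongrightarrow> conv_fun_fun f a x"
    unfolding conv_fun_fun_def
  proof (rule integral_dominated_convergence[where w="\<lambda>w. C * cmod (f w)"])
    show "AE w in lborel. (\<lambda>n. a (X n - w) * f w) \<longlonglongrightarrow> a (x - w) * f w"
    proof (rule AE_I2)
      fix w
      have "(\<lambda>n. X n - w) \<longlonglongrightarrow> x - w" by (rule tendsto_diff[OF X tendsto_const])
      then have "(\<lambda>n. a (X n - w)) \<longlonglongrightarrow> a (x - w)" by (rule continuous_on_tendsto_compose[OF a(1)]) auto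
      then show "(\<lambda>n. a (X n - w) * f w) \<longlonglongrightarrow> a (x - w) * f w" by (rule tendsto_mult_right)
    qed
    show "AE w in lborel. norm (a (X n - w) * f w) \<le> C * cmod (f w)" for n
      unfolding norm_mult by (intro AE_I2 mult_right_mono a(2)) simp
  qed (use f in auto)
qed

lemma cbi_conv:
  assumes f: "integrable lborel f" and g: "cbi g"
  shows "cbi (conv_fun_fun f g)"
proof -
  note g' = cbiD[OF g]
  obtain C where C: "\<And>x. cmod (g x) \<le> C" using g by (auto simp: cbi_def)
  show ?thesis unfolding cbi_def
    using continuous_conv_fun_fun[OF f g'(1) C] conv_fun_fun_integrable(1)[OF f g'(2)]
      conv_fun_fun_bounded(2)[OF f g'(3) C] by blast
qed

lemma conv_fun_fun_assoc:
  fixes f g a :: "complex^'n \<Rightarrow> complex"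
  assumes f: "integrable lborel f" and g: "integrable lborel g"
    and a: "a \<in> borel_measurable borel" "\<And>z. cmod (a z) \<le> C"
  shows "conv_fun_fun (conv_fun_fun f g) a = conv_fun_fun f (conv_fun_fun g a)"
proof
  fix z
  note [measurable] = a(1)
  have m: "(\<lambda>p. a (z - snd p)) \<in> borel_measurable (lborel \<Otimes>\<^sub>M lborel :: ((complex^'n) \<times> (complex^'n)) measure)"
    by measurable
  have int: "integrable (lborel \<Otimes>\<^sub>M lborel) (\<lambda>(u, v). a (z - v) * (g (v - u) * f u))"
    using integrable_bounded_mult(1)[OF conv_pair_integrable[OF f g] m a(2)] by (simp add: case_prod_unfold)
  have "conv_fun_fun (conv_fun_fun f g) a z = (\<integral>v. (\<integral>u. a (z - v) * (g (v - u) * f u) \<partial>lborel) \<partial>lborel)"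
    unfolding conv_fun_fun_def by simp
  also have "\<dots> = (\<integral>u. (\<integral>v. a (z - v) * (g (v - u) * f u) \<partial>lborel) \<partial>lborel)"
    by (rule lborel_pair.Fubini_integral[OF int])
  also have "\<dots> = (\<integral>u. (\<integral>v. a (z - u - v) * g v \<partial>lborel) * f u \<partial>lborel)"
  proof (rule Bochner_Integration.integral_cong[OF refl])
    fix u
    have "(\<integral>v. a (z - v) * (g (v - u) * f u) \<partial>lborel) = (\<integral>v. a (z - (v + u)) * (g (v + u - u) * f u) \<partial>lborel)"
      by (rule lborel_integral_translate(1)[symmetric])
    also have "\<dots> = (\<integral>v. a (z - u - v) * g v * f u \<partial>lborel)"
      by (simp add: algebra_simps)
    finally show "(\<integral>v. a (z - v) * (g (v - u) * f u) \<partial>lborel) = (\<integral>v. a (z - u - v) * g v \<partial>lborel) * f u" by simp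
  qed
  finally show "conv_fun_fun (conv_fun_fun f g) a z = conv_fun_fun f (conv_fun_fun g a) z"
    by (simp add: conv_fun_fun_def)
qed

lemma conv_fun_fun_left_commute:
  assumes f: "integrable lborel f" and g: "integrable lborel g"
    and a: "a \<in> borel_measurable borel" "\<And>z. cmod (a z) \<le> C"
  shows "conv_fun_fun f (conv_fun_fun g a) = conv_fun_fun g (conv_fun_fun f a)"
  using conv_fun_fun_assoc[OF f g a] conv_fun_fun_assoc[OF g f a] conv_fun_fun_commute[of f g] by simp

lemma conv_fun_fun_isometry:
  fixes T :: "complex^'n \<Rightarrow> complex^'n"
  assumes T: "linear T" "\<And>x. norm (T x) = norm x" and f: "f \<in> borel_measurable borel" and a: "a \<in> borel_measurable borel"
  shows "conv_fun_fun f a (T z) = conv_fun_fun (\<lambda>w. f (T w)) (\<lambda>w. a (T w)) z"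
proof -
  note [measurable] = f a
  have "(\<integral>w. a (T z - T w) * f (T w) \<partial>lborel) = (\<integral>w. a (T z - w) * f w \<partial>lborel)"
    by (rule lborel_integral_isometry[OF T, of "\<lambda>w. a (T z - w) * f w"]) measurable
  then show ?thesis by (simp add: conv_fun_fun_def linear_diff[OF T(1)])
qed

lemma fourier_isometry:
  fixes T :: "complex^'n \<Rightarrow> complex^'n"
  assumes T: "linear T" "\<And>x. norm (T x) = norm x" and f: "f \<in> borel_measurable borel"
  shows "fourier (\<lambda>x. f (T x)) \<xi> = fourier f (T \<xi>)"
proof -
  note f[measurable]
  have T': "T x \<bullet> T \<xi> = x \<bullet> \<xi>" for x
    using orthogonal_transformation T unfolding orthogonal_transformation_def by blast
  have "(\<integral>x. wave (- (T x \<bullet> T \<xi>)) * f (T x) \<partial>lborel) = fourier f (T \<xi>)"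
    unfolding fourier_wave by (rule lborel_integral_isometry[OF T, of "\<lambda>x. wave (- (x \<bullet> T \<xi>)) * f x"]) measurable
  then show ?thesis unfolding T' fourier_wave .
qed

text \<open>Manufactures an integrable function with a prescribed transform \<open>f\<close>, which
  is how the cut-offs are obtained.\<close>

lemma fourier_inverse:
  fixes f :: "complex^'n \<Rightarrow> complex"
  assumes f: "cbi f" and F: "integrable lborel (fourier f)"
  shows "cbi (\<lambda>x. fourier f (- x))" "fourier (\<lambda>x. fourier f (- x)) = f"
proof -
  have "continuous_on UNIV (\<lambda>x. fourier f (- x))"
    by (rule continuous_on_compose2[OF continuous_fourier[OF cbiD(2)[OF f]]]) (auto intro: continuous_intros)
  moreover have "integrable lborel (\<lambda>x. fourier f (- x))"
    using lborel_integrable_translate(3)[of "fourier f" 0] F by simp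
  ultimately show "cbi (\<lambda>x. fourier f (- x))" unfolding cbi_def using cmod_fourier_le[of f] by blast
  show "fourier (\<lambda>x. fourier f (- x)) = f"
  proof
    fix \<xi>
    have "fourier (\<lambda>x. fourier f (- x)) \<xi> = (\<integral>x. wave (- ((0 - x) \<bullet> \<xi>)) * fourier f (- (0 - x)) \<partial>lborel)"
      unfolding fourier_wave[of "\<lambda>x. fourier f (- x)"] by (rule lborel_integral_translate(3)[symmetric])
    also have "\<dots> = (\<integral>x. fourier f x * wave (\<xi> \<bullet> x) \<partial>lborel)" by (simp add: inner_commute mult.commute)
    also have "\<dots> = f \<xi>" by (rule fourier_inversion[OF assms, symmetric])
    finally show "fourier (\<lambda>x. fourier f (- x)) \<xi> = f \<xi>" .
  qed
qed

lemma cbi_closed_under: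
  assumes "cbi f" "cbi g"
  shows "cbi (\<lambda>x. f x - g x)" "cbi (\<lambda>x. f x + g x)" "cbi (\<lambda>x. c * f x)"
proof -
  obtain C D where "\<And>x. cmod (f x) \<le> C" "\<And>x. cmod (g x) \<le> D" using assms by (auto simp: cbi_def)
  then have "\<forall>x. cmod (f x - g x) \<le> C + D" "\<forall>x. cmod (f x + g x) \<le> C + D" "\<forall>x. cmod (c * f x) \<le> cmod c * C"
    by (auto intro!: order_trans[OF norm_triangle_ineq4 add_mono] order_trans[OF norm_triangle_ineq add_mono] mult_left_mono simp: norm_mult)
  then show "cbi (\<lambda>x. f x - g x)" "cbi (\<lambda>x. f x + g x)" "cbi (\<lambda>x. c * f x)"
    unfolding cbi_def using assms by (auto simp: cbi_def intro!: continuous_intros)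
qed

lemma fourier_inj:
  assumes f: "cbi f" and g: "cbi g" and eq: "\<And>\<xi>. fourier f \<xi> = fourier g \<xi>"
  shows "f = g"
proof
  fix x
  have "f x - g x = 0"
    using fourier_eq_0_imp[OF cbi_closed_under(1)[OF f g]] eq by (simp add: fourier_simps(1)[OF cbiD(2)[OF f] cbiD(2)[OF g]])
  then show "f x = g x" by simp
qed

text \<open>A transform equal to 1 on the spectrum of \<open>f\<close> makes \<open>g\<close> act as
  a unit on \<open>f\<close>; integrable functions offer only such local units for
  convolution.\<close>

lemma conv_eq_self:
  assumes f: "cbi f" and g: "cbi g" and eq: "\<And>\<xi>. fourier f \<xi> \<noteq> 0 \<Longrightarrow> fourier g \<xi> = 1"
  shows "conv_fun_fun g f = f"
proof (rule fourier_inj[OF cbi_conv[OF cbiD(2)[OF g] f] f])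
  show "fourier (conv_fun_fun g f) \<xi> = fourier f \<xi>" for \<xi>
    unfolding fourier_conv[OF cbiD(2)[OF g] cbiD(2)[OF f]] using eq[of \<xi>] by (cases "fourier f \<xi> = 0") auto
qed

section \<open>Wiener's theorem\<close>

lemma integrable_indicator_complex:
  fixes B :: "(complex^'n) set"
  assumes "B \<in> sets borel" "bounded B"
  shows "integrable lborel (indicator B :: complex^'n \<Rightarrow> complex)"
proof -
  have "integrable lborel (indicator B :: complex^'n \<Rightarrow> real)"
    using assms(1) emeasure_bounded_finite[OF assms(2)] by (intro integrable_real_indicator) auto
  then have "integrable lborel (\<lambda>x. complex_of_real (indicator B x))" by (rule integrable_of_real)
  moreover have "(\<lambda>x. complex_of_real (indicator B x)) = indicator B" by (auto simp: fun_eq_iff indicator_def)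
  ultimately show ?thesis by (simp only:)
qed

text \<open>The support has radius \<open>s / 2\<close>, so that the convolution of two tents lives
  in the ball of radius \<open>s\<close>.\<close>

definition tent :: "real \<Rightarrow> complex^'n \<Rightarrow> complex" where
  "tent s x = complex_of_real (max 0 (s - 2 * norm x))"

lemma cbi_tent: "s > 0 \<Longrightarrow> cbi (tent s :: complex^'n \<Rightarrow> complex)"
proof -
  assume s: "s > 0"
  have c: "continuous_on UNIV (tent s :: complex^'n \<Rightarrow> complex)"
    unfolding tent_def[abs_def] by (intro continuous_intros)
  have "integrable lborel (\<lambda>x :: complex^'n. indicator (cball 0 s) x *\<^sub>R tent s x)"
    by (rule borel_integrable_compact[OF compact_cball continuous_on_subset[OF c]]) simp
  moreover have "(\<lambda>x. indicator (cball 0 s) x *\<^sub>R tent s x) = (tent s :: complex^'n \<Rightarrow> complex)"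
    using s by (auto simp: fun_eq_iff tent_def indicator_def dist_norm)
  moreover have "cmod (tent s x) \<le> s" for x :: "complex^'n"
    using s unfolding tent_def norm_of_real by auto
  ultimately show ?thesis unfolding cbi_def using c by metis
qed

text \<open>Being the convolution of a function with itself, it has the square of a square
  integrable function as transform, and this is integrable. The constant normalizes the integral to
  1.\<close>

definition bump :: "real \<Rightarrow> complex^'n \<Rightarrow> complex" where
  "bump s x = (1 / (fourier (tent s :: complex^'n \<Rightarrow> complex) 0)\<^sup>2) * conv_fun_fun (tent s) (tent s) x"

lemma fourier_at_0: "fourier f 0 = (\<integral>x. f x \<partial>lborel)"
  by (simp add: fourier_wave wave_simps(1))

text \<open>The tent is nonnegative, so its transform at 0 is its L1 norm. If that were 0 the whole
  transform would vanish, and with it the tent.\<close>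

lemma fourier_tent_0: "s > 0 \<Longrightarrow> fourier (tent s :: complex^'n \<Rightarrow> complex) 0 \<noteq> 0"
proof
  assume s: "s > 0" and 0: "fourier (tent s :: complex^'n \<Rightarrow> complex) 0 = 0"
  have "tent s x = complex_of_real (cmod (tent s x))" for x :: "complex^'n" unfolding tent_def norm_of_real by simp
  then have "complex_of_real (l1 (tent s :: complex^'n \<Rightarrow> complex)) = 0"
    using 0 unfolding fourier_at_0 integral_complex_of_real[symmetric] by presburger
  then have "l1 (tent s :: complex^'n \<Rightarrow> complex) = 0" unfolding of_real_eq_0_iff .
  then have "fourier (tent s) \<xi> = 0" for \<xi> :: "complex^'n"
    using cmod_fourier_le[of "tent s" \<xi>] by simp
  from fourier_eq_0_imp[OF cbi_tent[OF s] this, of 0] show False using s by (simp add: tent_def)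
qed

lemma bump:
  assumes s: "s > 0"
  shows cbi_bump: "cbi (bump s :: complex^'n \<Rightarrow> complex)"
    and bump_eq_0: "s \<le> norm u \<Longrightarrow> bump s (u :: complex^'n) = 0"
    and integral_bump: "(\<integral>x. bump s (x :: complex^'n) \<partial>lborel) = 1"
    and integrable_fourier_bump: "integrable lborel (fourier (bump s :: complex^'n \<Rightarrow> complex))"
    and bump_isometry: "linear T \<Longrightarrow> (\<And>x :: complex^'n. norm (T x) = norm x) \<Longrightarrow> bump s (T x :: complex^'n) = bump s x"
proof -
  note t = cbi_tent[OF s, where 'n='n] and t' = cbiD[OF cbi_tent[OF s, where 'n='n]]
  let ?v = "fourier (tent s :: complex^'n \<Rightarrow> complex) 0"
  show "cbi (bump s :: complex^'n \<Rightarrow> complex)"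
    unfolding bump_def[abs_def] by (intro cbi_closed_under(3)[OF _ t] cbi_conv t t')
  show "bump s u = 0" if u: "s \<le> norm u" for u :: "complex^'n"
  proof -
    have z: "tent s (u - w) * tent s w = 0" for w
    proof -
      have "norm u \<le> norm (u - w) + norm w" by norm
      then have "s \<le> 2 * norm (u - w) \<or> s \<le> 2 * norm w" using u by linarith
      then show ?thesis by (auto simp: tent_def)
    qed
    show ?thesis unfolding bump_def conv_fun_fun_def z by simp
  qed
  have F: "fourier (bump s) \<xi> = (1 / ?v\<^sup>2) * (fourier (tent s) \<xi>)\<^sup>2" for \<xi> :: "complex^'n"
    unfolding bump_def[abs_def]
    by (subst fourier_simps(3)[OF conv_fun_fun_integrable(1) t'(2)])
      (simp_all add: t' fourier_conv power2_eq_square)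
  show "(\<integral>x. bump s (x :: complex^'n) \<partial>lborel) = 1"
    unfolding fourier_at_0[symmetric] F using fourier_tent_0[OF s, where 'n='n] by simp
  have m: "(\<lambda>\<xi> :: complex^'n. (fourier (tent s) \<xi>)\<^sup>2) \<in> borel_measurable lborel"
    using borel_measurable_continuous_onI[OF continuous_fourier[OF t'(2)]] by measurable
  have "integrable lborel (\<lambda>\<xi> :: complex^'n. (fourier (tent s) \<xi>)\<^sup>2)"
    by (rule Bochner_Integration.integrable_bound[OF fourier_square_integrable[OF t] m]) (simp add: norm_power)
  then have "integrable lborel (\<lambda>\<xi> :: complex^'n. (1 / ?v\<^sup>2) * (fourier (tent s) \<xi>)\<^sup>2)"
    by (rule integrable_mult_right)
  then show "integrable lborel (fourier (bump s :: complex^'n \<Rightarrow> complex))"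
    unfolding F[symmetric] .
  show "bump s (T x) = bump s x" if T: "linear T" "\<And>x. norm (T x) = norm x" for T :: "complex^'n \<Rightarrow> complex^'n" and x :: "complex^'n"
  proof -
    have "(\<lambda>w. tent s (T w)) = (tent s :: complex^'n \<Rightarrow> complex)" by (simp add: fun_eq_iff tent_def T(2))
    then show ?thesis unfolding bump_def conv_fun_fun_isometry[OF T t'(3) t'(3)] by simp
  qed
qed

text \<open>The function whose Fourier transform is the indicator of \<open>B\<close> mollified at
  scale \<open>s\<close>, written out by the inversion formula.\<close>

definition cut :: "real \<Rightarrow> (complex^'n) set \<Rightarrow> complex^'n \<Rightarrow> complex" where
  "cut s B x = fourier (conv_fun_fun (indicator B) (bump s)) (- x)"

lemma cut:
  fixes B :: "(complex^'n) set"
  assumes s: "s > 0" and B: "B \<in> sets borel" "bounded B"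
  shows cbi_cut: "cbi (cut s B)"
    and fourier_cut: "fourier (cut s B) \<xi> = conv_fun_fun (indicator B) (bump s) \<xi>"
    and fourier_cut_1: "ball \<xi> s \<subseteq> B \<Longrightarrow> fourier (cut s B) \<xi> = 1"
    and fourier_cut_0: "ball \<xi> s \<inter> B = {} \<Longrightarrow> fourier (cut s B) \<xi> = 0"
proof -
  note b = cbi_bump[OF s, where 'n='n] and b' = cbiD[OF cbi_bump[OF s, where 'n='n]]
  have i: "integrable lborel (indicator B :: _ \<Rightarrow> complex)"
    by (rule integrable_indicator_complex[OF B])
  note e = cbi_conv[OF i b]
  have F: "integrable lborel (fourier (conv_fun_fun (indicator B) (bump s)))"
  proof -
    have "(\<lambda>\<xi>. fourier (indicator B) \<xi> * fourier (bump s) \<xi>) = fourier (conv_fun_fun (indicator B) (bump s))"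
      by (simp add: fun_eq_iff fourier_conv[OF i b'(2)])
    moreover have "integrable lborel (\<lambda>\<xi>. fourier (indicator B) \<xi> * fourier (bump s) (\<xi> :: complex^'n))"
      using borel_measurable_continuous_onI[OF continuous_fourier[OF i]]
      by (intro integrable_bounded_mult(1)[OF integrable_fourier_bump[OF s] _ cmod_fourier_le]) simp
    ultimately show ?thesis by simp
  qed
  show "cbi (cut s B)" and f: "fourier (cut s B) \<xi> = conv_fun_fun (indicator B) (bump s) \<xi>"
    using fourier_inverse[OF e F] unfolding cut_def[abs_def] by simp_all
  have z: "bump s (\<xi> - w) = 0" if "w \<notin> ball \<xi> s" for w
    by (rule bump_eq_0[OF s]) (use that in \<open>simp add: dist_norm\<close>)
  show "fourier (cut s B) \<xi> = 1" if "ball \<xi> s \<subseteq> B"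
  proof -
    have e: "bump s (\<xi> - w) * indicator B w = bump s (\<xi> - w)" for w
      using z[of w] that by (cases "w \<in> B"; cases "w \<in> ball \<xi> s") (auto simp del: mem_ball)
    show ?thesis unfolding f conv_fun_fun_def e lborel_integral_translate(3) integral_bump[OF s] ..
  qed
  show "fourier (cut s B) \<xi> = 0" if "ball \<xi> s \<inter> B = {}"
  proof -
    have e: "bump s (\<xi> - w) * indicator B w = 0" for w
      using z[of w] that by (cases "w \<in> B"; cases "w \<in> ball \<xi> s") (auto simp del: mem_ball)
    show ?thesis unfolding f conv_fun_fun_def e by simp
  qed
qed

text \<open>Indicators of disjoint sets add and mollification is linear, so a partition into Borel
  sets becomes a partition of unity on the Fourier side.\<close>

lemma cut_Un:
  fixes A B :: "(complex^'n) set"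
  assumes s: "s > 0" and A: "A \<in> sets borel" "bounded A" and B: "B \<in> sets borel" "bounded B" and AB: "A \<inter> B = {}"
  shows "cut s (A \<union> B) = (\<lambda>x. cut s A x + cut s B x)"
proof (rule fourier_inj)
  have U: "A \<union> B \<in> sets borel" "bounded (A \<union> B)" using A B by auto
  note cA = cbi_cut[OF s A] and cB = cbi_cut[OF s B]
  show "cbi (cut s (A \<union> B))" by (rule cbi_cut[OF s U])
  show "cbi (\<lambda>x. cut s A x + cut s B x)" by (rule cbi_closed_under(2)[OF cA cB])
  fix \<xi> :: "complex^'n"
  obtain C where C: "\<And>x. cmod (bump s (x :: complex^'n)) \<le> C" using cbi_bump[OF s, where 'n='n] by (auto simp: cbi_def)
  have i: "integrable lborel (indicator A :: _ \<Rightarrow> complex)" "integrable lborel (indicator B :: _ \<Rightarrow> complex)"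
    by (rule integrable_indicator_complex[OF A], rule integrable_indicator_complex[OF B])
  note j = conv_fun_fun_bounded(1)[OF _ cbiD(3)[OF cbi_bump[OF s]] C]
  have "(indicator (A \<union> B) w :: complex) = indicator A w + indicator B w" for w
    using AB by (auto simp: indicator_def)
  then show "fourier (cut s (A \<union> B)) \<xi> = fourier (\<lambda>x. cut s A x + cut s B x) \<xi>"
    unfolding fourier_simps(2)[OF cbiD(2)[OF cA] cbiD(2)[OF cB]] fourier_cut[OF s A] fourier_cut[OF s B] fourier_cut[OF s U]
      conv_fun_fun_def by (simp add: distrib_left j i)
qed

lemma cut_isometry:
  fixes T :: "complex^'n \<Rightarrow> complex^'n"
  assumes T: "linear T" "\<And>x. norm (T x) = norm x" and s: "s > 0"
  shows "cut s (cball 0 r) (T x) = cut s (cball 0 r) x"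
proof -
  have m: "(indicator (cball 0 r) :: complex^'n \<Rightarrow> complex) \<in> borel_measurable borel"
    by (intro borel_measurable_indicator) simp
  note b = cbiD[OF cbi_bump[OF s, where 'n='n]]
  have i: "integrable lborel (indicator (cball 0 r) :: complex^'n \<Rightarrow> complex)"
    by (rule integrable_indicator_complex) auto
  let ?e = "conv_fun_fun (indicator (cball 0 r)) (bump s) :: complex^'n \<Rightarrow> complex"
  have e: "?e \<in> borel_measurable borel" by (rule cbiD(3)[OF cbi_conv[OF i cbi_bump[OF s]]])
  have "(\<lambda>x. indicator (cball 0 r) (T x)) = (indicator (cball 0 r) :: complex^'n \<Rightarrow> complex)"
    by (simp add: indicator_def T(2) fun_eq_iff)
  then have "(\<lambda>x. ?e (T x)) = ?e"
    unfolding conv_fun_fun_isometry[OF T m b(3)] bump_isometry[OF s T] by simp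
  then show ?thesis
    using fourier_isometry[OF T e, of "- x"] by (simp add: cut_def linear_neg[OF T(1)])
qed

text \<open>Modulation and dilation with preserved L1 norm: on the Fourier side \<open>f\<close> is
  dilated by \<open>c\<close> and recentred at \<open>\<xi>\<close>.\<close>

definition modul :: "real \<Rightarrow> complex^'n \<Rightarrow> (complex^'n \<Rightarrow> complex) \<Rightarrow> complex^'n \<Rightarrow> complex" where
  "modul c \<xi> f x = complex_of_real (c ^ DIM(complex^'n)) * wave (x \<bullet> \<xi>) * f (c *\<^sub>R x)"

lemma modul:
  fixes f :: "complex^'n \<Rightarrow> complex"
  assumes f: "cbi f" and c: "c > 0"
  shows cbi_modul: "cbi (modul c \<xi> f)"
    and fourier_modul: "fourier (modul c \<xi> f) \<eta> = fourier f ((1 / c) *\<^sub>R (\<eta> - \<xi>))"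
    and l1_modul: "l1 (modul c \<xi> f) = l1 f"
proof -
  note f' = cbiD[OF f]
  obtain C where C: "\<And>x. cmod (f x) \<le> C" using f by (auto simp: cbi_def)
  have cont: "continuous_on UNIV (modul c \<xi> f)" unfolding modul_def[abs_def]
    by (intro continuous_intros continuous_on_compose2[OF f'(1)]) auto
  have i: "integrable lborel (\<lambda>x. f (c *\<^sub>R x))"
    using lborel_integrable_affine[OF f'(2), of c 0] c by simp
  have "integrable lborel (modul c \<xi> f)"
    unfolding modul_def[abs_def] mult.assoc
    by (intro integrable_mult_right integrable_mult_unimodular i) (auto simp: wave_simps(4))
  moreover have "cmod (modul c \<xi> f x) \<le> c ^ DIM(complex^'n) * C" for x
    using c C[of "c *\<^sub>R x"] by (simp add: modul_def norm_mult norm_power wave_simps(4) mult_left_mono)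
  ultimately show "cbi (modul c \<xi> f)" unfolding cbi_def using cont by blast
  have "l1 f = \<bar>c\<bar> ^ DIM(complex^'n) *\<^sub>R (\<integral>x. cmod (f (0 + c *\<^sub>R x)) \<partial>lborel)"
    by (rule lborel_integral_affine) (use c in simp)
  then show "l1 (modul c \<xi> f) = l1 f"
    using c by (simp add: modul_def norm_mult norm_power wave_simps(4))
  have "fourier f ((1 / c) *\<^sub>R (\<eta> - \<xi>))
      = \<bar>c\<bar> ^ DIM(complex^'n) *\<^sub>R (\<integral>x. wave (- ((0 + c *\<^sub>R x) \<bullet> ((1 / c) *\<^sub>R (\<eta> - \<xi>)))) * f (0 + c *\<^sub>R x) \<partial>lborel)"
    unfolding fourier_wave by (rule lborel_integral_affine) (use c in simp)
  also have "\<dots> = (\<integral>x. complex_of_real (c ^ DIM(complex^'n)) * (wave (- (x \<bullet> (\<eta> - \<xi>))) * f (c *\<^sub>R x)) \<partial>lborel)"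
    using c by (simp add: scaleR_conv_of_real[where 'a=complex])
  also have "\<dots> = (\<integral>x. wave (- (x \<bullet> \<eta>)) * modul c \<xi> f x \<partial>lborel)"
  proof (rule Bochner_Integration.integral_cong[OF refl])
    fix x
    have "- (x \<bullet> (\<eta> - \<xi>)) = - (x \<bullet> \<eta>) + x \<bullet> \<xi>" by (simp add: inner_diff_right)
    then show "complex_of_real (c ^ DIM(complex^'n)) * (wave (- (x \<bullet> (\<eta> - \<xi>))) * f (c *\<^sub>R x)) = wave (- (x \<bullet> \<eta>)) * modul c \<xi> f x"
      unfolding modul_def by (simp only: wave_simps(2) mult_ac)
  qed
  finally show "fourier (modul c \<xi> f) \<eta> = fourier f ((1 / c) *\<^sub>R (\<eta> - \<xi>))" by (simp add: fourier_wave)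
qed

section \<open>Local division and its globalization\<close>

text \<open>Translates converge pointwise by continuity and have equal L1 norms, so Scheffe's lemma
  applies.\<close>

lemma translation_L1_continuous:
  fixes f :: "complex^'n \<Rightarrow> complex"
  assumes f: "cbi f" and u: "u \<longlonglongrightarrow> 0"
  shows "(\<lambda>n. \<integral>x. cmod (f (x - u n) - f x) \<partial>lborel) \<longlonglongrightarrow> 0"
proof -
  note f' = cbiD[OF f]
  note [measurable] = f'(3)
  have i: "integrable lborel (\<lambda>x. f (x - u n) - f x)" for n
    using lborel_integrable_translate(2)[of f] f'(2) by simp
  have "(\<lambda>n. \<integral>\<^sup>+x. norm (f (x - u n) - f x) \<partial>lborel) \<longlonglongrightarrow> 0"
  proof (rule Scheffe_lemma2[OF _ f'(2)])
    show "AE x in lborel. (\<lambda>n. f (x - u n)) \<longlonglongrightarrow> f x"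
    proof (rule AE_I2)
      fix x
      have "(\<lambda>n. x - u n) \<longlonglongrightarrow> x - 0" by (rule tendsto_diff[OF tendsto_const u])
      then show "(\<lambda>n. f (x - u n)) \<longlonglongrightarrow> f x" by (intro continuous_on_tendsto_compose[OF f'(1)]) auto
    qed
    show "(\<integral>\<^sup>+x. norm (f (x - u n)) \<partial>lborel) \<le> (\<integral>\<^sup>+x. norm (f x) \<partial>lborel)" for n
      by (subst nn_integral_lborel_translate(2)[of "\<lambda>x. ennreal (norm (f x))"]) measurable
  qed measurable
  then have "(\<lambda>n. ennreal (\<integral>x. cmod (f (x - u n) - f x) \<partial>lborel)) \<longlonglongrightarrow> ennreal 0"
    by (subst (asm) nn_integral_eq_integral[OF integrable_norm[OF i]]) auto
  then show ?thesis by (subst (asm) tendsto_ennreal_iff) (auto intro: always_eventually integral_nonneg_AE)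
qed

text \<open>A widely spread function changes under translation by \<open>y\<close> almost only by
  the phase of its modulation. Averaging against \<open>\<psi>\<close> turns these phases into
  \<open>fourier \<psi> \<xi>\<close>. The bound \<open>K n\<close> is the same for all
  \<open>\<xi>\<close>, and it is this uniformity that a compactness argument can use.\<close>

lemma conv_modul_approx:
  fixes \<psi> f :: "complex^'n \<Rightarrow> complex"
  assumes \<psi>: "integrable lborel \<psi>" and f: "cbi f"
  obtains K where "K \<longlonglongrightarrow> 0"
    "\<And>n \<xi>. l1 (\<lambda>x. conv_fun_fun \<psi> (modul (1 / real (Suc n)) \<xi> f) x
        - fourier \<psi> \<xi> * modul (1 / real (Suc n)) \<xi> f x) \<le> K n"
proof
  note f' = cbiD[OF f]
  \<comment> \<open>The L1 modulus of continuity of \<open>f\<close>. It tends to 0 at the origin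
    and never exceeds twice the L1 norm, as dominated convergence requires.\<close>
  define \<omega> where "\<omega> u = (\<integral>x. cmod (f (x - u) - f x) \<partial>lborel)" for u
  define c where "c n = 1 / real (Suc n)" for n
  have c: "c n > 0" for n by (simp add: c_def)
  have c0: "c \<longlonglongrightarrow> 0" unfolding c_def by real_asymp
  have [measurable]: "\<psi> \<in> borel_measurable borel" "f \<in> borel_measurable borel"
    using borel_measurable_integrable[OF \<psi>] f'(3) by simp_all
  have \<omega>m [measurable]: "\<omega> \<in> borel_measurable borel" unfolding \<omega>_def[abs_def] by measurable
  have fi: "integrable lborel (\<lambda>x. f (x - u))" for u
    using lborel_integrable_translate(2)[of f] f'(2) by simp
  have \<omega>le: "0 \<le> \<omega> u" "\<omega> u \<le> 2 * l1 f" for u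
  proof -
    show "0 \<le> \<omega> u" by (simp add: \<omega>_def integral_nonneg_AE)
    have "\<omega> u \<le> (\<integral>x. cmod (f (x - u)) + cmod (f x) \<partial>lborel)"
      unfolding \<omega>_def by (rule integral_mono) (use fi f'(2) norm_triangle_ineq4 in auto)
    also have "\<dots> = 2 * l1 f" using fi f'(2) by (simp add: lborel_integral_translate(2)[of "\<lambda>x. cmod (f x)"])
    finally show "\<omega> u \<le> 2 * l1 f" .
  qed
  let ?K = "\<lambda>n. \<integral>y. cmod (\<psi> y) * \<omega> (c n *\<^sub>R y) \<partial>lborel"
  have "?K \<longlonglongrightarrow> (\<integral>y. 0 \<partial>(lborel :: (complex^'n) measure))"
  proof (rule integral_dominated_convergence[where w="\<lambda>y. cmod (\<psi> y) * (2 * l1 f)"])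
    show "AE y in lborel. (\<lambda>n. cmod (\<psi> y) * \<omega> (c n *\<^sub>R y)) \<longlonglongrightarrow> 0"
    proof (rule AE_I2)
      fix y :: "complex^'n"
      have "(\<lambda>n. c n *\<^sub>R y) \<longlonglongrightarrow> 0 *\<^sub>R y" by (rule tendsto_scaleR[OF c0 tendsto_const])
      then have "(\<lambda>n. \<omega> (c n *\<^sub>R y)) \<longlonglongrightarrow> 0"
        unfolding \<omega>_def by (intro translation_L1_continuous[OF f]) simp
      then show "(\<lambda>n. cmod (\<psi> y) * \<omega> (c n *\<^sub>R y)) \<longlonglongrightarrow> 0" by (rule tendsto_mult_right_zero)
    qed
    show "AE y in lborel. norm (cmod (\<psi> y) * \<omega> (c n *\<^sub>R y)) \<le> cmod (\<psi> y) * (2 * l1 f)" for n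
      using \<omega>le by (intro AE_I2) (simp add: abs_mult mult_left_mono)
  qed (use \<psi> in \<open>auto intro: integrable_norm\<close>)
  then show "?K \<longlonglongrightarrow> 0" by simp
  fix n \<xi>
  let ?V = "modul (c n) \<xi> f"
  note V = cbi_modul[OF f c, of n \<xi>]
  note V' = cbiD[OF V] and l1V = l1_modul[OF f c, of n \<xi>]
  note [measurable] = V'(3)
  let ?d = "\<lambda>x y. (?V (x - y) - wave (- (y \<bullet> \<xi>)) * ?V x) * \<psi> y"
  have i1: "integrable (lborel \<Otimes>\<^sub>M lborel) (\<lambda>(y, x). ?V (x - y) * \<psi> y)" by (rule conv_pair_integrable[OF \<psi> V'(2)])
  have m: "(\<lambda>p. wave (- (fst p \<bullet> \<xi>))) \<in> borel_measurable (lborel \<Otimes>\<^sub>M lborel :: ((complex^'n) \<times> (complex^'n)) measure)" by measurable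
  have i2: "integrable (lborel \<Otimes>\<^sub>M lborel) (\<lambda>(y, x). wave (- (y \<bullet> \<xi>)) * ?V x * \<psi> y)"
    using pair_product_integrable[OF \<psi> V'(2) m] by (simp add: wave_simps(4) mult_ac)
  have int: "integrable (lborel \<Otimes>\<^sub>M lborel) (\<lambda>(y, x). ?d x y)"
    using Bochner_Integration.integrable_diff[OF i1 i2] by (simp add: case_prod_unfold left_diff_distrib)
  have int': "integrable (lborel \<Otimes>\<^sub>M lborel) (\<lambda>(y, x). cmod (?d x y))"
    using integrable_norm[OF int] by (simp add: case_prod_unfold)
  obtain C where C: "\<And>x. cmod (?V x) \<le> C" using V by (auto simp: cbi_def)
  have eq: "conv_fun_fun \<psi> ?V x - fourier \<psi> \<xi> * ?V x = (\<integral>y. ?d x y \<partial>lborel)" for x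
  proof -
    have "(\<integral>y. ?d x y \<partial>lborel) = (\<integral>y. ?V (x - y) * \<psi> y - (wave (- (y \<bullet> \<xi>)) * \<psi> y) * ?V x \<partial>lborel)"
      by (simp add: algebra_simps)
    also have "\<dots> = conv_fun_fun \<psi> ?V x - fourier \<psi> \<xi> * ?V x"
      using conv_fun_fun_bounded(1)[OF \<psi> V'(3) C] wave_integrable[OF \<psi>]
      by (simp add: conv_fun_fun_def fourier_wave)
    finally show ?thesis ..
  qed
  have inner: "(\<integral>x. cmod (?d x y) \<partial>lborel) = cmod (\<psi> y) * \<omega> (c n *\<^sub>R y)" for y
  proof -
    have d: "cmod (?d x y) = cmod (\<psi> y) * (c n ^ DIM(complex^'n) * cmod (f (0 + c n *\<^sub>R x - c n *\<^sub>R y) - f (0 + c n *\<^sub>R x)))" for x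
    proof -
      have "(x - y) \<bullet> \<xi> = - (y \<bullet> \<xi>) + x \<bullet> \<xi>" by (simp add: inner_diff_left)
      then have "wave ((x - y) \<bullet> \<xi>) = wave (- (y \<bullet> \<xi>)) * wave (x \<bullet> \<xi>)" by (simp only: wave_simps(2))
      then have "?d x y = complex_of_real (c n ^ DIM(complex^'n)) * (wave (- (y \<bullet> \<xi>)) * (wave (x \<bullet> \<xi>) * ((f (0 + c n *\<^sub>R x - c n *\<^sub>R y) - f (0 + c n *\<^sub>R x)) * \<psi> y)))"
        by (simp add: modul_def algebra_simps)
      from arg_cong[OF this, of cmod] show ?thesis
        using less_imp_le[OF c[of n]] unfolding norm_mult[of "complex_of_real _"] norm_mult[of "wave _"] norm_mult[of _ "\<psi> y"] wave_simps(4)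
        by (simp add: norm_power mult_ac)
    qed
    have "\<omega> (c n *\<^sub>R y) = \<bar>c n\<bar> ^ DIM(complex^'n) *\<^sub>R (\<integral>x. cmod (f (0 + c n *\<^sub>R x - c n *\<^sub>R y) - f (0 + c n *\<^sub>R x)) \<partial>lborel)"
      unfolding \<omega>_def by (rule lborel_integral_affine) (use c[of n] in simp)
    then show ?thesis unfolding d using less_imp_le[OF c[of n]] by simp
  qed
  have "l1 (\<lambda>x. conv_fun_fun \<psi> ?V x - fourier \<psi> \<xi> * ?V x) \<le> (\<integral>x. (\<integral>y. cmod (?d x y) \<partial>lborel) \<partial>lborel)"
    unfolding eq by (rule integral_mono[OF integrable_norm[OF lborel_pair.integrable_snd[OF int]] lborel_pair.integrable_snd[OF int']])
      (rule integral_norm_bound)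
  also have "\<dots> = (\<integral>y. (\<integral>x. cmod (?d x y) \<partial>lborel) \<partial>lborel)"
    by (rule lborel_pair.Fubini_integral[OF int'])
  also have "\<dots> = ?K n" unfolding inner ..
  finally show "l1 (\<lambda>x. conv_fun_fun \<psi> (modul (1 / real (Suc n)) \<xi> f) x
        - fourier \<psi> \<xi> * modul (1 / real (Suc n)) \<xi> f x) \<le> ?K n" unfolding c_def .
qed

lemma l1_nonneg: "0 \<le> l1 f"
  by (simp add: integral_nonneg_AE)

text \<open>On functions fixed by \<open>V\<close>, convolution with \<open>\<psi>\<close> is
  \<open>c\<close> plus convolution with the error \<open>E\<close>. As the L1 norm of
  \<open>E\<close> is below \<open>cmod c\<close>, the Neumann series of this operator applied to
  \<open>\<phi>\<close> converges and gives the quotient \<open>h\<close>.\<close>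

lemma wiener_local:
  fixes \<psi> V \<phi> :: "complex^'n \<Rightarrow> complex"
  assumes \<psi>: "integrable lborel \<psi>" and V: "cbi V" and \<phi>: "cbi \<phi>" "conv_fun_fun V \<phi> = \<phi>"
    and small: "l1 (\<lambda>x. conv_fun_fun \<psi> V x - c * V x) < cmod c"
  obtains h where "cbi h" "conv_fun_fun \<psi> h = \<phi>"
proof -
  define E where "E x = conv_fun_fun \<psi> V x - c * V x" for x
  define g where "g k = ((\<lambda>f x. (- 1 / c) * conv_fun_fun E f x) ^^ k) \<phi>" for k
  have g0: "g 0 = \<phi>" and gS: "g (Suc k) = (\<lambda>x. (- 1 / c) * conv_fun_fun E (g k) x)" for k by (simp_all add: g_def)
  have c: "c \<noteq> 0" using le_less_trans[OF l1_nonneg small] by simp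
  have Ei: "integrable lborel E"
    unfolding E_def by (intro Bochner_Integration.integrable_diff integrable_mult_right conv_fun_fun_integrable(1) \<psi> cbiD(2)[OF V])
  define q where "q = l1 E / cmod c"
  have q: "0 \<le> q" "q < 1" using small c l1_nonneg[of E] by (simp_all add: q_def E_def)
  obtain C where C: "\<And>x. cmod (\<phi> x) \<le> C" using \<phi>(1) by (auto simp: cbi_def)
  \<comment> \<open>One ratio \<open>q\<close> governs both the supremum and the L1 norm, which
    keeps the sum of the series in \<open>cbi\<close>. Convolutions commute, so \<open>V\<close>
    fixes every term.\<close>
  have gk: "cbi (g k) \<and> (\<forall>x. cmod (g k x) \<le> q ^ k * C) \<and> l1 (g k) \<le> q ^ k * l1 \<phi> \<and> conv_fun_fun V (g k) = g k" for k
  proof (induction k)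
    case 0 then show ?case using \<phi> C by (simp add: g0)
  next
    case (Suc k)
    then have k: "cbi (g k)" "\<And>x. cmod (g k x) \<le> q ^ k * C" "l1 (g k) \<le> q ^ k * l1 \<phi>" "conv_fun_fun V (g k) = g k" by auto
    note k' = cbiD[OF k(1)]
    have "cmod (g (Suc k) x) \<le> q ^ Suc k * C" for x
    proof -
      have "cmod (conv_fun_fun E (g k) x) \<le> (q ^ k * C) * l1 E" by (rule conv_fun_fun_bounded(2)[OF Ei k'(3) k(2)])
      then have "cmod (conv_fun_fun E (g k) x) / cmod c \<le> (q ^ k * C) * l1 E / cmod c" by (rule divide_right_mono) simp
      then show ?thesis unfolding gS by (simp add: norm_mult norm_divide q_def mult_ac)
    qed
    moreover have "l1 (g (Suc k)) \<le> q ^ Suc k * l1 \<phi>"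
    proof -
      have "l1 (conv_fun_fun E (g k)) \<le> l1 E * l1 (g k)" by (rule conv_fun_fun_integrable(2)[OF Ei k'(2)])
      also have "\<dots> \<le> l1 E * (q ^ k * l1 \<phi>)" by (rule mult_left_mono[OF k(3) l1_nonneg])
      finally have "l1 (conv_fun_fun E (g k)) / cmod c \<le> l1 E * (q ^ k * l1 \<phi>) / cmod c" by (rule divide_right_mono) simp
      then show ?thesis unfolding gS by (simp add: norm_mult norm_divide q_def mult_ac)
    qed
    moreover have "conv_fun_fun V (g (Suc k)) = g (Suc k)"
    proof -
      have "conv_fun_fun V (g (Suc k)) = (\<lambda>x. (- 1 / c) * conv_fun_fun V (conv_fun_fun E (g k)) x)"
        unfolding gS conv_fun_fun_def[of V] mult.assoc by simp
      also have "conv_fun_fun V (conv_fun_fun E (g k)) = conv_fun_fun E (g k)"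
        using conv_fun_fun_left_commute[OF cbiD(2)[OF V] Ei k'(3) k(2)] k(4) by simp
      finally show ?thesis by (simp add: gS)
    qed
    ultimately show ?case using cbi_closed_under(3)[OF cbi_conv[OF Ei k(1)] k(1), of "- 1 / c"] by (simp add: gS)
  qed
  have gC: "cmod (g k x) \<le> q ^ k * C" for k x using gk by blast
  have sq: "summable (\<lambda>k. q ^ k * r)" for r using q by (intro summable_mult2 summable_geometric) simp
  have sg: "summable (\<lambda>k. cmod (g k x))" for x
    by (rule summable_comparison_test'[OF sq[of C], of 0]) (use gC in simp)
  define H where "H x = (\<Sum>k. g k x)" for x
  have H: "(\<lambda>k. g k x) sums H x" for x
    unfolding H_def by (rule summable_sums[OF summable_norm_cancel[OF sg]])
  have "cbi H"
  proof -
    have "uniform_limit UNIV (\<lambda>n x. \<Sum>k<n. g k x) H sequentially"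
      unfolding H_def[abs_def] by (rule Weierstrass_m_test[OF gC sq])
    then have "continuous_on UNIV H"
      by (rule uniform_limit_theorem[rotated]) (use gk in \<open>auto intro!: always_eventually continuous_on_sum simp: cbi_def\<close>)
    moreover have "integrable lborel H"
      by (rule integral_sums(1)[OF _ _ sq[of "l1 \<phi>"] sg H]) (use gk in \<open>auto simp: cbi_def\<close>)
    moreover have "cmod (H x) \<le> (\<Sum>k. q ^ k * C)" for x
      unfolding H_def by (rule norm_suminf_le[OF gC sq])
    ultimately show ?thesis unfolding cbi_def by blast
  qed
  then have cbi: "cbi (\<lambda>x. (1 / c) * H x)" by (rule cbi_closed_under(3)) (rule V)
  have "conv_fun_fun \<psi> (\<lambda>x. (1 / c) * H x) x = \<phi> x" for x
  proof -
    have step: "conv_fun_fun \<psi> (g k) x = c * g k x - c * g (Suc k) x" for k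
    proof -
      have k: "cbi (g k)" "conv_fun_fun V (g k) = g k" using gk by auto
      note k' = cbiD[OF k(1)]
      have "conv_fun_fun \<psi> (g k) = conv_fun_fun (conv_fun_fun \<psi> V) (g k)"
        using conv_fun_fun_assoc[OF \<psi> cbiD(2)[OF V] k'(3) gC] k(2) by simp
      also have "conv_fun_fun \<psi> V = (\<lambda>x. E x + c * V x)" by (simp add: E_def fun_eq_iff)
      finally have "conv_fun_fun \<psi> (g k) x = conv_fun_fun (\<lambda>x. E x + c * V x) (g k) x" by (rule fun_cong)
      also have "conv_fun_fun (\<lambda>x. E x + c * V x) (g k) x = conv_fun_fun E (g k) x + c * conv_fun_fun V (g k) x"
        using conv_fun_fun_bounded(1)[OF Ei k'(3) gC] conv_fun_fun_bounded(1)[OF cbiD(2)[OF V] k'(3) gC]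
        by (simp add: conv_fun_fun_def distrib_left mult.left_commute[of _ c])
      finally show ?thesis using c by (simp add: gS k(2))
    qed
    have "(\<lambda>k. \<integral>w. g k (x - w) * \<psi> w \<partial>lborel) sums (\<integral>w. H (x - w) * \<psi> w \<partial>lborel)"
    proof (rule integral_sums(2)[OF _ _ sq[of "C * l1 \<psi>"]])
      fix k
      have gm: "g k \<in> borel_measurable borel" using gk cbiD(3) by blast
      note [measurable] = this
      have m: "(\<lambda>w. g k (x - w)) \<in> borel_measurable lborel" by measurable
      show "integrable lborel (\<lambda>w. g k (x - w) * \<psi> w)" by (rule integrable_bounded_mult(1)[OF \<psi> m gC])
      show "(\<integral>w. norm (g k (x - w) * \<psi> w) \<partial>lborel) \<le> q ^ k * (C * l1 \<psi>)"
        using integrable_bounded_mult(2)[OF \<psi> m gC] by (simp add: mult.assoc)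
    next
      fix w
      show "summable (\<lambda>k. norm (g k (x - w) * \<psi> w))" unfolding norm_mult by (rule summable_mult2[OF sg])
      show "(\<lambda>k. g k (x - w) * \<psi> w) sums (H (x - w) * \<psi> w)" by (rule sums_mult2[OF H])
    qed
    then have "(\<lambda>k. c * g k x - c * g (Suc k) x) sums conv_fun_fun \<psi> H x"
      unfolding conv_fun_fun_def[symmetric] step .
    \<comment> \<open>The series telescopes: each error term is cancelled by the next summand, and
      \<open>c * \<phi>\<close> remains.\<close>
    moreover have "(\<lambda>k. c * g k x - c * g (Suc k) x) sums (c * g 0 x - c * 0)"
      by (rule telescope_sums') (intro tendsto_mult_left summable_LIMSEQ_zero[OF summable_norm_cancel[OF sg]])
    ultimately have "conv_fun_fun \<psi> H x = c * \<phi> x" using sums_unique2 g0 by fastforce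
    then show ?thesis using c by (simp add: conv_fun_fun_def mult.assoc)
  qed
  then show thesis using that[OF cbi] by blast
qed

text \<open>The spectrum of \<open>\<phi>\<close> is compact, so finitely many small pieces cover
  it. Each piece is divided by \<open>\<psi>\<close> locally, and the pieces add up to
  \<open>\<phi>\<close> because their cut-offs sum to 1 on the spectrum.\<close>

lemma wiener_exact:
  fixes \<psi> \<phi> :: "complex^'n \<Rightarrow> complex"
  assumes \<psi>: "regular_fun \<psi>" and \<phi>: "cbi \<phi>" and supp: "\<And>\<xi>. norm \<xi> > R \<Longrightarrow> fourier \<phi> \<xi> = 0"
  obtains h where "cbi h" "conv_fun_fun \<psi> h = \<phi>"
proof -
  have \<psi>': "integrable lborel \<psi>" "\<And>\<xi>. fourier \<psi> \<xi> \<noteq> 0" using \<psi> by (auto simp: regular_fun_def)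
  note \<phi>' = cbiD[OF \<phi>]
  obtain D where D: "\<And>x. cmod (\<phi> x) \<le> D" using \<phi> by (auto simp: cbi_def)
  have cb: "cball 0 2 \<in> sets borel" "bounded (cball 0 2 :: (complex^'n) set)" by auto
  \<comment> \<open>The mollification at scale 1 of a ball of radius 2 is still identically 1 on the
    unit ball.\<close>
  define V :: "complex^'n \<Rightarrow> complex" where "V = cut 1 (cball 0 2)"
  have V: "cbi V" unfolding V_def by (rule cbi_cut[OF _ cb]) simp
  have V1: "fourier V \<xi> = 1" if "norm \<xi> \<le> 1" for \<xi>
  proof -
    have "ball \<xi> 1 \<subseteq> cball 0 2"
    proof
      fix x assume "x \<in> ball \<xi> 1"
      moreover have "norm x \<le> norm \<xi> + norm (\<xi> - x)" by norm
      ultimately show "x \<in> cball 0 2" using that by (simp add: dist_norm)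
    qed
    then show ?thesis unfolding V_def by (intro fourier_cut_1[OF _ cb]) auto
  qed
  obtain K where K: "K \<longlonglongrightarrow> 0"
    "\<And>n \<xi>. l1 (\<lambda>x. conv_fun_fun \<psi> (modul (1 / real (Suc n)) \<xi> V) x - fourier \<psi> \<xi> * modul (1 / real (Suc n)) \<xi> V x) \<le> K n"
    by (rule conv_modul_approx[OF \<psi>'(1) V]) (rule that)
  \<comment> \<open>One unit larger than the spectrum: balls of radius \<open>s \<le> 1\<close>
    around points of the spectrum stay inside, so the cut-off for the whole of \<open>?S\<close> is
    1 there.\<close>
  let ?S = "cball 0 (R + 1) :: (complex^'n) set"
  show thesis
  proof (cases "?S = {}")
    case True
    \<comment> \<open>An empty ball means that \<open>R\<close> is negative, so the transform
      vanishes everywhere.\<close>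
    have "\<phi> x = 0" for x
      by (rule fourier_eq_0_imp[OF \<phi>], rule supp) (use True norm_ge_zero in \<open>smt (verit) cball_eq_empty\<close>)
    then have "conv_fun_fun \<psi> \<phi> = \<phi>" by (simp add: conv_fun_fun_def fun_eq_iff)
    then show thesis using that \<phi> by blast
  next
    case False
    have "continuous_on ?S (\<lambda>\<xi>. cmod (fourier \<psi> \<xi>))"
      using continuous_on_subset[OF continuous_fourier[OF \<psi>'(1)]] by (intro continuous_intros) auto
    \<comment> \<open>The transform has no zeros, so compactness bounds it away from 0 on
      \<open>?S\<close>. A single scale \<open>n\<close> then meets the smallness condition of the
      local division at every centre.\<close>
    from continuous_attains_inf[OF compact_cball False this] obtain \<xi>m where
      \<xi>m: "\<And>\<xi>. \<xi> \<in> ?S \<Longrightarrow> cmod (fourier \<psi> \<xi>m) \<le> cmod (fourier \<psi> \<xi>)" by blast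
    have "cmod (fourier \<psi> \<xi>m) > 0" using \<psi>'(2) by simp
    from order_tendstoD(2)[OF K(1) this] obtain n where n: "K n < cmod (fourier \<psi> \<xi>m)"
      using eventually_happens'[OF sequentially_bot] by blast
    define r where "r = 1 / real (Suc n)"
    have r: "r > 0" "r \<le> 1" by (simp_all add: r_def)
    \<comment> \<open>A point where the cut-off of a piece does not vanish is within
      \<open>s\<close> of the piece, hence within \<open>2 s = r\<close> of its centre, where the
      modulated \<open>V\<close> has transform 1.\<close>
    define s where "s = r / 2"
    have s: "s > 0" "s \<le> 1" using r by (simp_all add: s_def)
    have piece: "\<exists>h. cbi h \<and> conv_fun_fun \<psi> h = conv_fun_fun (cut s B) \<phi>"
      if B: "B \<in> sets borel" "B \<subseteq> ball \<xi> s" and \<xi>: "\<xi> \<in> ?S" for B \<xi>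
    proof -
      have bB: "bounded B" using B(2) bounded_ball bounded_subset by blast
      note P = cbi_cut[OF s(1) B(1) bB]
      note W = cbi_modul[OF V r(1), of \<xi>]
      note pc = cbi_conv[OF cbiD(2)[OF P] \<phi>]
      have "conv_fun_fun (modul r \<xi> V) (conv_fun_fun (cut s B) \<phi>) = conv_fun_fun (cut s B) \<phi>"
      proof (rule conv_eq_self[OF pc W])
        fix \<eta> assume "fourier (conv_fun_fun (cut s B) \<phi>) \<eta> \<noteq> 0"
        then have "fourier (cut s B) \<eta> \<noteq> 0" unfolding fourier_conv[OF cbiD(2)[OF P] \<phi>'(2)] by auto
        then have "ball \<eta> s \<inter> B \<noteq> {}" using fourier_cut_0[OF s(1) B(1) bB] by blast
        then obtain x where "x \<in> ball \<eta> s" "x \<in> ball \<xi> s" using B(2) by blast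
        then have "norm (\<eta> - x) < s" "norm (\<xi> - x) < s" by (simp_all add: dist_norm)
        moreover have "norm (\<eta> - \<xi>) \<le> norm (\<eta> - x) + norm (\<xi> - x)" by norm
        ultimately have "norm (\<eta> - \<xi>) \<le> r" by (simp add: s_def)
        then show "fourier (modul r \<xi> V) \<eta> = 1"
          unfolding fourier_modul[OF V r(1)] using r by (intro V1) (unfold norm_scaleR, simp add: field_simps)
      qed
      moreover have "l1 (\<lambda>x. conv_fun_fun \<psi> (modul r \<xi> V) x - fourier \<psi> \<xi> * modul r \<xi> V x) < cmod (fourier \<psi> \<xi>)"
        using K(2)[of n \<xi>] n \<xi>m[OF \<xi>] by (simp add: r_def)
      ultimately show ?thesis using wiener_local[OF \<psi>'(1) W pc] by metis
    qed
    obtain k where k: "finite k" "k \<subseteq> ?S" "?S \<subseteq> (\<Union>x\<in>k. ball x s)"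
      using seq_compact_imp_totally_bounded[of ?S] s(1) compact_cball compact_imp_seq_compact by metis
    have "\<exists>h. cbi h \<and> conv_fun_fun \<psi> h = conv_fun_fun (cut s (?S \<inter> (\<Union>x\<in>k. ball x s))) \<phi>"
      using k(1,2)
    proof (induction k)
      case empty
      obtain x where "x \<in> ?S" using False by blast
      then have "\<exists>h. cbi h \<and> conv_fun_fun \<psi> h = conv_fun_fun (cut s {}) \<phi>"
        by (intro piece[of "{}"]) auto
      then show ?case by simp
    next
      case (insert x k)
      \<comment> \<open>Only the part of the new ball that is not yet covered is added, which makes
        the two sets disjoint as required for adding cut-offs.\<close>
      let ?A = "?S \<inter> (\<Union>x\<in>k. ball x s)" and ?B = "?S \<inter> ball x s - (\<Union>x\<in>k. ball x s)"
      have A: "?A \<in> sets borel" "bounded ?A" and B: "?B \<in> sets borel" "bounded ?B"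
        by (intro sets.Int sets.Diff borel_open open_UN borel_closed closed_cball ballI open_ball
            bounded_subset[OF bounded_cball[of 0 "R + 1"]]; blast)+
      obtain h1 where h1: "cbi h1" "conv_fun_fun \<psi> h1 = conv_fun_fun (cut s ?A) \<phi>" using insert by auto
      obtain h2 where h2: "cbi h2" "conv_fun_fun \<psi> h2 = conv_fun_fun (cut s ?B) \<phi>"
        using piece[OF B(1), of x] insert.prems by auto
      have AB: "?S \<inter> (\<Union>x\<in>insert x k. ball x s) = ?A \<union> ?B" "?A \<inter> ?B = {}" by auto
      obtain C1 C2 where C: "\<And>x. cmod (h1 x) \<le> C1" "\<And>x. cmod (h2 x) \<le> C2" using h1(1) h2(1) by (auto simp: cbi_def)
      have "conv_fun_fun \<psi> (\<lambda>x. h1 x + h2 x) = (\<lambda>x. conv_fun_fun \<psi> h1 x + conv_fun_fun \<psi> h2 x)"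
        using conv_fun_fun_bounded(1)[OF \<psi>'(1) cbiD(3)[OF h1(1)] C(1)] conv_fun_fun_bounded(1)[OF \<psi>'(1) cbiD(3)[OF h2(1)] C(2)]
        by (simp add: fun_eq_iff conv_fun_fun_def distrib_right)
      also have "\<dots> = (\<lambda>x. conv_fun_fun (cut s ?A) \<phi> x + conv_fun_fun (cut s ?B) \<phi> x)" using h1 h2 by simp
      also have "\<dots> = conv_fun_fun (cut s (?A \<union> ?B)) \<phi>"
        unfolding cut_Un[OF s(1) A B AB(2)]
        using conv_fun_fun_bounded(1)[OF cbiD(2)[OF cbi_cut[OF s(1) A]] \<phi>'(3) D] conv_fun_fun_bounded(1)[OF cbiD(2)[OF cbi_cut[OF s(1) B]] \<phi>'(3) D]
        by (simp add: fun_eq_iff conv_fun_fun_def distrib_left)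
      finally show ?case unfolding AB(1) using cbi_closed_under(2)[OF h1(1) h2(1)] by blast
    qed
    also have "?S \<inter> (\<Union>x\<in>k. ball x s) = ?S" using k(3) by blast
    also have "conv_fun_fun (cut s ?S) \<phi> = \<phi>"
    proof (rule conv_eq_self[OF \<phi>])
      show "cbi (cut s ?S)" by (rule cbi_cut[OF s(1)]) auto
      fix \<xi> assume "fourier \<phi> \<xi> \<noteq> 0"
      then have \<xi>: "norm \<xi> \<le> R" using supp[of \<xi>] by fastforce
      have "ball \<xi> s \<subseteq> ?S"
      proof
        fix x assume "x \<in> ball \<xi> s"
        moreover have "norm x \<le> norm \<xi> + norm (\<xi> - x)" by norm
        ultimately show "x \<in> ?S" using \<xi> s by (simp add: dist_norm)
      qed
      then show "fourier (cut s ?S) \<xi> = 1" by (intro fourier_cut_1[OF s(1)]) auto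
    qed
    finally show thesis using that by blast
  qed
qed

lemma borel_measurable_unitary:
  fixes A :: "complex^'n::finite^'n"
  assumes "A \<in> unitary_matrices"
  shows "(\<lambda>x. A *v x) \<in> borel_measurable borel"
  using linear_unitary[of A]
  by (intro borel_measurable_continuous_onI) (simp add: linear_continuous_on linear_conv_bounded_linear)

lemma radial_L1_AE:
  assumes "radial_L1 \<psi>" and A: "A \<in> unitary_matrices"
  shows "AE x in lborel. \<psi> (A *v x) = \<psi> x"
proof -
  note A' = conj_transpose_unitary[OF A]
  have "AE x in lborel. \<psi> (matrix_inv (conj_transpose A) *v x) = \<psi> x"
    using assms(1) A' unfolding radial_L1_def by blast
  then show ?thesis by (simp add: matrix_inv_unitary[OF A'])
qed

text \<open>The approximate identity consists of dilations of one function with compactly supported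
  Fourier transform; by uniqueness its quotients by \<open>\<psi>\<close> inherit radiality.\<close>

lemma wiener_approximate_identity:
  fixes \<psi> :: "complex^'n::finite \<Rightarrow> complex"
  assumes \<psi>: "regular_fun \<psi>" "radial_L1 \<psi>"
  obtains L where "0 \<le> L" "\<And>\<epsilon> \<delta>. 0 < \<epsilon> \<Longrightarrow> 0 < \<delta> \<Longrightarrow> \<exists>\<phi> h. conv_fun_fun \<psi> h = \<phi> \<and> cbi h \<and>
      (\<forall>A\<in>unitary_matrices. \<forall>z. h (A *v z) = h z) \<and> cbi \<phi> \<and> (\<integral>x. \<phi> x \<partial>lborel) = 1 \<and> l1 \<phi> \<le> L \<and>
      (\<integral>x. indicator {x. \<delta> \<le> norm x} x * cmod (\<phi> x) \<partial>lborel) \<le> \<epsilon>"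
proof -
  have \<psi>i: "integrable lborel \<psi>" "\<And>\<xi>. fourier \<psi> \<xi> \<noteq> 0" using \<psi> by (auto simp: regular_fun_def)
  have cb: "cball 0 2 \<in> sets borel" "bounded (cball 0 2 :: (complex^'n) set)" by auto
  define V :: "complex^'n \<Rightarrow> complex" where "V = cut 1 (cball 0 2)"
  have V: "cbi V" unfolding V_def by (rule cbi_cut[OF _ cb]) simp
  note V' = cbiD[OF V]
  note [measurable] = V'(3)
  have V3: "fourier V \<xi> = 0" if "norm \<xi> > 3" for \<xi>
  proof -
    have "ball \<xi> 1 \<inter> cball 0 2 = {}"
    proof (rule ccontr)
      assume "ball \<xi> 1 \<inter> cball 0 2 \<noteq> {}"
      then obtain x where "norm (\<xi> - x) < 1" "norm x \<le> 2" by (auto simp: dist_norm)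
      moreover have "norm \<xi> \<le> norm (\<xi> - x) + norm x" by norm
      ultimately show False using that by simp
    qed
    then show ?thesis unfolding V_def by (intro fourier_cut_0[OF _ cb]) auto
  qed
  have "ball 0 1 \<subseteq> (cball 0 2 :: (complex^'n) set)" by auto
  then have V0: "fourier V 0 = 1" unfolding V_def by (intro fourier_cut_1[OF _ cb]) auto
  have iso: "linear (\<lambda>x. A *v x)" "\<And>x. norm (A *v x) = norm x" if "A \<in> unitary_matrices" for A :: "complex^'n^'n"
    using that by (simp_all add: linear_unitary norm_unitary)
  have \<psi>r: "fourier \<psi> (A *v \<xi>) = fourier \<psi> \<xi>" if A: "A \<in> unitary_matrices" for A \<xi>
  proof -
    have m [measurable]: "\<psi> \<in> borel_measurable borel" using borel_measurable_integrable[OF \<psi>i(1)] by simp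
    note [measurable] = borel_measurable_unitary[OF A]
    have "fourier (\<lambda>x. \<psi> (A *v x)) \<xi> = fourier \<psi> \<xi>"
      unfolding fourier_wave using radial_L1_AE[OF \<psi>(2) A] by (intro integral_cong_AE) auto
    then show ?thesis using fourier_isometry[OF iso[OF A] m] by simp
  qed
  have "\<exists>\<phi> h. conv_fun_fun \<psi> h = \<phi> \<and> cbi h \<and>
      (\<forall>A\<in>unitary_matrices. \<forall>z. h (A *v z) = h z) \<and> cbi \<phi> \<and> (\<integral>x. \<phi> x \<partial>lborel) = 1 \<and> l1 \<phi> \<le> l1 V \<and>
      (\<integral>x. indicator {x. \<delta> \<le> norm x} x * cmod (\<phi> x) \<partial>lborel) \<le> \<epsilon>" if \<epsilon>: "0 < \<epsilon>" and \<delta>: "0 < \<delta>" for \<epsilon> \<delta>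
  proof -
    have "(\<lambda>n. \<integral>x. indicator {x. \<delta> * real (Suc n) \<le> norm x} x * cmod (V x) \<partial>lborel) \<longlonglongrightarrow> (\<integral>x. 0 \<partial>(lborel :: (complex^'n) measure))"
    proof (rule integral_dominated_convergence[where w="\<lambda>x. cmod (V x)"])
      show "AE x in lborel. (\<lambda>n. indicator {x. \<delta> * real (Suc n) \<le> norm x} x * cmod (V x)) \<longlonglongrightarrow> 0"
      proof (rule AE_I2)
        fix x :: "complex^'n"
        have "\<forall>\<^sub>F n in sequentially. norm x / \<delta> < real n" by real_asymp
        then have "\<forall>\<^sub>F n in sequentially. indicator {x. \<delta> * real (Suc n) \<le> norm x} x * cmod (V x) = 0"
          by eventually_elim (use \<delta> in \<open>auto simp: field_simps indicator_def\<close>)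
        then show "(\<lambda>n. indicator {x. \<delta> * real (Suc n) \<le> norm x} x * cmod (V x)) \<longlonglongrightarrow> 0" by (rule tendsto_eventually)
      qed
      show "AE x in lborel. norm (indicator {x. \<delta> * real (Suc n) \<le> norm x} x * cmod (V x)) \<le> cmod (V x)" for n
        by (intro AE_I2) (simp add: indicator_def)
    qed (use V'(2) in auto)
    from order_tendstoD(2)[OF this, of \<epsilon>] \<epsilon> obtain n where
      n: "(\<integral>x. indicator {x. \<delta> * real (Suc n) \<le> norm x} x * cmod (V x) \<partial>lborel) < \<epsilon>"
      using eventually_happens'[OF sequentially_bot] by auto
    \<comment> \<open>Dilation by \<open>c\<close> carries the tail of \<open>\<phi>\<close> beyond
      \<open>\<delta>\<close> to the tail of \<open>V\<close> beyond \<open>\<delta> * c\<close>,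
      which is small for the chosen \<open>n\<close>.\<close>
    define c where "c = real (Suc n)"
    have c: "c > 0" by (simp add: c_def)
    define \<phi> where "\<phi> = modul c 0 V"
    have \<phi>: "cbi \<phi>" unfolding \<phi>_def by (rule cbi_modul[OF V c])
    have \<phi>F: "fourier \<phi> \<xi> = fourier V ((1 / c) *\<^sub>R \<xi>)" for \<xi> unfolding \<phi>_def using fourier_modul[OF V c, of 0] by simp
    have "fourier \<phi> \<xi> = 0" if "norm \<xi> > 3 * c" for \<xi> unfolding \<phi>F using c that by (intro V3) (simp add: field_simps)
    from wiener_exact[OF \<psi>(1) \<phi> this] obtain h where h: "cbi h" "conv_fun_fun \<psi> h = \<phi>" .
    note h' = cbiD[OF h(1)]
    have "h (A *v z) = h z" if A: "A \<in> unitary_matrices" for A z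
    proof -
      have F: "fourier \<psi> \<xi> * fourier h \<xi> = fourier \<phi> \<xi>" for \<xi> using fourier_conv[OF \<psi>i(1) h'(2)] h(2) by simp
      have \<phi>A: "fourier \<phi> (A *v \<xi>) = fourier \<phi> \<xi>" for \<xi>
      proof -
        have "(\<lambda>x. \<phi> (A *v x)) = \<phi>"
        proof
          fix x
          have "V (A *v (c *\<^sub>R x)) = V (c *\<^sub>R x)" unfolding V_def by (rule cut_isometry[OF iso[OF A]]) simp
          then show "\<phi> (A *v x) = \<phi> x" by (simp add: \<phi>_def modul_def linear_scale[OF iso(1)[OF A]])
        qed
        then show ?thesis using fourier_isometry[OF iso[OF A] cbiD(3)[OF \<phi>], of \<xi>] by simp
      qed
      have hA: "cbi (\<lambda>x. h (A *v x))"
      proof -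
        have "continuous_on UNIV (\<lambda>x. A *v x)"
          using iso(1)[OF A] by (simp add: linear_continuous_on linear_conv_bounded_linear)
        then have "continuous_on UNIV (\<lambda>x. h (A *v x))" by (rule continuous_on_compose2[OF h'(1)]) simp
        then show ?thesis using h(1) lborel_integrable_isometry[OF iso[OF A] h'(2)] by (auto simp: cbi_def)
      qed
      have "(\<lambda>x. h (A *v x)) = h"
      proof (rule fourier_inj[OF hA h(1)])
        fix \<xi>
        \<comment> \<open>Both \<open>\<psi>\<close> and \<open>\<phi>\<close> have rotation
          invariant transforms, and the nonvanishing factor \<open>fourier \<psi> \<xi>\<close> can
          be cancelled.\<close>
        have "fourier \<psi> \<xi> * fourier h (A *v \<xi>) = fourier \<psi> \<xi> * fourier h \<xi>"
          using F[of \<xi>] F[of "A *v \<xi>"] \<phi>A[of \<xi>] \<psi>r[OF A, of \<xi>] by simp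
        then show "fourier (\<lambda>x. h (A *v x)) \<xi> = fourier h \<xi>"
          using \<psi>i(2) fourier_isometry[OF iso[OF A] h'(3)] by simp
      qed
      then show ?thesis by (rule fun_cong)
    qed
    moreover have "(\<integral>x. \<phi> x \<partial>lborel) = 1" unfolding fourier_at_0[symmetric] \<phi>F by (simp add: V0)
    moreover have "l1 \<phi> \<le> l1 V" unfolding \<phi>_def using l1_modul[OF V c] by simp
    moreover have "(\<integral>x. indicator {x. \<delta> \<le> norm x} x * cmod (\<phi> x) \<partial>lborel) \<le> \<epsilon>"
    proof -
      have "(\<integral>x. indicator {x. \<delta> * c \<le> norm x} x * cmod (V x) \<partial>lborel)
        = \<bar>c\<bar> ^ DIM(complex^'n) *\<^sub>R (\<integral>x. indicator {x. \<delta> * c \<le> norm x} (0 + c *\<^sub>R x) * cmod (V (0 + c *\<^sub>R x)) \<partial>lborel)"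
        by (rule lborel_integral_affine) (use c in simp)
      also have "\<dots> = (\<integral>x. c ^ DIM(complex^'n) * (indicator {x. \<delta> * c \<le> norm x} (c *\<^sub>R x) * cmod (V (c *\<^sub>R x))) \<partial>lborel)"
        using c by simp
      also have "\<dots> = (\<integral>x. indicator {x. \<delta> \<le> norm x} x * cmod (\<phi> x) \<partial>lborel)"
        using c by (intro Bochner_Integration.integral_cong refl)
          (simp add: \<phi>_def modul_def norm_mult norm_power wave_simps indicator_def)
      finally show ?thesis using n by (simp add: c_def)
    qed
    ultimately show ?thesis using h \<phi> by blast
  qed
  then show thesis using that[OF l1_nonneg[of V]] by blast
qed

section \<open>Invariant functions and operators\<close>

lemma uniformly_continuous_UNIV_iff:
  "uniformly_continuous_on UNIV f \<longleftrightarrow> (\<forall>e>0. \<exists>d>0. \<forall>x y. dist y x < d \<longrightarrow> dist (f y) (f x) < e)"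
  by (simp add: uniformly_continuous_on_def)

lemma uniformly_continuous_UNIV_D:
  assumes "uniformly_continuous_on UNIV f" "0 < e"
  obtains d where "d > 0" "\<And>x y. dist y x < d \<Longrightarrow> dist (f y) (f x) < e"
  using assms unfolding uniformly_continuous_UNIV_iff by meson

text \<open>The summand 1 keeps the quotient meaningful when \<open>l = 0\<close>; \<open>l\<close>
  is an L1 norm or a nuclear sum in the applications.\<close>

lemma divide_add_1_mult_less: "0 < e \<Longrightarrow> 0 \<le> l \<Longrightarrow> 0 < e / (l + 1) \<and> e / (l + 1) * l < e" for e l :: real
  by (simp add: field_simps add_nonneg_pos)

lemma invariant_fun_iff:
  assumes "G \<subseteq> carrier motion_group"
  shows "invariant_fun G a \<longleftrightarrow> (\<forall>(A, z)\<in>G. \<forall>w. a (conj_transpose A *v (w - z)) = a w)"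
proof -
  have "A \<in> unitary_matrices" if "(A, z) \<in> G" for A z using assms that by (auto simp: motion_group_def)
  then show ?thesis unfolding invariant_fun_def by (auto simp: inv_motion_act)
qed

lemma Cbu_funD:
  assumes "a \<in> Cbu_fun G"
  shows "uniformly_continuous_on UNIV a" "a \<in> borel_measurable borel" "invariant_fun G a"
    "\<exists>C\<ge>0. \<forall>z. cmod (a z) \<le> C"
proof -
  show "uniformly_continuous_on UNIV a" "invariant_fun G a" using assms by (auto simp: Cbu_fun_def)
  then show "a \<in> borel_measurable borel"
    using borel_measurable_continuous_onI uniformly_continuous_imp_continuous by blast
  have "bounded (range a)" using assms by (simp add: Cbu_fun_def)
  then obtain C where "\<And>z. cmod (a z) \<le> C" by (auto simp: bounded_iff)
  moreover from this[of 0] have "0 \<le> C" using norm_ge_zero order_trans by blast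
  ultimately show "\<exists>C\<ge>0. \<forall>z. cmod (a z) \<le> C" by blast
qed

lemma Cbu_funI:
  assumes "uniformly_continuous_on UNIV a" "invariant_fun G a" "\<And>z. cmod (a z) \<le> C"
  shows "a \<in> Cbu_fun G"
  using assms by (auto simp: Cbu_fun_def bounded_iff)

text \<open>The rotation part of a motion passes through the integral onto both factors, where
  radiality of \<open>\<psi>\<close> absorbs one copy. The translation part commutes with
  convolution.\<close>

lemma invariant_conv_fun_fun:
  fixes \<psi> :: "complex^'n::finite \<Rightarrow> complex"
  assumes G: "G \<subseteq> carrier motion_group" and \<psi>: "integrable lborel \<psi>" "radial_L1 \<psi>"
    and a: "a \<in> borel_measurable borel" "invariant_fun G a"
  shows "invariant_fun G (conv_fun_fun \<psi> a)"
  unfolding invariant_fun_iff[OF G]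
proof clarify
  fix A z w assume Az: "(A, z) \<in> G"
  then have "A \<in> unitary_matrices" using G by (auto simp: motion_group_def)
  then have A: "conj_transpose A \<in> unitary_matrices" by (rule conj_transpose_unitary)
  let ?A = "conj_transpose A"
  have inv: "a (?A *v (u - z)) = a u" for u using a(2) Az unfolding invariant_fun_iff[OF G] by blast
  have m: "\<psi> \<in> borel_measurable borel" using borel_measurable_integrable[OF \<psi>(1)] by simp
  note [measurable] = m a(1) borel_measurable_unitary[OF A]
  have "conv_fun_fun \<psi> a (?A *v (w - z)) = conv_fun_fun (\<lambda>u. \<psi> (?A *v u)) (\<lambda>u. a (?A *v u)) (w - z)"
    by (rule conv_fun_fun_isometry[OF linear_unitary norm_unitary[OF A] m a(1)])
  also have "\<dots> = (\<integral>u. a (w - u) * \<psi> (?A *v u) \<partial>lborel)"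
    unfolding conv_fun_fun_def using inv[of "w - _"] by (simp add: algebra_simps)
  also have "\<dots> = conv_fun_fun \<psi> a w"
    unfolding conv_fun_fun_def
  proof (rule integral_cong_AE)
    show "AE u in lborel. a (w - u) * \<psi> (?A *v u) = a (w - u) * \<psi> u"
      using radial_L1_AE[OF \<psi>(2) A] by eventually_elim simp
  qed measurable
  finally show "conv_fun_fun \<psi> a (?A *v (w - z)) = conv_fun_fun \<psi> a w" .
qed

lemma conv_fun_fun_Cbu:
  fixes \<psi> :: "complex^'n::finite \<Rightarrow> complex"
  assumes G: "G \<subseteq> carrier motion_group" and \<psi>: "integrable lborel \<psi>" "radial_L1 \<psi>" and a: "a \<in> Cbu_fun G"
  shows "conv_fun_fun \<psi> a \<in> Cbu_fun G"
proof -
  note a' = Cbu_funD[OF a]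
  obtain C where C: "\<And>z. cmod (a z) \<le> C" using a'(4) by blast
  show ?thesis
  proof (rule Cbu_funI[OF _ invariant_conv_fun_fun[OF G \<psi> a'(2,3)] conv_fun_fun_bounded(2)[OF \<psi>(1) a'(2) C]])
    show "uniformly_continuous_on UNIV (conv_fun_fun \<psi> a)"
      unfolding uniformly_continuous_UNIV_iff
    proof (intro allI impI)
      fix e :: real assume e: "0 < e"
      have "0 < e / (l1 \<psi> + 1)" using divide_add_1_mult_less[OF e l1_nonneg[of \<psi>]] by blast
      then obtain d where d: "d > 0" "\<And>x y. dist y x < d \<Longrightarrow> dist (a y) (a x) < e / (l1 \<psi> + 1)"
        by (rule uniformly_continuous_UNIV_D[OF a'(1)]) (rule that)
      have "dist (conv_fun_fun \<psi> a y) (conv_fun_fun \<psi> a x) < e" if "dist y x < d" for x y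
      proof -
        note i = conv_fun_fun_bounded(1)[OF \<psi>(1) a'(2) C]
        have m: "(\<lambda>w. a (y - w) - a (x - w)) \<in> borel_measurable lborel" using a'(2) by measurable
        have le: "cmod (a (y - w) - a (x - w)) \<le> e / (l1 \<psi> + 1)" for w
          using d(2)[of "y - w" "x - w"] that by (simp add: dist_norm)
        have "conv_fun_fun \<psi> a y - conv_fun_fun \<psi> a x = (\<integral>w. (a (y - w) - a (x - w)) * \<psi> w \<partial>lborel)"
          using i by (simp add: conv_fun_fun_def left_diff_distrib)
        then have "cmod (conv_fun_fun \<psi> a y - conv_fun_fun \<psi> a x) \<le> e / (l1 \<psi> + 1) * l1 \<psi>"
          using order_trans[OF integral_norm_bound integrable_bounded_mult(2)[OF \<psi>(1) m le]] by simp
        also have "\<dots> < e" using divide_add_1_mult_less[OF e l1_nonneg[of \<psi>]] by blast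
        finally show ?thesis by (simp add: dist_norm)
      qed
      then show "\<exists>d>0. \<forall>x y. dist y x < d \<longrightarrow> dist (conv_fun_fun \<psi> a y) (conv_fun_fun \<psi> a x) < e"
        using d(1) by blast
    qed
  qed
qed

lemma sup_closure_Cbu:
  assumes X: "X \<subseteq> Cbu_fun G"
  shows "sup_closure X \<subseteq> Cbu_fun G"
proof
  fix f assume "f \<in> sup_closure X"
  then have f: "\<exists>g\<in>Cbu_fun G. \<forall>z. cmod (f z - g z) \<le> e" if "e > 0" for e
    using X that by (force simp: sup_closure_def)
  obtain g0 where g0: "g0 \<in> Cbu_fun G" "\<And>z. cmod (f z - g0 z) \<le> 1" using f[of 1] by auto
  obtain C where C: "\<And>z. cmod (g0 z) \<le> C" using Cbu_funD(4)[OF g0(1)] by blast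
  show "f \<in> Cbu_fun G"
  proof (rule Cbu_funI)
    show "cmod (f z) \<le> C + 1" for z
    proof -
      have "cmod (f z) \<le> cmod (g0 z) + cmod (f z - g0 z)" by norm
      then show ?thesis using g0(2)[of z] C[of z] by linarith
    qed
    show "uniformly_continuous_on UNIV f"
      unfolding uniformly_continuous_UNIV_iff
    proof (intro allI impI)
      fix e :: real assume e: "0 < e"
      then obtain g where g: "g \<in> Cbu_fun G" "\<And>z. cmod (f z - g z) \<le> e / 4" using f[of "e / 4"] by auto
      obtain d where d: "d > 0" "\<And>x y. dist y x < d \<Longrightarrow> dist (g y) (g x) < e / 4"
        by (rule uniformly_continuous_UNIV_D[OF Cbu_funD(1)[OF g(1)], of "e / 4"]) (use e in simp, rule that)
      have "dist (f y) (f x) < e" if "dist y x < d" for x y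
      proof -
        have "cmod (f y - f x) \<le> cmod (f y - g y) + cmod (g y - g x) + cmod (f x - g x)" by norm
        then show ?thesis using g(2)[of x] g(2)[of y] d(2)[OF that] e unfolding dist_norm by linarith
      qed
      then show "\<exists>d>0. \<forall>x y. dist y x < d \<longrightarrow> dist (f y) (f x) < e" using d(1) by blast
    qed
    show "invariant_fun G f"
      unfolding invariant_fun_def
    proof (intro ballI allI)
      fix g z assume g: "g \<in> G"
      have "cmod (f (motion_act (inv\<^bsub>motion_group\<^esub> g) z) - f z) \<le> 0 + e" if e: "e > 0" for e
      proof -
        obtain b where b: "b \<in> Cbu_fun G" "\<And>z. cmod (f z - b z) \<le> e / 2" using f[of "e / 2"] e by auto
        have "b (motion_act (inv\<^bsub>motion_group\<^esub> g) z) = b z"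
          using Cbu_funD(3)[OF b(1)] g by (simp add: invariant_fun_def)
        moreover have "cmod (f y - f z) \<le> cmod (f y - b y) + cmod (b y - b z) + cmod (f z - b z)" for y by norm
        ultimately show ?thesis using b(2) e by (smt (verit) field_sum_of_halves norm_zero right_minus_eq)
      qed
      then have "cmod (f (motion_act (inv\<^bsub>motion_group\<^esub> g) z) - f z) \<le> 0" by (rule field_le_epsilon)
      then show "f (motion_act (inv\<^bsub>motion_group\<^esub> g) z) = f z" by simp
    qed
  qed
qed

text \<open>Since \<open>\<phi>\<close> integrates to 1, the error is the integral of
  \<open>(F - c) \<phi>\<close>; it is split into the ball of radius \<open>\<delta>\<close> and the
  tail. The abstract \<open>F\<close> covers both the values of a function and the matrix
  coefficients of translated operators.\<close>

lemma approximate_identity_bound: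
  fixes \<phi> :: "complex^'n::finite \<Rightarrow> complex"
  assumes \<phi>: "integrable lborel \<phi>" "(\<integral>x. \<phi> x \<partial>lborel) = 1" "l1 \<phi> \<le> L"
      "(\<integral>x. indicator {x. \<delta> \<le> norm x} x * cmod (\<phi> x) \<partial>lborel) \<le> \<epsilon>"
    and F: "integrable lborel (\<lambda>w. F w * \<phi> w)" and nonneg: "0 \<le> r" "0 \<le> M"
    and le: "\<And>w. norm w < \<delta> \<Longrightarrow> cmod (F w - c) \<le> r" "\<And>w. cmod (F w - c) \<le> M"
  shows "cmod ((\<integral>w. F w * \<phi> w \<partial>lborel) - c) \<le> r * L + M * \<epsilon>"
proof -
  let ?I = "indicator {x. \<delta> \<le> norm x} :: complex^'n \<Rightarrow> real"
  have [measurable]: "?I \<in> borel_measurable borel" by (intro borel_measurable_indicator) measurable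
  have I: "integrable lborel (\<lambda>x. ?I x * cmod (\<phi> x))"
    by (rule Bochner_Integration.integrable_bound[OF integrable_norm[OF \<phi>(1)]])
      (use borel_measurable_integrable[OF \<phi>(1)] in \<open>measurable, auto simp: indicator_def\<close>)
  have i: "integrable lborel (\<lambda>w. F w * \<phi> w - c * \<phi> w)" using F \<phi>(1) by simp
  have "(\<integral>w. F w * \<phi> w \<partial>lborel) - c = (\<integral>w. F w * \<phi> w - c * \<phi> w \<partial>lborel)" using F \<phi>(1,2) by simp
  also have "cmod \<dots> \<le> (\<integral>w. r * cmod (\<phi> w) + M * (?I w * cmod (\<phi> w)) \<partial>lborel)"
  proof (rule Bochner_Integration.integral_norm_bound_integral[OF i])
    show "integrable lborel (\<lambda>w. r * cmod (\<phi> w) + M * (?I w * cmod (\<phi> w)))" using I \<phi>(1) by simp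
    fix w
    have "cmod (F w - c) \<le> r + M * ?I w"
      using le(1)[of w] le(2)[of w] nonneg by (cases "norm w < \<delta>") (auto simp: indicator_def)
    from mult_right_mono[OF this norm_ge_zero, of "\<phi> w"]
    show "norm (F w * \<phi> w - c * \<phi> w) \<le> r * cmod (\<phi> w) + M * (?I w * cmod (\<phi> w))"
      by (simp add: left_diff_distrib[symmetric] norm_mult distrib_right mult.assoc)
  qed
  also have "\<dots> = r * l1 \<phi> + M * (\<integral>x. ?I x * cmod (\<phi> x) \<partial>lborel)" using I \<phi>(1) by simp
  also have "\<dots> \<le> r * L + M * \<epsilon>" by (intro add_mono mult_left_mono \<phi> nonneg)
  finally show ?thesis .
qed

lemma radial_L1_I: "(\<And>A z. A \<in> unitary_matrices \<Longrightarrow> h (A *v z) = h z) \<Longrightarrow> radial_L1 h"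
  by (simp add: radial_L1_def matrix_inv_unitary conj_transpose_unitary)

theorem Cbu_fun_eq_closure:
  fixes \<psi> :: "complex^'n::finite \<Rightarrow> complex"
  assumes G: "G \<subseteq> carrier motion_group" and \<psi>: "regular_fun \<psi>" "radial_L1 \<psi>"
  shows "Cbu_fun G = sup_closure (conv_fun_fun \<psi> ` Cbu_fun G)"
proof
  have \<psi>i: "integrable lborel \<psi>" using \<psi> by (simp add: regular_fun_def)
  show "sup_closure (conv_fun_fun \<psi> ` Cbu_fun G) \<subseteq> Cbu_fun G"
    by (rule sup_closure_Cbu) (auto intro: conv_fun_fun_Cbu[OF G \<psi>i \<psi>(2)])
  show "Cbu_fun G \<subseteq> sup_closure (conv_fun_fun \<psi> ` Cbu_fun G)"
  proof
    fix a assume a: "a \<in> Cbu_fun G"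
    note a' = Cbu_funD[OF a]
    obtain C where C: "0 \<le> C" "\<And>z. cmod (a z) \<le> C" using a'(4) by blast
    obtain L where L: "0 \<le> L" "\<And>\<epsilon> \<delta>. 0 < \<epsilon> \<Longrightarrow> 0 < \<delta> \<Longrightarrow> \<exists>\<phi> h. conv_fun_fun \<psi> h = \<phi> \<and> cbi h \<and>
      (\<forall>A\<in>unitary_matrices. \<forall>z. h (A *v z) = h z) \<and> cbi \<phi> \<and> (\<integral>x. \<phi> x \<partial>lborel) = 1 \<and> l1 \<phi> \<le> L \<and>
      (\<integral>x. indicator {x. \<delta> \<le> norm x} x * cmod (\<phi> x) \<partial>lborel) \<le> \<epsilon>"
      by (rule wiener_approximate_identity[OF \<psi>]) (rule that)
    show "a \<in> sup_closure (conv_fun_fun \<psi> ` Cbu_fun G)"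
      unfolding sup_closure_def
    proof (intro CollectI allI impI)
      fix e :: real assume e: "0 < e"
      \<comment> \<open>The contribution near the origin and the one from the tail are each kept to
        \<open>e / 2\<close>; the 1 in the denominators covers \<open>L = 0\<close> and
        \<open>C = 0\<close>.\<close>
      define r where "r = e / (2 * (L + 1))"
      define \<epsilon> where "\<epsilon> = e / (4 * (C + 1))"
      have r: "0 < r" "r * L \<le> e / 2" and \<epsilon>: "0 < \<epsilon>" "2 * C * \<epsilon> \<le> e / 2"
        using e L(1) C(1) by (simp_all add: r_def \<epsilon>_def field_simps)
      obtain \<delta> where \<delta>: "\<delta> > 0" "\<And>x y. dist y x < \<delta> \<Longrightarrow> dist (a y) (a x) < r"
        by (rule uniformly_continuous_UNIV_D[OF a'(1) r(1)]) (rule that)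
      obtain \<phi> h where h: "conv_fun_fun \<psi> h = \<phi>" "cbi h" "\<And>A z. A \<in> unitary_matrices \<Longrightarrow> h (A *v z) = h z"
        and \<phi>: "cbi \<phi>" "(\<integral>x. \<phi> x \<partial>lborel) = 1" "l1 \<phi> \<le> L"
          "(\<integral>x. indicator {x. \<delta> \<le> norm x} x * cmod (\<phi> x) \<partial>lborel) \<le> \<epsilon>"
        using L(2)[OF \<epsilon>(1) \<delta>(1)] by blast
      note h' = cbiD[OF h(2)] and \<phi>' = cbiD[OF \<phi>(1)]
      have "conv_fun_fun \<psi> (conv_fun_fun h a) = conv_fun_fun \<phi> a"
        using conv_fun_fun_assoc[OF \<psi>i h'(2) a'(2) C(2)] h(1) by simp
      moreover have "conv_fun_fun h a \<in> Cbu_fun G" by (rule conv_fun_fun_Cbu[OF G h'(2) radial_L1_I[OF h(3)] a])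
      moreover have "cmod (a z - conv_fun_fun \<phi> a z) \<le> e" for z
      proof -
        have "cmod ((\<integral>w. a (z - w) * \<phi> w \<partial>lborel) - a z) \<le> r * L + 2 * C * \<epsilon>"
        proof (rule approximate_identity_bound[OF \<phi>'(2) \<phi>(2-4) conv_fun_fun_bounded(1)[OF \<phi>'(2) a'(2) C(2)]])
          show "cmod (a (z - w) - a z) \<le> r" if "norm w < \<delta>" for w
            using \<delta>(2)[of "z - w" z] that by (simp add: dist_norm)
          show "cmod (a (z - w) - a z) \<le> 2 * C" for w
            using norm_triangle_ineq4[of "a (z - w)" "a z"] C(2)[of "z - w"] C(2)[of z] by linarith
        qed (use r C in auto)
        then show ?thesis using r \<epsilon> by (simp add: conv_fun_fun_def norm_minus_commute)
      qed
      ultimately show "\<exists>g\<in>conv_fun_fun \<psi> ` Cbu_fun G. \<forall>z. cmod (a z - g z) \<le> e" by (metis image_eqI)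
    qed
  qed
qed

section \<open>Convolution of invariant operators with functions\<close>

text \<open>A difference of two values is one value of the transform of
  \<open>op_translate (x - y) S - S\<close>, so norm continuity of the translates gives uniform
  continuity.\<close>

lemma berezin_Cbu_fun:
  assumes G: "G \<subseteq> carrier motion_group" and S: "S \<in> Cbu_op \<inter> Hom_ops G"
  shows "berezin S \<in> Cbu_fun G"
proof (rule Cbu_funI[OF _ _ cmod_berezin_le])
  have S': "S \<in> Cbu_op" "S \<in> bounded_ops" using S Cbu_opD by auto
  show "invariant_fun G (berezin S)" using S Hom_ops_iff[OF G] by blast
  show "uniformly_continuous_on UNIV (berezin S)"
    unfolding uniformly_continuous_UNIV_iff
  proof (intro allI impI)
    fix e :: real assume "0 < e"
    with S'(1) obtain d where d: "d > 0" "\<And>z. z \<noteq> 0 \<Longrightarrow> norm z < d \<Longrightarrow> norm (op_translate z S - S) < e"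
      unfolding Cbu_op_iff LIM_def dist_norm by force
    have "dist (berezin S y) (berezin S x) < e" if "dist y x < d" for x y
    proof (cases "x = y")
      case False
      have "berezin S y - berezin S x = berezin (op_translate (x - y) S - S) x"
        by (simp add: berezin_simps berezin_op_translate[OF S'(2)])
      then have "cmod (berezin S y - berezin S x) \<le> norm (op_translate (x - y) S - S)"
        using cmod_berezin_le by metis
      also have "\<dots> < e" using that False by (intro d(2)) (auto simp: dist_norm norm_minus_commute)
      finally show ?thesis by (simp add: dist_norm)
    qed (use \<open>0 < e\<close> in simp)
    then show "\<exists>d>0. \<forall>x y. dist y x < d \<longrightarrow> dist (berezin S y) (berezin S x) < e"
      using d(1) by blast
  qed
qed

lemma conv_L1_op_invariant:
  fixes \<psi> :: "complex^'n::finite \<Rightarrow> complex"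
  assumes G: "G \<subseteq> carrier motion_group" and \<psi>: "integrable lborel \<psi>" "radial_L1 \<psi>" and S: "S \<in> Cbu_op \<inter> Hom_ops G"
  shows "conv_L1_op \<psi> S \<in> Cbu_op \<inter> Hom_ops G"
proof -
  have S': "S \<in> Cbu_op" using S by simp
  note b = Cbu_funD[OF berezin_Cbu_fun[OF G S]]
  have "berezin (conv_L1_op \<psi> S) = conv_fun_fun \<psi> (berezin S)"
    using berezin_conv_L1_op[OF \<psi>(1) S'] by blast
  then have "conv_L1_op \<psi> S \<in> Hom_ops G"
    using conv_L1_op_bounded_ops[OF \<psi>(1) S'] invariant_conv_fun_fun[OF G \<psi> b(2,3)] by (simp add: Hom_ops_iff[OF G])
  then show ?thesis using conv_L1_Cbu_op[OF \<psi>(1) S'] by blast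
qed

lemma closed_Hom_ops: "closed (Hom_ops G)"
proof -
  have "closed {S. op_motion g S = S}" for g
    unfolding op_motion_def by (intro closed_Collect_eq continuous_intros)
  then have "closed (bounded_ops \<inter> (\<Inter>g\<in>G. {S. op_motion g S = S}))"
    by (intro closed_Int closed_bounded_ops closed_INT) auto
  moreover have "bounded_ops \<inter> (\<Inter>g\<in>G. {S. op_motion g S = S}) = Hom_ops G" by (auto simp: Hom_ops_def)
  ultimately show ?thesis by simp
qed

theorem Cbu_op_eq_closure:
  fixes \<psi> :: "complex^'n::finite \<Rightarrow> complex"
  assumes G: "G \<subseteq> carrier motion_group" and \<psi>: "regular_fun \<psi>" "radial_L1 \<psi>"
  shows "Cbu_op \<inter> Hom_ops G = closure (conv_L1_op \<psi> ` (Cbu_op \<inter> Hom_ops G))"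
proof
  have \<psi>i: "integrable lborel \<psi>" using \<psi> by (simp add: regular_fun_def)
  show "closure (conv_L1_op \<psi> ` (Cbu_op \<inter> Hom_ops G)) \<subseteq> Cbu_op \<inter> Hom_ops G"
    using conv_L1_op_invariant[OF G \<psi>i \<psi>(2)] by (intro closure_minimal closed_Int closed_Cbu_op closed_Hom_ops) blast
  show "Cbu_op \<inter> Hom_ops G \<subseteq> closure (conv_L1_op \<psi> ` (Cbu_op \<inter> Hom_ops G))"
  proof
    fix S assume S: "S \<in> Cbu_op \<inter> Hom_ops G"
    then have S': "S \<in> Cbu_op" "S \<in> bounded_ops" using Cbu_opD by auto
    note b = Cbu_funD[OF berezin_Cbu_fun[OF G S]]
    obtain L where L: "0 \<le> L" "\<And>\<epsilon> \<delta>. 0 < \<epsilon> \<Longrightarrow> 0 < \<delta> \<Longrightarrow> \<exists>\<phi> h. conv_fun_fun \<psi> h = \<phi> \<and> cbi h \<and>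
      (\<forall>A\<in>unitary_matrices. \<forall>z. h (A *v z) = h z) \<and> cbi \<phi> \<and> (\<integral>x. \<phi> x \<partial>lborel) = 1 \<and> l1 \<phi> \<le> L \<and>
      (\<integral>x. indicator {x. \<delta> \<le> norm x} x * cmod (\<phi> x) \<partial>lborel) \<le> \<epsilon>"
      by (rule wiener_approximate_identity[OF \<psi>]) (rule that)
    show "S \<in> closure (conv_L1_op \<psi> ` (Cbu_op \<inter> Hom_ops G))"
      unfolding closure_approachable
    proof (intro allI impI)
      fix e :: real assume e: "0 < e"
      let ?C = "norm S"
      define r where "r = e / (4 * (L + 1))"
      define \<epsilon> where "\<epsilon> = e / (8 * (?C + 1))"
      have C0: "0 < ?C + 1" by (simp add: add_nonneg_pos)
      have r: "0 < r" "r * L \<le> e / 4" and \<epsilon>: "0 < \<epsilon>" "2 * ?C * \<epsilon> \<le> e / 4"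
        using e L(1) C0 by (simp_all add: r_def \<epsilon>_def field_simps)
      obtain \<delta> where \<delta>: "\<delta> > 0" "\<And>z. z \<noteq> 0 \<Longrightarrow> norm z < \<delta> \<Longrightarrow> norm (op_translate z S - S) < r"
        using S'(1) r(1) unfolding Cbu_op_iff LIM_def dist_norm by force
      obtain \<phi> h where h: "conv_fun_fun \<psi> h = \<phi>" "cbi h" "\<And>A z. A \<in> unitary_matrices \<Longrightarrow> h (A *v z) = h z"
        and \<phi>: "cbi \<phi>" "(\<integral>x. \<phi> x \<partial>lborel) = 1" "l1 \<phi> \<le> L"
          "(\<integral>x. indicator {x. \<delta> \<le> norm x} x * cmod (\<phi> x) \<partial>lborel) \<le> \<epsilon>"
        using L(2)[OF \<epsilon>(1) \<delta>(1)] by blast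
      note h' = cbiD[OF h(2)] and \<phi>' = cbiD[OF \<phi>(1)]
      have hS: "conv_L1_op h S \<in> Cbu_op \<inter> Hom_ops G" by (rule conv_L1_op_invariant[OF G h'(2) radial_L1_I[OF h(3)] S])
      then have hS': "conv_L1_op h S \<in> Cbu_op" by simp
      have eq: "conv_L1_op \<psi> (conv_L1_op h S) = conv_L1_op \<phi> S"
      proof (rule berezin_inj[OF conv_L1_op_bounded_ops[OF \<psi>i hS'] conv_L1_op_bounded_ops[OF \<phi>'(2) S'(1)]])
        fix z
        have "berezin (conv_L1_op h S) = conv_fun_fun h (berezin S)" using berezin_conv_L1_op[OF h'(2) S'(1)] by blast
        then show "berezin (conv_L1_op \<psi> (conv_L1_op h S)) z = berezin (conv_L1_op \<phi> S) z"
          unfolding berezin_conv_L1_op[OF \<psi>i hS'] berezin_conv_L1_op[OF \<phi>'(2) S'(1)]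
          using conv_fun_fun_assoc[OF \<psi>i h'(2) b(2) cmod_berezin_le] h(1) by simp
      qed
      \<comment> \<open>The integral is defined only weakly, so the norm is estimated through matrix
        coefficients, with all constants proportional to \<open>norm f * norm g\<close>.\<close>
      have "norm (conv_L1_op \<phi> S - S) \<le> r * L + 2 * ?C * \<epsilon>"
      proof (rule norm_op_le)
        fix f g :: "'n fock"
        let ?m = "norm f * norm g"
        have cs: "cmod (cinner (blinfun_apply T f) g) \<le> norm T * ?m" for T :: "'n op"
          using order_trans[OF cinner_cauchy_schwarz mult_right_mono[OF norm_blinfun norm_ge_zero], of T f g]
          by (simp add: mult.assoc)
        have d: "cmod (cinner (blinfun_apply (op_translate w S) f) g - cinner (blinfun_apply S f) g) \<le> norm (op_translate w S - S) * ?m" for w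
          using cs[of "op_translate w S - S"] by (simp add: blinfun.diff_left cinner_simps)
        have "cmod ((\<integral>w. cinner (blinfun_apply (op_translate w S) f) g * \<phi> w \<partial>lborel) - cinner (blinfun_apply S f) g)
          \<le> (r * ?m) * L + (2 * ?C * ?m) * \<epsilon>"
        proof (rule approximate_identity_bound[OF \<phi>'(2) \<phi>(2-4) conv_L1_op_integrable[OF \<phi>'(2) S'(1)]])
          show "cmod (cinner (blinfun_apply (op_translate w S) f) g - cinner (blinfun_apply S f) g) \<le> r * ?m" if "norm w < \<delta>" for w
          proof -
            have "norm (op_translate w S - S) \<le> r"
              using \<delta>(2)[of w] that r(1) op_translate_0[OF S'(2)] by (cases "w = 0") auto
            from mult_right_mono[OF this, of ?m] show ?thesis using d[of w] by simp
          qed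
          show "cmod (cinner (blinfun_apply (op_translate w S) f) g - cinner (blinfun_apply S f) g) \<le> 2 * ?C * ?m" for w
          proof -
            have "norm (op_translate w S - S) \<le> norm (op_translate w S) + norm S" by (rule norm_triangle_ineq4)
            also have "norm (op_translate w S) \<le> norm S" by (rule op_translate_props(2))
            finally have "norm (op_translate w S - S) \<le> 2 * ?C" by simp
            from mult_right_mono[OF this, of ?m] show ?thesis using d[of w] by simp
          qed
        qed (use r in auto)
        then show "cmod (cinner (blinfun_apply (conv_L1_op \<phi> S - S) f) g) \<le> (r * L + 2 * ?C * \<epsilon>) * ?m"
          by (simp add: blinfun.diff_left cinner_simps cinner_conv_L1_op[OF \<phi>'(2) S'(1)] algebra_simps)
      qed (use r \<epsilon> L in auto)
      then have "dist (conv_L1_op \<psi> (conv_L1_op h S)) S < e"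
        unfolding eq dist_norm using r(2) \<epsilon>(2) e by linarith
      then show "\<exists>T\<in>conv_L1_op \<psi> ` (Cbu_op \<inter> Hom_ops G). dist T S < e" using hS by blast
    qed
  qed
qed

section \<open>Convolution of a trace class operator with functions\<close>

lemma weyl_coh_0: "blinfun_apply (weyl z) (coh 0) = coh z"
  by (rule fock_eqI) (simp add: fock_fun_weyl fock_fun_coh kern_0)

lemma vacuum_sum: "(\<Sum>n. norm (if n = 0 then coh 0 else 0 :: 'n::finite fock) * norm (if n = (0::nat) then coh 0 else 0 :: 'n fock)) = 1"
proof -
  have "(\<lambda>n. norm (if n = 0 then coh 0 else 0 :: 'n fock) * norm (if n = (0::nat) then coh 0 else 0 :: 'n fock))
    = (\<lambda>n. if n = 0 then 1 else 0)" by (auto simp: norm_coh)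
  then show ?thesis using sums_unique[OF sums_single[of 0 "\<lambda>_. 1 :: real"]] by simp
qed

lemma cinner_translate_vacuum:
  "cinner (blinfun_apply (op_translate z vacuum_proj) f) g = cinner f (coh z) * cinner (coh z) g"
proof -
  let ?v = "\<lambda>n :: nat. if n = 0 then coh 0 else 0"
  have "(\<lambda>n. cinner f (blinfun_apply (weyl z) (?v n)) * cinner (blinfun_apply (weyl z) (?v n)) g)
    = (\<lambda>n. if n = 0 then cinner f (coh z) * cinner (coh z) g else 0)"
    by (auto simp: weyl_coh_0 cinner_simps)
  then show ?thesis
    using sums_unique2[OF op_translate_sums[OF vacuum_proj(1), of f z g]] sums_single[of 0 "\<lambda>_. cinner f (coh z) * cinner (coh z) g"]
    by simp
qed

text \<open>Exhibits Toeplitz operators as the special case \<open>\<Psi> = vacuum_proj\<close> of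
  \<open>conv_tc_fun\<close>, to which the general results on regular radial \<open>\<Psi>\<close>
  apply.\<close>

lemma toeplitz_conv_vacuum:
  assumes a: "a \<in> borel_measurable borel" "\<And>z. cmod (a z) \<le> C"
  shows "toeplitz a = conv_tc_fun vacuum_proj a"
proof (rule berezin_inj)
  have C: "0 \<le> C" using order_trans[OF norm_ge_zero a(2)] .
  have AE: "AE z in lborel. cmod (a z) \<le> C" using a(2) by simp
  show "toeplitz a \<in> bounded_ops" by (rule toeplitz_bounded_ops[OF a(1) AE C])
  show "conv_tc_fun vacuum_proj a \<in> bounded_ops" by (rule conv_tc_fun_bounded_ops[OF vacuum_proj(1) a])
  show "berezin (toeplitz a) z = berezin (conv_tc_fun vacuum_proj a) z" for z
    unfolding berezin_toeplitz[OF a(1) AE C] berezin_conv_tc_fun[OF vacuum_proj(1) a] berezin_vacuum_proj ..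
qed

lemma op_translate_conv_tc_fun:
  assumes \<Psi>: "nuclear_rep \<Psi> u v" and a: "a \<in> borel_measurable borel" "\<And>z. cmod (a z) \<le> C"
  shows "op_translate z (conv_tc_fun \<Psi> a) = conv_tc_fun \<Psi> (\<lambda>w. a (w - z))"
proof (rule berezin_inj)
  have a': "(\<lambda>w. a (w - z)) \<in> borel_measurable borel" using a(1) by measurable
  note b = conv_tc_fun_bounded_ops[OF \<Psi> a]
  show "op_translate z (conv_tc_fun \<Psi> a) \<in> bounded_ops" by (rule op_translate_props(1)[OF b])
  show "conv_tc_fun \<Psi> (\<lambda>w. a (w - z)) \<in> bounded_ops" by (rule conv_tc_fun_bounded_ops[OF \<Psi> a' a(2)])
  show "berezin (op_translate z (conv_tc_fun \<Psi> a)) w = berezin (conv_tc_fun \<Psi> (\<lambda>w. a (w - z))) w" for w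
    unfolding berezin_op_translate[OF b] berezin_conv_tc_fun[OF \<Psi> a] berezin_conv_tc_fun[OF \<Psi> a' a(2)] conv_fun_fun_def
    by (simp add: algebra_simps)
qed

lemma conv_tc_fun_diff:
  assumes \<Psi>: "nuclear_rep \<Psi> u v" and a: "a \<in> borel_measurable borel" "\<And>z. cmod (a z) \<le> C"
    and b: "b \<in> borel_measurable borel" "\<And>z. cmod (b z) \<le> D"
  shows "conv_tc_fun \<Psi> a - conv_tc_fun \<Psi> b = conv_tc_fun \<Psi> (\<lambda>z. a z - b z)"
proof (rule berezin_inj)
  have ab: "(\<lambda>z. a z - b z) \<in> borel_measurable borel" using a(1) b(1) by measurable
  have le: "cmod (a z - b z) \<le> C + D" for z by (rule order_trans[OF norm_triangle_ineq4 add_mono[OF a(2) b(2)]])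
  show "conv_tc_fun \<Psi> a - conv_tc_fun \<Psi> b \<in> bounded_ops"
    by (intro bounded_ops_closed_under conv_tc_fun_bounded_ops[OF \<Psi> a] conv_tc_fun_bounded_ops[OF \<Psi> b])
  show "conv_tc_fun \<Psi> (\<lambda>z. a z - b z) \<in> bounded_ops" by (rule conv_tc_fun_bounded_ops[OF \<Psi> ab le])
  note i = conv_fun_fun_bounded(1)[OF berezin_integrable(1)[OF \<Psi>]]
  show "berezin (conv_tc_fun \<Psi> a - conv_tc_fun \<Psi> b) w = berezin (conv_tc_fun \<Psi> (\<lambda>z. a z - b z)) w" for w
    unfolding berezin_simps berezin_conv_tc_fun[OF \<Psi> a] berezin_conv_tc_fun[OF \<Psi> b] berezin_conv_tc_fun[OF \<Psi> ab le]
    using i[OF a] i[OF b] by (simp add: conv_fun_fun_def left_diff_distrib)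
qed

text \<open>Translating the operator amounts to translating the symbol, so uniform continuity of
  \<open>a\<close> becomes norm continuity through the bound by the nuclear sum.\<close>

lemma conv_tc_fun_invariant:
  assumes G: "G \<subseteq> carrier motion_group" and \<Psi>: "nuclear_rep \<Psi> u v" "radial_L1 (berezin \<Psi>)" and a: "a \<in> Cbu_fun G"
  shows "conv_tc_fun \<Psi> a \<in> Cbu_op \<inter> Hom_ops G"
proof -
  note a' = Cbu_funD[OF a]
  obtain C where C: "\<And>z. cmod (a z) \<le> C" using a'(4) by blast
  note b = conv_tc_fun_bounded_ops[OF \<Psi>(1) a'(2) C]
  have "berezin (conv_tc_fun \<Psi> a) = conv_fun_fun (berezin \<Psi>) a"
    using berezin_conv_tc_fun[OF \<Psi>(1) a'(2) C] by blast
  then have "conv_tc_fun \<Psi> a \<in> Hom_ops G"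
    using b invariant_conv_fun_fun[OF G berezin_integrable(1)[OF \<Psi>(1)] \<Psi>(2) a'(2,3)] by (simp add: Hom_ops_iff[OF G])
  moreover have "conv_tc_fun \<Psi> a \<in> Cbu_op"
    unfolding Cbu_op_iff LIM_def
  proof (intro conjI b allI impI)
    fix e :: real assume e: "0 < e"
    let ?K = "\<Sum>n. norm (u n) * norm (v n)"
    have K: "0 \<le> ?K" by (intro suminf_nonneg nuclear_repD(1)[OF \<Psi>(1)]) simp
    note e' = divide_add_1_mult_less[OF e K]
    obtain d where d: "d > 0" "\<And>x y. dist y x < d \<Longrightarrow> dist (a y) (a x) < e / (?K + 1)"
      by (rule uniformly_continuous_UNIV_D[OF a'(1) conjunct1[OF e']]) (rule that)
    have "dist (op_translate z (conv_tc_fun \<Psi> a)) (conv_tc_fun \<Psi> a) < e" if "dist z 0 < d" for z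
    proof -
      have az: "(\<lambda>w. a (w - z)) \<in> borel_measurable borel" using a'(2) by measurable
      have m: "(\<lambda>w. a (w - z) - a w) \<in> borel_measurable borel" using a'(2) az by measurable
      have le: "cmod (a (w - z) - a w) \<le> e / (?K + 1)" for w
        using d(2)[of "w - z" w] that by (simp add: dist_norm)
      have "op_translate z (conv_tc_fun \<Psi> a) - conv_tc_fun \<Psi> a = conv_tc_fun \<Psi> (\<lambda>w. a (w - z) - a w)"
        unfolding op_translate_conv_tc_fun[OF \<Psi>(1) a'(2) C] by (rule conv_tc_fun_diff[OF \<Psi>(1) az C a'(2) C])
      then have "dist (op_translate z (conv_tc_fun \<Psi> a)) (conv_tc_fun \<Psi> a) \<le> e / (?K + 1) * ?K"
        unfolding dist_norm using norm_conv_tc_fun_le[OF \<Psi>(1) m le] by simp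
      then show ?thesis using e' by linarith
    qed
    then show "\<exists>d>0. \<forall>z. z \<noteq> 0 \<and> dist z 0 < d \<longrightarrow> dist (op_translate z (conv_tc_fun \<Psi> a)) (conv_tc_fun \<Psi> a) < e"
      using d(1) by meson
  qed
  ultimately show ?thesis by blast
qed

lemma conv_L1_op_berezin:
  assumes \<Psi>: "nuclear_rep \<Psi> u v" and S: "S \<in> Cbu_op" and b: "berezin S \<in> borel_measurable borel"
  shows "conv_L1_op (berezin \<Psi>) S = conv_tc_fun \<Psi> (berezin S)"
proof (rule berezin_inj)
  note i = berezin_integrable(1)[OF \<Psi>]
  show "conv_L1_op (berezin \<Psi>) S \<in> bounded_ops" by (rule conv_L1_op_bounded_ops[OF i S])
  show "conv_tc_fun \<Psi> (berezin S) \<in> bounded_ops" by (rule conv_tc_fun_bounded_ops[OF \<Psi> b cmod_berezin_le])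
  show "berezin (conv_L1_op (berezin \<Psi>) S) z = berezin (conv_tc_fun \<Psi> (berezin S)) z" for z
    unfolding berezin_conv_L1_op[OF i S] berezin_conv_tc_fun[OF \<Psi> b cmod_berezin_le] ..
qed

text \<open>The closure result for functions is applied to \<open>\<psi> = berezin \<Psi>\<close>.
  Each convolution of this function with an invariant operator is a convolution of
  \<open>\<Psi>\<close> with an invariant symbol, so the range grows.\<close>

theorem Cbu_op_eq_closure_conv_tc_fun:
  assumes G: "G \<subseteq> carrier motion_group" and \<Psi>: "nuclear_rep \<Psi> u v" "radial_L1 (berezin \<Psi>)" "regular_fun (berezin \<Psi>)"
  shows "Cbu_op \<inter> Hom_ops G = closure (conv_tc_fun \<Psi> ` Cbu_fun G)"
proof
  show "closure (conv_tc_fun \<Psi> ` Cbu_fun G) \<subseteq> Cbu_op \<inter> Hom_ops G"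
    using conv_tc_fun_invariant[OF G \<Psi>(1,2)] by (intro closure_minimal closed_Int closed_Cbu_op closed_Hom_ops) blast
  have "conv_L1_op (berezin \<Psi>) S \<in> conv_tc_fun \<Psi> ` Cbu_fun G" if "S \<in> Cbu_op \<inter> Hom_ops G" for S
    using berezin_Cbu_fun[OF G that] conv_L1_op_berezin[OF \<Psi>(1) _ Cbu_funD(2)[OF berezin_Cbu_fun[OF G that]]] that by auto
  then show "Cbu_op \<inter> Hom_ops G \<subseteq> closure (conv_tc_fun \<Psi> ` Cbu_fun G)"
    by (subst Cbu_op_eq_closure[OF G \<Psi>(3,2)]) (intro closure_mono, blast)
qed

lemma radial_berezin:
  fixes \<Psi> :: "'n::finite op"
  assumes "radial_op \<Psi>"
  shows "radial_L1 (berezin \<Psi>)"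
proof (rule radial_L1_I)
  fix A :: "complex^'n^'n" and z assume A: "A \<in> unitary_matrices"
  have "op_motion (conj_transpose A, 0) \<Psi> = \<Psi>" "\<Psi> \<in> bounded_ops"
    using assms conj_transpose_unitary[OF A] by (auto simp: radial_op_def)
  then show "berezin \<Psi> (A *v z) = berezin \<Psi> z"
    using berezin_op_motion[OF conj_transpose_unitary[OF A], of \<Psi> 0 z] by simp
qed

lemma vacuum_regular_radial:
  "radial_L1 (berezin (vacuum_proj :: 'n::finite op))" "regular_fun (berezin (vacuum_proj :: 'n op))"
proof -
  have e: "berezin (vacuum_proj :: 'n op) = (\<lambda>z. complex_of_real (exp (- pi * (norm z)\<^sup>2)))"
    using berezin_vacuum_proj by blast
  show "radial_L1 (berezin (vacuum_proj :: 'n op))"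
    by (rule radial_L1_I) (simp add: e norm_unitary)
  show "regular_fun (berezin (vacuum_proj :: 'n op))"
    unfolding e regular_fun_def fourier_gauss using gauss_integrable by simp
qed

text \<open>The transform \<open>B \<mapsto> fourier (berezin B) \<xi>\<close> is continuous for the trace norm and is multiplied by a
  character under translations, so a zero at \<open>\<xi>\<close> would pass from \<open>\<Psi>\<close> to all of the trace class.\<close>

lemma regular_berezin:
  fixes \<Psi> :: "'n::finite op"
  assumes "regular_op \<Psi>"
  shows "regular_fun (berezin \<Psi>)"
  unfolding regular_fun_def
proof (intro conjI allI notI)
  have tc: "\<Psi> \<in> trace_class" using assms by (simp add: regular_op_def)
  then obtain u v where \<Psi>: "nuclear_rep \<Psi> u v" using trace_class_imp_nuclear by blast
  have ti: "integrable lborel (berezin B)" if "B \<in> trace_class" for B :: "'n op"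
    using trace_class_imp_nuclear[OF that] berezin_integrable(1) by blast
  show "integrable lborel (berezin \<Psi>)" by (rule ti[OF tc])
  fix \<xi> :: "complex^'n" assume 0: "fourier (berezin \<Psi>) \<xi> = 0"
  define Z :: "'n op set" where "Z = {B \<in> trace_class. fourier (berezin B) \<xi> = 0}"
  have Zs: "op_scaleC c B \<in> Z" if "B \<in> Z" for B c
    using that trace_class_scale fourier_simps(3)[OF ti ti, of B B c \<xi>] by (auto simp: Z_def berezin_simps[abs_def])
  have Za: "B + D \<in> Z" if "B \<in> Z" "D \<in> Z" for B D
    using that trace_class_add fourier_simps(2)[OF ti ti, of B D \<xi>] by (auto simp: Z_def berezin_simps[abs_def])
  have Z0: "0 \<in> Z"
  proof -
    have "op_scaleC 0 \<Psi> = 0" by (rule blinfun_eqI, rule fock_eqI) (simp add: op_scaleC_apply fock_fun_simps)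
    moreover have "\<Psi> \<in> Z" using tc 0 by (simp add: Z_def)
    ultimately show ?thesis using Zs[of \<Psi> 0] by simp
  qed
  have Zt: "op_translate z \<Psi> \<in> Z" for z
  proof -
    have "op_translate z \<Psi> \<in> trace_class"
      unfolding op_translate_def
      by (rule nuclear_imp_trace_class[OF nuclear_rep_compose_right[OF nuclear_rep_compose_left[OF \<Psi> weyl_bounded_ops]
          op_adjoint_bounded_ops[OF weyl_bounded_ops]]])
    moreover have "fourier (berezin (op_translate z \<Psi>)) \<xi> = 0"
    proof -
      have "fourier (berezin (op_translate z \<Psi>)) \<xi> = (\<integral>w. wave (- (w \<bullet> \<xi>)) * berezin \<Psi> (w - z) \<partial>lborel)"
        unfolding fourier_wave berezin_op_translate[OF nuclear_rep_bounded_ops[OF \<Psi>]] ..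
      also have "\<dots> = (\<integral>w. wave (- ((w + z) \<bullet> \<xi>)) * berezin \<Psi> (w + z - z) \<partial>lborel)"
        by (rule lborel_integral_translate(1)[symmetric])
      also have "\<dots> = (\<integral>w. wave (- (z \<bullet> \<xi>)) * (wave (- (w \<bullet> \<xi>)) * berezin \<Psi> w) \<partial>lborel)"
      proof (rule Bochner_Integration.integral_cong[OF refl])
        fix w
        have "- ((w + z) \<bullet> \<xi>) = - (z \<bullet> \<xi>) + - (w \<bullet> \<xi>)" by (simp add: inner_add_left)
        then show "wave (- ((w + z) \<bullet> \<xi>)) * berezin \<Psi> (w + z - z) = wave (- (z \<bullet> \<xi>)) * (wave (- (w \<bullet> \<xi>)) * berezin \<Psi> w)"
          by (simp only: wave_simps(2) add_diff_cancel_right' mult.assoc)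
      qed
      also have "\<dots> = wave (- (z \<bullet> \<xi>)) * fourier (berezin \<Psi>) \<xi>" by (simp add: fourier_wave)
      finally show ?thesis by (simp add: 0)
    qed
    ultimately show ?thesis by (simp add: Z_def)
  qed
  let ?\<Phi> = "vacuum_proj :: 'n op"
  have \<Phi>: "?\<Phi> \<in> trace_class" by (rule nuclear_imp_trace_class[OF vacuum_proj(1)])
  \<comment> \<open>The tolerance is the transform of the vacuum at \<open>\<xi>\<close>. The
    approximant has transform 0 there, so the trace norm of the difference must be at least this
    large.\<close>
  obtain F c where F: "finite F"
    "trace_norm (?\<Phi> - (\<Sum>z\<in>F. op_scaleC (c z) (op_translate z \<Psi>))) < exp (- pi * (norm \<xi>)\<^sup>2)"
    using assms \<Phi> exp_gt_zero unfolding regular_op_def by blast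
  let ?D = "\<Sum>z\<in>F. op_scaleC (c z) (op_translate z \<Psi>)"
  have "?D \<in> Z" using F(1) by (induction F) (auto intro!: Za Zs Zt Z0)
  from Zs[OF this, of "- 1"] have D: "op_scaleC (- 1) ?D \<in> trace_class" "fourier (berezin (op_scaleC (- 1) ?D)) \<xi> = 0"
    by (auto simp: Z_def)
  have B: "?\<Phi> - ?D = ?\<Phi> + op_scaleC (- 1) ?D"
    by (rule blinfun_eqI, rule fock_eqI)
      (simp add: blinfun.diff_left blinfun.add_left op_scaleC_apply fock_fun_simps)
  obtain p q where pq: "nuclear_rep (?\<Phi> - ?D) p q" "(\<Sum>n. norm (p n) * norm (q n)) \<le> trace_norm (?\<Phi> - ?D)"
    using trace_class_imp_nuclear trace_class_add[OF \<Phi> D(1)] unfolding B by blast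
  have "fourier (berezin (?\<Phi> - ?D)) \<xi> = complex_of_real (exp (- pi * (norm \<xi>)\<^sup>2))"
  proof -
    have e: "berezin ?\<Phi> = (\<lambda>z. complex_of_real (exp (- pi * (norm z)\<^sup>2)))" by (rule ext, rule berezin_vacuum_proj)
    have "berezin (?\<Phi> - ?D) = (\<lambda>z. berezin ?\<Phi> z + berezin (op_scaleC (- 1) ?D) z)"
      unfolding B by (rule ext, rule berezin_simps(1))
    then have "fourier (berezin (?\<Phi> - ?D)) \<xi> = fourier (berezin ?\<Phi>) \<xi> + fourier (berezin (op_scaleC (- 1) ?D)) \<xi>"
      by (simp only: fourier_simps(2)[OF ti[OF \<Phi>] ti[OF D(1)]])
    then show ?thesis unfolding D(2) unfolding e fourier_gauss by simp
  qed
  then have "exp (- pi * (norm \<xi>)\<^sup>2) \<le> l1 (berezin (?\<Phi> - ?D))"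
    using cmod_fourier_le[of "berezin (?\<Phi> - ?D)" \<xi>] by (simp only: norm_of_real abs_exp_cancel)
  also have "\<dots> \<le> trace_norm (?\<Phi> - ?D)" using berezin_integrable(2)[OF pq(1)] pq(2) by simp
  also have "\<dots> < exp (- pi * (norm \<xi>)\<^sup>2)" by (rule F(2))
  finally show False by simp
qed

section \<open>Convolution of two operators\<close>

text \<open>A Toeplitz operator is the superposition, with density \<open>b\<close>, of the
  projections onto the coherent states. Its trace against \<open>\<Psi>\<close> therefore integrates
  \<open>b\<close> against the diagonal coefficients of \<open>\<Psi>\<close>.\<close>

lemma op_trace_toeplitz:
  fixes b :: "complex^'n::finite \<Rightarrow> complex"
  assumes \<Psi>: "nuclear_rep \<Psi> p q" and b: "b \<in> borel_measurable borel" "\<And>z. cmod (b z) \<le> C"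
  shows "op_trace (\<Psi> o\<^sub>L toeplitz b) = (\<integral>z. b z * berezin \<Psi> z \<partial>lborel)"
proof -
  let ?\<Phi> = "vacuum_proj :: 'n op"
  note T = conv_tc_fun_bounded_ops[OF vacuum_proj(1) b]
  have C: "0 \<le> C" using order_trans[OF norm_ge_zero b(2)] .
  note s = nuclear_repD(1)[OF \<Psi>]
  define f where "f m z = cinner (blinfun_apply (op_translate z ?\<Phi>) (p m)) (q m) * b z" for m z
  have le: "cmod (f m z) \<le> C * (norm (p m) * norm (q m))" for m z
  proof -
    have "cmod (cinner (p m) (coh z)) * cmod (cinner (coh z) (q m)) \<le> (norm (p m) * 1) * (1 * norm (q m))"
      using cinner_cauchy_schwarz[of "p m" "coh z"] cinner_cauchy_schwarz[of "coh z" "q m"]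
      by (intro mult_mono) (auto simp: norm_coh)
    from mult_mono[OF this b(2)[of z]] C show ?thesis
      unfolding f_def cinner_translate_vacuum norm_mult by (simp add: mult.commute)
  qed
  have "(\<lambda>m. \<integral>z. f m z \<partial>lborel) sums (\<integral>z. b z * berezin \<Psi> z \<partial>lborel)"
  proof (rule integral_sums(2)[OF _ _ summable_mult[OF s, of C]])
    show "integrable lborel (f m)" for m
      unfolding f_def by (rule nuclear_translate_integral(1)[OF vacuum_proj(1) b])
    show "(\<integral>z. norm (f m z) \<partial>lborel) \<le> C * (norm (p m) * norm (q m))" for m
      unfolding f_def using nuclear_translate_integral(2)[OF vacuum_proj(1) b, of "p m" "q m"] unfolding vacuum_sum by simp
    show "summable (\<lambda>m. norm (f m z))" for z
      by (rule summable_comparison_test'[OF summable_mult[OF s, of C], of 0]) (use le in simp)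
    show "(\<lambda>m. f m z) sums (b z * berezin \<Psi> z)" for z
      using sums_mult[OF nuclear_rep_cinner_sums[OF \<Psi>, of "coh z" "coh z"], of "b z"]
      unfolding f_def cinner_translate_vacuum berezin_def by (simp add: mult_ac)
  qed
  moreover have "(\<lambda>m. \<integral>z. f m z \<partial>lborel) sums op_trace (\<Psi> o\<^sub>L toeplitz b)"
    using op_trace_compose(1)[OF \<Psi> T] unfolding f_def cinner_conv_tc_fun[OF vacuum_proj(1) b] toeplitz_conv_vacuum[OF b] .
  ultimately show ?thesis by (rule sums_unique2[symmetric])
qed

text \<open>Parity followed by translation acts on the symbol as \<open>w \<mapsto> z - w\<close>,
  which is the reflection in a convolution of functions.\<close>

lemma conv_op_op_toeplitz:
  fixes b :: "complex^'n::finite \<Rightarrow> complex"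
  assumes \<Psi>: "nuclear_rep \<Psi> p q" and b: "b \<in> borel_measurable borel" "\<And>z. cmod (b z) \<le> C"
  shows "conv_op_op \<Psi> (toeplitz b) z = conv_fun_fun (berezin \<Psi>) b z"
proof -
  have C: "0 \<le> C" using order_trans[OF norm_ge_zero b(2)] .
  have AE: "AE z in lborel. cmod (b z) \<le> C" using b(2) by simp
  have b': "(\<lambda>w. b (z - w)) \<in> borel_measurable borel" using b(1) by measurable
  have AE': "AE w in lborel. cmod (b (z - w)) \<le> C" using b(2) by simp
  let ?g = "\<lambda>z :: complex^'n. complex_of_real (exp (- pi * (norm z)\<^sup>2))"
  note T = toeplitz_bounded_ops[OF b(1) AE C]
  have P: "parity_op o\<^sub>L toeplitz b o\<^sub>L parity_op \<in> bounded_ops"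
    by (intro bounded_ops_closed_under parity_bounded_ops T)
  have "op_translate z (parity_op o\<^sub>L toeplitz b o\<^sub>L parity_op) = toeplitz (\<lambda>w. b (z - w))"
  proof (rule berezin_inj[OF op_translate_props(1)[OF P] toeplitz_bounded_ops[OF b' AE' C]])
    fix w
    have "(\<integral>u. b (z - (w - u)) * ?g u \<partial>lborel) = (\<integral>u. b (z - (w - (0 - u))) * ?g (0 - u) \<partial>lborel)"
      by (rule lborel_integral_translate(3)[symmetric])
    then show "berezin (op_translate z (parity_op o\<^sub>L toeplitz b o\<^sub>L parity_op)) w = berezin (toeplitz (\<lambda>w. b (z - w))) w"
      unfolding berezin_op_translate[OF P] berezin_parity[OF T] berezin_toeplitz[OF b(1) AE C] berezin_toeplitz[OF b' AE' C]
        conv_fun_fun_def by (simp add: algebra_simps)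
  qed
  then show ?thesis
    unfolding conv_op_op_def conv_fun_fun_def using op_trace_toeplitz[OF \<Psi> b' b(2)] by simp
qed

text \<open>Convolution with \<open>\<Psi>\<close> is continuous from the operator norm to the
  supremum norm, so its range is controlled by its values on a dense set of operators.\<close>

lemma conv_op_op_diff_le:
  assumes \<Psi>: "nuclear_rep \<Psi> p q" and S: "S \<in> bounded_ops" and T: "T \<in> bounded_ops"
  shows "cmod (conv_op_op \<Psi> S z - conv_op_op \<Psi> T z) \<le> norm (S - T) * (\<Sum>n. norm (p n) * norm (q n))"
proof -
  define R where "R X = op_translate z (parity_op o\<^sub>L X o\<^sub>L parity_op)" for X
  have Rb: "R X \<in> bounded_ops" if "X \<in> bounded_ops" for X
    unfolding R_def by (intro op_translate_props(1) bounded_ops_closed_under parity_bounded_ops that)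
  have Rd: "R S - R T = R (S - T)"
    unfolding R_def op_translate_linear(2)[symmetric] op_motion_parity[symmetric] op_motion_linear(2) ..
  have Rn: "norm (R X) \<le> norm X" for X
    unfolding R_def op_motion_parity[symmetric]
    by (rule order_trans[OF op_translate_props(2) norm_op_motion_le[OF minus_mat_1_unitary]])
  note s = nuclear_repD(1)[OF \<Psi>]
  have "(\<lambda>m. cinner (blinfun_apply (R S) (p m)) (q m) - cinner (blinfun_apply (R T) (p m)) (q m))
      sums (op_trace (\<Psi> o\<^sub>L R S) - op_trace (\<Psi> o\<^sub>L R T))"
    by (rule sums_diff[OF op_trace_compose(1)[OF \<Psi> Rb[OF S]] op_trace_compose(1)[OF \<Psi> Rb[OF T]]])
  then have sm: "(\<lambda>m. cinner (blinfun_apply (R (S - T)) (p m)) (q m)) sums (conv_op_op \<Psi> S z - conv_op_op \<Psi> T z)"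
    unfolding conv_op_op_def Rd[symmetric] R_def[symmetric] by (simp add: blinfun.diff_left cinner_simps)
  have le: "cmod (cinner (blinfun_apply (R (S - T)) (p m)) (q m)) \<le> norm (S - T) * (norm (p m) * norm (q m))" for m
  proof -
    have "norm (blinfun_apply (R (S - T)) (p m)) \<le> norm (S - T) * norm (p m)"
      by (rule order_trans[OF norm_blinfun mult_right_mono[OF Rn]]) simp
    from order_trans[OF cinner_cauchy_schwarz mult_right_mono[OF this norm_ge_zero]] show ?thesis by (simp add: mult.assoc)
  qed
  have "cmod (\<Sum>m. cinner (blinfun_apply (R (S - T)) (p m)) (q m)) \<le> (\<Sum>m. norm (S - T) * (norm (p m) * norm (q m)))"
    by (rule norm_suminf_le[OF le summable_mult[OF s]])
  then show ?thesis using sums_unique[OF sm] suminf_mult[OF s] by simp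
qed

lemma sup_closure_mono: "X \<subseteq> Y \<Longrightarrow> sup_closure X \<subseteq> sup_closure Y"
  unfolding sup_closure_def by blast

theorem Cbu_fun_eq_closure_conv_op_op:
  fixes \<Psi> :: "'n::finite op"
  assumes G: "G \<subseteq> carrier motion_group" and \<Psi>: "nuclear_rep \<Psi> u v" "radial_L1 (berezin \<Psi>)" "regular_fun (berezin \<Psi>)"
  shows "Cbu_fun G = sup_closure (conv_op_op \<Psi> ` (Cbu_op \<inter> Hom_ops G))"
proof
  let ?\<Phi> = "vacuum_proj :: 'n op"
  note \<Psi>i = berezin_integrable(1)[OF \<Psi>(1)]
  have T: "conv_tc_fun ?\<Phi> b \<in> Cbu_op \<inter> Hom_ops G" "conv_op_op \<Psi> (conv_tc_fun ?\<Phi> b) = conv_fun_fun (berezin \<Psi>) b" if b: "b \<in> Cbu_fun G" for b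
  proof -
    show "conv_tc_fun ?\<Phi> b \<in> Cbu_op \<inter> Hom_ops G" by (rule conv_tc_fun_invariant[OF G vacuum_proj(1) vacuum_regular_radial(1) b])
    obtain C where C: "\<And>z. cmod (b z) \<le> C" using Cbu_funD(4)[OF b] by blast
    show "conv_op_op \<Psi> (conv_tc_fun ?\<Phi> b) = conv_fun_fun (berezin \<Psi>) b"
      using conv_op_op_toeplitz[OF \<Psi>(1) Cbu_funD(2)[OF b] C] unfolding toeplitz_conv_vacuum[OF Cbu_funD(2)[OF b] C] by blast
  qed
  have "conv_fun_fun (berezin \<Psi>) ` Cbu_fun G \<subseteq> conv_op_op \<Psi> ` (Cbu_op \<inter> Hom_ops G)"
    using T by (metis image_eqI image_subsetI)
  then show "Cbu_fun G \<subseteq> sup_closure (conv_op_op \<Psi> ` (Cbu_op \<inter> Hom_ops G))"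
    by (subst Cbu_fun_eq_closure[OF G \<Psi>(3,2)]) (rule sup_closure_mono)
  let ?K = "\<Sum>n. norm (u n) * norm (v n)"
  have K: "0 \<le> ?K" by (intro suminf_nonneg nuclear_repD(1)[OF \<Psi>(1)]) simp
  \<comment> \<open>An invariant operator is a limit of Toeplitz operators, on which the convolution
    is one of functions. Invariance and uniform continuity of the result are thus inherited through
    the closure.\<close>
  have "conv_op_op \<Psi> S \<in> sup_closure (Cbu_fun G)" if S: "S \<in> Cbu_op \<inter> Hom_ops G" for S
    unfolding sup_closure_def
  proof (intro CollectI allI impI)
    fix e :: real assume e: "0 < e"
    note e' = divide_add_1_mult_less[OF e K]
    have "S \<in> closure (conv_tc_fun ?\<Phi> ` Cbu_fun G)"
      using S Cbu_op_eq_closure_conv_tc_fun[OF G vacuum_proj(1) vacuum_regular_radial] by blast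
    then obtain b where b: "b \<in> Cbu_fun G" "dist (conv_tc_fun ?\<Phi> b) S < e / (?K + 1)"
      using conjunct1[OF e'] unfolding closure_approachable by blast
    have bb: "S \<in> bounded_ops" "conv_tc_fun ?\<Phi> b \<in> bounded_ops" using S T(1)[OF b(1)] Cbu_opD(1) by auto
    have "cmod (conv_op_op \<Psi> S z - conv_fun_fun (berezin \<Psi>) b z) \<le> e" for z
    proof -
      have "cmod (conv_op_op \<Psi> S z - conv_op_op \<Psi> (conv_tc_fun ?\<Phi> b) z) \<le> norm (S - conv_tc_fun ?\<Phi> b) * ?K"
        by (rule conv_op_op_diff_le[OF \<Psi>(1) bb])
      also have "\<dots> \<le> e / (?K + 1) * ?K"
        using b(2) K by (intro mult_right_mono) (auto simp: dist_norm norm_minus_commute)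
      finally show ?thesis using e' unfolding T(2)[OF b(1)] by linarith
    qed
    then show "\<exists>g\<in>Cbu_fun G. \<forall>z. cmod (conv_op_op \<Psi> S z - g z) \<le> e"
      using conv_fun_fun_Cbu[OF G \<Psi>i \<Psi>(2) b(1)] by blast
  qed
  then have "conv_op_op \<Psi> ` (Cbu_op \<inter> Hom_ops G) \<subseteq> Cbu_fun G" using sup_closure_Cbu[OF order_refl] by blast
  then show "sup_closure (conv_op_op \<Psi> ` (Cbu_op \<inter> Hom_ops G)) \<subseteq> Cbu_fun G" by (rule sup_closure_Cbu)
qed

section \<open>The Toeplitz algebra\<close>

lemma toeplitz_Cbu_fun:
  assumes G: "G \<subseteq> carrier motion_group"
  shows "Cbu_op \<inter> Hom_ops G = closure (toeplitz ` Cbu_fun G)"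
proof -
  have "toeplitz b = conv_tc_fun vacuum_proj b" if "b \<in> Cbu_fun G" for b
    using Cbu_funD(2,4)[OF that] toeplitz_conv_vacuum by blast
  then have "toeplitz ` Cbu_fun G = conv_tc_fun vacuum_proj ` Cbu_fun G" by (intro image_cong) auto
  then show ?thesis using Cbu_op_eq_closure_conv_tc_fun[OF G vacuum_proj(1) vacuum_regular_radial] by simp
qed

lemma coh_tendsto_0: "((\<lambda>z. norm (coh z - coh 0 :: 'n::finite fock)) \<longlongrightarrow> 0) (at 0)"
proof -
  have e: "norm (coh z - coh 0 :: 'n fock) = sqrt (2 - 2 * exp (- pi / 2 * (norm z)\<^sup>2))" for z :: "complex^'n"
  proof -
    have "cinner (coh z) (coh 0) = complex_of_real (exp (- pi / 2 * (norm z)\<^sup>2))"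
      using fock_fun_conv_coh[of "coh z" 0] unfolding fock_fun_coh kern_exp by (simp add: hip_simps hip_self exp_of_real[symmetric])
    moreover from this have "cinner (coh 0) (coh z) = complex_of_real (exp (- pi / 2 * (norm z)\<^sup>2))"
      by (subst cinner_commute) (simp only: complex_cnj_complex_of_real)
    ultimately have "complex_of_real ((norm (coh z - coh 0 :: 'n fock))\<^sup>2) = complex_of_real (2 - 2 * exp (- pi / 2 * (norm z)\<^sup>2))"
      unfolding cinner_self_norm[symmetric] cinner_simps by (simp add: cinner_self_norm norm_coh)
    then have "(norm (coh z - coh 0 :: 'n fock))\<^sup>2 = 2 - 2 * exp (- pi / 2 * (norm z)\<^sup>2)" unfolding of_real_eq_iff .
    then show ?thesis using real_sqrt_abs[of "norm (coh z - coh 0 :: 'n fock)"] by simp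
  qed
  have "((\<lambda>z :: complex^'n. sqrt (2 - 2 * exp (- pi / 2 * (norm z)\<^sup>2))) \<longlongrightarrow> sqrt (2 - 2 * exp (- pi / 2 * (norm (0 :: complex^'n))\<^sup>2))) (at 0)"
    by (intro tendsto_intros)
  then show ?thesis unfolding e by simp
qed

lemma sums_two:
  fixes x :: "nat \<Rightarrow> 'b::real_normed_vector"
  assumes "\<And>n. 2 \<le> n \<Longrightarrow> x n = 0"
  shows "x sums (x 0 + x 1)"
proof -
  have "x sums (\<Sum>n\<in>{0, 1}. x n)" by (rule sums_finite) (simp, rule assms, auto)
  then show ?thesis by simp
qed

text \<open>Translates of a merely bounded symbol need not depend continuously on the translation in
  the supremum norm. The difference is therefore placed on the vacuum projection, whose translates
  vary continuously in trace norm because the coherent states vary continuously in norm.\<close>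

lemma toeplitz_Cbu_op:
  fixes a :: "complex^'n::finite \<Rightarrow> complex"
  assumes "a \<in> L_infinity"
  shows "toeplitz a \<in> Cbu_op"
proof -
  obtain C0 where a: "a \<in> borel_measurable borel" "AE z in lborel. cmod (a z) \<le> C0"
    using assms by (auto simp: L_infinity_def)
  define C where "C = max C0 0"
  have C: "0 \<le> C" "AE z in lborel. cmod (a z) \<le> C"
    using a(2) by (simp add: C_def, rule eventually_mono) (simp add: C_def)
  \<comment> \<open>A representative bounded everywhere, as the convolution with a trace class
    operator requires; it gives the same Toeplitz operator.\<close>
  define b where "b z = (if cmod (a z) \<le> C then a z else 0)" for z
  note [measurable] = a(1)
  have b: "b \<in> borel_measurable borel" "\<And>z. cmod (b z) \<le> C"
    using C(1) unfolding b_def by (measurable, simp)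
  have bAE: "AE z in lborel. cmod (b z) \<le> C" using b(2) by simp
  let ?\<Phi> = "vacuum_proj :: 'n op"
  have "toeplitz a = toeplitz b"
  proof (rule op_eqI)
    fix f g :: "'n fock"
    note [measurable] = b(1) borel_measurable_entire[OF fock_fun_entire]
    have "AE z in lborel. a z = b z" using C(2) by eventually_elim (simp add: b_def)
    then have "AE z in lborel. 0 < ennreal (exp (- pi * (norm z)\<^sup>2)) \<longrightarrow> a z = b z" by eventually_elim simp
    then have ae: "AE z in gauss_measure. a z = b z"
      unfolding gauss_measure_def by (subst AE_density) simp_all
    show "cinner (blinfun_apply (toeplitz a) f) g = cinner (blinfun_apply (toeplitz b) f) g"
      unfolding cinner_toeplitz[OF a(1) C(2,1)] cinner_toeplitz[OF b(1) bAE C(1)]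
    proof (rule integral_cong_AE)
      show "AE z in gauss_measure. a z * fock_fun f z * cnj (fock_fun g z) = b z * fock_fun f z * cnj (fock_fun g z)"
        using ae by eventually_elim simp
    qed (rule borel_measurable_integrable[OF toeplitz_integrable[OF a(1) C(2,1)]]
        borel_measurable_integrable[OF toeplitz_integrable[OF b(1) bAE C(1)]])+
  qed
  also have "\<dots> = conv_tc_fun ?\<Phi> b" by (rule toeplitz_conv_vacuum[OF b])
  finally have eq: "toeplitz a = conv_tc_fun ?\<Phi> b" .
  note bb = conv_tc_fun_bounded_ops[OF vacuum_proj(1) b]
  have le: "norm (op_translate z (conv_tc_fun ?\<Phi> b) - conv_tc_fun ?\<Phi> b) \<le> C * (2 * norm (coh z - coh 0 :: 'n fock))" for z
  proof -
    \<comment> \<open>The difference of the projections onto \<open>coh z\<close> and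
      \<open>coh 0\<close> is split by adding and subtracting a mixed term. Each of the two rank one
      pieces contains the factor \<open>coh z - coh 0\<close> once, so the nuclear sum is twice its
      norm.\<close>
    let ?u = "\<lambda>n :: nat. if n = 0 then coh z - coh 0 else if n = 1 then coh 0 else 0 :: 'n fock"
    let ?v = "\<lambda>n :: nat. if n = 0 then coh z else if n = 1 then coh z - coh 0 else 0 :: 'n fock"
    let ?D = "op_translate z ?\<Phi> - ?\<Phi>"
    have tv: "blinfun_apply (op_translate z ?\<Phi>) f = scaleC (cinner f (coh z)) (coh z)" for f
      by (rule cinner_eqI) (simp add: cinner_translate_vacuum cinner_simps)
    have D: "blinfun_apply ?D f = scaleC (cinner f (coh z)) (coh z - coh 0) + scaleC (cinner f (coh z - coh 0)) (coh 0)" for f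
      by (rule fock_eqI) (simp add: blinfun.diff_left tv vacuum_proj(2) cinner_simps fock_fun_simps algebra_simps)
    have rep: "nuclear_rep ?D ?u ?v"
      unfolding nuclear_rep_def
    proof
      show "summable (\<lambda>n. norm (?u n) * norm (?v n))"
        using sums_two[of "\<lambda>n. norm (?u n) * norm (?v n)"] by (auto simp: sums_iff)
      show "\<forall>f. (\<lambda>n. scaleC (cinner f (?v n)) (?u n)) sums blinfun_apply ?D f"
      proof
        fix f
        have "(\<lambda>n. scaleC (cinner f (?v n)) (?u n)) sums (scaleC (cinner f (?v 0)) (?u 0) + scaleC (cinner f (?v 1)) (?u 1))"
          by (rule sums_two) (auto simp: cinner_simps intro!: fock_eqI simp: fock_fun_simps)
        then show "(\<lambda>n. scaleC (cinner f (?v n)) (?u n)) sums blinfun_apply ?D f" unfolding D by simp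
      qed
    qed
    have K: "(\<Sum>n. norm (?u n) * norm (?v n)) = 2 * norm (coh z - coh 0 :: 'n fock)"
      using sums_unique[OF sums_two[of "\<lambda>n. norm (?u n) * norm (?v n)"]] by (simp add: norm_coh)
    have "op_translate z (conv_tc_fun ?\<Phi> b) - conv_tc_fun ?\<Phi> b = conv_tc_fun ?D b"
    proof (rule berezin_inj)
      show "op_translate z (conv_tc_fun ?\<Phi> b) - conv_tc_fun ?\<Phi> b \<in> bounded_ops"
        by (intro bounded_ops_closed_under op_translate_props(1) bb)
      show "conv_tc_fun ?D b \<in> bounded_ops" by (rule conv_tc_fun_bounded_ops[OF rep b])
      fix w
      note bn = nuclear_rep_bounded_ops[OF vacuum_proj(1)]
      note i = conv_fun_fun_bounded(1)[OF berezin_integrable(1)[OF vacuum_proj(1)] b]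
      have "(\<integral>u. b (w - z - u) * berezin ?\<Phi> u \<partial>lborel) = (\<integral>u. b (w - z - (u - z)) * berezin ?\<Phi> (u - z) \<partial>lborel)"
        by (rule lborel_integral_translate(2)[symmetric])
      moreover have "integrable lborel (\<lambda>u. b (w - z - (u - z)) * berezin ?\<Phi> (u - z))"
        using lborel_integrable_translate(2)[of "\<lambda>u. b (w - z - u) * berezin ?\<Phi> u"] i by blast
      ultimately show "berezin (op_translate z (conv_tc_fun ?\<Phi> b) - conv_tc_fun ?\<Phi> b) w = berezin (conv_tc_fun ?D b) w"
        unfolding berezin_simps berezin_op_translate[OF bb] berezin_conv_tc_fun[OF vacuum_proj(1) b] berezin_conv_tc_fun[OF rep b]
          conv_fun_fun_def berezin_op_translate[OF bn] using i by (simp add: right_diff_distrib)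
    qed
    then show ?thesis using norm_conv_tc_fun_le[OF rep b] K by simp
  qed
  have "((\<lambda>z. C * (2 * norm (coh z - coh 0 :: 'n fock))) \<longlongrightarrow> C * (2 * 0)) (at 0)"
    by (intro tendsto_mult_left coh_tendsto_0)
  then have "((\<lambda>z. C * (2 * norm (coh z - coh 0 :: 'n fock))) \<longlongrightarrow> 0) (at 0)" by simp
  then have "((\<lambda>z. op_translate z (conv_tc_fun ?\<Phi> b) - conv_tc_fun ?\<Phi> b) \<longlongrightarrow> 0) (at 0)"
    by (rule Lim_null_comparison[rotated]) (use le in \<open>auto intro: always_eventually\<close>)
  then show ?thesis unfolding eq Cbu_op_iff using bb LIM_zero_iff by blast
qed

lemma closed_subalgebra_invariant:
  fixes G :: "'n::finite motion set"
  assumes G: "G \<subseteq> carrier motion_group"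
  shows "closed_subalgebra (Cbu_op \<inter> Hom_ops G)"
proof -
  have u: "A \<in> unitary_matrices" if "(A, z) \<in> G" for A z using G that by (auto simp: motion_group_def)
  have zero: "op_motion g 0 = 0" for g :: "'n motion" using op_motion_linear(2)[of g 0 0] by simp
  have "0 \<in> Cbu_op \<inter> Hom_ops G"
    using bounded_ops_closed_under(1) by (auto simp: Cbu_op_def Hom_ops_def zero op_translate_conv_motion)
  moreover have "S + T \<in> Cbu_op \<inter> Hom_ops G \<and> (S o\<^sub>L T) \<in> Cbu_op \<inter> Hom_ops G"
    if "S \<in> Cbu_op \<inter> Hom_ops G" "T \<in> Cbu_op \<inter> Hom_ops G" for S T
    using that Cbu_op_closed_under(1,3)[of S T] bounded_ops_closed_under(3,6)[of S T] op_motion_compose[OF u]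
    by (auto simp: Hom_ops_def op_motion_linear)
  moreover have "op_scaleC c S \<in> Cbu_op \<inter> Hom_ops G" if S: "S \<in> Cbu_op \<inter> Hom_ops G" for c S
  proof -
    have "invariant_fun G (berezin (op_scaleC c S))"
      using S unfolding Int_iff Hom_ops_iff[OF G] by (simp add: invariant_fun_def berezin_simps)
    then show ?thesis using S Cbu_op_closed_under(4)[of S S c] Cbu_opD(1) by (auto simp: Hom_ops_iff[OF G])
  qed
  moreover have "closed (Cbu_op \<inter> Hom_ops G)" by (intro closed_Int closed_Cbu_op closed_Hom_ops)
  ultimately show ?thesis unfolding closed_subalgebra_def using Cbu_opD(1) by auto
qed

text \<open>The invariant uniformly continuous operators form a closed algebra containing the
  generators, which bounds the Toeplitz algebra from above. From below, every admissible algebra is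
  closed and contains the Toeplitz operators with symbols in \<open>Cbu_fun G\<close>, whose closure
  is already everything.\<close>

theorem toeplitz_algebra_eq:
  assumes G: "G \<subseteq> carrier motion_group"
  shows "toeplitz_algebra G = Cbu_op \<inter> Hom_ops G"
proof
  have "toeplitz ` L_infinity \<inter> Hom_ops G \<subseteq> Cbu_op \<inter> Hom_ops G" using toeplitz_Cbu_op by blast
  then show "toeplitz_algebra G \<subseteq> Cbu_op \<inter> Hom_ops G"
    unfolding toeplitz_algebra_def using closed_subalgebra_invariant[OF G] by blast
  show "Cbu_op \<inter> Hom_ops G \<subseteq> toeplitz_algebra G"
    unfolding toeplitz_algebra_def
  proof (rule Inter_greatest)
    fix \<A> assume "\<A> \<in> {\<A>. closed_subalgebra \<A> \<and> toeplitz ` L_infinity \<inter> Hom_ops G \<subseteq> \<A>}"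
    then have A: "closed \<A>" "toeplitz ` L_infinity \<inter> Hom_ops G \<subseteq> \<A>" by (auto simp: closed_subalgebra_def)
    have "Cbu_fun G \<subseteq> L_infinity"
    proof
      fix b assume b: "b \<in> Cbu_fun G"
      then show "b \<in> L_infinity" using Cbu_funD(2,4)[OF b] by (auto simp: L_infinity_def)
    qed
    moreover have "toeplitz ` Cbu_fun G \<subseteq> Hom_ops G" 
      using closure_subset[of "toeplitz ` Cbu_fun G"] unfolding toeplitz_Cbu_fun[OF G, symmetric] by blast
    ultimately have "toeplitz ` Cbu_fun G \<subseteq> \<A>" using A(2) by blast
    then show "Cbu_op \<inter> Hom_ops G \<subseteq> \<A>" unfolding toeplitz_Cbu_fun[OF G] by (rule closure_minimal[OF _ A(1)])
  qed
qed

theorem theorem4p2: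
  fixes G :: "'n::finite motion set"
  assumes "subgroup G motion_group"
  shows "(\<forall>(\<psi> :: complex^'n \<Rightarrow> complex) (\<Psi> :: 'n op).
            regular_fun \<psi> \<and> radial_L1 \<psi> \<and> regular_op \<Psi> \<and> radial_op \<Psi> \<longrightarrow>
              Cbu_fun G = sup_closure (conv_fun_fun \<psi> ` Cbu_fun G) \<and>
              Cbu_op \<inter> Hom_ops G = closure (conv_L1_op \<psi> ` (Cbu_op \<inter> Hom_ops G)) \<and>
              Cbu_fun G = sup_closure (conv_op_op \<Psi> ` (Cbu_op \<inter> Hom_ops G)) \<and>
              Cbu_op \<inter> Hom_ops G = closure (conv_tc_fun \<Psi> ` Cbu_fun G)) \<and>
         toeplitz_algebra G = Cbu_op \<inter> Hom_ops G \<and>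
         Cbu_op \<inter> Hom_ops G = closure (toeplitz ` Cbu_fun G)"
proof -
  have G: "G \<subseteq> carrier motion_group" by (rule subgroup.subset[OF assms])
  show ?thesis
  proof (intro conjI allI impI; (elim conjE)?)
    fix \<psi> :: "complex^'n \<Rightarrow> complex" and \<Psi> :: "'n op"
    assume \<psi>: "regular_fun \<psi>" "radial_L1 \<psi>" and "regular_op \<Psi>" "radial_op \<Psi>"
    then have \<Psi>: "radial_L1 (berezin \<Psi>)" "regular_fun (berezin \<Psi>)"
      using radial_berezin regular_berezin by auto
    obtain u v where uv: "nuclear_rep \<Psi> u v"
      using \<open>regular_op \<Psi>\<close> trace_class_imp_nuclear unfolding regular_op_def by blast
    show "Cbu_fun G = sup_closure (conv_fun_fun \<psi> ` Cbu_fun G)" by (rule Cbu_fun_eq_closure[OF G \<psi>])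
    show "Cbu_op \<inter> Hom_ops G = closure (conv_L1_op \<psi> ` (Cbu_op \<inter> Hom_ops G))" by (rule Cbu_op_eq_closure[OF G \<psi>])
    show "Cbu_fun G = sup_closure (conv_op_op \<Psi> ` (Cbu_op \<inter> Hom_ops G))"
      by (rule Cbu_fun_eq_closure_conv_op_op[OF G uv \<Psi>])
    show "Cbu_op \<inter> Hom_ops G = closure (conv_tc_fun \<Psi> ` Cbu_fun G)"
      by (rule Cbu_op_eq_closure_conv_tc_fun[OF G uv \<Psi>])
  qed (rule toeplitz_algebra_eq[OF G], rule toeplitz_Cbu_fun[OF G])
qed

end
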